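(* Let $\mathcal{C}$ be a finitely complete $(\infty,1)$-category such that the final object $1$ has two subobjects, let $I$ be a set and let $\Phi$ be a product closed filter on $P(I)$. Then a map $(f_i)_{i\in I}$ in $\prod_\Phi\mathcal{C}$ is an equivalence if and only if $$\{i\in I: f_i\text{ is an equivalence}\}\in\Phi.$$
   Context: An $(\infty,1)$-category means a quasi-category, Kan enriched category or complete Segal space (CSS). A product closed filter on $P(I)$ is a subset $\Phi\subseteq P(I)$ of the power set that contains $I$, is closed under finite intersections and is upward closed. By assumption $\mathrm{Sub}_{\mathcal{C}}(1)\cong\{0,1\}$ (exactly two subobjects), so $\mathrm{Sub}_{\mathcal{C}^I}(1)=\{0,1\}^I=P(I)$ and $\Phi$ is a filter of subobjects of the final object of the finitely complete $(\infty,1)$-category $\mathcal{C}^I$. The filter product is the filter quotient $\prod_\Phi\mathcal{C}:=(\mathcal{C}^I)_\Phi$. Filter quotient of a finitely complete $(\infty,1)$-category $\mathcal{D}$ by a filter $\Phi\subseteq \mathrm{Sub}_{\mathcal D}(1)$: for a CSS (or quasi-category), $\mathcal{D}_\Phi=\mathrm{colim}_{V\in\Phi^{op}}\mathcal{D}_{/V}$, the level-wise colimit with transition maps $-\times U:\mathcal{D}_{/V}\to\mathcal{D}_{/U}$ for $U\leq V$; for a Kan enriched category, $\mathcal{D}_\Phi$ has the objects of $\mathcal{D}$ and $\mathrm{Map}_{\mathcal{D}_\Phi}(X,Y)=\mathrm{colim}_{V\in\Phi^{op}}\mathrm{Map}_{\mathcal{D}}(X\times V,Y)$. Maps $(f_i)_{i\in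 I}$ of $\mathcal{C}^I$ are regarded in $\prod_\Phi\mathcal{C}$ via the canonical functor $P_\Phi:\mathcal{C}^I\to(\mathcal{C}^I)_\Phi$.
   Formalization: The "if" direction assumes that the subobject 0 of 1 is strict (every map into 0 is an equivalence), as it fails otherwise; for Kan enriched categories the products X×V are strict enriched products, with strictly functorial inclusions of the V, so that the filter quotient is defined. *)

theory Defs
  imports Main "HOL-Library.FuncSet"
begin

section \<open>Simplicial sets\<close>

text \<open>
  A morphism [m] \<rightarrow> [n] of the simplex category is the sorted list of its values
  \<open>[\<theta> 0, \<dots>, \<theta> m]\<close>, and \<open>act X n \<theta>\<close> is the induced map \<open>X\<^sub>n \<rightarrow> X\<^sub>m\<close>. So for an
  n-simplex \<open>x\<close>, \<open>act X n [i] x\<close> is its i-th vertex and \<open>act X n [i, j] x\<close> its edge from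
  vertex i to vertex j.
\<close>

definition ops :: "nat \<Rightarrow> nat \<Rightarrow> nat list set" where
  "ops m n = {\<theta>. length \<theta> = Suc m \<and> sorted \<theta> \<and> set \<theta> \<subseteq> {..n}}"

record 'a sset =
  simps :: "nat \<Rightarrow> 'a set"
  act :: "nat \<Rightarrow> nat list \<Rightarrow> 'a \<Rightarrow> 'a"

definition is_sset :: "'a sset \<Rightarrow> bool" where
  "is_sset X \<longleftrightarrow>
     (\<forall>m n. \<forall>\<theta>\<in>ops m n. \<forall>x\<in>simps X n. act X n \<theta> x \<in> simps X m) \<and>
     (\<forall>n. \<forall>x\<in>simps X n. act X n [0..<Suc n] x = x) \<and>
     (\<forall>k m n. \<forall>\<phi>\<in>ops k m. \<forall>\<theta>\<in>ops m n. \<forall>x\<in>simps X n.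
        act X m \<phi> (act X n \<theta> x) = act X n (map ((!) \<theta>) \<phi>) x)"

definition simplicial_map :: "'a sset \<Rightarrow> 'b sset \<Rightarrow> (nat \<Rightarrow> 'a \<Rightarrow> 'b) \<Rightarrow> bool" where
  "simplicial_map X Y f \<longleftrightarrow>
     (\<forall>n. \<forall>x\<in>simps X n. f n x \<in> simps Y n) \<and>
     (\<forall>m n. \<forall>\<theta>\<in>ops m n. \<forall>x\<in>simps X n. f m (act X n \<theta> x) = act Y n \<theta> (f n x))"

text \<open>The n-simplex that is totally degenerate on a vertex.\<close>

definition deg :: "'a sset \<Rightarrow> nat \<Rightarrow> 'a \<Rightarrow> 'a" where
  "deg X n x = act X 0 (replicate (Suc n) 0) x"

definition face :: "'a sset \<Rightarrow> nat \<Rightarrow> nat \<Rightarrow> 'a \<Rightarrow> 'a" where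
  "face X n i x = act X n (removeAll i [0..<Suc n]) x"

definition std_simplex :: "nat \<Rightarrow> nat list sset" where
  "std_simplex k = \<lparr>simps = (\<lambda>n. ops n k), act = (\<lambda>n \<theta> \<sigma>. map ((!) \<sigma>) \<theta>)\<rparr>"

definition prod2 :: "'a sset \<Rightarrow> 'b sset \<Rightarrow> ('a \<times> 'b) sset" where
  "prod2 X Y = \<lparr>simps = (\<lambda>n. simps X n \<times> simps Y n),
                act = (\<lambda>n \<theta> (x, y). (act X n \<theta> x, act Y n \<theta> y))\<rparr>"

definition prod_sset :: "'i set \<Rightarrow> ('i \<Rightarrow> 'a sset) \<Rightarrow> ('i \<Rightarrow> 'a) sset" where
  "prod_sset I X = \<lparr>simps = (\<lambda>n. \<Pi>\<^sub>E i\<in>I. simps (X i) n),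
                    act = (\<lambda>n \<theta> x. \<lambda>i\<in>I. act (X i) n \<theta> (x i))\<rparr>"

text \<open>
  A map from the boundary of the n-simplex (\<open>n \<ge> 1\<close>), respectively from its k-th horn, given
  by its faces \<open>y i\<close>. For \<open>n = 1\<close> the faces are vertices and there is no compatibility condition.
\<close>

definition boundary :: "'a sset \<Rightarrow> nat \<Rightarrow> (nat \<Rightarrow> 'a) \<Rightarrow> bool" where
  "boundary X n y \<longleftrightarrow>
     (\<forall>i\<le>n. y i \<in> simps X (n - 1)) \<and>
     (\<forall>i j. 2 \<le> n \<and> i < j \<and> j \<le> n \<longrightarrow>
        face X (n - 1) i (y j) = face X (n - 1) (j - 1) (y i))"

definition horn :: "'a sset \<Rightarrow> nat \<Rightarrow> nat \<Rightarrow> (nat \<Rightarrow> 'a) \<Rightarrow> bool" where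
  "horn X n k y \<longleftrightarrow>
     (\<forall>i\<le>n. i \<noteq> k \<longrightarrow> y i \<in> simps X (n - 1)) \<and>
     (\<forall>i j. 2 \<le> n \<and> i < j \<and> j \<le> n \<and> i \<noteq> k \<and> j \<noteq> k \<longrightarrow>
        face X (n - 1) i (y j) = face X (n - 1) (j - 1) (y i))"

definition boundary_fills :: "'a sset \<Rightarrow> nat \<Rightarrow> (nat \<Rightarrow> 'a) \<Rightarrow> bool" where
  "boundary_fills X n y \<longleftrightarrow> (\<exists>z\<in>simps X n. \<forall>i\<le>n. face X n i z = y i)"

definition horn_fills :: "'a sset \<Rightarrow> nat \<Rightarrow> nat \<Rightarrow> (nat \<Rightarrow> 'a) \<Rightarrow> bool" where
  "horn_fills X n k y \<longleftrightarrow> (\<exists>z\<in>simps X n. \<forall>i\<le>n. i \<noteq> k \<longrightarrow> face X n i z = y i)"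

definition kan_complex :: "'a sset \<Rightarrow> bool" where
  "kan_complex X \<longleftrightarrow> is_sset X \<and>
     (\<forall>n k y. 1 \<le> n \<and> k \<le> n \<and> horn X n k y \<longrightarrow> horn_fills X n k y)"

definition kan_fibration :: "'a sset \<Rightarrow> 'b sset \<Rightarrow> (nat \<Rightarrow> 'a \<Rightarrow> 'b) \<Rightarrow> bool" where
  "kan_fibration X Y p \<longleftrightarrow> simplicial_map X Y p \<and>
     (\<forall>n k y. \<forall>b\<in>simps Y n. 1 \<le> n \<and> k \<le> n \<and> horn X n k y \<and>
        (\<forall>i\<le>n. i \<noteq> k \<longrightarrow> p (n - 1) (y i) = face Y n i b) \<longrightarrow>
        (\<exists>z\<in>simps X n. p n z = b \<and> (\<forall>i\<le>n. i \<noteq> k \<longrightarrow> face X n i z = y i)))"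

definition contractible_sset :: "'a sset \<Rightarrow> bool" where
  "contractible_sset X \<longleftrightarrow> simps X 0 \<noteq> {} \<and>
     (\<forall>n y. 1 \<le> n \<and> boundary X n y \<longrightarrow> boundary_fills X n y)"

text \<open>The relation defining the set of components (an equivalence relation on a Kan complex).\<close>

definition same_component :: "'a sset \<Rightarrow> 'a \<Rightarrow> 'a \<Rightarrow> bool" where
  "same_component X x y \<longleftrightarrow> (\<exists>w\<in>simps X 1. act X 1 [0] w = x \<and> act X 1 [1] w = y)"

text \<open>
  Weak equivalences of Kan complexes: bijective on components and on all homotopy groups, the
  latter described by n-simplices with boundary constant at the base point.
\<close>

definition sphere :: "'a sset \<Rightarrow> nat \<Rightarrow> 'a \<Rightarrow> 'a \<Rightarrow> bool" where
  "sphere X n b x \<longleftrightarrow> x \<in> simps X n \<and> (\<forall>i\<le>n. face X n i x = deg X (n - 1) b)"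

definition sphere_homotopic :: "'a sset \<Rightarrow> nat \<Rightarrow> 'a \<Rightarrow> 'a \<Rightarrow> 'a \<Rightarrow> bool" where
  "sphere_homotopic X n b x x' \<longleftrightarrow>
     (\<exists>w\<in>simps X (Suc n). face X (Suc n) n w = x \<and> face X (Suc n) (Suc n) w = x' \<and>
        (\<forall>i<n. face X (Suc n) i w = deg X n b))"

definition weak_equivalence :: "'a sset \<Rightarrow> 'b sset \<Rightarrow> (nat \<Rightarrow> 'a \<Rightarrow> 'b) \<Rightarrow> bool" where
  "weak_equivalence X Y f \<longleftrightarrow> simplicial_map X Y f \<and>
     (\<forall>y\<in>simps Y 0. \<exists>x\<in>simps X 0. same_component Y (f 0 x) y) \<and>
     (\<forall>x\<in>simps X 0. \<forall>x'\<in>simps X 0. same_component Y (f 0 x) (f 0 x') \<longrightarrow> same_component X x x') \<and>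
     (\<forall>n\<ge>1. \<forall>b\<in>simps X 0.
        (\<forall>\<beta>. sphere Y n (f 0 b) \<beta> \<longrightarrow>
           (\<exists>\<alpha>. sphere X n b \<alpha> \<and> sphere_homotopic Y n (f 0 b) (f n \<alpha>) \<beta>)) \<and>
        (\<forall>\<alpha> \<alpha>'. sphere X n b \<alpha> \<and> sphere X n b \<alpha>' \<and>
           sphere_homotopic Y n (f 0 b) (f n \<alpha>) (f n \<alpha>') \<longrightarrow> sphere_homotopic X n b \<alpha> \<alpha>'))"

text \<open>Finitely many nondegenerate simplices.\<close>

definition finite_sset :: "'a sset \<Rightarrow> bool" where
  "finite_sset K \<longleftrightarrow> is_sset K \<and>
     finite {(n, x). x \<in> simps K n \<and>
       \<not> (\<exists>m<n. \<exists>\<theta>\<in>ops n m. \<exists>y\<in>simps K m. x = act K m \<theta> y)}"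

section \<open>Slices and cones\<close>

text \<open>The join slice over a vertex: an n-simplex is an (n+1)-simplex with last vertex \<open>v\<close>.\<close>

definition slice :: "'a sset \<Rightarrow> 'a \<Rightarrow> 'a sset" where
  "slice S v = \<lparr>simps = (\<lambda>n. {x \<in> simps S (Suc n). act S (Suc n) [Suc n] x = v}),
                act = (\<lambda>n \<theta> x. act S (Suc n) (\<theta> @ [Suc n]) x)\<rparr>"

definition slice_proj :: "'a sset \<Rightarrow> nat \<Rightarrow> 'a \<Rightarrow> 'a" where
  "slice_proj S n x = act S (Suc n) [0..<Suc n] x"

text \<open>The slice over a pair of vertices, i.e. over a diagram on two points.\<close>

definition slice2 :: "'a sset \<Rightarrow> 'a \<Rightarrow> 'a \<Rightarrow> ('a \<times> 'a) sset" where
  "slice2 S u v =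
     \<lparr>simps = (\<lambda>n. {(s, t). s \<in> simps (slice S u) n \<and> t \<in> simps (slice S v) n \<and>
                              slice_proj S n s = slice_proj S n t}),
      act = (\<lambda>n \<theta> (s, t). (act (slice S u) n \<theta> s, act (slice S v) n \<theta> t))\<rparr>"

text \<open>
  The slice over a diagram \<open>p : K \<rightarrow> S\<close>. An n-simplex is a map from the join of the n-simplex
  with \<open>K\<close> to \<open>S\<close> that restricts to \<open>p\<close> on \<open>K\<close>. It is given by its restriction \<open>b\<close> to the
  n-simplex and, for every j-simplex \<open>c\<close> of \<open>K\<close>, the (n+1+j)-simplex \<open>F j c\<close> which is its
  restriction to the join of the n-simplex with \<open>c\<close>.
\<close>

definition cone_slice ::
  "'a sset \<Rightarrow> 'k sset \<Rightarrow> (nat \<Rightarrow> 'k \<Rightarrow> 'a) \<Rightarrow> ('a \<times> (nat \<Rightarrow> 'k \<Rightarrow> 'a)) sset" where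
  "cone_slice S K p =
     \<lparr>simps = (\<lambda>n. {(b, F). b \<in> simps S n \<and>
        (\<forall>j c. c \<notin> simps K j \<longrightarrow> F j c = undefined) \<and>
        (\<forall>j. \<forall>c\<in>simps K j.
           F j c \<in> simps S (Suc n + j) \<and>
           act S (Suc n + j) [0..<Suc n] (F j c) = b \<and>
           act S (Suc n + j) [Suc n..<Suc n + Suc j] (F j c) = p j c \<and>
           (\<forall>i. \<forall>\<phi>\<in>ops i j.
              act S (Suc n + j) ([0..<Suc n] @ map ((+) (Suc n)) \<phi>) (F j c) =
              F i (act K j \<phi> c)))}),
      act = (\<lambda>n \<theta> (b, F). (act S n \<theta> b,
        \<lambda>j c. if c \<in> simps K j
               then act S (Suc n + j) (\<theta> @ [Suc n..<Suc n + Suc j]) (F j c)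
               else undefined))\<rparr>"

section \<open>Colimits of directed diagrams\<close>

text \<open>
  Contravariant diagrams on a down-directed set \<open>\<Phi>\<close>, with transition maps
  \<open>T V U : G V \<rightarrow> G U\<close> for \<open>U \<le> V\<close>. Elements of the colimit are germs.
\<close>

definition germ ::
  "'j::order set \<Rightarrow> ('j \<Rightarrow> 'a set) \<Rightarrow> ('j \<Rightarrow> 'j \<Rightarrow> 'a \<Rightarrow> 'a) \<Rightarrow> 'j \<Rightarrow> 'a \<Rightarrow> ('j \<times> 'a) set" where
  "germ \<Phi> G T V x =
     {(U, y). U \<in> \<Phi> \<and> y \<in> G U \<and> (\<exists>W\<in>\<Phi>. W \<le> U \<and> W \<le> V \<and> T U W y = T V W x)}"

definition germs ::
  "'j::order set \<Rightarrow> ('j \<Rightarrow> 'a set) \<Rightarrow> ('j \<Rightarrow> 'j \<Rightarrow> 'a \<Rightarrow> 'a) \<Rightarrow> ('j \<times> 'a) set set" where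
  "germs \<Phi> G T = {germ \<Phi> G T V x | V x. V \<in> \<Phi> \<and> x \<in> G V}"

definition colim_sset ::
  "'j::order set \<Rightarrow> ('j \<Rightarrow> 'a sset) \<Rightarrow> ('j \<Rightarrow> 'j \<Rightarrow> nat \<Rightarrow> 'a \<Rightarrow> 'a) \<Rightarrow> ('j \<times> 'a) set sset" where
  "colim_sset \<Phi> G T =
     \<lparr>simps = (\<lambda>n. germs \<Phi> (\<lambda>V. simps (G V) n) (\<lambda>V U. T V U n)),
      act = (\<lambda>n \<theta> c. THE d. \<exists>(V, x)\<in>c.
        d = germ \<Phi> (\<lambda>V. simps (G V) (length \<theta> - 1)) (\<lambda>V U. T V U (length \<theta> - 1))
              V (act (G V) n \<theta> x))\<rparr>"

section \<open>Filters\<close>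

definition product_closed_filter :: "'i set \<Rightarrow> 'i set set \<Rightarrow> bool" where
  "product_closed_filter I \<Phi> \<longleftrightarrow> \<Phi> \<subseteq> Pow I \<and> I \<in> \<Phi> \<and>
     (\<forall>A\<in>\<Phi>. \<forall>B\<in>\<Phi>. A \<inter> B \<in> \<Phi>) \<and>
     (\<forall>A\<in>\<Phi>. \<forall>B. A \<subseteq> B \<and> B \<subseteq> I \<longrightarrow> B \<in> \<Phi>)"

text \<open>The object of the power of C that represents the subobject \<open>J \<in> P(I) = {0,1}\<^sup>I\<close> of 1.\<close>

definition sub_object :: "'i set \<Rightarrow> 'o \<Rightarrow> 'o \<Rightarrow> 'i set \<Rightarrow> 'i \<Rightarrow> 'o" where
  "sub_object I zero one J = (\<lambda>i\<in>I. if i \<in> J then one else zero)"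

section \<open>Quasi-categories\<close>

definition quasi_category :: "'a sset \<Rightarrow> bool" where
  "quasi_category S \<longleftrightarrow> is_sset S \<and>
     (\<forall>n k y. 2 \<le> n \<and> 0 < k \<and> k < n \<and> horn S n k y \<longrightarrow> horn_fills S n k y)"

definition q_equiv :: "'a sset \<Rightarrow> 'a \<Rightarrow> bool" where
  "q_equiv S f \<longleftrightarrow> f \<in> simps S 1 \<and>
     (\<exists>g\<in>simps S 1. \<exists>\<sigma>\<in>simps S 2. \<exists>\<tau>\<in>simps S 2.
        act S 2 [0, 1] \<sigma> = f \<and> act S 2 [1, 2] \<sigma> = g \<and>
        act S 2 [0, 2] \<sigma> = deg S 1 (act S 1 [0] f) \<and>
        act S 2 [0, 1] \<tau> = g \<and> act S 2 [1, 2] \<tau> = f \<and>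
        act S 2 [0, 2] \<tau> = deg S 1 (act S 1 [1] f))"

definition q_terminal :: "'a sset \<Rightarrow> 'a \<Rightarrow> bool" where
  "q_terminal S t \<longleftrightarrow> t \<in> simps S 0 \<and>
     (\<forall>n y. 1 \<le> n \<and> boundary S n y \<and> act S (n - 1) [n - 1] (y 0) = t \<longrightarrow>
        boundary_fills S n y)"

text \<open>
  Every finite diagram has a limit. Finite simplicial sets have countably many simplices, so
  it suffices to index diagrams by simplicial sets with simplices in \<open>nat\<close>.
\<close>

definition q_finitely_complete :: "'a sset \<Rightarrow> bool" where
  "q_finitely_complete S \<longleftrightarrow>
     (\<forall>(K :: nat sset) p. finite_sset K \<and> simplicial_map K S p \<longrightarrow>
        (\<exists>c. q_terminal (cone_slice S K p) c))"

text \<open>The (right) mapping space: the fibre of the slice over \<open>y\<close> at \<open>x\<close>.\<close>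

definition q_map :: "'a sset \<Rightarrow> 'a \<Rightarrow> 'a \<Rightarrow> 'a sset" where
  "q_map S x y = \<lparr>simps = (\<lambda>n. {w \<in> simps (slice S y) n. slice_proj S n w = deg S n x}),
                  act = act (slice S y)\<rparr>"

definition q_subterminal :: "'a sset \<Rightarrow> 'a \<Rightarrow> bool" where
  "q_subterminal S u \<longleftrightarrow> u \<in> simps S 0 \<and>
     (\<forall>z\<in>simps S 0. simps (q_map S z u) 0 = {} \<or> contractible_sset (q_map S z u))"

text \<open>Monomorphisms into \<open>y\<close> are the (-1)-truncated objects of the slice over \<open>y\<close>.\<close>

definition q_monos :: "'a sset \<Rightarrow> 'a \<Rightarrow> 'a set" where
  "q_monos S y = {m \<in> simps (slice S y) 0. q_subterminal (slice S y) m}"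

definition q_iso :: "'a sset \<Rightarrow> 'a \<Rightarrow> 'a \<Rightarrow> bool" where
  "q_iso S x y \<longleftrightarrow> (\<exists>e. q_equiv S e \<and> act S 1 [0] e = x \<and> act S 1 [1] e = y)"

definition q_Sub :: "'a sset \<Rightarrow> 'a \<Rightarrow> 'a set set" where
  "q_Sub S y = {{m' \<in> q_monos S y. q_iso (slice S y) m m'} | m. m \<in> q_monos S y}"

definition q_product :: "'a sset \<Rightarrow> 'a \<Rightarrow> 'a \<Rightarrow> 'a \<Rightarrow> 'a \<Rightarrow> bool" where
  "q_product S x y a b \<longleftrightarrow> q_terminal (slice2 S x y) (a, b)"

text \<open>
  \<open>F\<close> is a functor \<open>- \<times> u : S\<^sub>/\<^sub>v \<rightarrow> S\<^sub>/\<^sub>u\<close> (for \<open>u \<le> v\<close> subobjects of the final object):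
  there is a natural transformation in \<open>S\<close> from \<open>F x\<close> to \<open>x\<close> whose components, together with
  the structure maps of the \<open>F x\<close>, are product projections.
\<close>

definition q_times :: "'a sset \<Rightarrow> 'a \<Rightarrow> 'a \<Rightarrow> (nat \<Rightarrow> 'a \<Rightarrow> 'a) \<Rightarrow> bool" where
  "q_times S v u F \<longleftrightarrow> simplicial_map (slice S v) (slice S u) F \<and>
     (\<exists>\<epsilon>. simplicial_map (prod2 (std_simplex 1) (slice S v)) S \<epsilon> \<and>
        (\<forall>n. \<forall>x\<in>simps (slice S v) n.
           \<epsilon> n (replicate (Suc n) 0, x) = slice_proj S n (F n x) \<and>
           \<epsilon> n (replicate (Suc n) 1, x) = slice_proj S n x) \<and>
        (\<forall>x\<in>simps (slice S v) 0.
           q_product S (slice_proj S 0 x) u (\<epsilon> 1 ([0, 1], deg (slice S v) 1 x)) (F 0 x)))"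

text \<open>
  The filter quotient of \<open>D\<close> by a filter \<open>\<Phi>\<close> of subobjects \<open>ob V\<close> of the final object. The
  colimit of the slices needs a diagram, i.e. a functorial choice \<open>T\<close> of the functors
  \<open>- \<times> U\<close>; it is a parameter of the construction.
\<close>

definition q_filter_system ::
  "'a sset \<Rightarrow> 'j::order set \<Rightarrow> ('j \<Rightarrow> 'a) \<Rightarrow> ('j \<Rightarrow> 'j \<Rightarrow> nat \<Rightarrow> 'a \<Rightarrow> 'a) \<Rightarrow> bool" where
  "q_filter_system D \<Phi> ob T \<longleftrightarrow>
     (\<forall>V\<in>\<Phi>. \<forall>U\<in>\<Phi>. U \<le> V \<longrightarrow> q_times D (ob V) (ob U) (T V U)) \<and>
     (\<forall>V\<in>\<Phi>. \<forall>n. \<forall>x\<in>simps (slice D (ob V)) n. T V V n x = x) \<and>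
     (\<forall>V\<in>\<Phi>. \<forall>U\<in>\<Phi>. \<forall>W\<in>\<Phi>. W \<le> U \<and> U \<le> V \<longrightarrow>
        (\<forall>n. \<forall>x\<in>simps (slice D (ob V)) n. T U W n (T V U n x) = T V W n x))"

definition q_filter_quotient ::
  "'a sset \<Rightarrow> 'j::order set \<Rightarrow> ('j \<Rightarrow> 'a) \<Rightarrow> ('j \<Rightarrow> 'j \<Rightarrow> nat \<Rightarrow> 'a \<Rightarrow> 'a) \<Rightarrow> ('j \<times> 'a) set sset" where
  "q_filter_quotient D \<Phi> ob T = colim_sset \<Phi> (\<lambda>V. slice D (ob V)) T"

text \<open>
  The canonical functor from \<open>D\<close> to its filter quotient: the structure map of the slice over the
  final object \<open>ob tp\<close>, precomposed with a section \<open>s\<close> of the equivalence from this slice to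
  \<open>D\<close>.
\<close>

definition q_canonical ::
  "'a sset \<Rightarrow> 'j::order set \<Rightarrow> ('j \<Rightarrow> 'a) \<Rightarrow> ('j \<Rightarrow> 'j \<Rightarrow> nat \<Rightarrow> 'a \<Rightarrow> 'a) \<Rightarrow> 'j \<Rightarrow>
    (nat \<Rightarrow> 'a \<Rightarrow> ('j \<times> 'a) set) \<Rightarrow> bool" where
  "q_canonical D \<Phi> ob T tp P \<longleftrightarrow>
     (\<exists>s. simplicial_map D (slice D (ob tp)) s \<and>
        (\<forall>n. \<forall>x\<in>simps D n. slice_proj D n (s n x) = x) \<and>
        (\<forall>n. \<forall>x\<in>simps D n.
           P n x = germ \<Phi> (\<lambda>V. simps (slice D (ob V)) n) (\<lambda>V U. T V U n) tp (s n x)))"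

definition q_power :: "'i set \<Rightarrow> 'a sset \<Rightarrow> ('i \<Rightarrow> 'a) sset" where
  "q_power I C = prod_sset I (\<lambda>_. C)"

section \<open>Kan enriched categories\<close>

text \<open>\<open>scomp C n x y z g f\<close> is the composite of the n-simplices \<open>f\<close> of \<open>Map(x,y)\<close> and \<open>g\<close> of
  \<open>Map(y,z)\<close>.\<close>

record ('o, 'm) scat =
  sobj :: "'o set"
  shom :: "'o \<Rightarrow> 'o \<Rightarrow> 'm sset"
  scomp :: "nat \<Rightarrow> 'o \<Rightarrow> 'o \<Rightarrow> 'o \<Rightarrow> 'm \<Rightarrow> 'm \<Rightarrow> 'm"
  sid :: "'o \<Rightarrow> 'm"

definition kan_enriched :: "('o, 'm) scat \<Rightarrow> bool" where
  "kan_enriched C \<longleftrightarrow>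
     (\<forall>x\<in>sobj C. \<forall>y\<in>sobj C. kan_complex (shom C x y)) \<and>
     (\<forall>x\<in>sobj C. sid C x \<in> simps (shom C x x) 0) \<and>
     (\<forall>x\<in>sobj C. \<forall>y\<in>sobj C. \<forall>z\<in>sobj C.
        simplicial_map (prod2 (shom C y z) (shom C x y)) (shom C x z)
          (\<lambda>n (g, f). scomp C n x y z g f)) \<and>
     (\<forall>x\<in>sobj C. \<forall>y\<in>sobj C. \<forall>n. \<forall>f\<in>simps (shom C x y) n.
        scomp C n x x y f (deg (shom C x x) n (sid C x)) = f \<and>
        scomp C n x y y (deg (shom C y y) n (sid C y)) f = f) \<and>
     (\<forall>w\<in>sobj C. \<forall>x\<in>sobj C. \<forall>y\<in>sobj C. \<forall>z\<in>sobj C. \<forall>n.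
        \<forall>f\<in>simps (shom C w x) n. \<forall>g\<in>simps (shom C x y) n. \<forall>h\<in>simps (shom C y z) n.
          scomp C n w x z (scomp C n x y z h g) f = scomp C n w y z h (scomp C n w x y g f))"

definition k_equiv :: "('o, 'm) scat \<Rightarrow> 'o \<Rightarrow> 'o \<Rightarrow> 'm \<Rightarrow> bool" where
  "k_equiv C x y f \<longleftrightarrow> f \<in> simps (shom C x y) 0 \<and>
     (\<exists>g\<in>simps (shom C y x) 0.
        same_component (shom C x x) (scomp C 0 x y x g f) (sid C x) \<and>
        same_component (shom C y y) (scomp C 0 y x y f g) (sid C y))"

text \<open>
  The homotopy coherent nerve. \<open>cube_chains i j m\<close> are the m-simplices of the nerve of the
  poset of subsets of {i..j} containing i and j, which is the mapping space from i to j of the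
  simplicial category freely generated by the n-simplex; composition there is union. An
  n-simplex of the nerve is a simplicial functor \<open>(x, F)\<close> on this simplicial category.
\<close>

definition cube_chains :: "nat \<Rightarrow> nat \<Rightarrow> nat \<Rightarrow> nat set list set" where
  "cube_chains i j m = {A. length A = Suc m \<and> sorted_wrt (\<subseteq>) A \<and>
     (\<forall>S\<in>set A. i \<in> S \<and> j \<in> S \<and> S \<subseteq> {i..j})}"

definition coherent_nerve ::
  "('o, 'm) scat \<Rightarrow> ((nat \<Rightarrow> 'o) \<times> (nat \<Rightarrow> nat \<Rightarrow> nat \<Rightarrow> nat set list \<Rightarrow> 'm)) sset" where
  "coherent_nerve C =
     \<lparr>simps = (\<lambda>n. {(x, F).
        (\<forall>i. if i \<le> n then x i \<in> sobj C else x i = undefined) \<and>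
        (\<forall>i j m A. \<not> (i \<le> j \<and> j \<le> n \<and> A \<in> cube_chains i j m) \<longrightarrow> F i j m A = undefined) \<and>
        (\<forall>i j m. \<forall>A\<in>cube_chains i j m. i \<le> j \<and> j \<le> n \<longrightarrow>
           F i j m A \<in> simps (shom C (x i) (x j)) m \<and>
           (\<forall>k. \<forall>\<theta>\<in>ops k m.
              F i j k (map ((!) A) \<theta>) = act (shom C (x i) (x j)) m \<theta> (F i j m A))) \<and>
        (\<forall>i\<le>n. F i i 0 [{i}] = sid C (x i)) \<and>
        (\<forall>i j k m. \<forall>A\<in>cube_chains i j m. \<forall>B\<in>cube_chains j k m. i \<le> j \<and> j \<le> k \<and> k \<le> n \<longrightarrow>
           F i k m (map2 (\<union>) A B) =
           scomp C m (x i) (x j) (x k) (F j k m B) (F i j m A))}),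
      act = (\<lambda>n \<theta> (x, F).
        (\<lambda>i. if i < length \<theta> then x (\<theta> ! i) else undefined,
         \<lambda>i j m A. if i \<le> j \<and> j < length \<theta> \<and> A \<in> cube_chains i j m
                    then F (\<theta> ! i) (\<theta> ! j) m (map ((`) ((!) \<theta>)) A)
                    else undefined))\<rparr>"

definition k_finitely_complete :: "('o, 'm) scat \<Rightarrow> bool" where
  "k_finitely_complete C \<longleftrightarrow> q_finitely_complete (coherent_nerve C)"

definition k_terminal :: "('o, 'm) scat \<Rightarrow> 'o \<Rightarrow> bool" where
  "k_terminal C t \<longleftrightarrow> t \<in> sobj C \<and> (\<forall>z\<in>sobj C. contractible_sset (shom C z t))"

text \<open>
  A 0-simplex \<open>m\<close> of \<open>Map(u,y)\<close> is a monomorphism if postcomposition with it is, for every \<open>z\<close>,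
  a weak equivalence from \<open>Map(z,u)\<close> onto the union of the components of \<open>Map(z,y)\<close> it meets.
\<close>

definition k_post_components :: "('o, 'm) scat \<Rightarrow> 'o \<Rightarrow> 'o \<Rightarrow> 'o \<Rightarrow> 'm \<Rightarrow> 'm sset" where
  "k_post_components C z u y m =
     \<lparr>simps = (\<lambda>n. {h \<in> simps (shom C z y) n. \<forall>i\<le>n. \<exists>f\<in>simps (shom C z u) 0.
        same_component (shom C z y) (scomp C 0 z u y m f) (act (shom C z y) n [i] h)}),
      act = act (shom C z y)\<rparr>"

definition k_monos :: "('o, 'm) scat \<Rightarrow> 'o \<Rightarrow> ('o \<times> 'm) set" where
  "k_monos C y = {(u, m). u \<in> sobj C \<and> m \<in> simps (shom C u y) 0 \<and>
     (\<forall>z\<in>sobj C. weak_equivalence (shom C z u) (k_post_components C z u y m)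
        (\<lambda>n f. scomp C n z u y (deg (shom C u y) n m) f))}"

definition k_sub_iso :: "('o, 'm) scat \<Rightarrow> 'o \<Rightarrow> 'o \<times> 'm \<Rightarrow> 'o \<times> 'm \<Rightarrow> bool" where
  "k_sub_iso C y a b \<longleftrightarrow> (\<exists>e. k_equiv C (fst a) (fst b) e \<and>
     same_component (shom C (fst a) y) (scomp C 0 (fst a) (fst b) y (snd b) e) (snd a))"

definition k_Sub :: "('o, 'm) scat \<Rightarrow> 'o \<Rightarrow> ('o \<times> 'm) set set" where
  "k_Sub C y = {{b \<in> k_monos C y. k_sub_iso C y a b} | a. a \<in> k_monos C y}"

definition k_power :: "'i set \<Rightarrow> ('o, 'm) scat \<Rightarrow> ('i \<Rightarrow> 'o, 'i \<Rightarrow> 'm) scat" where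
  "k_power I C =
     \<lparr>sobj = (\<Pi>\<^sub>E i\<in>I. sobj C),
      shom = (\<lambda>X Y. prod_sset I (\<lambda>i. shom C (X i) (Y i))),
      scomp = (\<lambda>n X Y Z g f. \<lambda>i\<in>I. scomp C n (X i) (Y i) (Z i) (g i) (f i)),
      sid = (\<lambda>X. \<lambda>i\<in>I. sid C (X i))\<rparr>"

definition k_product :: "('o, 'm) scat \<Rightarrow> 'o \<Rightarrow> 'o \<Rightarrow> 'o \<Rightarrow> 'm \<Rightarrow> 'm \<Rightarrow> bool" where
  "k_product C x y p a b \<longleftrightarrow> p \<in> sobj C \<and>
     a \<in> simps (shom C p x) 0 \<and> b \<in> simps (shom C p y) 0 \<and>
     (\<forall>z\<in>sobj C. \<forall>n. bij_betw
        (\<lambda>h. (scomp C n z p x (deg (shom C p x) n a) h, scomp C n z p y (deg (shom C p y) n b) h))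
        (simps (shom C z p) n) (simps (shom C z x) n \<times> simps (shom C z y) n))"

definition k_pair ::
  "('o, 'm) scat \<Rightarrow> 'o \<Rightarrow> 'o \<Rightarrow> 'o \<Rightarrow> 'm \<Rightarrow> 'm \<Rightarrow> nat \<Rightarrow> 'o \<Rightarrow> 'm \<Rightarrow> 'm \<Rightarrow> 'm" where
  "k_pair C x y p a b n z f g = (THE h. h \<in> simps (shom C z p) n \<and>
     scomp C n z p x (deg (shom C p x) n a) h = f \<and>
     scomp C n z p y (deg (shom C p y) n b) h = g)"

text \<open>
  For the colimit of the \<open>Map(X \<times> V, Y)\<close> to carry a composition, the products \<open>X \<times> V\<close> have to
  be products of the enriched category and the inclusions between the subobjects \<open>ob V\<close> of
  the final object strictly functorial. Such a choice is a parameter of the construction: the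
  inclusions \<open>inc U V : ob U \<rightarrow> ob V\<close>, the products \<open>tens V X\<close> of \<open>X\<close> and \<open>ob V\<close>, and their
  projections \<open>pr1 V X\<close>, \<open>pr2 V X\<close>.
\<close>

record ('j, 'o, 'm) k_choice =
  inc :: "'j \<Rightarrow> 'j \<Rightarrow> 'm"
  tens :: "'j \<Rightarrow> 'o \<Rightarrow> 'o"
  pr1 :: "'j \<Rightarrow> 'o \<Rightarrow> 'm"
  pr2 :: "'j \<Rightarrow> 'o \<Rightarrow> 'm"

definition k_filter_system ::
  "('o, 'm) scat \<Rightarrow> 'j::order set \<Rightarrow> ('j \<Rightarrow> 'o) \<Rightarrow> ('j, 'o, 'm) k_choice \<Rightarrow> bool" where
  "k_filter_system D \<Phi> ob T \<longleftrightarrow>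
     (\<forall>U\<in>\<Phi>. \<forall>V\<in>\<Phi>. U \<le> V \<longrightarrow> inc T U V \<in> simps (shom D (ob U) (ob V)) 0) \<and>
     (\<forall>V\<in>\<Phi>. inc T V V = sid D (ob V)) \<and>
     (\<forall>U\<in>\<Phi>. \<forall>V\<in>\<Phi>. \<forall>W\<in>\<Phi>. U \<le> V \<and> V \<le> W \<longrightarrow>
        scomp D 0 (ob U) (ob V) (ob W) (inc T V W) (inc T U V) = inc T U W) \<and>
     (\<forall>V\<in>\<Phi>. \<forall>X\<in>sobj D. k_product D X (ob V) (tens T V X) (pr1 T V X) (pr2 T V X))"

text \<open>The map \<open>X \<times> U \<rightarrow> X \<times> V\<close> for \<open>U \<le> V\<close>, and restriction along it.\<close>

definition k_tens_inc ::
  "('o, 'm) scat \<Rightarrow> ('j \<Rightarrow> 'o) \<Rightarrow> ('j, 'o, 'm) k_choice \<Rightarrow> 'j \<Rightarrow> 'j \<Rightarrow> 'o \<Rightarrow> 'm" where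
  "k_tens_inc D ob T U V X =
     k_pair D X (ob V) (tens T V X) (pr1 T V X) (pr2 T V X) 0 (tens T U X)
       (pr1 T U X) (scomp D 0 (tens T U X) (ob U) (ob V) (inc T U V) (pr2 T U X))"

definition k_restrict ::
  "('o, 'm) scat \<Rightarrow> ('j \<Rightarrow> 'o) \<Rightarrow> ('j, 'o, 'm) k_choice \<Rightarrow> 'o \<Rightarrow> 'o \<Rightarrow>
    'j \<Rightarrow> 'j \<Rightarrow> nat \<Rightarrow> 'm \<Rightarrow> 'm" where
  "k_restrict D ob T X Y V U n f =
     scomp D n (tens T U X) (tens T V X) Y f
       (deg (shom D (tens T U X) (tens T V X)) n (k_tens_inc D ob T U V X))"

definition k_germ ::
  "('o, 'm) scat \<Rightarrow> 'j::order set \<Rightarrow> ('j \<Rightarrow> 'o) \<Rightarrow> ('j, 'o, 'm) k_choice \<Rightarrow> nat \<Rightarrow> 'o \<Rightarrow> 'o \<Rightarrow>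
    'j \<Rightarrow> 'm \<Rightarrow> ('j \<times> 'm) set" where
  "k_germ D \<Phi> ob T n X Y V f =
     germ \<Phi> (\<lambda>V. simps (shom D (tens T V X) Y) n) (\<lambda>V U. k_restrict D ob T X Y V U n) V f"

text \<open>The composite of \<open>f : X \<times> V \<rightarrow> Y\<close> and \<open>g : Y \<times> V \<rightarrow> Z\<close> is \<open>g \<circ> (f, pr2) : X \<times> V \<rightarrow> Z\<close>.\<close>

definition k_filter_quotient ::
  "('o, 'm) scat \<Rightarrow> 'j::order set \<Rightarrow> ('j \<Rightarrow> 'o) \<Rightarrow> ('j, 'o, 'm) k_choice \<Rightarrow>
    ('o, ('j \<times> 'm) set) scat" where
  "k_filter_quotient D \<Phi> ob T =
     \<lparr>sobj = sobj D,
      shom = (\<lambda>X Y. colim_sset \<Phi> (\<lambda>V. shom D (tens T V X) Y) (k_restrict D ob T X Y)),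
      scomp = (\<lambda>n X Y Z G F. THE H. \<exists>V\<in>\<Phi>. \<exists>f g. (V, f) \<in> F \<and> (V, g) \<in> G \<and>
        H = k_germ D \<Phi> ob T n X Z V
              (scomp D n (tens T V X) (tens T V Y) Z g
                (k_pair D Y (ob V) (tens T V Y) (pr1 T V Y) (pr2 T V Y) n (tens T V X)
                  f (deg (shom D (tens T V X) (ob V)) n (pr2 T V X))))),
      sid = (\<lambda>X. THE H. \<exists>V\<in>\<Phi>. H = k_germ D \<Phi> ob T 0 X X V (pr1 T V X))\<rparr>"

text \<open>The action of the canonical functor on 0-simplices of \<open>Map(X,Y)\<close>.\<close>

definition k_canonical ::
  "('o, 'm) scat \<Rightarrow> 'j::order set \<Rightarrow> ('j \<Rightarrow> 'o) \<Rightarrow> ('j, 'o, 'm) k_choice \<Rightarrow> 'j \<Rightarrow>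
    'o \<Rightarrow> 'o \<Rightarrow> 'm \<Rightarrow> ('j \<times> 'm) set" where
  "k_canonical D \<Phi> ob T tp X Y f =
     k_germ D \<Phi> ob T 0 X Y tp (scomp D 0 (tens T tp X) X Y f (pr1 T tp X))"

section \<open>Complete Segal spaces\<close>

text \<open>
  \<open>bsimps W n k\<close> is the set of k-simplices of the space \<open>W\<^sub>n\<close>; \<open>hact\<close> and \<open>vact\<close> are the
  actions in the first (categorical) and in the second (space) direction.
\<close>

record 'a bsset =
  bsimps :: "nat \<Rightarrow> nat \<Rightarrow> 'a set"
  hact :: "nat \<Rightarrow> nat \<Rightarrow> nat list \<Rightarrow> 'a \<Rightarrow> 'a"
  vact :: "nat \<Rightarrow> nat \<Rightarrow> nat list \<Rightarrow> 'a \<Rightarrow> 'a"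

definition row :: "'a bsset \<Rightarrow> nat \<Rightarrow> 'a sset" where
  "row W k = \<lparr>simps = (\<lambda>n. bsimps W n k), act = (\<lambda>n. hact W n k)\<rparr>"

definition level :: "'a bsset \<Rightarrow> nat \<Rightarrow> 'a sset" where
  "level W n = \<lparr>simps = bsimps W n, act = vact W n\<rparr>"

definition of_rows ::
  "(nat \<Rightarrow> 'a sset) \<Rightarrow> (nat \<Rightarrow> nat \<Rightarrow> nat list \<Rightarrow> 'a \<Rightarrow> 'a) \<Rightarrow> 'a bsset" where
  "of_rows R v = \<lparr>bsimps = (\<lambda>n k. simps (R k) n), hact = (\<lambda>n k. act (R k) n), vact = v\<rparr>"

definition is_bsset :: "'a bsset \<Rightarrow> bool" where
  "is_bsset W \<longleftrightarrow> (\<forall>k. is_sset (row W k)) \<and> (\<forall>n. is_sset (level W n)) \<and>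
     (\<forall>m n k l. \<forall>\<theta>\<in>ops m n. \<forall>\<phi>\<in>ops l k. \<forall>x\<in>bsimps W n k.
        hact W n l \<theta> (vact W n k \<phi> x) = vact W m k \<phi> (hact W n k \<theta> x))"

definition bisimplicial_map :: "'a bsset \<Rightarrow> 'b bsset \<Rightarrow> (nat \<Rightarrow> nat \<Rightarrow> 'a \<Rightarrow> 'b) \<Rightarrow> bool" where
  "bisimplicial_map W Z f \<longleftrightarrow>
     (\<forall>k. simplicial_map (row W k) (row Z k) (\<lambda>n. f n k)) \<and>
     (\<forall>n. simplicial_map (level W n) (level Z n) (f n))"

definition vdeg :: "'a bsset \<Rightarrow> nat \<Rightarrow> nat \<Rightarrow> 'a \<Rightarrow> 'a" where
  "vdeg W n k x = deg (level W n) k x"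

text \<open>The matching space: maps from the boundary of the n-simplex to \<open>W\<close>; a point for \<open>n = 0\<close>.\<close>

definition matching :: "'a bsset \<Rightarrow> nat \<Rightarrow> (nat \<Rightarrow> 'a) sset" where
  "matching W n = (let N = (if n = 0 then {} else {..n}) in
     \<lparr>simps = (\<lambda>k. {y \<in> (\<Pi>\<^sub>E i\<in>N. bsimps W (n - 1) k). n = 0 \<or> boundary (row W k) n y}),
      act = (\<lambda>k \<phi> y. \<lambda>i\<in>N. vact W (n - 1) k \<phi> (y i))\<rparr>)"

definition reedy_fibrant :: "'a bsset \<Rightarrow> bool" where
  "reedy_fibrant W \<longleftrightarrow> (\<forall>n. kan_fibration (level W n) (matching W n)
     (\<lambda>k x. \<lambda>i\<in>(if n = 0 then {} else {..n}). face (row W k) n i x))"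

text \<open>The iterated fibre product of \<open>n\<close> copies of \<open>W\<^sub>1\<close> over \<open>W\<^sub>0\<close>.\<close>

definition spines :: "'a bsset \<Rightarrow> nat \<Rightarrow> (nat \<Rightarrow> 'a) sset" where
  "spines W n =
     \<lparr>simps = (\<lambda>k. {y \<in> (\<Pi>\<^sub>E i\<in>{..<n}. bsimps W 1 k).
        \<forall>i. Suc i < n \<longrightarrow> hact W 1 k [1] (y i) = hact W 1 k [0] (y (Suc i))}),
      act = (\<lambda>k \<phi> y. \<lambda>i\<in>{..<n}. vact W 1 k \<phi> (y i))\<rparr>"

definition segal_space :: "'a bsset \<Rightarrow> bool" where
  "segal_space W \<longleftrightarrow> is_bsset W \<and> reedy_fibrant W \<and>
     (\<forall>n\<ge>2. weak_equivalence (level W n) (spines W n)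
        (\<lambda>k x. \<lambda>i\<in>{..<n}. hact W n k [i, Suc i] x))"

definition s_map :: "'a bsset \<Rightarrow> 'a \<Rightarrow> 'a \<Rightarrow> 'a sset" where
  "s_map W x y =
     \<lparr>simps = (\<lambda>k. {w \<in> bsimps W 1 k. hact W 1 k [0] w = vdeg W 0 k x \<and>
                                        hact W 1 k [1] w = vdeg W 0 k y}),
      act = vact W 1\<rparr>"

definition s_ident :: "'a bsset \<Rightarrow> 'a \<Rightarrow> 'a" where
  "s_ident W x = deg (row W 0) 1 x"

text \<open>\<open>f\<close> has a left inverse \<open>g\<close> and a right inverse \<open>h\<close> up to homotopy in the mapping spaces.\<close>

definition s_equiv :: "'a bsset \<Rightarrow> 'a \<Rightarrow> bool" where
  "s_equiv W f \<longleftrightarrow> f \<in> bsimps W 1 0 \<and>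
     (let x = hact W 1 0 [0] f; y = hact W 1 0 [1] f in
       (\<exists>g\<in>simps (s_map W y x) 0. \<exists>\<sigma>\<in>bsimps W 2 0.
          hact W 2 0 [0, 1] \<sigma> = f \<and> hact W 2 0 [1, 2] \<sigma> = g \<and>
          same_component (s_map W x x) (hact W 2 0 [0, 2] \<sigma>) (s_ident W x)) \<and>
       (\<exists>h\<in>simps (s_map W y x) 0. \<exists>\<tau>\<in>bsimps W 2 0.
          hact W 2 0 [0, 1] \<tau> = h \<and> hact W 2 0 [1, 2] \<tau> = f \<and>
          same_component (s_map W y y) (hact W 2 0 [0, 2] \<tau>) (s_ident W y)))"

definition hoequiv_space :: "'a bsset \<Rightarrow> 'a sset" where
  "hoequiv_space W =
     \<lparr>simps = (\<lambda>k. {x \<in> bsimps W 1 k. \<forall>i\<le>k. s_equiv W (vact W 1 k [i] x)}), act = vact W 1\<rparr>"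

definition complete_segal_space :: "'a bsset \<Rightarrow> bool" where
  "complete_segal_space W \<longleftrightarrow> segal_space W \<and>
     weak_equivalence (level W 0) (hoequiv_space W) (\<lambda>k. hact W 0 k [0, 0])"

text \<open>Slices and cones are formed in each row.\<close>

definition s_slice :: "'a bsset \<Rightarrow> 'a \<Rightarrow> 'a bsset" where
  "s_slice W v = of_rows (\<lambda>k. slice (row W k) (vdeg W 0 k v)) (\<lambda>n. vact W (Suc n))"

definition s_slice_proj :: "'a bsset \<Rightarrow> nat \<Rightarrow> nat \<Rightarrow> 'a \<Rightarrow> 'a" where
  "s_slice_proj W n k x = slice_proj (row W k) n x"

definition s_slice2 :: "'a bsset \<Rightarrow> 'a \<Rightarrow> 'a \<Rightarrow> ('a \<times> 'a) bsset" where
  "s_slice2 W u v = of_rows (\<lambda>k. slice2 (row W k) (vdeg W 0 k u) (vdeg W 0 k v))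
     (\<lambda>n k \<phi> (s, t). (vact W (Suc n) k \<phi> s, vact W (Suc n) k \<phi> t))"

definition s_cone_slice ::
  "'a bsset \<Rightarrow> 'k sset \<Rightarrow> (nat \<Rightarrow> 'k \<Rightarrow> 'a) \<Rightarrow> ('a \<times> (nat \<Rightarrow> 'k \<Rightarrow> 'a)) bsset" where
  "s_cone_slice W K p = of_rows (\<lambda>k. cone_slice (row W k) K (\<lambda>j c. vdeg W j k (p j c)))
     (\<lambda>n k \<phi> (b, F). (vact W n k \<phi> b,
        \<lambda>j c. if c \<in> simps K j then vact W (Suc n + j) k \<phi> (F j c) else undefined))"

definition s_terminal :: "'a bsset \<Rightarrow> 'a \<Rightarrow> bool" where
  "s_terminal W t \<longleftrightarrow> t \<in> bsimps W 0 0 \<and> (\<forall>z\<in>bsimps W 0 0. contractible_sset (s_map W z t))"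

definition s_finitely_complete :: "'a bsset \<Rightarrow> bool" where
  "s_finitely_complete W \<longleftrightarrow>
     (\<forall>(K :: nat sset) p. finite_sset K \<and> simplicial_map K (row W 0) p \<longrightarrow>
        (\<exists>c. s_terminal (s_cone_slice W K p) c))"

definition s_subterminal :: "'a bsset \<Rightarrow> 'a \<Rightarrow> bool" where
  "s_subterminal W u \<longleftrightarrow> u \<in> bsimps W 0 0 \<and>
     (\<forall>z\<in>bsimps W 0 0. simps (s_map W z u) 0 = {} \<or> contractible_sset (s_map W z u))"

definition s_monos :: "'a bsset \<Rightarrow> 'a \<Rightarrow> 'a set" where
  "s_monos W y = {m \<in> bsimps (s_slice W y) 0 0. s_subterminal (s_slice W y) m}"

definition s_iso :: "'a bsset \<Rightarrow> 'a \<Rightarrow> 'a \<Rightarrow> bool" where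
  "s_iso W x y \<longleftrightarrow> (\<exists>e. s_equiv W e \<and> hact W 1 0 [0] e = x \<and> hact W 1 0 [1] e = y)"

definition s_Sub :: "'a bsset \<Rightarrow> 'a \<Rightarrow> 'a set set" where
  "s_Sub W y = {{m' \<in> s_monos W y. s_iso (s_slice W y) m m'} | m. m \<in> s_monos W y}"

definition s_product :: "'a bsset \<Rightarrow> 'a \<Rightarrow> 'a \<Rightarrow> 'a \<Rightarrow> 'a \<Rightarrow> bool" where
  "s_product W x y a b \<longleftrightarrow> s_terminal (s_slice2 W x y) (a, b)"

text \<open>The product of \<open>W\<close> with the 1-simplex, the latter constant in the space direction.\<close>

definition s_interval_prod :: "'a bsset \<Rightarrow> (nat list \<times> 'a) bsset" where
  "s_interval_prod W = of_rows (\<lambda>k. prod2 (std_simplex 1) (row W k))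
     (\<lambda>n k \<phi> (\<sigma>, x). (\<sigma>, vact W n k \<phi> x))"

definition s_times :: "'a bsset \<Rightarrow> 'a \<Rightarrow> 'a \<Rightarrow> (nat \<Rightarrow> nat \<Rightarrow> 'a \<Rightarrow> 'a) \<Rightarrow> bool" where
  "s_times W v u F \<longleftrightarrow> bisimplicial_map (s_slice W v) (s_slice W u) F \<and>
     (\<exists>\<epsilon>. bisimplicial_map (s_interval_prod (s_slice W v)) W \<epsilon> \<and>
        (\<forall>n k. \<forall>x\<in>bsimps (s_slice W v) n k.
           \<epsilon> n k (replicate (Suc n) 0, x) = s_slice_proj W n k (F n k x) \<and>
           \<epsilon> n k (replicate (Suc n) 1, x) = s_slice_proj W n k x) \<and>
        (\<forall>x\<in>bsimps (s_slice W v) 0 0.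
           s_product W (s_slice_proj W 0 0 x) u
             (\<epsilon> 1 0 ([0, 1], s_ident (s_slice W v) x)) (F 0 0 x)))"

definition s_filter_system ::
  "'a bsset \<Rightarrow> 'j::order set \<Rightarrow> ('j \<Rightarrow> 'a) \<Rightarrow> ('j \<Rightarrow> 'j \<Rightarrow> nat \<Rightarrow> nat \<Rightarrow> 'a \<Rightarrow> 'a) \<Rightarrow> bool" where
  "s_filter_system D \<Phi> ob T \<longleftrightarrow>
     (\<forall>V\<in>\<Phi>. \<forall>U\<in>\<Phi>. U \<le> V \<longrightarrow> s_times D (ob V) (ob U) (T V U)) \<and>
     (\<forall>V\<in>\<Phi>. \<forall>n k. \<forall>x\<in>bsimps (s_slice D (ob V)) n k. T V V n k x = x) \<and>
     (\<forall>V\<in>\<Phi>. \<forall>U\<in>\<Phi>. \<forall>W\<in>\<Phi>. W \<le> U \<and> U \<le> V \<longrightarrow>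
        (\<forall>n k. \<forall>x\<in>bsimps (s_slice D (ob V)) n k. T U W n k (T V U n k x) = T V W n k x))"

definition s_filter_quotient ::
  "'a bsset \<Rightarrow> 'j::order set \<Rightarrow> ('j \<Rightarrow> 'a) \<Rightarrow> ('j \<Rightarrow> 'j \<Rightarrow> nat \<Rightarrow> nat \<Rightarrow> 'a \<Rightarrow> 'a) \<Rightarrow>
    ('j \<times> 'a) set bsset" where
  "s_filter_quotient D \<Phi> ob T =
     \<lparr>bsimps = (\<lambda>n k. simps (colim_sset \<Phi> (\<lambda>V. row (s_slice D (ob V)) k) (\<lambda>V U n. T V U n k)) n),
      hact = (\<lambda>n k. act (colim_sset \<Phi> (\<lambda>V. row (s_slice D (ob V)) k) (\<lambda>V U n. T V U n k)) n),
      vact = (\<lambda>n k. act (colim_sset \<Phi> (\<lambda>V. level (s_slice D (ob V)) n) (\<lambda>V U. T V U n)) k)\<rparr>"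

definition s_canonical ::
  "'a bsset \<Rightarrow> 'j::order set \<Rightarrow> ('j \<Rightarrow> 'a) \<Rightarrow> ('j \<Rightarrow> 'j \<Rightarrow> nat \<Rightarrow> nat \<Rightarrow> 'a \<Rightarrow> 'a) \<Rightarrow> 'j \<Rightarrow>
    (nat \<Rightarrow> nat \<Rightarrow> 'a \<Rightarrow> ('j \<times> 'a) set) \<Rightarrow> bool" where
  "s_canonical D \<Phi> ob T tp P \<longleftrightarrow>
     (\<exists>s. bisimplicial_map D (s_slice D (ob tp)) s \<and>
        (\<forall>n k. \<forall>x\<in>bsimps D n k. s_slice_proj D n k (s n k x) = x) \<and>
        (\<forall>n k. \<forall>x\<in>bsimps D n k.
           P n k x = germ \<Phi> (\<lambda>V. bsimps (s_slice D (ob V)) n k) (\<lambda>V U. T V U n k) tp (s n k x)))"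

definition s_power :: "'i set \<Rightarrow> 'a bsset \<Rightarrow> ('i \<Rightarrow> 'a) bsset" where
  "s_power I C = of_rows (\<lambda>k. prod_sset I (\<lambda>_. row C k))
     (\<lambda>n k \<phi> x. \<lambda>i\<in>I. vact C n k \<phi> (x i))"

section \<open>Strictness of the subobject 0\<close>

text \<open>
  Every map into \<open>z\<close> is an equivalence; in a finitely complete category this says that \<open>z\<close> is
  a strict initial object. It does not follow for the smaller of the two subobjects of 1. Let
  \<open>B\<close> be the category of groups and \<open>C\<close> the category obtained from \<open>B\<close> by adjoining a new final
  object 1. Then \<open>C\<close> is finitely complete, and the subobjects of 1 are 1 and the trivial group
  0, which is initial but not strict. For \<open>I = {a, b}\<close> and \<open>\<Phi> = {I, {a}}\<close> the filter product
  is the slice of \<open>C \<times> C\<close> over (1, 0), which is \<open>C \<times> B\<close>. So if \<open>h\<close> is a homomorphism of groups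
  that is no isomorphism, then \<open>(id, h)\<close> is no equivalence in the filter product, although
  \<open>{i. f\<^sub>i is an equivalence} = {a} \<in> \<Phi>\<close>.
\<close>

definition q_strict :: "'a sset \<Rightarrow> 'a \<Rightarrow> bool" where
  "q_strict S z \<longleftrightarrow> (\<forall>e\<in>simps S 1. act S 1 [1] e = z \<longrightarrow> q_equiv S e)"

definition k_strict :: "('o, 'm) scat \<Rightarrow> 'o \<Rightarrow> bool" where
  "k_strict C z \<longleftrightarrow> (\<forall>x\<in>sobj C. \<forall>e\<in>simps (shom C x z) 0. k_equiv C x z e)"

definition s_strict :: "'a bsset \<Rightarrow> 'a \<Rightarrow> bool" where
  "s_strict W z \<longleftrightarrow> (\<forall>e\<in>bsimps W 1 0. hact W 1 0 [1] e = z \<longrightarrow> s_equiv W e)"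

end

(*
  A map of the filter product lives at some stage V of the filter, i.e. in the slice of C^I over the
  subobject V of 1, and equivalences are detected at a finite stage because they are given by
  finitely many simplices. Restriction along V <= I multiplies with V, so it changes the component at
  i in V only by composing with the projections from products with 1, which are equivalences. Hence a
  map that becomes an equivalence over V has equivalences as components on V. Conversely, over
  J = {i. f_i is an equivalence} the components outside J are maps between objects over the strict
  object 0, so they are equivalences, and a map of a slice is an equivalence if its underlying map is.
*)
theory Submission
  imports Defs
begin

text \<open>The three models get three separate arguments, and strictness of the object 0 enters
  only the converse implication. The algebra of equivalences (cancellation, two-of-six) serves
  quasi-categories and Kan enriched categories alike; both are presented as weak categories, so that
  it is proved once. In a complete Segal space composition involves moving along paths. There an
  equivalence is moved along a path to an identity, which completeness provides, and cancellation is
  checked at the identity.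

  In slices, a map and its restriction are compared by a naturality square with product projections
  as vertical sides. Products are formed in the power, so their universal property has to be used at
  a single index: the other indices are filled by the projections themselves and by degenerate
  simplices or identities. The enriched quotient has no slices: a map of stage V is a map X x V ->
  Y, and invertibility becomes a lifting problem for f against the projections X x V -> X and Y x V
  -> Y.\<close>

section \<open>Weak categories\<close>

text \<open>
  A category up to homotopy, presented by its commutative triangles: \<open>tri f g h\<close> says that \<open>h\<close>
  is a composite of \<open>f\<close> followed by \<open>g\<close>.
\<close>

locale weak_category =
  fixes E :: "'e set" and src tgt :: "'e \<Rightarrow> 'v" and ident :: "'v \<Rightarrow> 'e"
    and tri :: "'e \<Rightarrow> 'e \<Rightarrow> 'e \<Rightarrow> bool"
  assumes triD: "tri f g h \<Longrightarrow> f \<in> E \<and> g \<in> E \<and> h \<in> E \<and> tgt f = src g \<and> src h = src f \<and> tgt h = tgt g"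
    and tri_exists: "f \<in> E \<Longrightarrow> g \<in> E \<Longrightarrow> tgt f = src g \<Longrightarrow> \<exists>h. tri f g h"
    and tri_id_left: "f \<in> E \<Longrightarrow> tri (ident (src f)) f f"
    and tri_id_right: "f \<in> E \<Longrightarrow> tri f (ident (tgt f)) f"
    and assoc1: "tri f g a \<Longrightarrow> tri g h b \<Longrightarrow> tri f b c \<Longrightarrow> tri a h c"
    and assoc2: "tri f g a \<Longrightarrow> tri g h b \<Longrightarrow> tri a h c \<Longrightarrow> tri f b c"
begin

definition equivalence :: "'e \<Rightarrow> bool" where
  "equivalence f \<longleftrightarrow> (\<exists>g. tri f g (ident (src f)) \<and> tri g f (ident (tgt f)))"

text \<open>The homotopy relation of arrows in a quasi-category: a triangle whose second side is an
  identity.\<close>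

definition homotopic :: "'e \<Rightarrow> 'e \<Rightarrow> bool" where
  "homotopic f f' \<longleftrightarrow> tri f (ident (tgt f)) f'"

lemma tri_unique: "tri f g h \<Longrightarrow> tri f g h' \<Longrightarrow> homotopic h h'"
  unfolding homotopic_def by (metis assoc1 triD tri_id_right)

text \<open>Associativity for \<open>f\<close>, an identity and \<open>g\<close>: the first two
  compose to \<open>f'\<close>, the last two to \<open>g\<close>.\<close>

lemma tri_homotopic1: "tri f g h \<Longrightarrow> homotopic f f' \<Longrightarrow> tri f' g h"
  unfolding homotopic_def by (metis assoc1 triD tri_id_left)

text \<open>The usual computation k = k(fg) = (kf)g = g, in diagrammatic order and with equality
  replaced by \<open>homotopic\<close>; then \<open>g\<close> can take the place of
  \<open>k\<close>.\<close>

lemma equivalence_if_inverses: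
  assumes "tri f g (ident (src f))" "tri k f (ident (tgt f))"
  shows "equivalence f"
proof -
  have "tri k (ident (src f)) k"
    using assms by (metis triD tri_id_right)
  then have "tri (ident (tgt f)) g k"
    using assoc1 assms by blast
  moreover have "tri (ident (tgt f)) g g"
    using assms by (metis triD tri_id_left)
  ultimately have "homotopic k g"
    by (metis tri_unique)
  then have "tri g f (ident (tgt f))"
    using assms tri_homotopic1 by blast
  then show ?thesis
    using assms unfolding equivalence_def by blast
qed

lemma equivalence_inverse:
  assumes "equivalence f"
  obtains g where "equivalence g" "tri f g (ident (src f))" "tri g f (ident (tgt f))"
proof -
  from assms obtain g where g: "tri f g (ident (src f))" "tri g f (ident (tgt f))"
    unfolding equivalence_def by blast
  moreover have "equivalence g"
    unfolding equivalence_def using g by (metis triD)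
  ultimately show thesis
    using that by blast
qed

text \<open>Inverses are moved across a triangle here and in the next lemma; composition and
  cancellation of equivalences reduce to these two moves.\<close>

lemma tri_right_inverse:
  assumes "tri f g h" "tri g g' (ident (src g))"
  shows "tri h g' f"
  using assms by (metis assoc1 triD tri_id_right)

lemma tri_left_inverse:
  assumes "tri f g h" "tri f' f (ident (tgt f))"
  shows "tri f' h g"
  using assms by (metis assoc2 triD tri_id_left)

lemma equivalence_ident: "f \<in> E \<Longrightarrow> equivalence (ident (src f))"
  unfolding equivalence_def by (metis triD tri_id_left)

lemma equivalence_comp:
  assumes t: "tri f g h" and "equivalence f" "equivalence g"
  shows "equivalence h"
proof -
  obtain f' where f': "tri f f' (ident (src f))" "tri f' f (ident (tgt f))"
    using assms(2) unfolding equivalence_def by blast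
  obtain g' where g': "tri g g' (ident (src g))" "tri g' g (ident (tgt g))"
    using assms(3) unfolding equivalence_def by blast
  obtain h' where h': "tri g' f' h'"
    using tri_exists t f' g' by (metis triD)
  have "tri h h' (ident (src h))"
    using assoc2[OF tri_right_inverse[OF t g'(1)] h'] f' t by (metis triD)
  moreover have "tri h' h (ident (tgt h))"
    using assoc1[OF h' tri_left_inverse[OF t f'(2)]] g' t by (metis triD)
  ultimately show ?thesis
    unfolding equivalence_def by blast
qed

lemma equivalence_cancel_right:
  assumes t: "tri f g h" and "equivalence g" "equivalence h"
  shows "equivalence f"
proof -
  obtain g' where g': "equivalence g'" "tri g g' (ident (src g))"
    using equivalence_inverse[OF assms(2)] by metis
  then show ?thesis
    using equivalence_comp[OF tri_right_inverse[OF t g'(2)]] assms by blast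
qed

lemma equivalence_cancel_left:
  assumes t: "tri f g h" and "equivalence f" "equivalence h"
  shows "equivalence g"
proof -
  obtain f' where f': "equivalence f'" "tri f' f (ident (tgt f))"
    using equivalence_inverse[OF assms(2)] by metis
  then show ?thesis
    using equivalence_comp[OF tri_left_inverse[OF t f'(2)]] assms by blast
qed

text \<open>The inverse of \<open>p\<close> followed by \<open>u\<close>, and \<open>w\<close>
  followed by the inverse of \<open>q\<close>, are inverses of \<open>v\<close> on its two sides. In
  the application \<open>v\<close> comes from an inverse in the filter quotient and \<open>w\<close>
  is the map whose invertibility is asked for.\<close>

lemma equivalence_two_of_six:
  assumes t: "tri u v p" "tri v w q" and "equivalence p" "equivalence q"
  shows "equivalence v" "equivalence w"
proof -
  obtain p' where p': "tri p' p (ident (tgt p))"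
    using assms(3) unfolding equivalence_def by blast
  obtain q' where q': "tri q q' (ident (src q))"
    using assms(4) unfolding equivalence_def by blast
  obtain k where k: "tri p' u k"
    using tri_exists p' t by (metis triD)
  obtain l where l: "tri w q' l"
    using tri_exists q' t by (metis triD)
  have "tri k v (ident (tgt v))"
    using assoc1[OF k t(1)] p' triD[OF t(1)] by simp
  moreover have "tri v l (ident (src v))"
    using assoc2[OF t(2) l] q' triD[OF t(2)] by simp
  ultimately show v: "equivalence v"
    using equivalence_if_inverses by blast
  show "equivalence w"
    by (rule equivalence_cancel_left[OF t(2) v assms(4)])
qed

text \<open>The diagonal of the square is the inverse of \<phi> followed by \<open>a\<close>; both
  triangles follow by associativity.\<close>

lemma equivalence_lift:
  assumes "tri \<phi> a' d" "tri a f d" "equivalence \<phi>"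
  shows "\<exists>g. tri \<phi> g a \<and> tri g f a'"
proof -
  obtain k where k: "tri \<phi> k (ident (src \<phi>))" "tri k \<phi> (ident (tgt \<phi>))"
    using assms(3) unfolding equivalence_def by blast
  obtain g where g: "tri k a g"
    using tri_exists k assms by (metis triD)
  have "tri \<phi> g a"
    using assoc2[OF k(1) g] tri_id_left[of a] triD[OF assms(1)] triD[OF assms(2)] by simp
  moreover have "tri k d a'"
    using assoc2[OF k(2) assms(1)] tri_id_left[of a'] triD[OF assms(1)] by simp
  then have "tri g f a'"
    by (rule assoc1[OF g assms(2)])
  ultimately show ?thesis
    by blast
qed

text \<open>For naturality squares, with product projections as \<open>e0\<close> and
  \<open>e1\<close>.\<close>

lemma equivalence_square:
  assumes "tri f e1 d" "tri e0 f' d" "equivalence e0" "equivalence e1"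
  shows "equivalence f \<longleftrightarrow> equivalence f'"
  using equivalence_comp[OF assms(1)] equivalence_comp[OF assms(2)]
    equivalence_cancel_right[OF assms(1)] equivalence_cancel_left[OF assms(2)] assms(3,4) by blast

end

section \<open>Simplicial sets, slices and directed colimits\<close>

section \<open>Simplicial sets\<close>

lemma act_in: "is_sset X \<Longrightarrow> x \<in> simps X n \<Longrightarrow> \<theta> \<in> ops m n \<Longrightarrow> act X n \<theta> x \<in> simps X m"
  unfolding is_sset_def by blast

lemma act_id: "is_sset X \<Longrightarrow> x \<in> simps X n \<Longrightarrow> act X n [0..<Suc n] x = x"
  unfolding is_sset_def by blast

lemma act_act:
  "is_sset X \<Longrightarrow> x \<in> simps X n \<Longrightarrow> \<theta> \<in> ops m n \<Longrightarrow> \<phi> \<in> ops (length \<phi> - 1) m \<Longrightarrow>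
    act X m \<phi> (act X n \<theta> x) = act X n (map ((!) \<theta>) \<phi>) x"
  unfolding is_sset_def by blast

lemma simplicial_map_in: "simplicial_map X Y f \<Longrightarrow> x \<in> simps X n \<Longrightarrow> f n x \<in> simps Y n"
  unfolding simplicial_map_def by blast

lemma simplicial_map_act:
  "simplicial_map X Y f \<Longrightarrow> x \<in> simps X n \<Longrightarrow> \<theta> \<in> ops m n \<Longrightarrow>
    f m (act X n \<theta> x) = act Y n \<theta> (f n x)"
  unfolding simplicial_map_def by blast

lemma replicate_0_in_ops: "replicate (Suc n) 0 \<in> ops n 0"
  by (auto simp: ops_def)

lemma deg_in: "is_sset X \<Longrightarrow> x \<in> simps X 0 \<Longrightarrow> deg X n x \<in> simps X n"
  unfolding deg_def by (rule act_in[OF _ _ replicate_0_in_ops])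

lemma act_deg:
  assumes "is_sset X" "x \<in> simps X 0" "\<theta> \<in> ops m n"
  shows "act X n \<theta> (deg X n x) = deg X m x"
proof -
  have "map ((!) (replicate (Suc n) 0)) \<theta> = replicate (Suc m) (0::nat)"
    using assms(3) unfolding ops_def
    by (auto intro!: nth_equalityI simp: subset_iff nth_Cons' simp del: replicate_Suc)
      (metis le_imp_less_Suc nth_mem nth_replicate lessI less_Suc_eq_le)
  moreover have "\<theta> \<in> ops (length \<theta> - 1) n"
    using assms(3) by (auto simp: ops_def)
  ultimately show ?thesis
    unfolding deg_def using act_act[OF assms(1,2) replicate_0_in_ops[of n], of \<theta>] by simp
qed

lemma simplicial_map_deg:
  "simplicial_map X Y f \<Longrightarrow> x \<in> simps X 0 \<Longrightarrow> f n (deg X n x) = deg Y n (f 0 x)"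
  unfolding deg_def by (rule simplicial_map_act[OF _ _ replicate_0_in_ops])

lemma face_op_in_ops: "i \<le> Suc n \<Longrightarrow> removeAll i [0..<Suc (Suc n)] \<in> ops n (Suc n)"
proof -
  assume "i \<le> Suc n"
  then have "length (removeAll i [0..<Suc (Suc n)]) = Suc n"
    by (simp flip: distinct_remove1_removeAll add: length_remove1 del: upt_Suc)
  moreover have "sorted (removeAll i [0..<Suc (Suc n)])"
    by (simp add: removeAll_filter_not_eq sorted_wrt_filter del: upt_Suc)
  ultimately show ?thesis
    by (auto simp: ops_def)
qed

lemma simplicial_map_face:
  "simplicial_map X Y f \<Longrightarrow> x \<in> simps X (Suc n) \<Longrightarrow> i \<le> Suc n \<Longrightarrow>
    f n (face X (Suc n) i x) = face Y (Suc n) i (f (Suc n) x)"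
  unfolding face_def by (rule simplicial_map_act[OF _ _ face_op_in_ops])

lemma ops_iff: "\<theta> \<in> ops m n \<longleftrightarrow> length \<theta> = Suc m \<and> sorted \<theta> \<and> (\<forall>i\<in>set \<theta>. i \<le> n)"
  by (auto simp: ops_def)

lemma ops_ops_length: "\<theta> \<in> ops m n \<Longrightarrow> \<theta> \<in> ops (length \<theta> - 1) n"
  by (simp add: ops_iff)

lemma face_last: "face X (Suc n) (Suc n) x = act X (Suc n) [0..<Suc n] x"
proof -
  have "removeAll (Suc n) [0..<Suc (Suc n)] = [0..<Suc n]"
    by (simp add: removeAll_filter_not_eq)
  then show ?thesis
    unfolding face_def by metis
qed

section \<open>Products of simplicial sets\<close>

lemma simps_prod_sset [simp]: "simps (prod_sset I X) n = (\<Pi>\<^sub>E i\<in>I. simps (X i) n)"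
  and act_prod_sset [simp]: "act (prod_sset I X) n \<theta> x = (\<lambda>i\<in>I. act (X i) n \<theta> (x i))"
  by (simp_all add: prod_sset_def)

lemma is_sset_prod_sset: "(\<And>i. i \<in> I \<Longrightarrow> is_sset (X i)) \<Longrightarrow> is_sset (prod_sset I X)"
  unfolding is_sset_def
  by (auto simp: PiE_iff extensional_def fun_eq_iff simp del: upt_Suc)

lemma simplicial_map_component:
  "i \<in> I \<Longrightarrow> simplicial_map (prod_sset I X) (X i) (\<lambda>n x. x i)"
  unfolding simplicial_map_def by (auto simp: PiE_iff)

lemma face_prod_sset: "face (prod_sset I X) n k x = (\<lambda>i\<in>I. face (X i) n k (x i))"
  by (simp add: face_def)

lemma deg_prod_sset: "deg (prod_sset I X) n x = (\<lambda>i\<in>I. deg (X i) n (x i))"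
  by (simp add: deg_def)

section \<open>Slices\<close>

lemma slice_act_simp [simp]: "act (slice S v) n \<theta> x = act S (Suc n) (\<theta> @ [Suc n]) x"
  by (simp add: slice_def)

lemma slice_simps_iff [simp]:
  "x \<in> simps (slice S v) n \<longleftrightarrow> x \<in> simps S (Suc n) \<and> act S (Suc n) [Suc n] x = v"
  by (simp add: slice_def)

lemma ops_snoc: "\<theta> \<in> ops m n \<Longrightarrow> \<theta> @ [Suc n] \<in> ops (Suc m) (Suc n)"
  by (auto simp: ops_iff sorted_append le_Suc_eq)

lemma last_in_ops: "[n] \<in> ops 0 n"
  by (simp add: ops_iff)

lemma upt_in_ops: "m \<le> n \<Longrightarrow> [0..<Suc m] \<in> ops m n"
  by (auto simp: ops_iff simp del: upt_Suc)

lemma is_sset_slice: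
  assumes S: "is_sset S"
  shows "is_sset (slice S v)"
  unfolding is_sset_def
proof (intro conjI allI ballI)
  fix m n \<theta> x
  assume \<theta>: "\<theta> \<in> ops m n" and x: "x \<in> simps (slice S v) n"
  have "act S (Suc m) [Suc m] (act S (Suc n) (\<theta> @ [Suc n]) x) = act S (Suc n) [Suc n] x"
    using x \<theta> act_act[OF S _ ops_snoc[OF \<theta>] ops_ops_length[OF last_in_ops], of x]
    by (simp add: nth_append ops_iff)
  then show "act (slice S v) n \<theta> x \<in> simps (slice S v) m"
    using x act_in[OF S _ ops_snoc[OF \<theta>]] by simp
next
  fix n x
  assume "x \<in> simps (slice S v) n"
  then show "act (slice S v) n [0..<Suc n] x = x"
    using act_id[OF S, of x "Suc n"] by simp
next
  fix k m n \<phi> \<theta> x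
  assume \<phi>: "\<phi> \<in> ops k m" and \<theta>: "\<theta> \<in> ops m n" and x: "x \<in> simps (slice S v) n"
  have "map ((!) (\<theta> @ [Suc n])) (\<phi> @ [Suc m]) = map ((!) \<theta>) \<phi> @ [Suc n]"
    using \<phi> \<theta> by (auto simp: ops_iff nth_append)
  then show "act (slice S v) m \<phi> (act (slice S v) n \<theta> x) = act (slice S v) n (map ((!) \<theta>) \<phi>) x"
    using x act_act[OF S _ ops_snoc[OF \<theta>] ops_ops_length[OF ops_snoc[OF \<phi>]], of x]
    unfolding slice_act_simp by (metis slice_simps_iff)
qed

lemma simplicial_map_slice_proj:
  assumes S: "is_sset S"
  shows "simplicial_map (slice S v) S (slice_proj S)"
  unfolding simplicial_map_def slice_proj_def
proof (intro conjI allI ballI)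
  fix n x
  assume "x \<in> simps (slice S v) n"
  then show "act S (Suc n) [0..<Suc n] x \<in> simps S n"
    using act_in[OF S _ upt_in_ops] by simp
next
  fix m n \<theta> x
  assume \<theta>: "\<theta> \<in> ops m n" and x: "x \<in> simps (slice S v) n"
  have "map ((!) (\<theta> @ [Suc n])) [0..<Suc m] = \<theta>"
    using \<theta> by (intro nth_equalityI) (auto simp: ops_iff nth_append simp del: upt_Suc)
  moreover have "map ((!) [0..<Suc n]) \<theta> = \<theta>"
    using \<theta> by (intro nth_equalityI) (auto simp: ops_iff less_Suc_eq_le simp del: upt_Suc)
  ultimately show "act S (Suc m) [0..<Suc m] (act (slice S v) n \<theta> x) =
      act S n \<theta> (act S (Suc n) [0..<Suc n] x)"
    using x act_act[OF S _ ops_snoc[OF \<theta>] ops_ops_length[OF upt_in_ops[of m "Suc m"]], of x]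
      act_act[OF S _ upt_in_ops[of n "Suc n"] ops_ops_length[OF \<theta>], of x]
    by (simp del: upt_Suc)
qed

text \<open>The last vertex of a simplex of the product is a function restricted to \<open>I\<close>
  and is compared with \<open>u\<close> as a function, hence \<open>u\<close> has to be
  extensional.\<close>

lemma slice_prod_sset:
  assumes "u \<in> extensional I"
  shows "slice (prod_sset I X) u = prod_sset I (\<lambda>i. slice (X i) (u i))"
proof -
  have "{x \<in> (\<Pi>\<^sub>E i\<in>I. simps (X i) (Suc n)). (\<lambda>i\<in>I. act (X i) (Suc n) [Suc n] (x i)) = u} =
      (\<Pi>\<^sub>E i\<in>I. {x \<in> simps (X i) (Suc n). act (X i) (Suc n) [Suc n] x = u i})" for n
    using assms by (auto simp: PiE_iff fun_eq_iff extensional_def)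
  then show ?thesis
    by (simp add: slice_def prod_sset_def fun_eq_iff)
qed

lemma slice_proj_prod_sset: "slice_proj (prod_sset I X) n x = (\<lambda>i\<in>I. slice_proj (X i) n (x i))"
  by (simp add: slice_proj_def)

lemma face_slice:
  assumes "i \<le> n"
  shows "face (slice S v) n i x = face S (Suc n) i x"
  using assms by (simp add: face_def)

section \<open>Directed colimits\<close>

text \<open>The filter of tails of \<Phi> towards small members. With it, facts about finitely many
  germs are combined by eventual conjunction, and no common stage has to be named.\<close>

definition below :: "'j::order set \<Rightarrow> 'j filter" where
  "below \<Phi> = (INF V\<in>\<Phi>. principal {W\<in>\<Phi>. W \<le> V})"

locale directed_system =
  fixes \<Phi> :: "'j::order set" and G :: "'j \<Rightarrow> 'a set" and T :: "'j \<Rightarrow> 'j \<Rightarrow> 'a \<Rightarrow> 'a"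
  assumes nonempty: "\<Phi> \<noteq> {}"
    and directed: "U \<in> \<Phi> \<Longrightarrow> V \<in> \<Phi> \<Longrightarrow> \<exists>W\<in>\<Phi>. W \<le> U \<and> W \<le> V"
    and T_in: "V \<in> \<Phi> \<Longrightarrow> U \<in> \<Phi> \<Longrightarrow> U \<le> V \<Longrightarrow> x \<in> G V \<Longrightarrow> T V U x \<in> G U"
    and T_T: "V \<in> \<Phi> \<Longrightarrow> U \<in> \<Phi> \<Longrightarrow> W \<in> \<Phi> \<Longrightarrow> W \<le> U \<Longrightarrow> U \<le> V \<Longrightarrow> x \<in> G V \<Longrightarrow>
      T U W (T V U x) = T V W x"
    and T_refl: "V \<in> \<Phi> \<Longrightarrow> x \<in> G V \<Longrightarrow> T V V x = x"
begin

lemma eventually_below: "eventually P (below \<Phi>) \<longleftrightarrow> (\<exists>V\<in>\<Phi>. \<forall>W\<in>\<Phi>. W \<le> V \<longrightarrow> P W)"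
  unfolding below_def
proof (subst eventually_INF_base)
  fix U V
  assume "U \<in> \<Phi>" "V \<in> \<Phi>"
  then obtain W where "W \<in> \<Phi>" "W \<le> U" "W \<le> V"
    using directed by blast
  then show "\<exists>W\<in>\<Phi>. principal {X\<in>\<Phi>. X \<le> W} \<le>
      inf (principal {X\<in>\<Phi>. X \<le> U}) (principal {X\<in>\<Phi>. X \<le> V})"
    by (intro bexI[of _ W]) auto
qed (auto simp: nonempty eventually_principal)

lemma below_neq_bot: "below \<Phi> \<noteq> bot"
  using eventually_below[of "\<lambda>_. False"] by (auto simp: trivial_limit_def)

lemma eventually_ge: "V \<in> \<Phi> \<Longrightarrow> \<forall>\<^sub>F W in below \<Phi>. W \<in> \<Phi> \<and> W \<le> V"
  unfolding eventually_below by blast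

text \<open>The point is transitivity: agreements found at two different stages are compared at a
  stage below both.\<close>

lemma germ_eq_iff:
  assumes "V \<in> \<Phi>" "U \<in> \<Phi>" "x \<in> G V" "y \<in> G U"
  shows "germ \<Phi> G T V x = germ \<Phi> G T U y \<longleftrightarrow> (\<exists>W\<in>\<Phi>. W \<le> V \<and> W \<le> U \<and> T V W x = T U W y)"
    (is "?L \<longleftrightarrow> ?R")
proof
  assume ?L
  moreover have "(V, x) \<in> germ \<Phi> G T V x"
    using assms by (auto simp: germ_def)
  ultimately show ?R
    by (auto simp: germ_def)
next
  have sub: "germ \<Phi> G T V x \<subseteq> germ \<Phi> G T U y"
    if *: "V \<in> \<Phi>" "U \<in> \<Phi>" "x \<in> G V" "y \<in> G U" "W \<in> \<Phi>" "W \<le> V" "W \<le> U" "T V W x = T U W y"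
    for V U x y W
  proof
    fix p
    assume "p \<in> germ \<Phi> G T V x"
    then obtain X z Y where p: "p = (X, z)" "X \<in> \<Phi>" "z \<in> G X" "Y \<in> \<Phi>" "Y \<le> X" "Y \<le> V"
      "T X Y z = T V Y x"
      by (auto simp: germ_def)
    obtain Z where Z: "Z \<in> \<Phi>" "Z \<le> Y" "Z \<le> W"
      using directed p * by blast
    have "T X Z z = T Y Z (T X Y z)"
      using T_T p(2-6) Z by simp
    also have "\<dots> = T V Z x"
      unfolding p(7) using T_T p(2-7) Z * by simp
    also have "\<dots> = T W Z (T V W x)"
      using T_T Z *(1-7) by simp
    also have "\<dots> = T U Z y"
      unfolding *(8) using T_T Z *(1-7) by simp
    finally have "T X Z z = T U Z y" .
    then show "p \<in> germ \<Phi> G T U y"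
      unfolding germ_def using p Z * by (auto intro!: bexI[of _ Z] elim: order_trans)
  qed
  assume ?R
  then show ?L
    using sub assms by (metis subset_antisym)
qed

text \<open>A germ is described by a function of the stage that is prescribed on a tail only.
  Operations on germs then act on these functions stage by stage, and two functions for the same
  germ agree eventually.\<close>

definition rep :: "('j \<times> 'a) set \<Rightarrow> ('j \<Rightarrow> 'a) \<Rightarrow> bool" where
  "rep c a \<longleftrightarrow> (\<exists>V\<in>\<Phi>. a V \<in> G V \<and> c = germ \<Phi> G T V (a V) \<and> (\<forall>W\<in>\<Phi>. W \<le> V \<longrightarrow> a W = T V W (a V)))"

lemma rep_coherent:
  assumes "rep c a"
  shows "\<forall>\<^sub>F V in below \<Phi>. V \<in> \<Phi> \<and> a V \<in> G V \<and> c = germ \<Phi> G T V (a V) \<and>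
    (\<forall>W\<in>\<Phi>. W \<le> V \<longrightarrow> a W = T V W (a V))"
proof -
  obtain V where V: "V \<in> \<Phi>" "a V \<in> G V" "c = germ \<Phi> G T V (a V)"
    "\<And>W. W\<in>\<Phi> \<Longrightarrow> W \<le> V \<Longrightarrow> a W = T V W (a V)"
    using assms unfolding rep_def by blast
  have "a W \<in> G W \<and> c = germ \<Phi> G T W (a W) \<and> (\<forall>X\<in>\<Phi>. X \<le> W \<longrightarrow> a X = T W X (a W))"
    if W: "W \<in> \<Phi>" "W \<le> V" for W
  proof -
    have a: "a W = T V W (a V)" "a W \<in> G W"
      using V(1,2) V(4)[OF W] W T_in by simp_all
    have "germ \<Phi> G T V (a V) = germ \<Phi> G T W (a W)"
      unfolding germ_eq_iff[OF V(1) W(1) V(2) a(2)]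
      using W T_refl[OF W(1) a(2)] a(1) by (intro bexI[of _ W]) auto
    moreover have "a X = T W X (a W)" if "X \<in> \<Phi>" "X \<le> W" for X
      using V(4)[of X] T_T[OF V(1) W(1) that(1,2) W(2) V(2)] a(1) that W(2) by simp
    ultimately show ?thesis
      using a V(3) by simp
  qed
  then show ?thesis
    unfolding eventually_below using V(1) by blast
qed

lemma rep_eventually: "rep c a \<Longrightarrow> \<forall>\<^sub>F V in below \<Phi>. V \<in> \<Phi> \<and> a V \<in> G V \<and> c = germ \<Phi> G T V (a V)"
  by (drule rep_coherent) (auto elim!: eventually_mono)

lemma rep_mem: "rep c a \<Longrightarrow> \<forall>\<^sub>F V in below \<Phi>. a V \<in> G V"
  by (drule rep_eventually) (auto elim!: eventually_mono)

lemma rep_in_germs: "rep c a \<Longrightarrow> c \<in> germs \<Phi> G T"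
  unfolding rep_def germs_def by blast

lemma rep_germ: "V \<in> \<Phi> \<Longrightarrow> x \<in> G V \<Longrightarrow> rep (germ \<Phi> G T V x) (\<lambda>W. T V W x)"
  unfolding rep_def using T_refl by (intro bexI[of _ V]) auto

lemma rep_exists:
  assumes "c \<in> germs \<Phi> G T"
  obtains a where "rep c a"
  using assms rep_germ unfolding germs_def by blast

lemma rep_unique:
  assumes "rep c a" "rep c b"
  shows "\<forall>\<^sub>F V in below \<Phi>. a V = b V"
proof -
  obtain V where V: "V \<in> \<Phi>" "a V \<in> G V" "c = germ \<Phi> G T V (a V)"
    "\<And>W. W\<in>\<Phi> \<Longrightarrow> W \<le> V \<Longrightarrow> a W = T V W (a V)"
    using assms(1) unfolding rep_def by blast
  obtain U where U: "U \<in> \<Phi>" "b U \<in> G U" "c = germ \<Phi> G T U (b U)"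
    "\<And>W. W\<in>\<Phi> \<Longrightarrow> W \<le> U \<Longrightarrow> b W = T U W (b U)"
    using assms(2) unfolding rep_def by blast
  obtain W where W: "W \<in> \<Phi>" "W \<le> V" "W \<le> U" "T V W (a V) = T U W (b U)"
    using germ_eq_iff[OF V(1) U(1) V(2) U(2)] V(3) U(3) by blast
  have "a X = b X" if "X \<in> \<Phi>" "X \<le> W" for X
  proof -
    have "a X = T W X (T V W (a V))"
      using V(1,2) V(4)[OF that(1)] W(1-3) that T_T by simp
    also have "\<dots> = b X"
      unfolding W(4) using U(1,2) U(4)[OF that(1)] W(1-3) that T_T by simp
    finally show ?thesis .
  qed
  then show ?thesis
    unfolding eventually_below using W(1) by blast
qed

text \<open>Eventual equality of the representatives gives \<open>c = c'\<close> eventually; this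
  equation does not mention the stage, and the filter is proper.\<close>

lemma rep_eqI:
  assumes "rep c a" "rep c' b" "\<forall>\<^sub>F V in below \<Phi>. a V = b V"
  shows "c = c'"
proof -
  have "\<forall>\<^sub>F V in below \<Phi>. c = c'"
    using rep_eventually[OF assms(1)] rep_eventually[OF assms(2)] assms(3)
    by eventually_elim metis
  then show ?thesis
    using below_neq_bot by simp
qed

text \<open>Operations of the colimit are defined through members of a germ, so it has to be known
  which pairs can occur.\<close>

lemma germ_mem_iff:
  assumes "c \<in> germs \<Phi> G T"
  shows "(V, x) \<in> c \<longleftrightarrow> V \<in> \<Phi> \<and> x \<in> G V \<and> c = germ \<Phi> G T V x"
proof -
  obtain U y where c: "c = germ \<Phi> G T U y" "U \<in> \<Phi>" "y \<in> G U"
    using assms by (auto simp: germs_def)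
  show ?thesis
  proof (cases "V \<in> \<Phi> \<and> x \<in> G V")
    case True
    then have "(V, x) \<in> germ \<Phi> G T U y \<longleftrightarrow> (\<exists>W\<in>\<Phi>. W \<le> V \<and> W \<le> U \<and> T V W x = T U W y)"
      by (simp add: germ_def)
    then show ?thesis
      using True c germ_eq_iff[of V U x y] by metis
  qed (auto simp: c(1) germ_def)
qed

end

lemma directed_systemI:
  assumes \<Phi>: "product_closed_filter I \<Phi>"
    and "\<And>V U x. V \<in> \<Phi> \<Longrightarrow> U \<in> \<Phi> \<Longrightarrow> U \<le> V \<Longrightarrow> x \<in> G V \<Longrightarrow> T V U x \<in> G U"
    and "\<And>V U W x. V \<in> \<Phi> \<Longrightarrow> U \<in> \<Phi> \<Longrightarrow> W \<in> \<Phi> \<Longrightarrow> W \<le> U \<Longrightarrow> U \<le> V \<Longrightarrow> x \<in> G V \<Longrightarrow>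
      T U W (T V U x) = T V W x"
    and "\<And>V x. V \<in> \<Phi> \<Longrightarrow> x \<in> G V \<Longrightarrow> T V V x = x"
  shows "directed_system \<Phi> G T"
proof
  show "\<Phi> \<noteq> {}"
    using \<Phi> unfolding product_closed_filter_def by blast
  show "\<exists>W\<in>\<Phi>. W \<le> U \<and> W \<le> V" if "U \<in> \<Phi>" "V \<in> \<Phi>" for U V
    using \<Phi> that unfolding product_closed_filter_def by (intro bexI[of _ "U \<inter> V"]) auto
qed (use assms in blast)+

locale sset_system =
  fixes \<Phi> :: "'j::order set" and G :: "'j \<Rightarrow> 'a sset" and T :: "'j \<Rightarrow> 'j \<Rightarrow> nat \<Rightarrow> 'a \<Rightarrow> 'a"
  assumes system: "directed_system \<Phi> (\<lambda>V. simps (G V) n) (\<lambda>V U. T V U n)"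
    and simplicial: "V \<in> \<Phi> \<Longrightarrow> U \<in> \<Phi> \<Longrightarrow> U \<le> V \<Longrightarrow> simplicial_map (G V) (G U) (T V U)"
    and sset: "V \<in> \<Phi> \<Longrightarrow> is_sset (G V)"
begin

abbreviation "rep_n n \<equiv> directed_system.rep \<Phi> (\<lambda>V. simps (G V) n) (\<lambda>V U. T V U n)"
abbreviation "germ_n n \<equiv> germ \<Phi> (\<lambda>V. simps (G V) n) (\<lambda>V U. T V U n)"
abbreviation "colim \<equiv> colim_sset \<Phi> G T"

lemma simps_colim: "simps colim n = germs \<Phi> (\<lambda>V. simps (G V) n) (\<lambda>V U. T V U n)"
  by (simp add: colim_sset_def)

lemma germ_act:
  assumes "V \<in> \<Phi>" "U \<in> \<Phi>" "x \<in> simps (G V) n" "y \<in> simps (G U) n" "\<theta> \<in> ops m n"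
    "germ_n n V x = germ_n n U y"
  shows "germ_n m V (act (G V) n \<theta> x) = germ_n m U (act (G U) n \<theta> y)"
proof -
  obtain W where W: "W \<in> \<Phi>" "W \<le> V" "W \<le> U" "T V W n x = T U W n y"
    using assms directed_system.germ_eq_iff[OF system, of V U x n y] by auto
  have "T V W m (act (G V) n \<theta> x) = T U W m (act (G U) n \<theta> y)"
    using simplicial_map_act[OF simplicial[OF assms(1) W(1,2)] assms(3,5)]
      simplicial_map_act[OF simplicial[OF assms(2) W(1,3)] assms(4,5)] W(4) by metis
  moreover have "act (G V) n \<theta> x \<in> simps (G V) m" "act (G U) n \<theta> y \<in> simps (G U) m"
    using act_in[OF sset _ assms(5)] assms(1-4) by blast+
  ultimately show ?thesis
    using W(1-3) by (subst directed_system.germ_eq_iff[OF system assms(1,2)]) blast+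
qed

lemma act_colim:
  assumes "\<theta> \<in> ops m n" "V \<in> \<Phi>" "x \<in> simps (G V) n"
  shows "act colim n \<theta> (germ_n n V x) = germ_n m V (act (G V) n \<theta> x)"
proof -
  have c: "germ_n n V x \<in> germs \<Phi> (\<lambda>V. simps (G V) n) (\<lambda>V U. T V U n)"
    using assms by (auto simp: germs_def)
  \<comment> \<open>\<open>colim_sset\<close> has no argument for the target dimension and reads it
    off the length of the operator.\<close>
  have m: "length \<theta> - 1 = m"
    using assms by (simp add: ops_iff)
  show ?thesis
    unfolding colim_sset_def sset.simps m
  proof (rule the_equality)
    show "\<exists>(U, y)\<in>germ_n n V x. germ_n m V (act (G V) n \<theta> x) = germ_n m U (act (G U) n \<theta> y)"
      using assms directed_system.germ_mem_iff[OF system c, of V x] by (intro bexI[of _ "(V, x)"]) auto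
  next
    fix d
    assume "\<exists>(U, y)\<in>germ_n n V x. d = germ_n m U (act (G U) n \<theta> y)"
    then obtain U y where "(U, y) \<in> germ_n n V x" and d: "d = germ_n m U (act (G U) n \<theta> y)"
      by blast
    then have "U \<in> \<Phi>" "y \<in> simps (G U) n" "germ_n n V x = germ_n n U y"
      using directed_system.germ_mem_iff[OF system c] by simp_all
    then show "d = germ_n m V (act (G V) n \<theta> x)"
      unfolding d by (rule germ_act[OF assms(2) _ assms(3) _ assms(1), symmetric])
  qed
qed

lemma rep_act:
  assumes \<theta>: "\<theta> \<in> ops m n" and a: "rep_n n c a"
  shows "rep_n m (act colim n \<theta> c) (\<lambda>V. act (G V) n \<theta> (a V))"
proof -
  obtain V where V: "V \<in> \<Phi>" "a V \<in> simps (G V) n" "c = germ_n n V (a V)"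
    "\<forall>W\<in>\<Phi>. W \<le> V \<longrightarrow> a W = T V W n (a V)"
    using a unfolding directed_system.rep_def[OF system] by blast
  show ?thesis
    unfolding directed_system.rep_def[OF system]
  proof (intro bexI[OF _ V(1)] conjI ballI impI)
    show "act (G V) n \<theta> (a V) \<in> simps (G V) m"
      by (rule act_in[OF sset[OF V(1)] V(2) \<theta>])
    show "act colim n \<theta> c = germ_n m V (act (G V) n \<theta> (a V))"
      unfolding V(3) by (rule act_colim[OF \<theta> V(1,2)])
  next
    fix W
    assume "W \<in> \<Phi>" "W \<le> V"
    then show "act (G W) n \<theta> (a W) = T V W m (act (G V) n \<theta> (a V))"
      using V(4) simplicial_map_act[OF simplicial[OF V(1)] V(2) \<theta>] by metis
  qed
qed

lemma simplicial_map_germ: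
  assumes "V \<in> \<Phi>"
  shows "simplicial_map (G V) colim (\<lambda>n. germ_n n V)"
  unfolding simplicial_map_def simps_colim
proof (intro conjI allI ballI)
  fix n x
  assume "x \<in> simps (G V) n"
  then show "germ_n n V x \<in> germs \<Phi> (\<lambda>V. simps (G V) n) (\<lambda>V U. T V U n)"
    using assms unfolding germs_def by blast
qed (rule act_colim[OF _ assms, symmetric])

text \<open>A path in the colimit is one simplex with two equations on its ends, so it lives at some
  stage; conversely, the germ of a path is a path.\<close>

lemma same_component_colim_iff:
  assumes a: "rep_n 0 A a" and b: "rep_n 0 B b"
  shows "same_component colim A B \<longleftrightarrow> (\<forall>\<^sub>F V in below \<Phi>. same_component (G V) (a V) (b V))"
proof
  have ops: "[0] \<in> ops 0 1" "[1] \<in> ops 0 1"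
    by (simp_all add: ops_iff)
  note u = directed_system.rep_unique[OF system]
  {
    assume "same_component colim A B"
    then obtain w where w: "w \<in> simps colim 1" "act colim 1 [0] w = A" "act colim 1 [1] w = B"
      unfolding same_component_def by blast
    then obtain c where c: "rep_n 1 w c"
      using directed_system.rep_exists[OF system] unfolding simps_colim by metis
    have "\<forall>\<^sub>F V in below \<Phi>. act (G V) 1 [0] (c V) = a V"
      using rep_act[OF ops(1) c] a unfolding w(2) by (rule u)
    moreover have "\<forall>\<^sub>F V in below \<Phi>. act (G V) 1 [1] (c V) = b V"
      using rep_act[OF ops(2) c] b unfolding w(3) by (rule u)
    moreover note directed_system.rep_mem[OF system c]
    ultimately show "\<forall>\<^sub>F V in below \<Phi>. same_component (G V) (a V) (b V)"
      by eventually_elim (auto simp: same_component_def)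
  }
  {
    assume "\<forall>\<^sub>F V in below \<Phi>. same_component (G V) (a V) (b V)"
    then have "\<forall>\<^sub>F V in below \<Phi>. V \<in> \<Phi> \<and> A = germ_n 0 V (a V) \<and> B = germ_n 0 V (b V) \<and>
        same_component (G V) (a V) (b V)"
      using directed_system.rep_eventually[OF system a] directed_system.rep_eventually[OF system b]
      by eventually_elim simp
    then obtain V where V: "V \<in> \<Phi>" "A = germ_n 0 V (a V)" "B = germ_n 0 V (b V)"
        "same_component (G V) (a V) (b V)"
      unfolding directed_system.eventually_below[OF system] using order_refl by blast
    then obtain w where w: "w \<in> simps (G V) 1" "act (G V) 1 [0] w = a V" "act (G V) 1 [1] w = b V"
      unfolding same_component_def by blast
    show "same_component colim A B"
      unfolding same_component_def
      using simplicial_map_in[OF simplicial_map_germ[OF V(1)] w(1)]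
        act_colim[OF ops(1) V(1) w(1)] act_colim[OF ops(2) V(1) w(1)] w(2,3) V(2,3) by auto
  }
qed

end

section \<open>Low-dimensional simplices\<close>

lemma face_1:
  "face X 1 0 x = act X 1 [1] x"
  "face X 1 1 x = act X 1 [0] x"
  "face X 1 (Suc 0) x = act X 1 [0] x"
  by (simp_all add: face_def upt_rec)

lemma face_2:
  "face X 2 0 x = act X 2 [1, 2] x"
  "face X 2 1 x = act X 2 [0, 2] x"
  "face X 2 (Suc 0) x = act X 2 [0, 2] x"
  "face X 2 2 x = act X 2 [0, 1] x"
  by (simp_all add: face_def upt_rec numeral_2_eq_2)

lemma face_3:
  "face X 3 0 x = act X 3 [1, 2, 3] x"
  "face X 3 1 x = act X 3 [0, 2, 3] x"
  "face X 3 (Suc 0) x = act X 3 [0, 2, 3] x"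
  "face X 3 2 x = act X 3 [0, 1, 3] x"
  "face X 3 3 x = act X 3 [0, 1, 2] x"
  by (simp_all add: face_def upt_rec numeral_2_eq_2 numeral_3_eq_3)

lemma le_2_cases: "i \<le> 2 \<longleftrightarrow> i = 0 \<or> i = 1 \<or> i = (2::nat)"
  by auto

lemma le_3_cases: "i \<le> 3 \<longleftrightarrow> i = 0 \<or> i = 1 \<or> i = 2 \<or> i = (3::nat)"
  by auto

text \<open>For explicit lists of numbers the hypotheses can be evaluated, so that identities
  between faces and degeneracies become rewriting.\<close>

lemma act_act_list:
  "is_sset X \<Longrightarrow> x \<in> simps X n \<Longrightarrow> length \<theta> = Suc m \<Longrightarrow> sorted \<theta> \<Longrightarrow> \<forall>i\<in>set \<theta>. i \<le> n \<Longrightarrow>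
    \<phi> \<noteq> [] \<Longrightarrow> sorted \<phi> \<Longrightarrow> \<forall>i\<in>set \<phi>. i \<le> m \<Longrightarrow>
    act X m \<phi> (act X n \<theta> x) = act X n (map ((!) \<theta>) \<phi>) x"
  by (rule act_act) (auto simp: ops_iff)

lemma act_in_list:
  "is_sset X \<Longrightarrow> x \<in> simps X n \<Longrightarrow> length \<theta> = Suc m \<Longrightarrow> sorted \<theta> \<Longrightarrow> \<forall>i\<in>set \<theta>. i \<le> n \<Longrightarrow>
    act X n \<theta> x \<in> simps X m"
  by (rule act_in) (auto simp: ops_iff)

lemma act_id_list:
  "is_sset X \<Longrightarrow> x \<in> simps X 0 \<Longrightarrow> act X 0 [0] x = x"
  "is_sset X \<Longrightarrow> x \<in> simps X 1 \<Longrightarrow> act X 1 [0, 1] x = x"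
  "is_sset X \<Longrightarrow> x \<in> simps X 2 \<Longrightarrow> act X 2 [0, 1, 2] x = x"
  using act_id[of X x 0] act_id[of X x 1] act_id[of X x 2]
  by (simp_all add: upt_rec numeral_2_eq_2)

lemma deg_1: "deg X 1 x = act X 0 [0, 0] x" "deg X (Suc 0) x = act X 0 [0, 0] x"
  by (simp_all add: deg_def)

lemma same_component_refl: "is_sset X \<Longrightarrow> x \<in> simps X 0 \<Longrightarrow> same_component X x x"
  unfolding same_component_def
  by (rule bexI[of _ "act X 0 [0, 0] x"])
    (simp_all add: act_act_list act_in_list act_id_list)

lemma same_component_simplicial_map:
  assumes f: "simplicial_map X Y f" and "same_component X x y"
  shows "same_component Y (f 0 x) (f 0 y)"
proof -
  obtain w where w: "w \<in> simps X 1" "act X 1 [0] w = x" "act X 1 [1] w = y"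
    using assms(2) unfolding same_component_def by blast
  have "[0] \<in> ops 0 1" "[1] \<in> ops 0 1"
    by (simp_all add: ops_iff)
  then show ?thesis
    unfolding same_component_def
    using simplicial_map_act[OF f w(1)] simplicial_map_in[OF f w(1)] w(2,3) by metis
qed

section \<open>Equivalences and filter products in quasi-categories\<close>

section \<open>Quasi-categories as weak categories\<close>

definition q_tri :: "'a sset \<Rightarrow> 'a \<Rightarrow> 'a \<Rightarrow> 'a \<Rightarrow> bool" where
  "q_tri S f g h \<longleftrightarrow>
     (\<exists>\<sigma>\<in>simps S 2. act S 2 [0, 1] \<sigma> = f \<and> act S 2 [1, 2] \<sigma> = g \<and> act S 2 [0, 2] \<sigma> = h)"

lemma quasi_category_is_sset: "quasi_category S \<Longrightarrow> is_sset S"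
  by (simp add: quasi_category_def)

lemma quasi_category_fill_2:
  assumes S: "quasi_category S" and "f \<in> simps S 1" "g \<in> simps S 1"
    "act S 1 [1] f = act S 1 [0] g"
  obtains \<sigma> where "\<sigma> \<in> simps S 2" "act S 2 [0, 1] \<sigma> = f" "act S 2 [1, 2] \<sigma> = g"
proof -
  \<comment> \<open>Face 0 of a triangle is its edge [1, 2] and face 2 its edge [0, 1]; the value at
    the missing index 1 is a default.\<close>
  define y where "y = (\<lambda>i::nat. if i = 0 then g else f)"
  have "horn S 2 1 y"
    using assms by (auto simp: horn_def y_def le_2_cases face_1 face_1[unfolded One_nat_def])
  then have "horn_fills S 2 1 y"
    using S by (auto simp: quasi_category_def)
  then show thesis
    using that by (auto simp: horn_fills_def le_2_cases face_2 y_def)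
qed

lemma horn_2I:
  assumes "\<And>i. i \<le> 2 \<Longrightarrow> i \<noteq> k \<Longrightarrow> y i \<in> simps S 1"
    "k \<noteq> 0 \<Longrightarrow> k \<noteq> 1 \<Longrightarrow> act S 1 [1] (y 1) = act S 1 [1] (y 0)"
    "k \<noteq> 0 \<Longrightarrow> k \<noteq> 2 \<Longrightarrow> act S 1 [1] (y 2) = act S 1 [0] (y 0)"
    "k \<noteq> 1 \<Longrightarrow> k \<noteq> 2 \<Longrightarrow> act S 1 [0] (y 2) = act S 1 [0] (y 1)"
  shows "horn S 2 k y"
proof -
  have "face S 1 i (y j) = face S 1 (j - 1) (y i)" if "i < j" "j \<le> 2" "i \<noteq> k" "j \<noteq> k" for i j
  proof -
    have "(i = 0 \<and> j = 1) \<or> (i = 0 \<and> j = 2) \<or> (i = 1 \<and> j = 2)"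
      using that by auto
    then show ?thesis
      using that assms by (elim disjE) (auto simp: face_1 face_1[unfolded One_nat_def])
  qed
  then show ?thesis
    unfolding horn_def using assms(1) by simp
qed

lemma horn_3I:
  assumes "\<And>i. i \<le> 3 \<Longrightarrow> i \<noteq> k \<Longrightarrow> y i \<in> simps S 2"
    "k \<noteq> 0 \<Longrightarrow> k \<noteq> 1 \<Longrightarrow> act S 2 [1, 2] (y 1) = act S 2 [1, 2] (y 0)"
    "k \<noteq> 0 \<Longrightarrow> k \<noteq> 2 \<Longrightarrow> act S 2 [1, 2] (y 2) = act S 2 [0, 2] (y 0)"
    "k \<noteq> 0 \<Longrightarrow> k \<noteq> 3 \<Longrightarrow> act S 2 [1, 2] (y 3) = act S 2 [0, 1] (y 0)"
    "k \<noteq> 1 \<Longrightarrow> k \<noteq> 2 \<Longrightarrow> act S 2 [0, 2] (y 2) = act S 2 [0, 2] (y 1)"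
    "k \<noteq> 1 \<Longrightarrow> k \<noteq> 3 \<Longrightarrow> act S 2 [0, 2] (y 3) = act S 2 [0, 1] (y 1)"
    "k \<noteq> 2 \<Longrightarrow> k \<noteq> 3 \<Longrightarrow> act S 2 [0, 1] (y 3) = act S 2 [0, 1] (y 2)"
  shows "horn S 3 k y"
proof -
  have "face S 2 i (y j) = face S 2 (j - 1) (y i)"
    if "i < j" "j \<le> 3" "i \<noteq> k" "j \<noteq> k" for i j
  proof -
    have "(i = 0 \<and> j = 1) \<or> (i = 0 \<and> j = 2) \<or> (i = 0 \<and> j = 3) \<or> (i = 1 \<and> j = 2) \<or>
        (i = 1 \<and> j = 3) \<or> (i = 2 \<and> j = 3)"
      using that by auto
    then show ?thesis
      using that assms by (elim disjE) (auto simp: face_2)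
  qed
  then show ?thesis
    unfolding horn_def using assms(1) by simp
qed

text \<open>For \<open>k = Suc n\<close> no index is excluded, so results on horns, such as the
  criteria in dimensions 2 and 3, also serve boundaries.\<close>

lemma boundary_iff_horn: "boundary X n y \<longleftrightarrow> horn X n (Suc n) y"
proof
  show "horn X n (Suc n) y" if "boundary X n y"
    using that by (simp add: boundary_def horn_def)
next
  assume *: "horn X n (Suc n) y"
  have "face X (n - 1) i (y j) = face X (n - 1) (j - 1) (y i)" if "2 \<le> n" "i < j" "j \<le> n" for i j
  proof -
    have "i \<noteq> Suc n" "j \<noteq> Suc n"
      using that by auto
    then show ?thesis
      using * that unfolding horn_def by blast
  qed
  then show "boundary X n y"
    using * unfolding boundary_def horn_def by simp
qed

lemma quasi_category_fill_3_1:
  assumes S: "quasi_category S" and "A \<in> simps S 2" "B \<in> simps S 2" "E \<in> simps S 2"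
    "act S 2 [1, 2] A = act S 2 [0, 1] B" "act S 2 [0, 1] A = act S 2 [0, 1] E"
    "act S 2 [0, 2] B = act S 2 [1, 2] E"
  obtains z where "z \<in> simps S 3"
    "act S 3 [0, 1, 2] z = A" "act S 3 [1, 2, 3] z = B" "act S 3 [0, 1, 3] z = E"
proof -
  define y where "y = (\<lambda>i::nat. if i = 0 then B else if i = 2 then E else A)"
  have "horn S 3 1 y"
    using assms by (intro horn_3I) (auto simp: y_def)
  then have "horn_fills S 3 1 y"
    using S by (auto simp: quasi_category_def)
  then show thesis
    using that by (auto simp: horn_fills_def le_3_cases face_3 y_def)
qed

lemma quasi_category_fill_3_2:
  assumes S: "quasi_category S" and "A \<in> simps S 2" "B \<in> simps S 2" "H \<in> simps S 2"
    "act S 2 [1, 2] A = act S 2 [0, 1] B" "act S 2 [0, 2] A = act S 2 [0, 1] H"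
    "act S 2 [1, 2] B = act S 2 [1, 2] H"
  obtains z where "z \<in> simps S 3"
    "act S 3 [0, 1, 2] z = A" "act S 3 [1, 2, 3] z = B" "act S 3 [0, 2, 3] z = H"
proof -
  define y where "y = (\<lambda>i::nat. if i = 0 then B else if i = 1 then H else A)"
  have "horn S 3 2 y"
    using assms by (intro horn_3I) (auto simp: y_def)
  then have "horn_fills S 3 2 y"
    using S by (auto simp: quasi_category_def)
  then show thesis
    using that by (auto simp: horn_fills_def le_3_cases face_3 y_def)
qed

text \<open>The given triangles are the faces 3, 0 and 2 of an inner horn in dimension 3; face 1 of
  a filler is the required triangle.\<close>

lemma q_tri_assoc1:
  assumes S: "quasi_category S" and "q_tri S f g a" "q_tri S g h b" "q_tri S f b c"
  shows "q_tri S a h c"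
proof -
  note X = quasi_category_is_sset[OF S]
  obtain A B E where *: "A \<in> simps S 2" "B \<in> simps S 2" "E \<in> simps S 2"
    "act S 2 [0, 1] A = f" "act S 2 [1, 2] A = g" "act S 2 [0, 2] A = a"
    "act S 2 [0, 1] B = g" "act S 2 [1, 2] B = h" "act S 2 [0, 2] B = b"
    "act S 2 [0, 1] E = f" "act S 2 [1, 2] E = b" "act S 2 [0, 2] E = c"
    using assms(2-) unfolding q_tri_def by auto
  then obtain z where z: "z \<in> simps S 3"
    "act S 3 [0, 1, 2] z = A" "act S 3 [1, 2, 3] z = B" "act S 3 [0, 1, 3] z = E"
    using quasi_category_fill_3_1[OF S *(1-3)] by auto
  have "act S 2 [0, 1] (act S 3 [0, 2, 3] z) = act S 2 [0, 2] (act S 3 [0, 1, 2] z)"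
    "act S 2 [1, 2] (act S 3 [0, 2, 3] z) = act S 2 [1, 2] (act S 3 [1, 2, 3] z)"
    "act S 2 [0, 2] (act S 3 [0, 2, 3] z) = act S 2 [0, 2] (act S 3 [0, 1, 3] z)"
    "act S 3 [0, 2, 3] z \<in> simps S 2"
    using z(1) by (simp_all add: act_act_list[OF X] act_in_list[OF X])
  then show ?thesis
    unfolding q_tri_def using * z by metis
qed

text \<open>As before, with the inner horn that lacks face 2.\<close>

lemma q_tri_assoc2:
  assumes S: "quasi_category S" and "q_tri S f g a" "q_tri S g h b" "q_tri S a h c"
  shows "q_tri S f b c"
proof -
  note X = quasi_category_is_sset[OF S]
  obtain A B E where *: "A \<in> simps S 2" "B \<in> simps S 2" "E \<in> simps S 2"
    "act S 2 [0, 1] A = f" "act S 2 [1, 2] A = g" "act S 2 [0, 2] A = a"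
    "act S 2 [0, 1] B = g" "act S 2 [1, 2] B = h" "act S 2 [0, 2] B = b"
    "act S 2 [0, 1] E = a" "act S 2 [1, 2] E = h" "act S 2 [0, 2] E = c"
    using assms(2-) unfolding q_tri_def by auto
  then obtain z where z: "z \<in> simps S 3"
    "act S 3 [0, 1, 2] z = A" "act S 3 [1, 2, 3] z = B" "act S 3 [0, 2, 3] z = E"
    using quasi_category_fill_3_2[OF S *(1-3)] by auto
  have "act S 2 [0, 1] (act S 3 [0, 1, 3] z) = act S 2 [0, 1] (act S 3 [0, 1, 2] z)"
    "act S 2 [1, 2] (act S 3 [0, 1, 3] z) = act S 2 [0, 2] (act S 3 [1, 2, 3] z)"
    "act S 2 [0, 2] (act S 3 [0, 1, 3] z) = act S 2 [0, 2] (act S 3 [0, 2, 3] z)"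
    "act S 3 [0, 1, 3] z \<in> simps S 2"
    using z(1) by (simp_all add: act_act_list[OF X] act_in_list[OF X])
  then show ?thesis
    unfolding q_tri_def using * z by metis
qed

lemma weak_category_quasi_category:
  assumes S: "quasi_category S"
  shows "weak_category (simps S 1) (act S 1 [0]) (act S 1 [1]) (deg S 1) (q_tri S)"
proof
  note X = quasi_category_is_sset[OF S]
  show "f \<in> simps S 1 \<and> g \<in> simps S 1 \<and> h \<in> simps S 1 \<and> act S 1 [1] f = act S 1 [0] g \<and>
      act S 1 [0] h = act S 1 [0] f \<and> act S 1 [1] h = act S 1 [1] g" if "q_tri S f g h" for f g h
    using that unfolding q_tri_def by (auto simp: act_act_list[OF X] act_in_list[OF X])
  show "\<exists>h. q_tri S f g h" if "f \<in> simps S 1" "g \<in> simps S 1" "act S 1 [1] f = act S 1 [0] g" for f g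
    using quasi_category_fill_2[OF S that] unfolding q_tri_def by metis
  show "q_tri S (deg S 1 (act S 1 [0] f)) f f" if "f \<in> simps S 1" for f
    unfolding q_tri_def deg_1 using that act_id_list(2)[OF X that]
    by (intro bexI[of _ "act S 1 [0, 0, 1] f"])
      (simp_all add: act_act_list[OF X] act_in_list[OF X])
  show "q_tri S f (deg S 1 (act S 1 [1] f)) f" if "f \<in> simps S 1" for f
    unfolding q_tri_def deg_1 using that act_id_list(2)[OF X that]
    by (intro bexI[of _ "act S 1 [0, 1, 1] f"])
      (simp_all add: act_act_list[OF X] act_in_list[OF X])
qed (fact q_tri_assoc1[OF S] q_tri_assoc2[OF S])+

lemma q_equiv_iff:
  assumes S: "quasi_category S"
  shows "weak_category.equivalence (act S 1 [0]) (act S 1 [1]) (deg S 1) (q_tri S) f \<longleftrightarrow> q_equiv S f"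
proof -
  interpret weak_category "simps S 1" "act S 1 [0]" "act S 1 [1]" "deg S 1" "q_tri S"
    by (rule weak_category_quasi_category[OF S])
  show ?thesis
  proof
    assume "equivalence f"
    then obtain g where g: "q_tri S f g (deg S 1 (act S 1 [0] f))" "q_tri S g f (deg S 1 (act S 1 [1] f))"
      unfolding equivalence_def by blast
    then have "f \<in> simps S 1" "g \<in> simps S 1"
      using triD by blast+
    then show "q_equiv S f"
      using g unfolding q_equiv_def q_tri_def by blast
  next
    assume "q_equiv S f"
    then show "equivalence f"
      unfolding equivalence_def q_equiv_def q_tri_def by blast
  qed
qed

lemma q_equiv_simplicial_map:
  assumes f: "simplicial_map X Y F" and X: "is_sset X" and e: "q_equiv X e"
  shows "q_equiv Y (F 1 e)"
proof -
  have *: "act Y 2 \<theta> (F 2 \<sigma>) = F 1 (act X 2 \<theta> \<sigma>)" if "\<sigma> \<in> simps X 2" "\<theta> \<in> ops 1 2" for \<sigma> \<theta>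
    using simplicial_map_act[OF f that] by simp
  have **: "F 1 (deg X 1 (act X 1 \<theta> a)) = deg Y 1 (act Y 1 \<theta> (F 1 a))"
    if "a \<in> simps X 1" "\<theta> \<in> ops 0 1" for a \<theta>
    using simplicial_map_act[OF f that] simplicial_map_deg[OF f act_in[OF X that]] by simp
  have ops: "[0, 1] \<in> ops 1 2" "[1, 2] \<in> ops 1 2" "[0, 2] \<in> ops 1 2" "[0] \<in> ops 0 1" "[1] \<in> ops 0 1"
    by (simp_all add: ops_iff)
  obtain g \<sigma> \<tau> where g: "e \<in> simps X 1" "g \<in> simps X 1" "\<sigma> \<in> simps X 2" "\<tau> \<in> simps X 2"
      "act X 2 [0, 1] \<sigma> = e" "act X 2 [1, 2] \<sigma> = g" "act X 2 [0, 2] \<sigma> = deg X 1 (act X 1 [0] e)"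
      "act X 2 [0, 1] \<tau> = g" "act X 2 [1, 2] \<tau> = e" "act X 2 [0, 2] \<tau> = deg X 1 (act X 1 [1] e)"
    using e unfolding q_equiv_def by blast
  show ?thesis
    unfolding q_equiv_def
  proof (intro conjI bexI)
    show "act Y 2 [0, 2] (F 2 \<sigma>) = deg Y 1 (act Y 1 [0] (F 1 e))"
      "act Y 2 [0, 2] (F 2 \<tau>) = deg Y 1 (act Y 1 [1] (F 1 e))"
      using **[OF g(1) ops(4)] **[OF g(1) ops(5)] *[OF g(3) ops(3)] *[OF g(4) ops(3)] g by simp_all
  qed (use * ops g simplicial_map_in[OF f] in simp_all)
qed

lemma two_leE: "2 \<le> n \<Longrightarrow> \<exists>m. n = Suc (Suc m)"
  by presburger

lemma horn_simplicial_map: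
  assumes F: "simplicial_map X Y F" and "horn X n k y" "1 \<le> n"
  shows "horn Y n k (\<lambda>i. F (n - 1) (y i))"
proof -
  have "face Y (n - 1) i (F (n - 1) (y j)) = face Y (n - 1) (j - 1) (F (n - 1) (y i))"
    if *: "2 \<le> n" "i < j" "j \<le> n" "i \<noteq> k" "j \<noteq> k" for i j
  proof -
    obtain m where n: "n = Suc (Suc m)"
      using two_leE[OF *(1)] by blast
    have "y i \<in> simps X (Suc m)" "y j \<in> simps X (Suc m)"
      "face X (Suc m) i (y j) = face X (Suc m) (j - 1) (y i)"
      using assms(2) * by (auto simp: horn_def n)
    then show ?thesis
      using simplicial_map_face[OF F, of "y j" m i] simplicial_map_face[OF F, of "y i" m "j - 1"] *
      by (simp add: n)
  qed
  then show ?thesis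
    using assms(2) simplicial_map_in[OF F] unfolding horn_def by auto
qed

lemma boundary_simplicial_map:
  "simplicial_map X Y F \<Longrightarrow> boundary X n y \<Longrightarrow> 1 \<le> n \<Longrightarrow> boundary Y n (\<lambda>i. F (n - 1) (y i))"
  unfolding boundary_iff_horn by (rule horn_simplicial_map)

lemma quasi_category_prod_sset:
  assumes C: "\<And>i. i \<in> I \<Longrightarrow> quasi_category (X i)"
  shows "quasi_category (prod_sset I X)"
  unfolding quasi_category_def
proof (intro conjI allI impI)
  show "is_sset (prod_sset I X)"
    using C by (intro is_sset_prod_sset) (auto simp: quasi_category_def)
next
  fix n k y
  assume *: "2 \<le> n \<and> 0 < k \<and> k < n \<and> horn (prod_sset I X) n k y"
  have "\<exists>z\<in>simps (X i) n. \<forall>j\<le>n. j \<noteq> k \<longrightarrow> face (X i) n j z = y j i" if "i \<in> I" for i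
    using C[OF that] horn_simplicial_map[OF simplicial_map_component[OF that], of X n k y] *
    unfolding quasi_category_def horn_fills_def by auto
  then obtain z where z: "\<And>i. i \<in> I \<Longrightarrow> z i \<in> simps (X i) n"
    "\<And>i j. i \<in> I \<Longrightarrow> j \<le> n \<Longrightarrow> j \<noteq> k \<Longrightarrow> face (X i) n j (z i) = y j i"
    by metis
  have "face (prod_sset I X) n j (restrict z I) = y j" if "j \<le> n" "j \<noteq> k" for j
  proof -
    have "y j \<in> (\<Pi>\<^sub>E i\<in>I. simps (X i) (n - 1))"
      using * that by (auto simp: horn_def)
    then show ?thesis
      using z that by (auto simp: face_prod_sset fun_eq_iff PiE_iff extensional_def)
  qed
  then show "horn_fills (prod_sset I X) n k y"
    unfolding horn_fills_def using z by (intro bexI[of _ "restrict z I"]) auto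
qed

text \<open>An n-horn over \<open>v\<close> is an (n+1)-horn of \<open>S\<close> that also lacks its
  last face, the one opposite to \<open>v\<close>. That face is supplied by filling the projected
  horn, and the completed horn is still inner because k is below n.\<close>

lemma quasi_category_slice:
  assumes S: "quasi_category S"
  shows "quasi_category (slice S v)"
  unfolding quasi_category_def
proof (intro conjI allI impI)
  note X = quasi_category_is_sset[OF S]
  show "is_sset (slice S v)"
    by (rule is_sset_slice[OF X])
  fix n k y
  assume *: "2 \<le> n \<and> 0 < k \<and> k < n \<and> horn (slice S v) n k y"
  then obtain m where n: "n = Suc (Suc m)"
    using two_leE by blast
  have y: "y i \<in> simps S n" "act S n [n] (y i) = v" if "i \<le> n" "i \<noteq> k" for i
    using * that by (auto simp: horn_def n)
  have "horn S n k (\<lambda>i. slice_proj S (n - 1) (y i))"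
    using horn_simplicial_map[OF simplicial_map_slice_proj[OF X], of v n k y] * by simp
  then obtain b where b: "b \<in> simps S n" "\<And>i. i \<le> n \<Longrightarrow> i \<noteq> k \<Longrightarrow> face S n i b = slice_proj S (n - 1) (y i)"
    using S * unfolding quasi_category_def horn_fills_def by blast
  define y' where "y' = y(Suc n := b)"
  have "horn S (Suc n) k y'"
    unfolding horn_def
  proof (intro conjI allI impI)
    fix i
    assume "i \<le> Suc n" "i \<noteq> k"
    then show "y' i \<in> simps S (Suc n - 1)"
      using y b by (auto simp: y'_def)
  next
    fix i j
    assume ij: "2 \<le> Suc n \<and> i < j \<and> j \<le> Suc n \<and> i \<noteq> k \<and> j \<noteq> k"
    show "face S (Suc n - 1) i (y' j) = face S (Suc n - 1) (j - 1) (y' i)"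
    proof (cases "j = Suc n")
      case True
      then show ?thesis
        using b(2)[of i] ij face_last[of S "Suc m" "y i"] by (simp add: y'_def slice_proj_def n)
    next
      case False
      have "face (slice S v) (n - 1) i (y j) = face (slice S v) (n - 1) (j - 1) (y i)"
        using * ij False unfolding horn_def by auto
      moreover have "j \<le> n"
        using ij False by simp
      ultimately show ?thesis
        using ij False face_slice[of i "Suc m" S v] face_slice[of "j - 1" "Suc m" S v]
        by (simp add: y'_def n)
    qed
  qed
  then have "horn_fills S (Suc n) k y'"
    using S * unfolding quasi_category_def by simp
  then obtain z where z: "z \<in> simps S (Suc n)" "\<And>i. i \<le> Suc n \<Longrightarrow> i \<noteq> k \<Longrightarrow> face S (Suc n) i z = y' i"
    unfolding horn_fills_def by blast
  \<comment> \<open>The filler ends at \<open>v\<close> because its face 0 does, and face 0 belongs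
    to the horn since k is positive.\<close>
  have "act S n [n] (face S (Suc n) 0 z) = act S (Suc n) [Suc n] z"
  proof -
    have "removeAll 0 [0..<Suc (Suc n)] ! n = Suc n"
      by (simp add: upt_rec[of 0] del: upt_Suc)
    then show ?thesis
      unfolding face_def
      using act_act[OF X z(1) face_op_in_ops[of 0] ops_ops_length[OF last_in_ops]] by simp
  qed
  then have "act S (Suc n) [Suc n] z = v"
    using z(2)[of 0] y(2)[of 0] * by (simp add: y'_def)
  moreover have "face (slice S v) n i z = y i" if "i \<le> n" "i \<noteq> k" for i
    using z(2)[of i] face_slice[OF that(1), of S v z] that by (simp add: y'_def)
  ultimately show "horn_fills (slice S v) n k y"
    unfolding horn_fills_def using z(1) by (intro bexI[of _ z]) auto
qed

section \<open>Equivalences in slices\<close>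

text \<open>A 3-simplex is filled whose vertices are the target y of \<open>F\<close>, its source x,
  again y, and \<open>u\<close>. Three faces are \<tau>, \<open>F\<close> and the degenerate
  triangle on the structure map y -> u; the missing face [0, 1, 3] is an edge of the slice over the
  given one-sided inverse.\<close>

lemma slice_lift_right_inverse:
  assumes S: "quasi_category S" and F: "F \<in> simps (slice S u) 1"
    and \<tau>: "\<tau> \<in> simps S 2" "act S 2 [1, 2] \<tau> = act S 2 [0, 1] F"
      "act S 2 [0, 2] \<tau> = deg S 1 (act S 2 [1] F)"
  obtains G where "act S 2 [0, 1] G = act S 2 [0, 1] \<tau>"
    "q_tri (slice S u) G F (deg (slice S u) 1 (act (slice S u) 1 [1] F))"
proof -
  note X = quasi_category_is_sset[OF S]
  have F2: "F \<in> simps S 2" "act S 2 [2] F = u"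
    using F by (simp_all add: numeral_2_eq_2)
  define H where "H = act S 1 [0, 0, 1] (act S 2 [1, 2] F)"
  have H: "H \<in> simps S 2" "act S 2 [0, 2] \<tau> = act S 2 [0, 1] H"
    "act S 2 [1, 2] F = act S 2 [1, 2] H"
    unfolding H_def using F2 \<tau> by (simp_all add: act_act_list[OF X] act_in_list[OF X] deg_1)
  obtain z where z: "z \<in> simps S 3"
    "act S 3 [0, 1, 2] z = \<tau>" "act S 3 [1, 2, 3] z = F" "act S 3 [0, 2, 3] z = H"
    using quasi_category_fill_3_2[OF S \<tau>(1) F2(1) H(1) \<tau>(2) H(2,3)] by auto
  have "act S 3 [3] z = u"
    using z(1,3) F2 by (auto simp: act_act_list[OF X])
  then have "z \<in> simps (slice S u) 2"
    using z(1) by (simp add: numeral_3_eq_3 numeral_2_eq_2)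
  moreover have "act (slice S u) 2 [1, 2] z = F"
    "act (slice S u) 2 [0, 2] z = deg (slice S u) 1 (act (slice S u) 1 [1] F)"
    using z(3,4) by (simp_all add: deg_1 H_def eval_nat_numeral)
  ultimately have "q_tri (slice S u) (act (slice S u) 2 [0, 1] z) F
      (deg (slice S u) 1 (act (slice S u) 1 [1] F))"
    unfolding q_tri_def by blast
  moreover have "act S 2 [0, 1] (act S 3 [0, 1, 3] z) = act S 2 [0, 1] (act S 3 [0, 1, 2] z)"
    using z(1) by (simp add: act_act_list[OF X])
  ultimately show thesis
    using that z(2) by (simp add: eval_nat_numeral)
qed

text \<open>The inverse of the underlying map is lifted to \<open>G\<close> against
  \<open>F\<close>, and then the underlying map is lifted to some \<open>F'\<close> against
  \<open>G\<close>. Thus \<open>G\<close> has inverses on both sides. \<open>F'\<close> need not be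
  \<open>F\<close>, but \<open>F\<close> is an equivalence by cancellation.\<close>

lemma q_equiv_slice:
  assumes S: "quasi_category S" and F: "F \<in> simps (slice S u) 1"
    and f: "q_equiv S (slice_proj S 1 F)"
  shows "q_equiv (slice S u) F"
proof -
  note X = quasi_category_is_sset[OF S]
  interpret weak_category "simps (slice S u) 1" "act (slice S u) 1 [0]" "act (slice S u) 1 [1]"
    "deg (slice S u) 1" "q_tri (slice S u)"
    by (rule weak_category_quasi_category[OF quasi_category_slice[OF S]])
  have F2: "F \<in> simps S 2" "act S 2 [2] F = u"
    using F by (simp_all add: numeral_2_eq_2)
  have "slice_proj S 1 F = act S 2 [0, 1] F"
    by (simp add: slice_proj_def eval_nat_numeral)
  then obtain g \<sigma> \<tau> where g: "\<sigma> \<in> simps S 2" "\<tau> \<in> simps S 2"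
      "act S 2 [0, 1] \<sigma> = act S 2 [0, 1] F" "act S 2 [1, 2] \<sigma> = g" "act S 2 [0, 2] \<sigma> = deg S 1 (act S 2 [0] F)"
      "act S 2 [0, 1] \<tau> = g" "act S 2 [1, 2] \<tau> = act S 2 [0, 1] F" "act S 2 [0, 2] \<tau> = deg S 1 (act S 2 [1] F)"
    using f F2 unfolding q_equiv_def by (auto simp: act_act_list[OF X])
  obtain G where G: "act S 2 [0, 1] G = g"
    "q_tri (slice S u) G F (deg (slice S u) 1 (act (slice S u) 1 [1] F))"
    using slice_lift_right_inverse[OF S F g(2,7,8)] g(6) by metis
  have G1: "G \<in> simps (slice S u) 1" "G \<in> simps S 2"
    using triD[OF G(2)] by (auto simp: numeral_2_eq_2)
  have "act S 2 [1] G = act S 2 [0] F"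
  proof -
    have "act S 2 [1] G = act S 1 [1] (act S 2 [0, 1] G)"
      using G1(2) by (simp add: act_act_list[OF X])
    also have "\<dots> = act S 1 [1] (act S 2 [0, 2] \<sigma>)"
      unfolding G(1) g(4)[symmetric] using g(1) by (simp add: act_act_list[OF X])
    also have "\<dots> = act S 2 [0] F"
      unfolding g(5) using F2(1) by (simp add: deg_1 act_act_list[OF X] act_in_list[OF X])
    finally show ?thesis .
  qed
  then have "act S 2 [1, 2] \<sigma> = act S 2 [0, 1] G" "act S 2 [0, 2] \<sigma> = deg S 1 (act S 2 [1] G)"
    using g(4,5) G(1) by simp_all
  then obtain F' where F': "q_tri (slice S u) F' G (deg (slice S u) 1 (act (slice S u) 1 [1] G))"
    using slice_lift_right_inverse[OF S G1(1) g(1)] by blast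
  have src: "act (slice S u) 1 [0] G = act (slice S u) 1 [1] F"
    using triD[OF G(2)] triD[OF tri_id_right[OF F]] by metis
  have "equivalence G"
    by (rule equivalence_if_inverses[OF G(2)[folded src] F'])
  moreover have "equivalence (deg (slice S u) 1 (act (slice S u) 1 [1] F))"
    using equivalence_ident[OF G1(1)] by (simp only: src)
  ultimately have "equivalence F"
    using equivalence_cancel_left[OF G(2)] by blast
  then show ?thesis
    using q_equiv_iff[OF quasi_category_slice[OF S]] by blast
qed

section \<open>Directed colimits of quasi-categories\<close>

lemma (in sset_system) q_equiv_colim_iff:
  assumes V: "V \<in> \<Phi>" and x: "x \<in> simps (G V) 1"
  shows "q_equiv colim (germ_n 1 V x) \<longleftrightarrow> (\<exists>U\<in>\<Phi>. U \<le> V \<and> q_equiv (G U) (T V U 1 x))"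
proof
  assume "\<exists>U\<in>\<Phi>. U \<le> V \<and> q_equiv (G U) (T V U 1 x)"
  then obtain U where U: "U \<in> \<Phi>" "U \<le> V" "q_equiv (G U) (T V U 1 x)"
    by blast
  have y: "T V U 1 x \<in> simps (G U) 1"
    using simplicial_map_in[OF simplicial[OF V U(1,2)] x] .
  have "germ_n 1 V x = germ_n 1 U (T V U 1 x)"
    using directed_system.T_refl[OF system U(1) y] U
    by (subst directed_system.germ_eq_iff[OF system V U(1) x y]) auto
  then show "q_equiv colim (germ_n 1 V x)"
    using q_equiv_simplicial_map[OF simplicial_map_germ[OF U(1)] sset[OF U(1)] U(3)] by simp
next
  assume "q_equiv colim (germ_n 1 V x)"
  then obtain g \<sigma> \<tau> where g: "g \<in> simps colim 1" "\<sigma> \<in> simps colim 2" "\<tau> \<in> simps colim 2"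
      "act colim 2 [0, 1] \<sigma> = germ_n 1 V x" "act colim 2 [1, 2] \<sigma> = g"
      "act colim 2 [0, 2] \<sigma> = deg colim 1 (act colim 1 [0] (germ_n 1 V x))"
      "act colim 2 [0, 1] \<tau> = g" "act colim 2 [1, 2] \<tau> = germ_n 1 V x"
      "act colim 2 [0, 2] \<tau> = deg colim 1 (act colim 1 [1] (germ_n 1 V x))"
    unfolding q_equiv_def by blast
  obtain a where a: "rep_n 1 g a"
    using g(1) directed_system.rep_exists[OF system] unfolding simps_colim by metis
  obtain s where s: "rep_n 2 \<sigma> s"
    using g(2) directed_system.rep_exists[OF system] unfolding simps_colim by metis
  obtain t where t: "rep_n 2 \<tau> t"
    using g(3) directed_system.rep_exists[OF system] unfolding simps_colim by metis
  have ops: "[0, 1] \<in> ops 1 2" "[1, 2] \<in> ops 1 2" "[0, 2] \<in> ops 1 2" "[0] \<in> ops 0 1" "[1] \<in> ops 0 1"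
    "[0, 0] \<in> ops 1 0"
    by (simp_all add: ops_iff)
  note r = directed_system.rep_germ[OF system V x]
  note act = rep_act[OF ops(1)] rep_act[OF ops(2)] rep_act[OF ops(3)] rep_act[OF ops(4)]
    rep_act[OF ops(5)] rep_act[OF ops(6)]
  note u = directed_system.rep_unique[OF system]
  have "\<forall>\<^sub>F U in below \<Phi>. act (G U) 2 [0, 1] (s U) = T V U 1 x"
    using act(1)[OF s] r unfolding g(4) by (rule u)
  moreover have "\<forall>\<^sub>F U in below \<Phi>. act (G U) 2 [1, 2] (s U) = a U"
    using act(2)[OF s] a unfolding g(5) by (rule u)
  moreover have "\<forall>\<^sub>F U in below \<Phi>. act (G U) 2 [0, 2] (s U) = act (G U) 0 [0, 0] (act (G U) 1 [0] (T V U 1 x))"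
    using act(3)[OF s] act(6)[OF act(4)[OF r]] unfolding g(6) deg_1(1) by (rule u)
  moreover have "\<forall>\<^sub>F U in below \<Phi>. act (G U) 2 [0, 1] (t U) = a U"
    using act(1)[OF t] a unfolding g(7) by (rule u)
  moreover have "\<forall>\<^sub>F U in below \<Phi>. act (G U) 2 [1, 2] (t U) = T V U 1 x"
    using act(2)[OF t] r unfolding g(8) by (rule u)
  moreover have "\<forall>\<^sub>F U in below \<Phi>. act (G U) 2 [0, 2] (t U) = act (G U) 0 [0, 0] (act (G U) 1 [1] (T V U 1 x))"
    using act(3)[OF t] act(6)[OF act(5)[OF r]] unfolding g(9) deg_1(1) by (rule u)
  moreover note directed_system.rep_mem[OF system a] directed_system.rep_mem[OF system s]
    directed_system.rep_mem[OF system t] directed_system.rep_mem[OF system r]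
    directed_system.eventually_ge[OF system V]
  ultimately have "\<forall>\<^sub>F U in below \<Phi>. U \<in> \<Phi> \<and> U \<le> V \<and> q_equiv (G U) (T V U 1 x)"
  proof eventually_elim
    case (elim U)
    then show ?case
      unfolding q_equiv_def deg_1(1)
      by (intro conjI bexI[of _ "a U"] bexI[of _ "s U"] bexI[of _ "t U"]) simp_all
  qed
  then show "\<exists>U\<in>\<Phi>. U \<le> V \<and> q_equiv (G U) (T V U 1 x)"
    unfolding directed_system.eventually_below[OF system] using order_refl by blast
qed

section \<open>Projections of products with a final object\<close>

text \<open>A boundary is mapped along \<iota>, filled there, and the filler is mapped back along
  \<open>r\<close>.\<close>

lemma q_terminal_retract:
  assumes r: "simplicial_map X Y r" and \<iota>: "simplicial_map Y X \<iota>"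
    and retract: "\<And>n y. y \<in> simps Y n \<Longrightarrow> r n (\<iota> n y) = y"
    and t: "t \<in> simps Y 0" "q_terminal X (\<iota> 0 t)"
  shows "q_terminal Y t"
  unfolding q_terminal_def
proof (intro conjI allI impI)
  fix n y
  assume *: "1 \<le> n \<and> boundary Y n y \<and> act Y (n - 1) [n - 1] (y 0) = t"
  then obtain m where n: "n = Suc m"
    by (metis One_nat_def Suc_le_D)
  have y: "y i \<in> simps Y m" if "i \<le> n" for i
    using * that by (auto simp: boundary_def n)
  have "act X (n - 1) [n - 1] (\<iota> (n - 1) (y 0)) = \<iota> 0 t"
    using simplicial_map_act[OF \<iota> y[of 0] last_in_ops] * by (simp add: n)
  moreover have "boundary X n (\<lambda>i. \<iota> (n - 1) (y i))"
    using boundary_simplicial_map[OF \<iota>] * by blast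
  ultimately have "boundary_fills X n (\<lambda>i. \<iota> (n - 1) (y i))"
    using t(2) * unfolding q_terminal_def by blast
  then obtain z where z: "z \<in> simps X n" "\<And>i. i \<le> n \<Longrightarrow> face X n i z = \<iota> m (y i)"
    unfolding boundary_fills_def n by auto
  have "face Y n i (r n z) = y i" if "i \<le> n" for i
  proof -
    have "face Y n i (r n z) = r m (face X n i z)"
      using simplicial_map_face[OF r] z(1) that unfolding n by metis
    then show ?thesis
      using z(2)[OF that] retract[OF y[OF that]] by simp
  qed
  then show "boundary_fills Y n y"
    unfolding boundary_fills_def using simplicial_map_in[OF r z(1)] by blast
qed (rule t(1))

lemma slice2_simps_iff:
  "(s, t) \<in> simps (slice2 S u v) n \<longleftrightarrow>
     s \<in> simps (slice S u) n \<and> t \<in> simps (slice S v) n \<and> slice_proj S n s = slice_proj S n t"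
  by (simp add: slice2_def)

lemma slice2_act: "act (slice2 S u v) n \<theta> (s, t) = (act (slice S u) n \<theta> s, act (slice S v) n \<theta> t)"
  by (simp add: slice2_def)

text \<open>The slice at index \<open>i\<close> is a retract of the slice of the product: a simplex
  is inserted at \<open>i\<close>, and all other indices carry degenerate simplices on the vertex
  \<open>(a, b)\<close>, so that \<open>(a i, b i)\<close> is sent to \<open>(a, b)\<close>.\<close>

lemma q_terminal_component:
  assumes X: "\<And>j. j \<in> I \<Longrightarrow> is_sset (X j)" and i: "i \<in> I"
    and ext: "u \<in> extensional I" "v \<in> extensional I"
    and t: "q_terminal (slice2 (prod_sset I X) u v) (a, b)"
  shows "q_terminal (slice2 (X i) (u i) (v i)) (a i, b i)"
proof -
  let ?A = "\<lambda>j. slice (X j) (u j)" and ?B = "\<lambda>j. slice (X j) (v j)"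
  define ins where "ins = (\<lambda>(A :: _ \<Rightarrow> 'b sset) c n s. \<lambda>j\<in>I. if j = i then s else deg (A j) n (c j))"
  note A = is_sset_slice[OF X] and p = simplicial_map_slice_proj[OF X]
  have prod: "slice (prod_sset I X) u = prod_sset I ?A" "slice (prod_sset I X) v = prod_sset I ?B"
    using slice_prod_sset ext by blast+
  have ab: "a \<in> simps (prod_sset I ?A) 0" "b \<in> simps (prod_sset I ?B) 0"
    "slice_proj (prod_sset I X) 0 a = slice_proj (prod_sset I X) 0 b"
    using t unfolding q_terminal_def slice2_simps_iff prod by blast+
  have ab_j: "a j \<in> simps (?A j) 0" "b j \<in> simps (?B j) 0" "slice_proj (X j) 0 (a j) = slice_proj (X j) 0 (b j)"
    if "j \<in> I" for j
    using ab that unfolding slice_proj_prod_sset simps_prod_sset by (auto simp: fun_eq_iff restrict_def split: if_splits) 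
  have ins_in: "ins A c n s \<in> simps (prod_sset I A) n"
    if "\<And>j. j \<in> I \<Longrightarrow> is_sset (A j)" "\<And>j. j \<in> I \<Longrightarrow> c j \<in> simps (A j) 0" "s \<in> simps (A i) n" for A c n s
    using that deg_in[of "A _" "c _" n] unfolding ins_def simps_prod_sset by auto
  have ins_act: "ins A c m (act (A i) n \<theta> s) = act (prod_sset I A) n \<theta> (ins A c n s)"
    if "\<And>j. j \<in> I \<Longrightarrow> is_sset (A j)" "\<And>j. j \<in> I \<Longrightarrow> c j \<in> simps (A j) 0" "\<theta> \<in> ops m n" for A c m n \<theta> s
    using that act_deg[of "A _" "c _" \<theta> m n] by (auto simp: ins_def fun_eq_iff)
  have ins_eq: "slice_proj (prod_sset I X) n (ins ?A a n s) = slice_proj (prod_sset I X) n (ins ?B b n s')"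
    if "slice_proj (X i) n s = slice_proj (X i) n s'" for n s s'
  proof -
    have "slice_proj (X j) n (deg (?A j) n (a j)) = slice_proj (X j) n (deg (?B j) n (b j))" if "j \<in> I" for j
      using simplicial_map_deg[OF p[OF that] ab_j(1)[OF that], of n]
        simplicial_map_deg[OF p[OF that] ab_j(2)[OF that], of n] ab_j(3)[OF that] by simp
    then show ?thesis
      using that by (auto simp: slice_proj_prod_sset ins_def fun_eq_iff)
  qed
  show ?thesis
  proof (rule q_terminal_retract)
    show "simplicial_map (slice2 (prod_sset I X) u v) (slice2 (X i) (u i) (v i)) (\<lambda>n (s, t). (s i, t i))"
      unfolding simplicial_map_def
    proof (intro conjI allI ballI)
      fix n and x :: "('a \<Rightarrow> 'b) \<times> ('a \<Rightarrow> 'b)"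
      assume "x \<in> simps (slice2 (prod_sset I X) u v) n"
      then show "(case x of (s, t) \<Rightarrow> (s i, t i)) \<in> simps (slice2 (X i) (u i) (v i)) n"
        using i by (cases x)
          (auto simp: slice2_simps_iff prod slice_proj_prod_sset fun_eq_iff PiE_iff
            simp del: slice_simps_iff; metis)
    next
      fix m n \<theta> and x :: "('a \<Rightarrow> 'b) \<times> ('a \<Rightarrow> 'b)"
      show "(case act (slice2 (prod_sset I X) u v) n \<theta> x of (s, t) \<Rightarrow> (s i, t i)) =
          act (slice2 (X i) (u i) (v i)) n \<theta> (case x of (s, t) \<Rightarrow> (s i, t i))"
        using i by (cases x) (simp add: slice2_act)
    qed
    show "simplicial_map (slice2 (X i) (u i) (v i)) (slice2 (prod_sset I X) u v)
        (\<lambda>n (s, t). (ins ?A a n s, ins ?B b n t))"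
      unfolding simplicial_map_def
    proof (intro conjI allI ballI)
      fix n x
      assume "x \<in> simps (slice2 (X i) (u i) (v i)) n"
      then show "(case x of (s, t) \<Rightarrow> (ins ?A a n s, ins ?B b n t)) \<in> simps (slice2 (prod_sset I X) u v) n"
        using ins_in[of ?A a, OF A ab_j(1)] ins_in[of ?B b, OF A ab_j(2)] ins_eq
        by (cases x) (simp add: slice2_simps_iff prod del: slice_simps_iff simps_prod_sset)
    next
      fix m n \<theta> x
      assume "\<theta> \<in> ops m n"
      then show "(case act (slice2 (X i) (u i) (v i)) n \<theta> x of (s, t) \<Rightarrow> (ins ?A a m s, ins ?B b m t)) =
          act (slice2 (prod_sset I X) u v) n \<theta> (case x of (s, t) \<Rightarrow> (ins ?A a n s, ins ?B b n t))"
        using ins_act[of ?A a, OF A ab_j(1)] ins_act[of ?B b, OF A ab_j(2)]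
        by (cases x) (simp add: slice2_act prod del: slice_act_simp act_prod_sset)
    qed
    show "(case case y of (s, t) \<Rightarrow> (ins ?A a n s, ins ?B b n t) of (s, t) \<Rightarrow> (s i, t i)) = y" for n y
      using i by (cases y) (simp add: ins_def)
    show "(a i, b i) \<in> simps (slice2 (X i) (u i) (v i)) 0"
      using ab_j[OF i] by (simp only: slice2_simps_iff)
    \<comment> \<open>In dimension 0 the degenerate simplices are the vertices themselves, so
      inserting \<open>c i\<close> gives back \<open>c\<close>.\<close>
    have "ins A c 0 (c i) = c" if "c \<in> simps (prod_sset I A) 0" "\<And>j. j \<in> I \<Longrightarrow> is_sset (A j)" for A c
      using that act_id[of "A _" "c _" 0] by (auto simp: ins_def fun_eq_iff deg_def PiE_iff extensional_def)
    then show "q_terminal (slice2 (prod_sset I X) u v) (case (a i, b i) of (s, t) \<Rightarrow> (ins ?A a 0 s, ins ?B b 0 t))"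
      using t ab(1,2) A by simp
  qed
qed

lemma upt_0_2: "[0..<2] = [0, Suc 0]"
  by (simp add: numeral_2_eq_2)

lemma boundary_2I:
  assumes "y 0 \<in> simps S 1" "y 1 \<in> simps S 1" "y 2 \<in> simps S 1"
    "act S 1 [1] (y 1) = act S 1 [1] (y 0)" "act S 1 [1] (y 2) = act S 1 [0] (y 0)"
    "act S 1 [0] (y 2) = act S 1 [0] (y 1)"
  shows "boundary S 2 y"
  unfolding boundary_iff_horn using assms by (intro horn_2I) (auto simp: le_2_cases)

text \<open>The pair (identity of \<open>x\<close>, map \<open>x\<close> -> \<open>one\<close>)
  factors through the product by an edge h, which is a section of \<open>a\<close> by construction.
  That \<open>a\<close> followed by h is the identity comes from a triangle in the double slice with
  vertices (a, b), (identity, k), (a, b), which terminality of (a, b) fills.\<close>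

lemma q_equiv_projection:
  assumes X: "is_sset S" and x: "x \<in> simps S 0" and one: "q_terminal S one"
    and t: "q_terminal (slice2 S x one) (a, b)"
  shows "q_equiv S a"
proof -
  note acts = act_act_list[OF X] act_in_list[OF X] act_id_list[OF X]
    act_id_list[OF X, unfolded One_nat_def]
  have ab: "a \<in> simps S 1" "b \<in> simps S 1" "act S 1 [1] a = x" "act S 1 [1] b = one"
    "act S 1 [0] a = act S 1 [0] b"
    using t unfolding q_terminal_def slice2_simps_iff by (auto simp: slice_proj_def)
  have "boundary_fills S 1 (\<lambda>i. if i = 0 then one else x)"
    using one x unfolding q_terminal_def by (auto simp: boundary_def acts)
  then obtain k where k: "k \<in> simps S 1" "act S 1 [1] k = one" "act S 1 [0] k = x"
    unfolding boundary_fills_def by (auto simp: face_1 face_1[unfolded One_nat_def] le_Suc_eq)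
  \<comment> \<open>This exhibits the given \<open>b\<close> as a composite of \<open>a\<close> and
    \<open>k\<close>; all edges into the terminal object \<open>one\<close> admit such a
    triangle.\<close>
  have "boundary_fills S 2 (\<lambda>i. if i = 0 then k else if i = 1 then b else a)"
  proof -
    have "boundary S 2 (\<lambda>i. if i = 0 then k else if i = 1 then b else a)"
      using ab k by (intro boundary_2I) auto
    then show ?thesis
      using one k(2) unfolding q_terminal_def by force
  qed
  then obtain m where m: "m \<in> simps S 2" "act S 2 [0, 1] m = a" "act S 2 [1, 2] m = k" "act S 2 [0, 2] m = b"
    unfolding boundary_fills_def by (auto simp: face_2 le_2_cases)
  let ?Q = "slice2 S x one"
  have v: "(a, b) \<in> simps ?Q 0" "(deg S 1 x, k) \<in> simps ?Q 0"
    using ab k x by (simp_all add: slice2_simps_iff slice_proj_def deg_1 acts)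
  have "boundary_fills ?Q 1 (\<lambda>i. if i = 0 then (a, b) else (deg S 1 x, k))"
    using t v ab unfolding q_terminal_def
    by (auto simp: boundary_def slice2_act acts)
  then obtain s t where st: "(s, t) \<in> simps ?Q 1"
    "act ?Q 1 [1] (s, t) = (a, b)" "act ?Q 1 [0] (s, t) = (deg S 1 x, k)"
    unfolding boundary_fills_def by (auto simp: face_1 face_1[unfolded One_nat_def] le_Suc_eq)
  have s: "s \<in> simps S 2" "act S 2 [2] s = x" "act S 2 [1, 2] s = a" "act S 2 [0, 2] s = deg S 1 x"
    and t': "t \<in> simps S 2" "act S 2 [2] t = one" "act S 2 [1, 2] t = b" "act S 2 [0, 2] t = k"
    "act S 2 [0, 1] s = act S 2 [0, 1] t"
    using st by (auto simp: slice2_simps_iff slice2_act slice_proj_def numeral_2_eq_2)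
  \<comment> \<open>The sides are the map (s, t) into (a, b), the identity of (a, b), and the map
    from (a, b) to (identity of \<open>x\<close>, k) given by a degenerate triangle on
    \<open>a\<close> together with \<open>m\<close>.\<close>
  have "boundary_fills ?Q 2 (\<lambda>i. if i = 0 then (s, t)
      else if i = 1 then (act S 1 [0, 0, 1] a, act S 1 [0, 0, 1] b)
      else (act S 1 [0, 1, 1] a, m))"
  proof -
    have "act S 1 [1, 1] a = deg S 1 x"
      using ab by (simp add: deg_1 acts flip: ab(3))
    have "act S 1 [0, 0] a = act S 1 [0, 0] b"
      using ab act_act_list[OF X ab(1), of "[0]" 0 "[0, 0]"] act_act_list[OF X ab(2), of "[0]" 0 "[0, 0]"]
      by simp
    then have y1: "(act S 1 [0, 0, 1] a, act S 1 [0, 0, 1] b) \<in> simps ?Q 1"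
      "act ?Q 1 [1] (act S 1 [0, 0, 1] a, act S 1 [0, 0, 1] b) = (a, b)"
      "act ?Q 1 [0] (act S 1 [0, 0, 1] a, act S 1 [0, 0, 1] b) = (a, b)"
      using ab by (simp_all add: slice2_simps_iff slice2_act slice_proj_def acts upt_0_2 flip: numeral_2_eq_2)
    have y2: "(act S 1 [0, 1, 1] a, m) \<in> simps ?Q 1"
      "act ?Q 1 [1] (act S 1 [0, 1, 1] a, m) = (deg S 1 x, k)"
      "act ?Q 1 [0] (act S 1 [0, 1, 1] a, m) = (a, b)"
      using ab m \<open>act S 1 [1, 1] a = deg S 1 x\<close> act_act_list[OF X m(1), of "[1, 2]" 1 "[1]"] k
      by (simp_all add: slice2_simps_iff slice2_act slice_proj_def acts upt_0_2 flip: numeral_2_eq_2)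
    have "boundary ?Q 2 (\<lambda>i. if i = 0 then (s, t)
        else if i = 1 then (act S 1 [0, 0, 1] a, act S 1 [0, 0, 1] b)
        else (act S 1 [0, 1, 1] a, m))"
      using st y1 y2 by (intro boundary_2I) simp_all
    moreover have "q_terminal ?Q (a, b)"
      by (rule t)
    ultimately show ?thesis
      using st(2) unfolding q_terminal_def by simp
  qed
  then obtain z z' where z: "(z, z') \<in> simps ?Q 2" "act ?Q 2 [1, 2] (z, z') = (s, t)"
    "act ?Q 2 [0, 2] (z, z') = (act S 1 [0, 0, 1] a, act S 1 [0, 0, 1] b)"
    "act ?Q 2 [0, 1] (z, z') = (act S 1 [0, 1, 1] a, m)"
    unfolding boundary_fills_def by (auto simp: face_2 le_2_cases)
  have z3: "z \<in> simps S 3" "act S 3 [1, 2, 3] z = s" "act S 3 [0, 2, 3] z = act S 1 [0, 0, 1] a"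
    "act S 3 [0, 1, 3] z = act S 1 [0, 1, 1] a"
    using z by (auto simp: slice2_simps_iff slice2_act numeral_3_eq_3 numeral_2_eq_2)
  \<comment> \<open>\<open>s\<close> is the triangle with sides h, \<open>a\<close> and the identity
    of \<open>x\<close>; face 3 of \<open>z\<close> is the triangle with sides \<open>a\<close>, h
    and the identity of the product.\<close>
  define h where "h = act S 2 [0, 1] s"
  define \<sigma> where "\<sigma> = act S 3 [0, 1, 2] z"
  have "act S 2 [0, 1] \<sigma> = act S 2 [0, 1] (act S 3 [0, 1, 3] z)"
    "act S 2 [1, 2] \<sigma> = act S 2 [0, 1] (act S 3 [1, 2, 3] z)"
    "act S 2 [0, 2] \<sigma> = act S 2 [0, 1] (act S 3 [0, 2, 3] z)" "\<sigma> \<in> simps S 2"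
    using z3(1) by (simp_all add: \<sigma>_def acts)
  then have "\<sigma> \<in> simps S 2" "act S 2 [0, 1] \<sigma> = a" "act S 2 [1, 2] \<sigma> = h"
    "act S 2 [0, 2] \<sigma> = deg S 1 (act S 1 [0] a)"
    unfolding z3 h_def using ab(1) by (simp_all add: acts deg_1)
  then show ?thesis
    unfolding q_equiv_def using s ab acts(2)[OF s(1), of "[0, 1]" 1]
    by (intro conjI bexI[of _ h] bexI[of _ \<sigma>] bexI[of _ s]) (simp_all add: h_def)
qed

section \<open>The functors given by products with subobjects\<close>

lemma simps_prod2 [simp]: "(x, y) \<in> simps (prod2 X Y) n \<longleftrightarrow> x \<in> simps X n \<and> y \<in> simps Y n"
  and act_prod2 [simp]: "act (prod2 X Y) n \<theta> (x, y) = (act X n \<theta> x, act Y n \<theta> y)"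
  by (simp_all add: prod2_def)

lemma simps_std_simplex [simp]: "simps (std_simplex k) n = ops n k"
  and act_std_simplex [simp]: "act (std_simplex k) n \<theta> \<sigma> = map ((!) \<sigma>) \<theta>"
  by (simp_all add: std_simplex_def)

text \<open>The diagonal cuts the product of two 1-simplices into two triangles. In each of them the
  interval and \<open>x\<close> are degenerated by complementary operators.\<close>

lemma naturality_square:
  assumes X: "is_sset X" and \<epsilon>: "simplicial_map (prod2 (std_simplex 1) X) S \<epsilon>" and x: "x \<in> simps X 1"
  shows "q_tri S (\<epsilon> 1 ([0, 0], x)) (\<epsilon> 1 ([0, 1], deg X 1 (act X 1 [1] x))) (\<epsilon> 1 ([0, 1], x))"
    and "q_tri S (\<epsilon> 1 ([0, 1], deg X 1 (act X 1 [0] x))) (\<epsilon> 1 ([1, 1], x)) (\<epsilon> 1 ([0, 1], x))"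
proof -
  note acts = act_act_list[OF X] act_in_list[OF X] act_id_list[OF X]
    act_id_list[OF X, unfolded One_nat_def]
  have *: "act S 2 \<theta> (\<epsilon> 2 (\<sigma>, y)) = \<epsilon> 1 (map ((!) \<sigma>) \<theta>, act X 2 \<theta> y)"
    if "\<sigma> \<in> ops 2 1" "y \<in> simps X 2" "\<theta> \<in> ops 1 2" for \<sigma> \<theta> y
    using simplicial_map_act[OF \<epsilon>, of "(\<sigma>, y)" 2 \<theta> 1] that by simp
  have **: "\<epsilon> 2 (\<sigma>, y) \<in> simps S 2" if "\<sigma> \<in> ops 2 1" "y \<in> simps X 2" for \<sigma> y
    using simplicial_map_in[OF \<epsilon>, of "(\<sigma>, y)" 2] that by simp
  show "q_tri S (\<epsilon> 1 ([0, 0], x)) (\<epsilon> 1 ([0, 1], deg X 1 (act X 1 [1] x))) (\<epsilon> 1 ([0, 1], x))"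
    unfolding q_tri_def
    by (intro bexI[of _ "\<epsilon> 2 ([0, 0, 1], act X 1 [0, 1, 1] x)"])
      (use x in \<open>simp_all add: * ** acts ops_iff deg_1\<close>)
  show "q_tri S (\<epsilon> 1 ([0, 1], deg X 1 (act X 1 [0] x))) (\<epsilon> 1 ([1, 1], x)) (\<epsilon> 1 ([0, 1], x))"
    unfolding q_tri_def
    by (intro bexI[of _ "\<epsilon> 2 ([0, 1, 1], act X 1 [0, 0, 1] x)"])
      (use x in \<open>simp_all add: * ** acts ops_iff deg_1\<close>)
qed

text \<open>\<open>e 0\<close> and \<open>e 1\<close> are the projections from the products with
  \<open>u\<close> at the source and the target of \<open>x\<close>; \<open>d\<close> is the
  diagonal of the naturality square that relates \<open>F\<close> at \<open>x\<close> to
  \<open>x\<close> itself.\<close>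

lemma q_times_square:
  assumes S: "is_sset S" and T: "q_times S v u F" and x: "x \<in> simps (slice S v) 1"
  obtains e d b where "q_tri S (slice_proj S 1 (F 1 x)) (e 1) d" "q_tri S (e 0) (slice_proj S 1 x) d"
    "\<And>j. j \<le> 1 \<Longrightarrow> q_product S (act S 2 [j] x) u (e j) (b j)"
proof -
  note X = is_sset_slice[OF S, of v]
  obtain \<epsilon> where \<epsilon>: "simplicial_map (prod2 (std_simplex 1) (slice S v)) S \<epsilon>"
    "\<And>n x. x\<in>simps (slice S v) n \<Longrightarrow> \<epsilon> n (replicate (Suc n) 0, x) = slice_proj S n (F n x)"
    "\<And>n x. x\<in>simps (slice S v) n \<Longrightarrow> \<epsilon> n (replicate (Suc n) 1, x) = slice_proj S n x"
    "\<And>x. x\<in>simps (slice S v) 0 \<Longrightarrow>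
      q_product S (slice_proj S 0 x) u (\<epsilon> 1 ([0, 1], deg (slice S v) 1 x)) (F 0 x)"
    using T unfolding q_times_def by blast
  define y where "y = (\<lambda>j. act (slice S v) 1 [j] x)"
  have y: "y j \<in> simps (slice S v) 0" "slice_proj S 0 (y j) = act S 2 [j] x" if "j \<le> 1" for j
  proof -
    show "y j \<in> simps (slice S v) 0"
      unfolding y_def using that x by (intro act_in_list[OF X]) auto
    show "slice_proj S 0 (y j) = act S 2 [j] x"
      using that x by (simp add: y_def slice_proj_def act_act_list[OF S] numeral_2_eq_2)
  qed
  show thesis
  proof (rule that[of "\<lambda>j. \<epsilon> 1 ([0, 1], deg (slice S v) 1 (y j))" "\<epsilon> 1 ([0, 1], x)" "\<lambda>j. F 0 (y j)"])
    show "q_tri S (slice_proj S 1 (F 1 x)) (\<epsilon> 1 ([0, 1], deg (slice S v) 1 (y 1))) (\<epsilon> 1 ([0, 1], x))"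
      using naturality_square(1)[OF X \<epsilon>(1) x] \<epsilon>(2)[OF x] by (simp add: y_def)
    show "q_tri S (\<epsilon> 1 ([0, 1], deg (slice S v) 1 (y 0))) (slice_proj S 1 x) (\<epsilon> 1 ([0, 1], x))"
      using naturality_square(2)[OF X \<epsilon>(1) x] \<epsilon>(3)[OF x] by (simp add: y_def)
    show "q_product S (act S 2 [j] x) u (\<epsilon> 1 ([0, 1], deg (slice S v) 1 (y j))) (F 0 (y j))" if "j \<le> 1" for j
      using \<epsilon>(4)[OF y(1)[OF that]] y(2)[OF that] by simp
  qed
qed

lemma q_tri_component:
  assumes "q_tri (prod_sset I X) f g h" "i \<in> I"
  shows "q_tri (X i) (f i) (g i) (h i)"
proof -
  obtain \<sigma> where "\<sigma> \<in> (\<Pi>\<^sub>E i\<in>I. simps (X i) 2)" "(\<lambda>i\<in>I. act (X i) 2 [0, 1] (\<sigma> i)) = f"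
    "(\<lambda>i\<in>I. act (X i) 2 [1, 2] (\<sigma> i)) = g" "(\<lambda>i\<in>I. act (X i) 2 [0, 2] (\<sigma> i)) = h"
    using assms(1) unfolding q_tri_def by auto
  then show ?thesis
    unfolding q_tri_def using assms(2) by (intro bexI[of _ "\<sigma> i"]) auto
qed

section \<open>Filter products of quasi-categories\<close>

lemma sset_system_slices:
  assumes \<Phi>: "product_closed_filter I \<Phi>" and D: "is_sset D" and T: "q_filter_system D \<Phi> ob T"
  shows "sset_system \<Phi> (\<lambda>V. slice D (ob V)) T"
proof (rule sset_system.intro)
  show simp: "simplicial_map (slice D (ob V)) (slice D (ob U)) (T V U)"
    if "V \<in> \<Phi>" "U \<in> \<Phi>" "U \<le> V" for U V
    using T that unfolding q_filter_system_def q_times_def by blast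
  show "is_sset (slice D (ob V))" for V
    by (rule is_sset_slice[OF D])
  show "directed_system \<Phi> (\<lambda>V. simps (slice D (ob V)) n) (\<lambda>V U. T V U n)" for n
  proof (rule directed_systemI[OF \<Phi>])
    show "T V U n x \<in> simps (slice D (ob U)) n"
      if "V \<in> \<Phi>" "U \<in> \<Phi>" "U \<le> V" "x \<in> simps (slice D (ob V)) n" for V U x
      by (rule simplicial_map_in[OF simp[OF that(1-3)] that(4)])
    show "T U W n (T V U n x) = T V W n x"
      if "V \<in> \<Phi>" "U \<in> \<Phi>" "W \<in> \<Phi>" "W \<le> U" "U \<le> V" "x \<in> simps (slice D (ob V)) n" for V U W x
      using T that unfolding q_filter_system_def by blast
    show "T V V n x = x" if "V \<in> \<Phi>" "x \<in> simps (slice D (ob V)) n" for V x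
      using T that unfolding q_filter_system_def by blast
  qed
qed

lemma power_equiv_transfer:
  fixes C :: "'a sset"
  assumes C: "quasi_category C" and one: "q_terminal C one" and zero: "zero \<in> simps C 0"
    and T: "q_times (q_power I C) v (sub_object I zero one V) F"
    and x: "x \<in> simps (slice (q_power I C) v) 1" and i: "i \<in> I"
  defines "y \<equiv> slice_proj (q_power I C) 1 (F 1 x)"
  shows "i \<in> V \<Longrightarrow> q_equiv C (y i) \<longleftrightarrow> q_equiv C (slice_proj (q_power I C) 1 x i)"
    and "q_strict C zero \<Longrightarrow> i \<notin> V \<Longrightarrow> F 1 x \<in> simps (slice (q_power I C) (sub_object I zero one V)) 1 \<Longrightarrow>
      q_equiv C (y i)"
proof -
  note X = quasi_category_is_sset[OF C]
  have D: "is_sset (q_power I C)"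
    unfolding q_power_def by (rule is_sset_prod_sset[OF X])
  interpret weak_category "simps C 1" "act C 1 [0]" "act C 1 [1]" "deg C 1" "q_tri C"
    by (rule weak_category_quasi_category[OF C])
  note equiv = q_equiv_iff[OF C]
  let ?u = "sub_object I zero one V"
  obtain e d b where e: "q_tri (q_power I C) y (e 1) d" "q_tri (q_power I C) (e 0) (slice_proj (q_power I C) 1 x) d"
    "\<And>j. j \<le> 1 \<Longrightarrow> q_product (q_power I C) (act (q_power I C) 2 [j] x) ?u (e j) (b j)"
    using q_times_square[OF D T x] unfolding y_def by metis
  have x2: "x \<in> simps (q_power I C) 2"
    using x by (simp add: numeral_2_eq_2)
  show "q_equiv C (y i) \<longleftrightarrow> q_equiv C (slice_proj (q_power I C) 1 x i)" if "i \<in> V"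
  proof -
    have "q_equiv C (e j i)" if j: "j \<le> 1" for j
    proof (rule q_equiv_projection[OF X])
      have *: "act (q_power I C) 2 [j] x \<in> simps (q_power I C) 0"
        using x2 j by (intro act_in_list[OF D]) auto
      then show "act (q_power I C) 2 [j] x i \<in> simps C 0"
        using i unfolding q_power_def simps_prod_sset by blast
      show "q_terminal C one"
        by (rule one)
      have "?u i = one"
        using i \<open>i \<in> V\<close> by (simp add: sub_object_def)
      moreover have "act (q_power I C) 2 [j] x \<in> extensional I" "?u \<in> extensional I"
        using * unfolding q_power_def simps_prod_sset PiE_def sub_object_def by auto
      ultimately show "q_terminal (slice2 C (act (q_power I C) 2 [j] x i) one) (e j i, b j i)"
        using e(3)[OF j] q_terminal_component[OF X i, of _ ?u "e j" "b j"]
        unfolding q_product_def q_power_def by metis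
    qed
    from this[of 0] this[of 1] have "equivalence (e 0 i)" "equivalence (e 1 i)"
      unfolding equiv by simp_all
    then show ?thesis
      using equivalence_square[OF q_tri_component[OF e(1)[unfolded q_power_def] i]
          q_tri_component[OF e(2)[unfolded q_power_def] i]]
      unfolding equiv q_power_def by blast
  qed
  show "q_equiv C (y i)" if strict: "q_strict C zero" and "i \<notin> V" and F: "F 1 x \<in> simps (slice (q_power I C) ?u) 1"
  proof -
    define \<sigma> where "\<sigma> = F 1 x i"
    have "?u i = zero"
      using i \<open>i \<notin> V\<close> by (simp add: sub_object_def)
    have F2: "F 1 x \<in> simps (q_power I C) 2" "act (q_power I C) 2 [2] (F 1 x) = ?u"
      using F by (simp_all add: numeral_2_eq_2)
    then have \<sigma>: "\<sigma> \<in> simps C 2" "y i = act C 2 [0, 1] \<sigma>"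
      using i by (auto simp: \<sigma>_def y_def q_power_def slice_proj_def upt_0_2 simp flip: numeral_2_eq_2)
    have \<sigma>2: "act C 2 [2] \<sigma> = zero"
      using fun_cong[OF F2(2), of i] i \<open>?u i = zero\<close> by (simp add: \<sigma>_def q_power_def)
    \<comment> \<open>Two sides of this triangle are structure maps to \<open>zero\<close>;
      strictness makes them equivalences, and cancellation the third.\<close>
    have "q_tri C (y i) (act C 2 [1, 2] \<sigma>) (act C 2 [0, 2] \<sigma>)"
      unfolding q_tri_def using \<sigma> by (intro bexI[of _ \<sigma>]) simp_all
    moreover have "equivalence (act C 2 [1, 2] \<sigma>)" "equivalence (act C 2 [0, 2] \<sigma>)"
      unfolding equiv using strict \<sigma>(1) \<sigma>2 unfolding q_strict_def
      by (simp_all add: act_act_list[OF X] act_in_list[OF X])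
    ultimately show ?thesis
      using equivalence_cancel_right unfolding equiv by blast
  qed
qed

lemma q_power_equiv:
  assumes X: "is_sset C" and "y \<in> simps (q_power I C) 1" "\<And>i. i \<in> I \<Longrightarrow> q_equiv C (y i)"
  shows "q_equiv (q_power I C) y"
proof -
  have "\<forall>i\<in>I. \<exists>g \<sigma> \<tau>. g \<in> simps C 1 \<and> \<sigma> \<in> simps C 2 \<and> \<tau> \<in> simps C 2 \<and>
        act C 2 [0, 1] \<sigma> = y i \<and> act C 2 [1, 2] \<sigma> = g \<and>
        act C 2 [0, 2] \<sigma> = deg C 1 (act C 1 [0] (y i)) \<and>
        act C 2 [0, 1] \<tau> = g \<and> act C 2 [1, 2] \<tau> = y i \<and>
        act C 2 [0, 2] \<tau> = deg C 1 (act C 1 [1] (y i))"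
    using assms(3) unfolding q_equiv_def by blast
  then obtain g \<sigma> \<tau> where g: "\<And>i. i\<in>I \<Longrightarrow> g i \<in> simps C 1 \<and> \<sigma> i \<in> simps C 2 \<and> \<tau> i \<in> simps C 2 \<and>
        act C 2 [0, 1] (\<sigma> i) = y i \<and> act C 2 [1, 2] (\<sigma> i) = g i \<and>
        act C 2 [0, 2] (\<sigma> i) = deg C 1 (act C 1 [0] (y i)) \<and>
        act C 2 [0, 1] (\<tau> i) = g i \<and> act C 2 [1, 2] (\<tau> i) = y i \<and>
        act C 2 [0, 2] (\<tau> i) = deg C 1 (act C 1 [1] (y i))"
    unfolding bchoice_iff by metis
  have y: "y \<in> (\<Pi>\<^sub>E i\<in>I. simps C 1)"
    using assms(2) by (simp add: q_power_def)
  then have ry: "restrict y I = y"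
    by (simp add: PiE_restrict)
  show ?thesis
    unfolding q_equiv_def q_power_def
  proof (intro conjI)
    show "y \<in> simps (prod_sset I (\<lambda>_. C)) 1"
      using y by simp
    show "\<exists>g\<in>simps (prod_sset I (\<lambda>_. C)) 1.
       \<exists>\<sigma>\<in>simps (prod_sset I (\<lambda>_. C)) 2. \<exists>\<tau>\<in>simps (prod_sset I (\<lambda>_. C)) 2.
             act (prod_sset I (\<lambda>_. C)) 2 [0, 1] \<sigma> = y \<and>
             act (prod_sset I (\<lambda>_. C)) 2 [1, 2] \<sigma> = g \<and>
             act (prod_sset I (\<lambda>_. C)) 2 [0, 2] \<sigma> =
               deg (prod_sset I (\<lambda>_. C)) 1 (act (prod_sset I (\<lambda>_. C)) 1 [0] y) \<and>
             act (prod_sset I (\<lambda>_. C)) 2 [0, 1] \<tau> = g \<and>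
             act (prod_sset I (\<lambda>_. C)) 2 [1, 2] \<tau> = y \<and>
             act (prod_sset I (\<lambda>_. C)) 2 [0, 2] \<tau> =
               deg (prod_sset I (\<lambda>_. C)) 1 (act (prod_sset I (\<lambda>_. C)) 1 [1] y)"
      by (rule bexI[of _ "restrict g I"], rule bexI[of _ "restrict \<sigma> I"], rule bexI[of _ "restrict \<tau> I"])
        (simp_all add: deg_prod_sset ry g g[unfolded One_nat_def] cong: restrict_cong)
  qed
qed

theorem q_filter_product_equiv:
  fixes C :: "'a sset"
  assumes \<Phi>: "product_closed_filter I \<Phi>"
    and C: "quasi_category C" and one: "q_terminal C one" and zero: "zero \<in> simps C 0"
    and T: "q_filter_system (q_power I C) \<Phi> (sub_object I zero one) T"
    and P: "q_canonical (q_power I C) \<Phi> (sub_object I zero one) T I P"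
    and f: "f \<in> simps (q_power I C) 1"
  shows "q_equiv (q_filter_quotient (q_power I C) \<Phi> (sub_object I zero one) T) (P 1 f) \<Longrightarrow>
      {i \<in> I. q_equiv C (f i)} \<in> \<Phi>"
    and "q_strict C zero \<Longrightarrow> {i \<in> I. q_equiv C (f i)} \<in> \<Phi> \<Longrightarrow>
      q_equiv (q_filter_quotient (q_power I C) \<Phi> (sub_object I zero one) T) (P 1 f)"
proof -
  let ?D = "q_power I C" and ?ob = "sub_object I zero one"
  note X = quasi_category_is_sset[OF C]
  have qD: "quasi_category ?D"
    unfolding q_power_def by (rule quasi_category_prod_sset[OF C])
  note D = quasi_category_is_sset[OF qD]
  interpret sset_system \<Phi> "\<lambda>V. slice ?D (?ob V)" T
    by (rule sset_system_slices[OF \<Phi> D T])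
  have I: "I \<in> \<Phi>" and sub: "\<And>V. V \<in> \<Phi> \<Longrightarrow> V \<le> I"
    using \<Phi> unfolding product_closed_filter_def by auto
  obtain s where s: "simplicial_map ?D (slice ?D (?ob I)) s"
    "\<And>n x. x\<in>simps ?D n \<Longrightarrow> slice_proj ?D n (s n x) = x"
    "\<And>n x. x\<in>simps ?D n \<Longrightarrow> P n x = germ_n n I (s n x)"
    using P unfolding q_canonical_def by blast
  define x where "x = s 1 f"
  have x: "x \<in> simps (slice ?D (?ob I)) 1" "slice_proj ?D 1 x = f"
    unfolding x_def by (rule simplicial_map_in[OF s(1) f], rule s(2)[OF f])
  have quotient: "q_equiv (q_filter_quotient ?D \<Phi> ?ob T) (P 1 f) \<longleftrightarrow>
      (\<exists>V\<in>\<Phi>. q_equiv (slice ?D (?ob V)) (T I V 1 x))"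
    unfolding q_filter_quotient_def s(3)[OF f] x_def[symmetric] q_equiv_colim_iff[OF I x(1)]
    using sub by blast
  have times: "q_times ?D (?ob I) (?ob V) (T I V)" if "V \<in> \<Phi>" for V
    using conjunct1[OF T[unfolded q_filter_system_def]] I sub[OF that] that by simp
  note transfer = power_equiv_transfer[OF C one zero times x(1), unfolded x(2)]
  have TI: "T I V 1 x \<in> simps (slice ?D (?ob V)) 1" if "V \<in> \<Phi>" for V
    by (rule simplicial_map_in[OF simplicial[OF I that sub[OF that]] x(1)])
  note proj = simplicial_map_slice_proj[OF D]
  show "{i \<in> I. q_equiv C (f i)} \<in> \<Phi>" if "q_equiv (q_filter_quotient ?D \<Phi> ?ob T) (P 1 f)"
  proof -
    obtain V where V: "V \<in> \<Phi>" "q_equiv (slice ?D (?ob V)) (T I V 1 x)"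
      using \<open>q_equiv (q_filter_quotient ?D \<Phi> ?ob T) (P 1 f)\<close> quotient by blast
    have "q_equiv C (f i)" if "i \<in> V" for i
    proof -
      have i: "i \<in> I"
        using sub[OF V(1)] that by blast
      have "q_equiv ?D (slice_proj ?D 1 (T I V 1 x))"
        by (rule q_equiv_simplicial_map[OF proj sset[OF V(1)] V(2)])
      then have "q_equiv C (slice_proj ?D 1 (T I V 1 x) i)"
        using q_equiv_simplicial_map[OF simplicial_map_component[OF i] D[unfolded q_power_def]]
        unfolding q_power_def by blast
      then show ?thesis
        using transfer(1)[OF V(1) i that] by blast
    qed
    then have "V \<subseteq> {i \<in> I. q_equiv C (f i)}"
      using sub[OF V(1)] by blast
    then show ?thesis
      using \<Phi> V(1) unfolding product_closed_filter_def by blast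
  qed
  show "q_equiv (q_filter_quotient ?D \<Phi> ?ob T) (P 1 f)"
    if strict: "q_strict C zero" and J: "{i \<in> I. q_equiv C (f i)} \<in> \<Phi>" (is "?J \<in> \<Phi>")
  proof -
    have "q_equiv C (slice_proj ?D 1 (T I ?J 1 x) i)" if "i \<in> I" for i
      using transfer[OF J that] strict TI[OF J] that by (cases "i \<in> ?J") blast+
    then have "q_equiv ?D (slice_proj ?D 1 (T I ?J 1 x))"
      using simplicial_map_in[OF proj TI[OF J]] by (intro q_power_equiv[OF X]) auto
    then have "q_equiv (slice ?D (?ob ?J)) (T I ?J 1 x)"
      by (rule q_equiv_slice[OF qD TI[OF J]])
    then show ?thesis
      using quotient J by blast
  qed
qed

section \<open>Equivalences and filter products in Kan enriched categories\<close>

section \<open>Components of Kan complexes\<close>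

lemma kan_complex_is_sset: "kan_complex X \<Longrightarrow> is_sset X"
  by (simp add: kan_complex_def)

lemma same_component_sym:
  assumes X: "kan_complex X" and "same_component X x y"
  shows "same_component X y x"
proof -
  note S = kan_complex_is_sset[OF X]
  note acts = act_act_list[OF S] act_in_list[OF S] act_id_list[OF S]
    act_id_list[OF S, unfolded One_nat_def]
  obtain w where w: "w \<in> simps X 1" "act X 1 [0] w = x" "act X 1 [1] w = y"
    using assms(2) unfolding same_component_def by blast
  define v where "v = act X 1 [0, 0] w"
  have v: "v \<in> simps X 1" "act X 1 [0] v = x" "act X 1 [1] v = x"
    using w by (simp_all add: v_def acts)
  \<comment> \<open>An outer horn at vertex 0 made of the given path and a constant path; the
    remaining side runs backwards.\<close>
  have "horn X 2 0 (\<lambda>i. if i = 1 then v else w)"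
    using w v by (intro horn_2I) auto
  then have "horn_fills X 2 0 (\<lambda>i. if i = 1 then v else w)"
    using X by (simp add: kan_complex_def)
  then obtain z where z: "z \<in> simps X 2" "act X 2 [0, 2] z = v" "act X 2 [0, 1] z = w"
    by (auto simp: horn_fills_def le_2_cases face_2)
  have "act X 1 [0] (act X 2 [1, 2] z) = act X 1 [1] (act X 2 [0, 1] z)"
    "act X 1 [1] (act X 2 [1, 2] z) = act X 1 [1] (act X 2 [0, 2] z)" "act X 2 [1, 2] z \<in> simps X 1"
    using z(1) by (simp_all add: acts)
  then show ?thesis
    unfolding same_component_def z(2,3) w v by blast
qed

lemma same_component_trans:
  assumes X: "kan_complex X" and "same_component X x y" "same_component X y z"
  shows "same_component X x z"
proof -
  note S = kan_complex_is_sset[OF X]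
  note acts = act_act_list[OF S] act_in_list[OF S] act_id_list[OF S]
  obtain v where v: "v \<in> simps X 1" "act X 1 [0] v = x" "act X 1 [1] v = y"
    using assms(2) unfolding same_component_def by blast
  obtain w where w: "w \<in> simps X 1" "act X 1 [0] w = y" "act X 1 [1] w = z"
    using assms(3) unfolding same_component_def by blast
  have "horn X 2 1 (\<lambda>i. if i = 0 then w else v)"
    using w v by (intro horn_2I) auto
  then have "horn_fills X 2 1 (\<lambda>i. if i = 0 then w else v)"
    using X by (simp add: kan_complex_def)
  then obtain u where u: "u \<in> simps X 2" "act X 2 [1, 2] u = w" "act X 2 [0, 1] u = v"
    by (auto simp: horn_fills_def le_2_cases face_2)
  have "act X 1 [0] (act X 2 [0, 2] u) = act X 1 [0] (act X 2 [0, 1] u)"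
    "act X 1 [1] (act X 2 [0, 2] u) = act X 1 [1] (act X 2 [1, 2] u)" "act X 2 [0, 2] u \<in> simps X 1"
    using u(1) by (simp_all add: acts)
  then show ?thesis
    unfolding same_component_def u(2,3) w v by blast
qed

lemma deg_0: "is_sset X \<Longrightarrow> x \<in> simps X 0 \<Longrightarrow> deg X 0 x = x"
  unfolding deg_def by (simp add: act_id_list)

section \<open>Simplicially enriched categories\<close>

locale enriched_category =
  fixes D :: "('o, 'm) scat"
  assumes hom_sset: "x \<in> sobj D \<Longrightarrow> y \<in> sobj D \<Longrightarrow> is_sset (shom D x y)"
    and sid_in: "x \<in> sobj D \<Longrightarrow> sid D x \<in> simps (shom D x x) 0"
    and comp_map: "x \<in> sobj D \<Longrightarrow> y \<in> sobj D \<Longrightarrow> z \<in> sobj D \<Longrightarrow>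
      simplicial_map (prod2 (shom D y z) (shom D x y)) (shom D x z) (\<lambda>n (g, f). scomp D n x y z g f)"
    and comp_id: "x \<in> sobj D \<Longrightarrow> y \<in> sobj D \<Longrightarrow> f \<in> simps (shom D x y) n \<Longrightarrow>
      scomp D n x x y f (deg (shom D x x) n (sid D x)) = f"
    and id_comp: "x \<in> sobj D \<Longrightarrow> y \<in> sobj D \<Longrightarrow> f \<in> simps (shom D x y) n \<Longrightarrow>
      scomp D n x y y (deg (shom D y y) n (sid D y)) f = f"
    and comp_assoc: "w \<in> sobj D \<Longrightarrow> x \<in> sobj D \<Longrightarrow> y \<in> sobj D \<Longrightarrow> z \<in> sobj D \<Longrightarrow>
      f \<in> simps (shom D w x) n \<Longrightarrow> g \<in> simps (shom D x y) n \<Longrightarrow> h \<in> simps (shom D y z) n \<Longrightarrow>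
      scomp D n w x z (scomp D n x y z h g) f = scomp D n w y z h (scomp D n w x y g f)"
begin

lemma comp_in:
  "x \<in> sobj D \<Longrightarrow> y \<in> sobj D \<Longrightarrow> z \<in> sobj D \<Longrightarrow> g \<in> simps (shom D y z) n \<Longrightarrow>
    f \<in> simps (shom D x y) n \<Longrightarrow> scomp D n x y z g f \<in> simps (shom D x z) n"
  using simplicial_map_in[OF comp_map, of x y z "(g, f)" n] by (simp add: prod2_def)

lemma act_comp:
  "x \<in> sobj D \<Longrightarrow> y \<in> sobj D \<Longrightarrow> z \<in> sobj D \<Longrightarrow> g \<in> simps (shom D y z) n \<Longrightarrow>
    f \<in> simps (shom D x y) n \<Longrightarrow> \<theta> \<in> ops m n \<Longrightarrow>
    act (shom D x z) n \<theta> (scomp D n x y z g f) =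
      scomp D m x y z (act (shom D y z) n \<theta> g) (act (shom D x y) n \<theta> f)"
  using simplicial_map_act[OF comp_map, of x y z "(g, f)" n \<theta> m] by (simp add: prod2_def)

lemma deg_comp:
  "x \<in> sobj D \<Longrightarrow> y \<in> sobj D \<Longrightarrow> z \<in> sobj D \<Longrightarrow> g \<in> simps (shom D y z) 0 \<Longrightarrow>
    f \<in> simps (shom D x y) 0 \<Longrightarrow> 
    deg (shom D x z) n (scomp D 0 x y z g f) =
      scomp D n x y z (deg (shom D y z) n g) (deg (shom D x y) n f)"
  unfolding deg_def by (rule act_comp) (use replicate_0_in_ops in auto)

lemma deg_hom_in: "x \<in> sobj D \<Longrightarrow> y \<in> sobj D \<Longrightarrow> f \<in> simps (shom D x y) 0 \<Longrightarrow> deg (shom D x y) n f \<in> simps (shom D x y) n"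
  by (rule deg_in[OF hom_sset])

lemma comp_id_0: "x \<in> sobj D \<Longrightarrow> y \<in> sobj D \<Longrightarrow> f \<in> simps (shom D x y) 0 \<Longrightarrow> scomp D 0 x x y f (sid D x) = f"
  and id_comp_0: "x \<in> sobj D \<Longrightarrow> y \<in> sobj D \<Longrightarrow> f \<in> simps (shom D x y) 0 \<Longrightarrow> scomp D 0 x y y (sid D y) f = f"
  using comp_id[of x y f 0] id_comp[of x y f 0] deg_0[OF hom_sset sid_in] by simp_all

lemma product_projections:
  assumes "k_product D x y p a b"
  shows "p \<in> sobj D" "a \<in> simps (shom D p x) 0" "b \<in> simps (shom D p y) 0"
  using assms unfolding k_product_def by blast+

lemma product_ext:
  assumes P: "k_product D x y p a b" and z: "z \<in> sobj D"
    and h: "h \<in> simps (shom D z p) n" "h' \<in> simps (shom D z p) n"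
    and "scomp D n z p x (deg (shom D p x) n a) h = scomp D n z p x (deg (shom D p x) n a) h'"
    and "scomp D n z p y (deg (shom D p y) n b) h = scomp D n z p y (deg (shom D p y) n b) h'"
  shows "h = h'"
proof -
  have "inj_on (\<lambda>h. (scomp D n z p x (deg (shom D p x) n a) h, scomp D n z p y (deg (shom D p y) n b) h))
        (simps (shom D z p) n)"
    using P z unfolding k_product_def bij_betw_def by blast
  then show ?thesis
    using assms(5,6) inj_onD[OF _ _ h] by fastforce
qed

lemma pair_props:
  assumes P: "k_product D x y p a b" and z: "z \<in> sobj D"
    and f: "f \<in> simps (shom D z x) n" and g: "g \<in> simps (shom D z y) n"
  shows "k_pair D x y p a b n z f g \<in> simps (shom D z p) n"
    and "scomp D n z p x (deg (shom D p x) n a) (k_pair D x y p a b n z f g) = f"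
    and "scomp D n z p y (deg (shom D p y) n b) (k_pair D x y p a b n z f g) = g"
proof -
  let ?Q = "\<lambda>h. h \<in> simps (shom D z p) n \<and> scomp D n z p x (deg (shom D p x) n a) h = f \<and>
    scomp D n z p y (deg (shom D p y) n b) h = g"
  have "(f, g) \<in> (\<lambda>h. (scomp D n z p x (deg (shom D p x) n a) h, scomp D n z p y (deg (shom D p y) n b) h)) `
        (simps (shom D z p) n)"
    using P z f g unfolding k_product_def bij_betw_def by blast
  then obtain h where h: "?Q h"
    by auto
  have "h' = h" if "?Q h'" for h'
    using product_ext[OF P z, of h' n h] h that by simp
  then have "?Q (THE h. ?Q h)"
    using theI[of ?Q h] h by blast
  then show "k_pair D x y p a b n z f g \<in> simps (shom D z p) n"
    "scomp D n z p x (deg (shom D p x) n a) (k_pair D x y p a b n z f g) = f"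
    "scomp D n z p y (deg (shom D p y) n b) (k_pair D x y p a b n z f g) = g"
    unfolding k_pair_def by blast+
qed

end

lemma enriched_if_kan_enriched: "kan_enriched C \<Longrightarrow> enriched_category C"
  unfolding kan_enriched_def by unfold_locales (auto simp: kan_complex_def)

lemma simps_k_power [simp]:
  "sobj (k_power I C) = (\<Pi>\<^sub>E i\<in>I. sobj C)"
  "shom (k_power I C) X Y = prod_sset I (\<lambda>i. shom C (X i) (Y i))"
  "scomp (k_power I C) n X Y Z g f = (\<lambda>i\<in>I. scomp C n (X i) (Y i) (Z i) (g i) (f i))"
  "sid (k_power I C) X = (\<lambda>i\<in>I. sid C (X i))"
  by (simp_all add: k_power_def)

lemma enriched_k_power:
  assumes "enriched_category C"
  shows "enriched_category (k_power I C)"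
proof -
  interpret enriched_category C
    by (rule assms)
  have [simp]: "X \<in> (\<Pi>\<^sub>E i\<in>I. sobj C) \<Longrightarrow> i \<in> I \<Longrightarrow> X i \<in> sobj C" for X i
    by blast
  show ?thesis
  proof
    fix X Y
    assume "X \<in> sobj (k_power I C)" "Y \<in> sobj (k_power I C)"
    then show "is_sset (shom (k_power I C) X Y)"
      unfolding simps_k_power by (intro is_sset_prod_sset hom_sset) auto
  next
    fix X Y Z
    assume *: "X \<in> sobj (k_power I C)" "Y \<in> sobj (k_power I C)" "Z \<in> sobj (k_power I C)"
    show "simplicial_map (prod2 (shom (k_power I C) Y Z) (shom (k_power I C) X Y)) (shom (k_power I C) X Z)
       (\<lambda>n (g, f). scomp (k_power I C) n X Y Z g f)"
      unfolding simplicial_map_def prod2_def using * 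
      by (auto simp: comp_in act_comp PiE_iff fun_eq_iff)
  next
    fix X Y f n
    assume *: "X \<in> sobj (k_power I C)" "Y \<in> sobj (k_power I C)" "f \<in> simps (shom (k_power I C) X Y) n"
    then show "scomp (k_power I C) n X X Y f (deg (shom (k_power I C) X X) n (sid (k_power I C) X)) = f"
      "scomp (k_power I C) n X Y Y (deg (shom (k_power I C) Y Y) n (sid (k_power I C) Y)) f = f"
      by (auto simp: fun_eq_iff deg_prod_sset comp_id id_comp PiE_iff extensional_def)
  qed (auto simp: sid_in comp_assoc PiE_iff fun_eq_iff)
qed

section \<open>The filter quotient of an enriched category\<close>

locale k_system = enriched_category D for D :: "('o, 'm) scat" +
  fixes I :: "'i set" and \<Phi> :: "'i set set" and ob :: "'i set \<Rightarrow> 'o"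
    and T :: "('i set, 'o, 'm) k_choice"
  assumes filter: "product_closed_filter I \<Phi>"
    and ob_in: "V \<in> \<Phi> \<Longrightarrow> ob V \<in> sobj D"
    and system: "k_filter_system D \<Phi> ob T"
begin

lemma inc_in: "U \<in> \<Phi> \<Longrightarrow> V \<in> \<Phi> \<Longrightarrow> U \<le> V \<Longrightarrow> inc T U V \<in> simps (shom D (ob U) (ob V)) 0"
  and inc_refl: "V \<in> \<Phi> \<Longrightarrow> inc T V V = sid D (ob V)"
  and inc_comp: "U \<in> \<Phi> \<Longrightarrow> V \<in> \<Phi> \<Longrightarrow> W \<in> \<Phi> \<Longrightarrow> U \<le> V \<Longrightarrow> V \<le> W \<Longrightarrow>
    scomp D 0 (ob U) (ob V) (ob W) (inc T V W) (inc T U V) = inc T U W"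
  and tens_product: "V \<in> \<Phi> \<Longrightarrow> X \<in> sobj D \<Longrightarrow> k_product D X (ob V) (tens T V X) (pr1 T V X) (pr2 T V X)"
  using system unfolding k_filter_system_def by simp_all

lemmas tens_in = product_projections(1)[OF tens_product]
  and pr1_in = product_projections(2)[OF tens_product]
  and pr2_in = product_projections(3)[OF tens_product]

abbreviation "tinc \<equiv> k_tens_inc D ob T"
abbreviation "restr \<equiv> k_restrict D ob T"
abbreviation "Q \<equiv> k_filter_quotient D \<Phi> ob T"

abbreviation pair :: "'i set \<Rightarrow> 'o \<Rightarrow> nat \<Rightarrow> 'o \<Rightarrow> 'm \<Rightarrow> 'm \<Rightarrow> 'm" where
  "pair V Y n z f g \<equiv> k_pair D Y (ob V) (tens T V Y) (pr1 T V Y) (pr2 T V Y) n z f g"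

lemmas in_hom = comp_in deg_hom_in tens_in pr1_in pr2_in ob_in inc_in

lemma tinc:
  assumes [simp]: "U \<in> \<Phi>" "V \<in> \<Phi>" "U \<le> V" "X \<in> sobj D"
  shows "tinc U V X \<in> simps (shom D (tens T U X) (tens T V X)) 0"
    and "scomp D 0 (tens T U X) (tens T V X) X (pr1 T V X) (tinc U V X) = pr1 T U X"
    and "scomp D 0 (tens T U X) (tens T V X) (ob V) (pr2 T V X) (tinc U V X) =
      scomp D 0 (tens T U X) (ob U) (ob V) (inc T U V) (pr2 T U X)"
proof -
  have f: "pr1 T U X \<in> simps (shom D (tens T U X) X) 0"
    "scomp D 0 (tens T U X) (ob U) (ob V) (inc T U V) (pr2 T U X) \<in> simps (shom D (tens T U X) (ob V)) 0"
    by (simp_all add: in_hom)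
  note p = pair_props[OF tens_product[of V X] tens_in[of U X] f]
  have [simp]: "deg (shom D (tens T V X) X) 0 (pr1 T V X) = pr1 T V X"
    "deg (shom D (tens T V X) (ob V)) 0 (pr2 T V X) = pr2 T V X"
    by (simp_all add: deg_0 hom_sset in_hom)
  show "tinc U V X \<in> simps (shom D (tens T U X) (tens T V X)) 0"
    "scomp D 0 (tens T U X) (tens T V X) X (pr1 T V X) (tinc U V X) = pr1 T U X"
    "scomp D 0 (tens T U X) (tens T V X) (ob V) (pr2 T V X) (tinc U V X) =
      scomp D 0 (tens T U X) (ob U) (ob V) (inc T U V) (pr2 T U X)"
    using p unfolding k_tens_inc_def by simp_all
qed

lemma tens_ext_0:
  assumes "V \<in> \<Phi>" "X \<in> sobj D" "z \<in> sobj D"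
    "h \<in> simps (shom D z (tens T V X)) 0" "h' \<in> simps (shom D z (tens T V X)) 0"
    "scomp D 0 z (tens T V X) X (pr1 T V X) h = scomp D 0 z (tens T V X) X (pr1 T V X) h'"
    "scomp D 0 z (tens T V X) (ob V) (pr2 T V X) h = scomp D 0 z (tens T V X) (ob V) (pr2 T V X) h'"
  shows "h = h'"
  using product_ext[OF tens_product[OF assms(1,2)] assms(3-5)] assms
  by (simp add: deg_0 hom_sset in_hom)

lemma tinc_refl: "V \<in> \<Phi> \<Longrightarrow> X \<in> sobj D \<Longrightarrow> tinc V V X = sid D (tens T V X)"
  by (rule tens_ext_0[of V X "tens T V X"])
    (simp_all add: tinc sid_in comp_id_0 id_comp_0 in_hom inc_refl)

lemma tinc_comp:
  assumes [simp]: "U \<in> \<Phi>" "V \<in> \<Phi>" "W \<in> \<Phi>" "U \<le> V" "V \<le> W" "X \<in> sobj D"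
  shows "scomp D 0 (tens T U X) (tens T V X) (tens T W X) (tinc V W X) (tinc U V X) = tinc U W X"
proof (rule tens_ext_0)
  have [simp]: "U \<le> W"
    using order_trans[of U V W] by simp
  show "scomp D 0 (tens T U X) (tens T W X) X (pr1 T W X)
     (scomp D 0 (tens T U X) (tens T V X) (tens T W X) (tinc V W X) (tinc U V X)) =
    scomp D 0 (tens T U X) (tens T W X) X (pr1 T W X) (tinc U W X)"
    by (simp add: tinc in_hom flip: comp_assoc)
  have "scomp D 0 (tens T U X) (tens T W X) (ob W) (pr2 T W X)
     (scomp D 0 (tens T U X) (tens T V X) (tens T W X) (tinc V W X) (tinc U V X)) =
    scomp D 0 (tens T U X) (tens T V X) (ob W)
      (scomp D 0 (tens T V X) (ob V) (ob W) (inc T V W) (pr2 T V X)) (tinc U V X)"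
    by (simp add: tinc(1,3) in_hom flip: comp_assoc)
  also have "\<dots> = scomp D 0 (tens T U X) (ob V) (ob W) (inc T V W)
      (scomp D 0 (tens T U X) (ob U) (ob V) (inc T U V) (pr2 T U X))"
    by (simp add: comp_assoc tinc(1,3) in_hom)
  also have "\<dots> = scomp D 0 (tens T U X) (ob U) (ob W) (inc T U W) (pr2 T U X)"
    by (simp add: in_hom inc_comp flip: comp_assoc)
  finally show "scomp D 0 (tens T U X) (tens T W X) (ob W) (pr2 T W X)
     (scomp D 0 (tens T U X) (tens T V X) (tens T W X) (tinc V W X) (tinc U V X)) =
    scomp D 0 (tens T U X) (tens T W X) (ob W) (pr2 T W X) (tinc U W X)"
    by (simp add: tinc(3))
  show "scomp D 0 (tens T U X) (tens T V X) (tens T W X) (tinc V W X) (tinc U V X)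
    \<in> simps (shom D (tens T U X) (tens T W X)) 0"
    "tinc U W X \<in> simps (shom D (tens T U X) (tens T W X)) 0"
    by (simp_all add: tinc in_hom)
qed (simp_all add: in_hom)

lemma restr_in:
  "V \<in> \<Phi> \<Longrightarrow> U \<in> \<Phi> \<Longrightarrow> U \<le> V \<Longrightarrow> X \<in> sobj D \<Longrightarrow> Y \<in> sobj D \<Longrightarrow> f \<in> simps (shom D (tens T V X) Y) n \<Longrightarrow>
    restr X Y V U n f \<in> simps (shom D (tens T U X) Y) n"
  unfolding k_restrict_def by (simp add: in_hom tinc)

lemma sset_system_hom:
  assumes [simp]: "X \<in> sobj D" "Y \<in> sobj D"
  shows "sset_system \<Phi> (\<lambda>V. shom D (tens T V X) Y) (restr X Y)"
proof (rule sset_system.intro)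
  show "is_sset (shom D (tens T V X) Y)" if "V \<in> \<Phi>" for V
    using that by (simp add: hom_sset in_hom)
  show "simplicial_map (shom D (tens T V X) Y) (shom D (tens T U X) Y) (restr X Y V U)"
    if [simp]: "V \<in> \<Phi>" "U \<in> \<Phi>" "U \<le> V" for V U
    unfolding simplicial_map_def
  proof (intro conjI allI ballI)
    fix m n \<theta> f
    assume [simp]: "\<theta> \<in> ops m n" "f \<in> simps (shom D (tens T V X) Y) n"
    show "restr X Y V U m (act (shom D (tens T V X) Y) n \<theta> f) =
        act (shom D (tens T U X) Y) n \<theta> (restr X Y V U n f)"
      unfolding k_restrict_def
      by (subst act_comp[where m = m]) (simp_all add: in_hom tinc act_deg[where m = m] hom_sset)
  qed (simp add: restr_in)
  show "directed_system \<Phi> (\<lambda>V. simps (shom D (tens T V X) Y) n) (\<lambda>V U. restr X Y V U n)" for n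
  proof (rule directed_systemI[OF filter])
    fix V U W f
    assume [simp]: "V \<in> \<Phi>" "U \<in> \<Phi>" "W \<in> \<Phi>" "W \<le> U" "U \<le> V" "f \<in> simps (shom D (tens T V X) Y) n"
    have [simp]: "W \<le> V"
      using order_trans[of W U V] by simp
    have "restr X Y U W n (restr X Y V U n f) = scomp D n (tens T W X) (tens T V X) Y f
        (deg (shom D (tens T W X) (tens T V X)) n
          (scomp D 0 (tens T W X) (tens T U X) (tens T V X) (tinc U V X) (tinc W U X)))"
      unfolding k_restrict_def
      by (subst deg_comp) (simp_all add: in_hom tinc comp_assoc)
    then show "restr X Y U W n (restr X Y V U n f) = restr X Y V W n f"
      by (simp add: tinc_comp k_restrict_def)
  next
    fix V f
    assume "V \<in> \<Phi>" "f \<in> simps (shom D (tens T V X) Y) n"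
    then show "restr X Y V V n f = f"
      unfolding k_restrict_def by (simp add: tinc_refl comp_id in_hom)
  qed (simp add: restr_in)
qed

lemma deg_pr1_tinc:
  assumes [simp]: "U \<in> \<Phi>" "V \<in> \<Phi>" "U \<le> V" "X \<in> sobj D"
  shows "scomp D n (tens T U X) (tens T V X) X (deg (shom D (tens T V X) X) n (pr1 T V X))
      (deg (shom D (tens T U X) (tens T V X)) n (tinc U V X)) = deg (shom D (tens T U X) X) n (pr1 T U X)"
    and "scomp D n (tens T U X) (tens T V X) (ob V) (deg (shom D (tens T V X) (ob V)) n (pr2 T V X))
      (deg (shom D (tens T U X) (tens T V X)) n (tinc U V X)) =
      scomp D n (tens T U X) (ob U) (ob V) (deg (shom D (ob U) (ob V)) n (inc T U V))
        (deg (shom D (tens T U X) (ob U)) n (pr2 T U X))"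
  using deg_comp[of "tens T U X" "tens T V X" X "pr1 T V X" "tinc U V X" n]
    deg_comp[of "tens T U X" "tens T V X" "ob V" "pr2 T V X" "tinc U V X" n]
    deg_comp[of "tens T U X" "ob U" "ob V" "inc T U V" "pr2 T U X" n]
  by (simp_all add: tinc in_hom)

text \<open>Composition in the co-Kleisli category of the comonad given by the product with
  \<open>ob V\<close>.\<close>

definition comp_over :: "'i set \<Rightarrow> nat \<Rightarrow> 'o \<Rightarrow> 'o \<Rightarrow> 'o \<Rightarrow> 'm \<Rightarrow> 'm \<Rightarrow> 'm" where
  "comp_over V n X Y Z g f = scomp D n (tens T V X) (tens T V Y) Z g
     (pair V Y n (tens T V X) f (deg (shom D (tens T V X) (ob V)) n (pr2 T V X)))"

lemma pair_tens:
  assumes "V \<in> \<Phi>" "X \<in> sobj D" "Y \<in> sobj D" "f \<in> simps (shom D (tens T V X) Y) n"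
  defines "h \<equiv> pair V Y n (tens T V X) f (deg (shom D (tens T V X) (ob V)) n (pr2 T V X))"
  shows "h \<in> simps (shom D (tens T V X) (tens T V Y)) n"
    and "scomp D n (tens T V X) (tens T V Y) Y (deg (shom D (tens T V Y) Y) n (pr1 T V Y)) h = f"
    and "scomp D n (tens T V X) (tens T V Y) (ob V) (deg (shom D (tens T V Y) (ob V)) n (pr2 T V Y)) h =
      deg (shom D (tens T V X) (ob V)) n (pr2 T V X)"
proof -
  have "deg (shom D (tens T V X) (ob V)) n (pr2 T V X) \<in> simps (shom D (tens T V X) (ob V)) n"
    using assms by (simp add: in_hom)
  then show "h \<in> simps (shom D (tens T V X) (tens T V Y)) n"
    "scomp D n (tens T V X) (tens T V Y) Y (deg (shom D (tens T V Y) Y) n (pr1 T V Y)) h = f"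
    "scomp D n (tens T V X) (tens T V Y) (ob V) (deg (shom D (tens T V Y) (ob V)) n (pr2 T V Y)) h =
      deg (shom D (tens T V X) (ob V)) n (pr2 T V X)"
    unfolding h_def using pair_props[OF tens_product[OF assms(1,3)] tens_in[OF assms(1,2)] assms(4)] by blast+
qed

lemma comp_over_in:
  "V \<in> \<Phi> \<Longrightarrow> X \<in> sobj D \<Longrightarrow> Y \<in> sobj D \<Longrightarrow> Z \<in> sobj D \<Longrightarrow> f \<in> simps (shom D (tens T V X) Y) n \<Longrightarrow>
    g \<in> simps (shom D (tens T V Y) Z) n \<Longrightarrow> comp_over V n X Y Z g f \<in> simps (shom D (tens T V X) Z) n"
  unfolding comp_over_def by (simp add: in_hom pair_tens)

text \<open>Both sides are \<open>g\<close> precomposed with a map X x U -> Y x V; the two maps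
  agree because their projections to \<open>Y\<close> and to \<open>ob V\<close> agree.\<close>

lemma restr_comp_over:
  assumes [simp]: "U \<in> \<Phi>" "V \<in> \<Phi>" "U \<le> V" "X \<in> sobj D" "Y \<in> sobj D" "Z \<in> sobj D"
    "f \<in> simps (shom D (tens T V X) Y) n" "g \<in> simps (shom D (tens T V Y) Z) n"
  shows "restr X Z V U n (comp_over V n X Y Z g f) =
    comp_over U n X Y Z (restr Y Z V U n g) (restr X Y V U n f)"
proof -
  let ?XU = "tens T U X" and ?XV = "tens T V X" and ?YU = "tens T U Y" and ?YV = "tens T V Y"
  define f' where "f' = restr X Y V U n f"
  define h where "h = pair V Y n ?XV f (deg (shom D ?XV (ob V)) n (pr2 T V X))"
  define h' where "h' = pair U Y n ?XU f' (deg (shom D ?XU (ob U)) n (pr2 T U X))"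
  define iX where "iX = deg (shom D ?XU ?XV) n (tinc U V X)"
  define iY where "iY = deg (shom D ?YU ?YV) n (tinc U V Y)"
  have [simp]: "f' \<in> simps (shom D ?XU Y) n"
    unfolding f'_def by (simp add: restr_in)
  note h = pair_tens[of V X Y f n, folded h_def] and h' = pair_tens[of U X Y f' n, folded h'_def]
  have [simp]: "iX \<in> simps (shom D ?XU ?XV) n" "iY \<in> simps (shom D ?YU ?YV) n"
    unfolding iX_def iY_def by (simp_all add: in_hom tinc)
  have [simp]: "h \<in> simps (shom D ?XV ?YV) n" "h' \<in> simps (shom D ?XU ?YU) n"
    using h(1) h'(1) by simp_all
  have "scomp D n ?XU ?XV ?YV h iX = scomp D n ?XU ?YU ?YV iY h'"
  proof (rule product_ext[OF tens_product[of V Y]])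
    have "scomp D n ?XU ?YV Y (deg (shom D ?YV Y) n (pr1 T V Y)) (scomp D n ?XU ?XV ?YV h iX) = f'"
      using h(2) by (simp add: in_hom f'_def iX_def k_restrict_def tinc flip: comp_assoc)
    moreover have "scomp D n ?XU ?YV Y (deg (shom D ?YV Y) n (pr1 T V Y)) (scomp D n ?XU ?YU ?YV iY h') = f'"
      using h'(2) deg_pr1_tinc(1)[of U V Y n, folded iY_def] by (simp add: in_hom flip: comp_assoc)
    ultimately show "scomp D n ?XU ?YV Y (deg (shom D ?YV Y) n (pr1 T V Y)) (scomp D n ?XU ?XV ?YV h iX) =
      scomp D n ?XU ?YV Y (deg (shom D ?YV Y) n (pr1 T V Y)) (scomp D n ?XU ?YU ?YV iY h')"
      by simp
    let ?inc = "scomp D n ?XU (ob U) (ob V) (deg (shom D (ob U) (ob V)) n (inc T U V))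
        (deg (shom D ?XU (ob U)) n (pr2 T U X))"
    have "scomp D n ?XU ?YV (ob V) (deg (shom D ?YV (ob V)) n (pr2 T V Y)) (scomp D n ?XU ?XV ?YV h iX) = ?inc"
      using h(3) deg_pr1_tinc(2)[of U V X n, folded iX_def] by (simp add: in_hom flip: comp_assoc)
    moreover have "scomp D n ?XU ?YV (ob V) (deg (shom D ?YV (ob V)) n (pr2 T V Y)) (scomp D n ?XU ?YU ?YV iY h') =
        scomp D n ?XU ?YU (ob V) (scomp D n ?YU ?YV (ob V) (deg (shom D ?YV (ob V)) n (pr2 T V Y)) iY) h'"
      by (simp add: in_hom comp_assoc)
    moreover have "\<dots> = ?inc"
      unfolding deg_pr1_tinc(2)[of U V Y n, folded iY_def, simplified]
      using h'(3) by (simp add: in_hom comp_assoc)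
    ultimately show "scomp D n ?XU ?YV (ob V) (deg (shom D ?YV (ob V)) n (pr2 T V Y)) (scomp D n ?XU ?XV ?YV h iX) =
      scomp D n ?XU ?YV (ob V) (deg (shom D ?YV (ob V)) n (pr2 T V Y)) (scomp D n ?XU ?YU ?YV iY h')"
      by simp
  qed (simp_all add: in_hom)
  then have "scomp D n ?XU ?XV Z (scomp D n ?XV ?YV Z g h) iX = scomp D n ?XU ?YU Z (scomp D n ?YU ?YV Z g iY) h'"
    by (simp add: comp_assoc in_hom)
  then show ?thesis
    unfolding comp_over_def k_restrict_def h_def h'_def f'_def iX_def iY_def .
qed

text \<open>Composition in the quotient chooses a common stage for two germs. Compatibility with
  restriction makes the result independent of that stage, so representatives compose stage by
  stage.\<close>

lemma rep_comp:
  assumes [simp]: "X \<in> sobj D" "Y \<in> sobj D" "Z \<in> sobj D"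
    and F: "sset_system.rep_n \<Phi> (\<lambda>V. shom D (tens T V X) Y) (restr X Y) n F f"
    and G: "sset_system.rep_n \<Phi> (\<lambda>V. shom D (tens T V Y) Z) (restr Y Z) n G g"
  shows "sset_system.rep_n \<Phi> (\<lambda>V. shom D (tens T V X) Z) (restr X Z) n (scomp Q n X Y Z G F)
    (\<lambda>V. comp_over V n X Y Z (g V) (f V))"
proof -
  interpret XY: sset_system \<Phi> "\<lambda>V. shom D (tens T V X) Y" "restr X Y"
    by (rule sset_system_hom) simp_all
  interpret YZ: sset_system \<Phi> "\<lambda>V. shom D (tens T V Y) Z" "restr Y Z"
    by (rule sset_system_hom) simp_all
  interpret XZ: sset_system \<Phi> "\<lambda>V. shom D (tens T V X) Z" "restr X Z"
    by (rule sset_system_hom) simp_all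
  note XYs = XY.system[of n] and YZs = YZ.system[of n] and XZs = XZ.system[of n]
  obtain V where "V \<in> \<Phi>" and ev: "\<forall>W\<in>\<Phi>. W \<le> V \<longrightarrow>
      (W \<in> \<Phi> \<and> f W \<in> simps (shom D (tens T W X) Y) n \<and> F = XY.germ_n n W (f W) \<and>
        (\<forall>U\<in>\<Phi>. U \<le> W \<longrightarrow> f U = restr X Y W U n (f W))) \<and>
      (W \<in> \<Phi> \<and> g W \<in> simps (shom D (tens T W Y) Z) n \<and> G = YZ.germ_n n W (g W) \<and>
        (\<forall>U\<in>\<Phi>. U \<le> W \<longrightarrow> g U = restr Y Z W U n (g W)))"
    using eventually_conj[OF directed_system.rep_coherent[OF XYs F] directed_system.rep_coherent[OF YZs G]]
    unfolding directed_system.eventually_below[OF XYs] by (elim bexE)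
  then have V: "V \<in> \<Phi>" "f V \<in> simps (shom D (tens T V X) Y) n"
    "g V \<in> simps (shom D (tens T V Y) Z) n" "F = XY.germ_n n V (f V)" "G = YZ.germ_n n V (g V)"
    "\<forall>W\<in>\<Phi>. W \<le> V \<longrightarrow> f W = restr X Y V W n (f V)" "\<forall>W\<in>\<Phi>. W \<le> V \<longrightarrow> g W = restr Y Z V W n (g V)"
    using mp[OF bspec[OF ev \<open>V \<in> \<Phi>\<close>] order_refl] by blast+
  define H where "H = XZ.germ_n n V (comp_over V n X Y Z (g V) (f V))"
  have rep: "XZ.rep_n n H (\<lambda>V. comp_over V n X Y Z (g V) (f V))"
    unfolding directed_system.rep_def[OF XZs]
  proof (intro bexI[OF _ V(1)] conjI ballI impI)
    show "comp_over V n X Y Z (g V) (f V) \<in> simps (shom D (tens T V X) Z) n"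
      using V(1-3) by (simp add: comp_over_in)
    show "H = XZ.germ_n n V (comp_over V n X Y Z (g V) (f V))"
      by (rule H_def)
    fix W
    assume W: "W \<in> \<Phi>" "W \<le> V"
    have fW: "f W = restr X Y V W n (f V)" "g W = restr Y Z V W n (g V)"
      using V(6,7) W by blast+
    show "comp_over W n X Y Z (g W) (f W) = restr X Z V W n (comp_over V n X Y Z (g V) (f V))"
      unfolding fW by (rule restr_comp_over[symmetric]) (use V(1-3) W in simp_all)
  qed
  have FG: "F \<in> germs \<Phi> (\<lambda>V. simps (shom D (tens T V X) Y) n) (\<lambda>V U. restr X Y V U n)"
    "G \<in> germs \<Phi> (\<lambda>V. simps (shom D (tens T V Y) Z) n) (\<lambda>V U. restr Y Z V U n)"
    by (rule directed_system.rep_in_germs[OF XYs F], rule directed_system.rep_in_germs[OF YZs G])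
  let ?Q = "\<lambda>H. \<exists>V\<in>\<Phi>. \<exists>f g. (V, f) \<in> F \<and> (V, g) \<in> G \<and> H = XZ.germ_n n V (comp_over V n X Y Z g f)"
  have "(THE H. ?Q H) = H"
  proof (rule the_equality)
    have "(V, f V) \<in> F" "(V, g V) \<in> G"
      using directed_system.germ_mem_iff[OF XYs FG(1), of V "f V"]
        directed_system.germ_mem_iff[OF YZs FG(2), of V "g V"] V(1-5) by simp_all
    then show "?Q H"
      unfolding H_def using V(1) by blast
  next
    fix H'
    assume "?Q H'"
    then obtain U f' g' where U: "U \<in> \<Phi>" "(U, f') \<in> F" "(U, g') \<in> G"
      and H': "H' = XZ.germ_n n U (comp_over U n X Y Z g' f')"
      by blast
    have f': "f' \<in> simps (shom D (tens T U X) Y) n" "F = XY.germ_n n U f'"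
      and g': "g' \<in> simps (shom D (tens T U Y) Z) n" "G = YZ.germ_n n U g'"
      using U(2,3) directed_system.germ_mem_iff[OF XYs FG(1), of U f']
        directed_system.germ_mem_iff[OF YZs FG(2), of U g'] by simp_all
    have "XY.rep_n n F (\<lambda>W. restr X Y U W n f')"
      unfolding f'(2) by (rule directed_system.rep_germ[OF XYs U(1) f'(1)])
    note ev_f = directed_system.rep_unique[OF XYs this F]
    have "YZ.rep_n n G (\<lambda>W. restr Y Z U W n g')"
      unfolding g'(2) by (rule directed_system.rep_germ[OF YZs U(1) g'(1)])
    note ev_g = directed_system.rep_unique[OF YZs this G]
    have c: "comp_over U n X Y Z g' f' \<in> simps (shom D (tens T U X) Z) n"
      using U(1) f'(1) g'(1) by (simp add: comp_over_in)
    show "H' = H"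
      unfolding H'
    proof (rule directed_system.rep_eqI[OF XZs directed_system.rep_germ[OF XZs U(1) c] rep, symmetric, THEN sym])
      show "\<forall>\<^sub>F W in below \<Phi>. restr X Z U W n (comp_over U n X Y Z g' f') = comp_over W n X Y Z (g W) (f W)"
        using ev_f ev_g directed_system.eventually_ge[OF XYs U(1)]
      proof eventually_elim
        case (elim W)
        then show ?case
          using restr_comp_over[of W U X Y Z f' n g'] U(1) f'(1) g'(1) by simp
      qed
    qed
  qed
  then have "scomp Q n X Y Z G F = H"
    unfolding k_filter_quotient_def scat.simps comp_over_def k_germ_def .
  then show ?thesis
    using rep by simp
qed

lemma rep_sid:
  assumes [simp]: "X \<in> sobj D"
  shows "sset_system.rep_n \<Phi> (\<lambda>V. shom D (tens T V X) X) (restr X X) 0 (sid Q X) (\<lambda>V. pr1 T V X)"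
proof -
  interpret sset_system \<Phi> "\<lambda>V. shom D (tens T V X) X" "restr X X"
    by (rule sset_system_hom) simp_all
  have restr: "restr X X V W 0 (pr1 T V X) = pr1 T W X" if "V \<in> \<Phi>" "W \<in> \<Phi>" "W \<le> V" for V W
    unfolding k_restrict_def using that by (simp add: deg_0 hom_sset in_hom tinc)
  obtain V where V: "V \<in> \<Phi>"
    using filter unfolding product_closed_filter_def by auto
  define H where "H = germ_n 0 V (pr1 T V X)"
  have rep: "rep_n 0 H (\<lambda>V. pr1 T V X)"
    unfolding directed_system.rep_def[OF system] H_def
    using restr[OF V] V by (intro bexI[OF _ V]) (simp add: in_hom)
  have "(THE H. \<exists>V\<in>\<Phi>. H = germ_n 0 V (pr1 T V X)) = H"
  proof (rule the_equality)
    show "\<exists>V\<in>\<Phi>. H = germ_n 0 V (pr1 T V X)"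
      unfolding H_def using V by blast
    fix H'
    assume "\<exists>V\<in>\<Phi>. H' = germ_n 0 V (pr1 T V X)"
    then obtain U where U: "U \<in> \<Phi>" "H' = germ_n 0 U (pr1 T U X)"
      by blast
    have "rep_n 0 H' (\<lambda>V. pr1 T V X)"
      unfolding directed_system.rep_def[OF system] U(2)
      using U(1) restr[OF U(1)] by (intro bexI[OF _ U(1)]) (simp add: in_hom)
    then show "H' = H"
      using directed_system.rep_eqI[OF system _ rep] by simp
  qed
  then have "sid Q X = H"
    unfolding k_filter_quotient_def scat.simps k_germ_def .
  then show ?thesis
    using rep by simp
qed

lemma rep_canonical:
  assumes [simp]: "X \<in> sobj D" "Y \<in> sobj D" "tp \<in> \<Phi>" and [simp]: "f \<in> simps (shom D X Y) 0"
    and tp: "\<And>V. V \<in> \<Phi> \<Longrightarrow> V \<le> tp"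
  shows "sset_system.rep_n \<Phi> (\<lambda>V. shom D (tens T V X) Y) (restr X Y) 0 (k_canonical D \<Phi> ob T tp X Y f)
    (\<lambda>V. scomp D 0 (tens T V X) X Y f (pr1 T V X))"
proof -
  interpret sset_system \<Phi> "\<lambda>V. shom D (tens T V X) Y" "restr X Y"
    by (rule sset_system_hom) simp_all
  have restr: "scomp D 0 (tens T W X) X Y f (pr1 T W X) =
      restr X Y tp W 0 (scomp D 0 (tens T tp X) X Y f (pr1 T tp X))" if "W \<in> \<Phi>" for W
    unfolding k_restrict_def using that tp by (simp add: deg_0 hom_sset in_hom tinc comp_assoc)
  show ?thesis
    unfolding directed_system.rep_def[OF system] k_canonical_def k_germ_def
  proof (intro bexI[of _ tp] conjI ballI impI)
    show "scomp D 0 (tens T tp X) X Y f (pr1 T tp X) \<in> simps (shom D (tens T tp X) Y) 0"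
      by (simp add: in_hom)
  qed (rule refl restr | simp)+
qed

text \<open>A candidate inverse is one germ and the two homotopies are paths in colimits, so all
  three live at one stage. Conversely, the relations at a stage persist at all lower ones, hence
  hold for the germs.\<close>

lemma k_equiv_quotient_iff:
  assumes [simp]: "X \<in> sobj D" "Y \<in> sobj D" "tp \<in> \<Phi>" "f \<in> simps (shom D X Y) 0"
    and tp: "\<And>V. V \<in> \<Phi> \<Longrightarrow> V \<le> tp"
  defines "f\<^sub>V \<equiv> \<lambda>V. scomp D 0 (tens T V X) X Y f (pr1 T V X)"
  shows "k_equiv Q X Y (k_canonical D \<Phi> ob T tp X Y f) \<longleftrightarrow>
    (\<exists>V\<in>\<Phi>. \<exists>g\<in>simps (shom D (tens T V Y) X) 0.
      same_component (shom D (tens T V X) X) (comp_over V 0 X Y X g (f\<^sub>V V)) (pr1 T V X) \<and>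
      same_component (shom D (tens T V Y) Y) (comp_over V 0 Y X Y (f\<^sub>V V) g) (pr1 T V Y))"
    (is "?L \<longleftrightarrow> ?R")
proof -
  let ?f = "k_canonical D \<Phi> ob T tp X Y f"
  interpret XX: sset_system \<Phi> "\<lambda>V. shom D (tens T V X) X" "restr X X"
    by (rule sset_system_hom) simp_all
  interpret YY: sset_system \<Phi> "\<lambda>V. shom D (tens T V Y) Y" "restr Y Y"
    by (rule sset_system_hom) simp_all
  interpret XY: sset_system \<Phi> "\<lambda>V. shom D (tens T V X) Y" "restr X Y"
    by (rule sset_system_hom) simp_all
  interpret YX: sset_system \<Phi> "\<lambda>V. shom D (tens T V Y) X" "restr Y X"
    by (rule sset_system_hom) simp_all
  have hom: "shom Q X X = XX.colim" "shom Q Y Y = YY.colim" "shom Q X Y = XY.colim" "shom Q Y X = YX.colim"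
    by (simp_all add: k_filter_quotient_def)
  have f: "XY.rep_n 0 ?f f\<^sub>V"
    unfolding f\<^sub>V_def by (rule rep_canonical) (use tp in simp_all)
  have f_in: "?f \<in> simps (shom Q X Y) 0"
    unfolding hom XY.simps_colim by (rule directed_system.rep_in_germs[OF XY.system f])
  show ?thesis
  proof
    assume ?L
    then obtain G where G: "G \<in> simps (shom Q Y X) 0"
      "same_component (shom Q X X) (scomp Q 0 X Y X G ?f) (sid Q X)"
      "same_component (shom Q Y Y) (scomp Q 0 Y X Y ?f G) (sid Q Y)"
      unfolding k_equiv_def by blast
    obtain g where g: "YX.rep_n 0 G g"
      using G(1) directed_system.rep_exists[OF YX.system] unfolding hom YX.simps_colim by metis
    have "\<forall>\<^sub>F V in below \<Phi>. same_component (shom D (tens T V X) X) (comp_over V 0 X Y X (g V) (f\<^sub>V V)) (pr1 T V X)"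
      using XX.same_component_colim_iff[OF rep_comp[OF _ _ _ f g] rep_sid] G(2) unfolding hom by simp
    moreover have "\<forall>\<^sub>F V in below \<Phi>. same_component (shom D (tens T V Y) Y) (comp_over V 0 Y X Y (f\<^sub>V V) (g V)) (pr1 T V Y)"
      using YY.same_component_colim_iff[OF rep_comp[OF _ _ _ g f] rep_sid] G(3) unfolding hom by simp
    moreover have "\<forall>\<^sub>F V in below \<Phi>. V \<in> \<Phi> \<and> g V \<in> simps (shom D (tens T V Y) X) 0 \<and> G = YX.germ_n 0 V (g V)"
      by (rule directed_system.rep_eventually[OF YX.system g])
    ultimately have "\<forall>\<^sub>F V in below \<Phi>. V \<in> \<Phi> \<and> g V \<in> simps (shom D (tens T V Y) X) 0 \<and>
        same_component (shom D (tens T V X) X) (comp_over V 0 X Y X (g V) (f\<^sub>V V)) (pr1 T V X) \<and>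
        same_component (shom D (tens T V Y) Y) (comp_over V 0 Y X Y (f\<^sub>V V) (g V)) (pr1 T V Y)"
      by eventually_elim simp
    then show ?R
      unfolding directed_system.eventually_below[OF XX.system] using order_refl by blast
  next
    assume ?R
    then obtain V g where V: "V \<in> \<Phi>" and g: "g \<in> simps (shom D (tens T V Y) X) 0"
      and gf: "same_component (shom D (tens T V X) X) (comp_over V 0 X Y X g (f\<^sub>V V)) (pr1 T V X)"
      and fg: "same_component (shom D (tens T V Y) Y) (comp_over V 0 Y X Y (f\<^sub>V V) g) (pr1 T V Y)"
      by blast
    define G where "G = YX.germ_n 0 V g"
    define g' where "g' = (\<lambda>W. restr Y X V W 0 g)"
    have G: "YX.rep_n 0 G g'"
      unfolding G_def g'_def by (rule directed_system.rep_germ[OF YX.system V g])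
    have G_in: "G \<in> simps (shom Q Y X) 0"
      unfolding hom YX.simps_colim by (rule directed_system.rep_in_germs[OF YX.system G])
    have f\<^sub>V: "f\<^sub>V W \<in> simps (shom D (tens T W X) Y) 0" "W \<le> V \<Longrightarrow> restr X Y V W 0 (f\<^sub>V V) = f\<^sub>V W" if "W \<in> \<Phi>" for W
      unfolding f\<^sub>V_def k_restrict_def using that V by (simp_all add: in_hom deg_0 hom_sset tinc comp_assoc)
    have pr: "restr X X V W 0 (pr1 T V X) = pr1 T W X" "restr Y Y V W 0 (pr1 T V Y) = pr1 T W Y"
      if "W \<in> \<Phi>" "W \<le> V" for W
      unfolding k_restrict_def using that V by (simp_all add: in_hom deg_0 hom_sset tinc)
    have "same_component (shom D (tens T W X) X) (comp_over W 0 X Y X (g' W) (f\<^sub>V W)) (pr1 T W X)"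
      if W: "W \<in> \<Phi>" "W \<le> V" for W
      using same_component_simplicial_map[OF XX.simplicial[OF V W] gf] restr_comp_over[OF W(1) V W(2) _ _ _ f\<^sub>V(1)[OF V] g]
        f\<^sub>V(2)[OF W] pr(1)[OF W] by (simp add: g'_def)
    moreover have "same_component (shom D (tens T W Y) Y) (comp_over W 0 Y X Y (f\<^sub>V W) (g' W)) (pr1 T W Y)"
      if W: "W \<in> \<Phi>" "W \<le> V" for W
      using same_component_simplicial_map[OF YY.simplicial[OF V W] fg] restr_comp_over[OF W(1) V W(2) _ _ _ g f\<^sub>V(1)[OF V]]
        f\<^sub>V(2)[OF W] pr(2)[OF W] by (simp add: g'_def)
    ultimately have
      "\<forall>\<^sub>F W in below \<Phi>. same_component (shom D (tens T W X) X) (comp_over W 0 X Y X (g' W) (f\<^sub>V W)) (pr1 T W X)"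
      "\<forall>\<^sub>F W in below \<Phi>. same_component (shom D (tens T W Y) Y) (comp_over W 0 Y X Y (f\<^sub>V W) (g' W)) (pr1 T W Y)"
      unfolding directed_system.eventually_below[OF XX.system] using V by blast+
    then show ?L
      unfolding k_equiv_def
      using f_in G_in XX.same_component_colim_iff[OF rep_comp[OF _ _ _ f G] rep_sid]
        YY.same_component_colim_iff[OF rep_comp[OF _ _ _ G f] rep_sid]
      unfolding hom by (intro conjI bexI[of _ G]) simp_all
  qed
qed

end

section \<open>Kan enriched categories as weak categories\<close>

text \<open>Arrows carry their source and target, which turns the family of mapping spaces into a
  single set of arrows as \<open>weak_category\<close> expects.\<close>

definition k_edges :: "('o, 'm) scat \<Rightarrow> ('o \<times> 'o \<times> 'm) set" where
  "k_edges C = {(x, y, f). x \<in> sobj C \<and> y \<in> sobj C \<and> f \<in> simps (shom C x y) 0}"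

definition k_tri :: "('o, 'm) scat \<Rightarrow> 'o \<times> 'o \<times> 'm \<Rightarrow> 'o \<times> 'o \<times> 'm \<Rightarrow> 'o \<times> 'o \<times> 'm \<Rightarrow> bool" where
  "k_tri C = (\<lambda>(x, y, f) (y', z, g) (x', z', h). y' = y \<and> x' = x \<and> z' = z \<and>
     (x, y, f) \<in> k_edges C \<and> (y, z, g) \<in> k_edges C \<and> (x, z, h) \<in> k_edges C \<and>
     same_component (shom C x z) (scomp C 0 x y z g f) h)"

abbreviation "k_src \<equiv> (\<lambda>(x, y, f). x)"
abbreviation "k_tgt \<equiv> (\<lambda>(x, y, f). y)"
abbreviation "k_ident C \<equiv> (\<lambda>x. (x, x, sid C x))"

lemma same_component_comp:
  assumes "enriched_category C" and [simp]: "x \<in> sobj C" "y \<in> sobj C" "z \<in> sobj C"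
    and f: "same_component (shom C x y) f f'" and g: "same_component (shom C y z) g g'"
  shows "same_component (shom C x z) (scomp C 0 x y z g f) (scomp C 0 x y z g' f')"
proof -
  interpret enriched_category C
    by (rule assms(1))
  obtain v where v: "v \<in> simps (shom C x y) 1" "act (shom C x y) 1 [0] v = f" "act (shom C x y) 1 [1] v = f'"
    using f unfolding same_component_def by blast
  obtain w where w: "w \<in> simps (shom C y z) 1" "act (shom C y z) 1 [0] w = g" "act (shom C y z) 1 [1] w = g'"
    using g unfolding same_component_def by blast
  have "[0] \<in> ops 0 1" "[1] \<in> ops 0 1"
    by (simp_all add: ops_iff)
  then show ?thesis
    unfolding same_component_def
    using act_comp[of x y z w 1 v _ 0] comp_in[of x y z w 1 v] v w
    by (intro bexI[of _ "scomp C 1 x y z w v"]) (simp_all del: One_nat_def)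
qed

text \<open>A triangle only records the component of the composite. Strict associativity puts the
  composites of \<open>h\<close> with \<open>a\<close> and of \<open>b\<close> with \<open>f\<close>
  into one component, which gives both associativity axioms at once.\<close>

lemma weak_category_kan_enriched:
  assumes C: "kan_enriched C"
  shows "weak_category (k_edges C) k_src k_tgt (k_ident C) (k_tri C)"
proof -
  interpret enriched_category C
    by (rule enriched_if_kan_enriched[OF C])
  have kan: "kan_complex (shom C x y)" if "x \<in> sobj C" "y \<in> sobj C" for x y
    using C that unfolding kan_enriched_def by blast
  note refl = same_component_refl[OF hom_sset]
  note cong = same_component_comp[OF enriched_category_axioms]
  note sym = same_component_sym[OF kan] and trans = same_component_trans[OF kan]
  show ?thesis
  proof
    show "f \<in> k_edges C \<and> g \<in> k_edges C \<and> h \<in> k_edges C \<and> k_tgt f = k_src g \<and> k_src h = k_src f \<and> k_tgt h = k_tgt g"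
      if "k_tri C f g h" for f g h
      using that unfolding k_tri_def by (auto split: prod.splits)
    show "\<exists>h. k_tri C f g h" if fg: "f \<in> k_edges C" "g \<in> k_edges C" "k_tgt f = k_src g" for f g
    proof -
      obtain x y a z b where *: "f = (x, y, a)" "g = (y, z, b)"
        using fg(3) by (cases f, cases g) auto
      show ?thesis
        using fg unfolding *
        by (intro exI[of _ "(x, z, scomp C 0 x y z b a)"]) (auto simp: k_tri_def k_edges_def comp_in refl)
    qed
    show "k_tri C (k_ident C (k_src f)) f f" "k_tri C f (k_ident C (k_tgt f)) f" if "f \<in> k_edges C" for f
      using that by (auto simp: k_tri_def k_edges_def sid_in comp_id_0 id_comp_0 refl)
  next
    fix f g a h b c
    assume t: "k_tri C f g a" "k_tri C g h b"
    obtain w x y z f' g' h' a' b' where *: "f = (w, x, f')" "g = (x, y, g')" "h = (y, z, h')" "a = (w, y, a')"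
      "b = (x, z, b')"
      using t unfolding k_tri_def by (auto split: prod.splits)
    have [simp]: "w \<in> sobj C" "x \<in> sobj C" "y \<in> sobj C" "z \<in> sobj C"
      and e: "f' \<in> simps (shom C w x) 0" "g' \<in> simps (shom C x y) 0" "h' \<in> simps (shom C y z) 0"
      "a' \<in> simps (shom C w y) 0" "b' \<in> simps (shom C x z) 0"
      and s: "same_component (shom C w y) (scomp C 0 w x y g' f') a'"
      "same_component (shom C x z) (scomp C 0 x y z h' g') b'"
      using t unfolding * k_tri_def k_edges_def by auto
    have "same_component (shom C w z) (scomp C 0 w y z h' (scomp C 0 w x y g' f')) (scomp C 0 w y z h' a')"
      using e s by (intro cong refl) auto
    moreover have "same_component (shom C w z) (scomp C 0 w x z (scomp C 0 x y z h' g') f') (scomp C 0 w x z b' f')"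
      using e s by (intro cong refl) auto
    ultimately have "same_component (shom C w z) (scomp C 0 w y z h' a') (scomp C 0 w x z b' f')"
      using e by (simp add: comp_assoc) (meson \<open>w \<in> sobj C\<close> \<open>z \<in> sobj C\<close> sym trans)
    note hc = this sym[OF _ _ this, simplified]
    have "k_tri C a h c \<longleftrightarrow> k_tri C f b c"
    proof (cases c)
      case (fields u v c')
      have "same_component (shom C w z) (scomp C 0 w y z h' a') c' \<longleftrightarrow>
          same_component (shom C w z) (scomp C 0 w x z b' f') c'"
        using hc trans[OF \<open>w \<in> sobj C\<close> \<open>z \<in> sobj C\<close>] by blast
      then show ?thesis
        unfolding fields * k_tri_def k_edges_def using e by auto
    qed
    then show "k_tri C f b c \<Longrightarrow> k_tri C a h c" "k_tri C a h c \<Longrightarrow> k_tri C f b c"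
      by blast+
  qed
qed

lemma k_equiv_iff:
  assumes C: "kan_enriched C" and [simp]: "x \<in> sobj C" "y \<in> sobj C"
  shows "weak_category.equivalence k_src k_tgt (k_ident C) (k_tri C) (x, y, f) \<longleftrightarrow> k_equiv C x y f"
proof -
  interpret enriched_category C
    by (rule enriched_if_kan_enriched[OF C])
  interpret weak_category "k_edges C" k_src k_tgt "k_ident C" "k_tri C"
    by (rule weak_category_kan_enriched[OF C])
  show ?thesis
    unfolding equivalence_def
    unfolding k_equiv_def k_tri_def
    by (auto simp: k_edges_def sid_in split: prod.splits)
qed

section \<open>Products of enriched categories\<close>

lemma k_product_component:
  assumes C: "enriched_category C" and P: "k_product (k_power I C) X Y P A B" and i: "i \<in> I"
    and X: "X \<in> sobj (k_power I C)" "Y \<in> sobj (k_power I C)"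
  shows "k_product C (X i) (Y i) (P i) (A i) (B i)"
proof -
  interpret enriched_category C
    by (rule C)
  interpret D: enriched_category "k_power I C"
    by (rule enriched_k_power[OF C])
  note p = D.product_projections[OF P]
  have j [simp]: "X j \<in> sobj C" "Y j \<in> sobj C" "P j \<in> sobj C"
    "A j \<in> simps (shom C (P j) (X j)) 0" "B j \<in> simps (shom C (P j) (Y j)) 0" if "j \<in> I" for j
    using that p X by auto
  have "bij_betw (\<lambda>h. (scomp C n z (P i) (X i) (deg (shom C (P i) (X i)) n (A i)) h,
        scomp C n z (P i) (Y i) (deg (shom C (P i) (Y i)) n (B i)) h))
      (simps (shom C z (P i)) n) (simps (shom C z (X i)) n \<times> simps (shom C z (Y i)) n)"
    if z [simp]: "z \<in> sobj C" for z n
  proof -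
    \<comment> \<open>The test object is \<open>z\<close> at \<open>i\<close> and the product itself
      elsewhere, where the maps are identities. So at the other indices the composites with the
      projections are \<open>A j\<close> and \<open>B j\<close>, whatever the map at
      \<open>i\<close> is.\<close>
    define Z where "Z = (\<lambda>j\<in>I. if j = i then z else P j)"
    define ext where "ext = (\<lambda>h. \<lambda>j\<in>I. if j = i then h else deg (shom C (P j) (P j)) n (sid C (P j)))"
    have Z: "Z \<in> sobj (k_power I C)"
      by (auto simp: Z_def)
    have Zi [simp]: "Z i = z"
      using i by (simp add: Z_def)
    have ext_in: "ext h \<in> simps (shom (k_power I C) Z P) n" if "h \<in> simps (shom C z (P i)) n" for h
      using that by (auto simp: ext_def Z_def deg_hom_in sid_in)
    have ext_comp: "scomp (k_power I C) n Z P X (deg (shom (k_power I C) P X) n A) (ext h) =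
          (\<lambda>j\<in>I. if j = i then scomp C n z (P i) (X i) (deg (shom C (P i) (X i)) n (A i)) h
            else deg (shom C (P j) (X j)) n (A j))"
      "scomp (k_power I C) n Z P Y (deg (shom (k_power I C) P Y) n B) (ext h) =
          (\<lambda>j\<in>I. if j = i then scomp C n z (P i) (Y i) (deg (shom C (P i) (Y i)) n (B i)) h
            else deg (shom C (P j) (Y j)) n (B j))" for h
      by (auto simp: fun_eq_iff ext_def Z_def deg_prod_sset comp_id deg_hom_in)
    show ?thesis
      unfolding bij_betw_def
    proof (intro conjI inj_onI equalityI subsetI)
      fix h h'
      assume h: "h \<in> simps (shom C z (P i)) n" "h' \<in> simps (shom C z (P i)) n"
        "(scomp C n z (P i) (X i) (deg (shom C (P i) (X i)) n (A i)) h,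
          scomp C n z (P i) (Y i) (deg (shom C (P i) (Y i)) n (B i)) h) =
         (scomp C n z (P i) (X i) (deg (shom C (P i) (X i)) n (A i)) h',
          scomp C n z (P i) (Y i) (deg (shom C (P i) (Y i)) n (B i)) h')"
      have "ext h = ext h'"
        by (rule D.product_ext[OF P Z ext_in[OF h(1)] ext_in[OF h(2)]])
          (unfold ext_comp, use h(3) in \<open>simp_all cong: restrict_cong if_cong\<close>)
      then have "ext h i = ext h' i"
        by simp
      then show "h = h'"
        using i by (simp add: ext_def)
    next
      fix q
      assume "q \<in> (\<lambda>h. (scomp C n z (P i) (X i) (deg (shom C (P i) (X i)) n (A i)) h,
        scomp C n z (P i) (Y i) (deg (shom C (P i) (Y i)) n (B i)) h)) ` (simps (shom C z (P i)) n)"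
      then show "q \<in> simps (shom C z (X i)) n \<times> simps (shom C z (Y i)) n"
        using i by (auto simp: comp_in deg_hom_in)
    next
      fix q
      assume "q \<in> simps (shom C z (X i)) n \<times> simps (shom C z (Y i)) n"
      then obtain f g where q: "q = (f, g)" "f \<in> simps (shom C z (X i)) n" "g \<in> simps (shom C z (Y i)) n"
        by blast
      define F where "F = (\<lambda>j\<in>I. if j = i then f else deg (shom C (P j) (X j)) n (A j))"
      define G where "G = (\<lambda>j\<in>I. if j = i then g else deg (shom C (P j) (Y j)) n (B j))"
      have FG: "F \<in> simps (shom (k_power I C) Z X) n" "G \<in> simps (shom (k_power I C) Z Y) n"
        using q by (auto simp: F_def G_def Z_def deg_hom_in)
      note pp = D.pair_props[OF P Z FG]
      define h where "h = k_pair (k_power I C) X Y P A B n Z F G i"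
      have "h \<in> simps (shom C z (P i)) n"
        using PiE_mem[OF pp(1)[unfolded simps_k_power simps_prod_sset] i] by (simp add: h_def)
      moreover have "scomp C n z (P i) (X i) (deg (shom C (P i) (X i)) n (A i)) h = f"
        using fun_cong[OF pp(2), of i] i by (simp add: h_def F_def deg_prod_sset)
      moreover have "scomp C n z (P i) (Y i) (deg (shom C (P i) (Y i)) n (B i)) h = g"
        using fun_cong[OF pp(3), of i] i by (simp add: h_def G_def deg_prod_sset)
      ultimately show "q \<in> (\<lambda>h. (scomp C n z (P i) (X i) (deg (shom C (P i) (X i)) n (A i)) h,
        scomp C n z (P i) (Y i) (deg (shom C (P i) (Y i)) n (B i)) h)) ` (simps (shom C z (P i)) n)"
        unfolding q(1) by force
    qed
  qed
  then show ?thesis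
    unfolding k_product_def using i by simp
qed

text \<open>The section h = (identity, k) satisfies a h = identity strictly. For h a, the first
  coordinate a h a equals \<open>a\<close>, and the second is joined to \<open>b\<close> by a path
  because Map(p, one) is contractible; pairing in dimension 1 turns this into a path from h a to the
  identity.\<close>

lemma k_equiv_projection:
  assumes C: "kan_enriched C" and x [simp]: "x \<in> sobj C" and one: "k_terminal C one"
    and P: "k_product C x one p a b"
  shows "k_equiv C p x a"
proof -
  interpret enriched_category C
    by (rule enriched_if_kan_enriched[OF C])
  note p [simp] = product_projections[OF P]
  have [simp]: "one \<in> sobj C" and contr: "\<And>z. z \<in> sobj C \<Longrightarrow> contractible_sset (shom C z one)"
    using one unfolding k_terminal_def by blast+
  have d0: "deg (shom C p x) 0 a = a" "deg (shom C p one) 0 b = b"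
    by (simp_all add: deg_0 hom_sset)
  obtain k where k: "k \<in> simps (shom C x one) 0"
    using contr[of x] unfolding contractible_sset_def by auto
  define h where "h = k_pair C x one p a b 0 x (sid C x) k"
  have h: "h \<in> simps (shom C x p) 0" "scomp C 0 x p x a h = sid C x" "scomp C 0 x p one b h = k"
    unfolding h_def using pair_props[OF P x sid_in[OF x] k] d0 by simp_all
  define ha where "ha = scomp C 0 p x p h a"
  have ha: "ha \<in> simps (shom C p p) 0" "scomp C 0 p p x a ha = a"
    unfolding ha_def using h by (simp_all add: comp_in id_comp_0 flip: comp_assoc)
  have bha: "scomp C 0 p p one b ha \<in> simps (shom C p one) 0"
    using ha by (simp add: comp_in)
  have "boundary (shom C p one) 1 (\<lambda>i. if i = 0 then b else scomp C 0 p p one b ha)"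
    unfolding boundary_def using bha by simp
  then have "boundary_fills (shom C p one) 1 (\<lambda>i. if i = 0 then b else scomp C 0 p p one b ha)"
    using contr[of p] unfolding contractible_sset_def by simp
  then obtain w where w: "w \<in> simps (shom C p one) 1" "act (shom C p one) 1 [1] w = b"
    "act (shom C p one) 1 [0] w = scomp C 0 p p one b ha"
    unfolding boundary_fills_def by (auto simp: face_1 face_1[unfolded One_nat_def] le_Suc_eq)
  have a1: "deg (shom C p x) 1 a \<in> simps (shom C p x) 1"
    by (simp add: deg_hom_in)
  define H where "H = k_pair C x one p a b 1 p (deg (shom C p x) 1 a) w"
  have H: "H \<in> simps (shom C p p) 1" "scomp C 1 p p x (deg (shom C p x) 1 a) H = deg (shom C p x) 1 a"
    "scomp C 1 p p one (deg (shom C p one) 1 b) H = w"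
    unfolding H_def using pair_props[OF P p(1) a1 w(1)] by simp_all
  have end_j: "scomp C 0 p p x a (act (shom C p p) 1 [j] H) = a"
    "scomp C 0 p p one b (act (shom C p p) 1 [j] H) = act (shom C p one) 1 [j] w"
    "act (shom C p p) 1 [j] H \<in> simps (shom C p p) 0" if "j \<le> 1" for j
  proof -
    have ops: "[j] \<in> ops 0 1"
      using that by (simp add: ops_iff)
    have da: "act (shom C p x) 1 [j] (deg (shom C p x) 1 a) = a"
      using act_deg[OF hom_sset _ ops, of p x a] d0 by simp
    have db: "act (shom C p one) 1 [j] (deg (shom C p one) 1 b) = b"
      using act_deg[OF hom_sset _ ops, of p one b] d0 by simp
    show "scomp C 0 p p x a (act (shom C p p) 1 [j] H) = a"
      using act_comp[OF p(1,1) x a1 H(1) ops] da H(2) by simp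
    show "scomp C 0 p p one b (act (shom C p p) 1 [j] H) = act (shom C p one) 1 [j] w"
      using act_comp[OF p(1,1) _ _ H(1) ops, of one "deg (shom C p one) 1 b"] db H(3) by (simp add: deg_hom_in)
    show "act (shom C p p) 1 [j] H \<in> simps (shom C p p) 0"
      by (rule act_in[OF hom_sset H(1) ops]) simp_all
  qed
  \<comment> \<open>The ends of \<open>H\<close> are identified by their two coordinates.\<close>
  have "act (shom C p p) 1 [0] H = ha"
    by (rule product_ext[OF P p(1) _ ha(1)]) (use end_j[of 0] ha(2) w d0 in simp_all)
  moreover have "act (shom C p p) 1 [1] H = sid C p"
    by (rule product_ext[OF P p(1) _ sid_in]) (use end_j[of 1] w d0 comp_id_0 in simp_all)
  ultimately have "same_component (shom C p p) (scomp C 0 p x p h a) (sid C p)"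
    unfolding same_component_def using H(1) ha_def by blast
  moreover have "same_component (shom C x x) (scomp C 0 x p x a h) (sid C x)"
    unfolding h(2) by (rule same_component_refl[OF hom_sset sid_in]) simp_all
  ultimately show ?thesis
    unfolding k_equiv_def using p h(1) by blast
qed

section \<open>Filter products of Kan enriched categories\<close>

text \<open>At one index, \<phi> is the map (f pr1, pr2) between the products with \<open>u\<close>;
  \<open>a\<close>, \<open>a'\<close> are the first projections and \<open>c\<close>,
  \<open>c'\<close> the second ones. The first claim is two-of-six for \<phi>, \<open>g\<close>,
  \<open>f\<close>. In the second, \<phi> is an equivalence, through the first projections and
  \<open>f\<close> or through the second projections, and \<open>g\<close> is the diagonal of the
  square.\<close>

lemma k_pullback_square:
  assumes C: "kan_enriched C"
    and ob [simp]: "x \<in> sobj C" "y \<in> sobj C" "p \<in> sobj C" "p' \<in> sobj C" "u \<in> sobj C"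
    and f [simp]: "f \<in> simps (shom C x y) 0"
    and a [simp]: "a \<in> simps (shom C p x) 0" "a' \<in> simps (shom C p' y) 0"
    and c [simp]: "c \<in> simps (shom C p u) 0" "c' \<in> simps (shom C p' u) 0"
    and \<phi> [simp]: "\<phi> \<in> simps (shom C p p') 0"
    and square: "scomp C 0 p p' y a' \<phi> = scomp C 0 p x y f a" "scomp C 0 p p' u c' \<phi> = c"
  shows "g \<in> simps (shom C p' x) 0 \<Longrightarrow> same_component (shom C p x) (scomp C 0 p p' x g \<phi>) a \<Longrightarrow>
      same_component (shom C p' y) (scomp C 0 p' x y f g) a' \<Longrightarrow>
      k_equiv C p x a \<Longrightarrow> k_equiv C p' y a' \<Longrightarrow> k_equiv C x y f"
    and "k_equiv C p x a \<and> k_equiv C p' y a' \<and> k_equiv C x y f \<or> k_equiv C p u c \<and> k_equiv C p' u c' \<Longrightarrow>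
      \<exists>g\<in>simps (shom C p' x) 0. same_component (shom C p x) (scomp C 0 p p' x g \<phi>) a \<and>
        same_component (shom C p' y) (scomp C 0 p' x y f g) a'"
proof -
  interpret enriched_category C
    by (rule enriched_if_kan_enriched[OF C])
  interpret weak_category "k_edges C" k_src k_tgt "k_ident C" "k_tri C"
    by (rule weak_category_kan_enriched[OF C])
  note equiv = k_equiv_iff[OF C]
  have refl: "same_component (shom C z w) h h" if "z \<in> sobj C" "w \<in> sobj C" "h \<in> simps (shom C z w) 0" for z w h
    using same_component_refl[OF hom_sset] that by blast
  define d where "d = scomp C 0 p x y f a"
  have d [simp]: "d \<in> simps (shom C p y) 0"
    unfolding d_def by (simp add: comp_in)
  have t1: "k_tri C (p, p', \<phi>) (p', y, a') (p, y, d)" and t2: "k_tri C (p, x, a) (x, y, f) (p, y, d)"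
    and t3: "k_tri C (p, p', \<phi>) (p', u, c') (p, u, c)"
    unfolding k_tri_def k_edges_def using square d_def refl by (simp_all add: comp_in)
  have tri_iff: "k_tri C (p, p', \<phi>) (p', x, g) (p, x, a) \<longleftrightarrow> g \<in> simps (shom C p' x) 0 \<and>
      same_component (shom C p x) (scomp C 0 p p' x g \<phi>) a"
    "k_tri C (p', x, g) (x, y, f) (p', y, a') \<longleftrightarrow> g \<in> simps (shom C p' x) 0 \<and>
      same_component (shom C p' y) (scomp C 0 p' x y f g) a'" for g
    unfolding k_tri_def k_edges_def by auto
  show "k_equiv C x y f" if "g \<in> simps (shom C p' x) 0" "same_component (shom C p x) (scomp C 0 p p' x g \<phi>) a"
      "same_component (shom C p' y) (scomp C 0 p' x y f g) a'" "k_equiv C p x a" "k_equiv C p' y a'"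
    using equivalence_two_of_six(2)[OF iffD2[OF tri_iff(1)] iffD2[OF tri_iff(2)]] that equiv by simp
  show "\<exists>g\<in>simps (shom C p' x) 0. same_component (shom C p x) (scomp C 0 p p' x g \<phi>) a \<and>
        same_component (shom C p' y) (scomp C 0 p' x y f g) a'"
    if *: "k_equiv C p x a \<and> k_equiv C p' y a' \<and> k_equiv C x y f \<or> k_equiv C p u c \<and> k_equiv C p' u c'"
  proof -
    have "equivalence (p, p', \<phi>)"
      using *
    proof
      assume "k_equiv C p x a \<and> k_equiv C p' y a' \<and> k_equiv C x y f"
      then have "equivalence (p, x, a)" "equivalence (p', y, a')" "equivalence (x, y, f)"
        using equiv by simp_all
      then show ?thesis
        using equivalence_cancel_right[OF t1] equivalence_comp[OF t2] by blast
    next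
      assume "k_equiv C p u c \<and> k_equiv C p' u c'"
      then have "equivalence (p, u, c)" "equivalence (p', u, c')"
        using equiv by simp_all
      then show ?thesis
        using equivalence_cancel_right[OF t3] by blast
    qed
    then obtain e where e: "k_tri C (p, p', \<phi>) e (p, x, a)" "k_tri C e (x, y, f) (p', y, a')"
      using equivalence_lift[OF t1 t2] by blast
    obtain g where "e = (p', x, g)"
      using e unfolding k_tri_def by (cases e) auto
    then show ?thesis
      using e tri_iff by blast
  qed
qed

lemma same_component_prod_sset_iff:
  assumes "a \<in> extensional I" "b \<in> extensional I"
  shows "same_component (prod_sset I X) a b \<longleftrightarrow> (\<forall>i\<in>I. same_component (X i) (a i) (b i))"
proof
  assume "same_component (prod_sset I X) a b"
  then obtain w where "w \<in> (\<Pi>\<^sub>E i\<in>I. simps (X i) 1)" "(\<lambda>i\<in>I. act (X i) 1 [0] (w i)) = a"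
    "(\<lambda>i\<in>I. act (X i) 1 [1] (w i)) = b"
    unfolding same_component_def by auto
  then show "\<forall>i\<in>I. same_component (X i) (a i) (b i)"
    unfolding same_component_def by (intro ballI bexI[of _ "w _"]) auto
next
  assume "\<forall>i\<in>I. same_component (X i) (a i) (b i)"
  then obtain w where w: "\<And>i. i \<in> I \<Longrightarrow> w i \<in> simps (X i) 1 \<and> act (X i) 1 [0] (w i) = a i \<and> act (X i) 1 [1] (w i) = b i"
    unfolding same_component_def Bex_def bchoice_iff by metis
  have "restrict a I = a" "restrict b I = b"
    using assms by (simp_all add: extensional_restrict)
  then show "same_component (prod_sset I X) a b"
    unfolding same_component_def
    by (intro bexI[of _ "restrict w I"]) (simp_all add: w w[unfolded One_nat_def] cong: restrict_cong)
qed

theorem k_filter_product_equiv: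
  fixes C :: "('o, 'm) scat"
  assumes \<Phi>: "product_closed_filter I \<Phi>"
    and C: "kan_enriched C" and one: "k_terminal C one" and zero: "zero \<in> sobj C"
    and T: "k_filter_system (k_power I C) \<Phi> (sub_object I zero one) T"
    and X: "X \<in> sobj (k_power I C)" "Y \<in> sobj (k_power I C)"
    and f: "f \<in> simps (shom (k_power I C) X Y) 0"
  defines "e \<equiv> k_equiv (k_filter_quotient (k_power I C) \<Phi> (sub_object I zero one) T) X Y
      (k_canonical (k_power I C) \<Phi> (sub_object I zero one) T I X Y f)"
  shows "e \<Longrightarrow> {i \<in> I. k_equiv C (X i) (Y i) (f i)} \<in> \<Phi>"
    and "k_strict C zero \<Longrightarrow> {i \<in> I. k_equiv C (X i) (Y i) (f i)} \<in> \<Phi> \<Longrightarrow> e"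
proof -
  let ?D = "k_power I C" and ?ob = "sub_object I zero one"
  have eC: "enriched_category C"
    by (rule enriched_if_kan_enriched[OF C])
  interpret C: enriched_category C
    by (rule eC)
  have ob: "?ob V \<in> sobj ?D" for V
    using zero one unfolding k_terminal_def sub_object_def by auto
  interpret k_system "k_power I C" I \<Phi> ?ob T
    unfolding k_system_def k_system_axioms_def using enriched_k_power[OF eC] \<Phi> T ob by blast
  have I: "I \<in> \<Phi>" and sub: "\<And>V. V \<in> \<Phi> \<Longrightarrow> V \<le> I"
    using \<Phi> unfolding product_closed_filter_def by auto
  define fV where "fV = (\<lambda>V. scomp ?D 0 (tens T V X) X Y f (pr1 T V X))"
  define \<phi> where "\<phi> = (\<lambda>V. pair V Y 0 (tens T V X) (fV V) (deg (shom ?D (tens T V X) (?ob V)) 0 (pr2 T V X)))"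
  have fV: "fV V \<in> simps (shom ?D (tens T V X) Y) 0" if "V \<in> \<Phi>" for V
    unfolding fV_def by (rule comp_in[OF tens_in[OF that X(1)] X f pr1_in[OF that X(1)]])
  have d0: "deg (shom ?D x y) 0 h = h" if "x \<in> sobj ?D" "y \<in> sobj ?D" "h \<in> simps (shom ?D x y) 0" for x y h
    by (rule deg_0[OF hom_sset[OF that(1,2)] that(3)])
  \<comment> \<open>The first projection of the pairing (g, pr2) is \<open>g\<close>, so composing
    with f pr1 leaves \<open>f\<close> after \<open>g\<close>.\<close>
  have fg: "comp_over V 0 Y X Y (fV V) g = scomp ?D 0 (tens T V Y) X Y f g"
    if V: "V \<in> \<Phi>" and g: "g \<in> simps (shom ?D (tens T V Y) X) 0" for V g
  proof -
    note h = pair_tens[OF V X(2,1) g]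
    have "deg (shom ?D (tens T V X) X) 0 (pr1 T V X) = pr1 T V X"
      by (rule d0[OF tens_in[OF V X(1)] X(1) pr1_in[OF V X(1)]])
    then show ?thesis
      unfolding comp_over_def fV_def
      using comp_assoc[OF tens_in[OF V X(2)] tens_in[OF V X(1)] X h(1) pr1_in[OF V X(1)] f] h(2) by metis
  qed
  have gf: "comp_over V 0 X Y X g (fV V) = scomp ?D 0 (tens T V X) (tens T V Y) X g (\<phi> V)" for V g
    unfolding comp_over_def \<phi>_def by simp
  \<comment> \<open>Invertibility at stage \<open>V\<close> now asks for a diagonal \<open>g\<close>
    in the square formed by \<phi>, \<open>f\<close> and the two first projections.\<close>
  have e: "e \<longleftrightarrow> (\<exists>V\<in>\<Phi>. \<exists>g\<in>simps (shom ?D (tens T V Y) X) 0.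
      same_component (shom ?D (tens T V X) X) (scomp ?D 0 (tens T V X) (tens T V Y) X g (\<phi> V)) (pr1 T V X) \<and>
      same_component (shom ?D (tens T V Y) Y) (scomp ?D 0 (tens T V Y) X Y f g) (pr1 T V Y))"
  proof -
    have "e \<longleftrightarrow> (\<exists>V\<in>\<Phi>. \<exists>g\<in>simps (shom ?D (tens T V Y) X) 0.
        same_component (shom ?D (tens T V X) X) (comp_over V 0 X Y X g (fV V)) (pr1 T V X) \<and>
        same_component (shom ?D (tens T V Y) Y) (comp_over V 0 Y X Y (fV V) g) (pr1 T V Y))"
      unfolding e_def fV_def by (rule k_equiv_quotient_iff[OF X I f sub])
    then show ?thesis
      by (simp only: fg gf cong: bex_cong)
  qed
  have comp: "X i \<in> sobj C" "Y i \<in> sobj C" "tens T V X i \<in> sobj C" "tens T V Y i \<in> sobj C" "?ob V i \<in> sobj C"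
    "f i \<in> simps (shom C (X i) (Y i)) 0"
    "pr1 T V X i \<in> simps (shom C (tens T V X i) (X i)) 0" "pr1 T V Y i \<in> simps (shom C (tens T V Y i) (Y i)) 0"
    "pr2 T V X i \<in> simps (shom C (tens T V X i) (?ob V i)) 0" "pr2 T V Y i \<in> simps (shom C (tens T V Y i) (?ob V i)) 0"
    "\<phi> V i \<in> simps (shom C (tens T V X i) (tens T V Y i)) 0"
    "scomp C 0 (tens T V X i) (tens T V Y i) (Y i) (pr1 T V Y i) (\<phi> V i) =
      scomp C 0 (tens T V X i) (X i) (Y i) (f i) (pr1 T V X i)"
    "scomp C 0 (tens T V X i) (tens T V Y i) (?ob V i) (pr2 T V Y i) (\<phi> V i) = pr2 T V X i"
    if V: "V \<in> \<Phi>" and i: "i \<in> I" for V i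
  proof -
    note h = pair_tens[OF V X fV[OF V], folded \<phi>_def]
    have deg: "deg (shom ?D (tens T V Y) Y) 0 (pr1 T V Y) = pr1 T V Y"
      "deg (shom ?D (tens T V Y) (?ob V)) 0 (pr2 T V Y) = pr2 T V Y"
      "deg (shom ?D (tens T V X) (?ob V)) 0 (pr2 T V X) = pr2 T V X"
      by (rule d0[OF tens_in[OF V X(2)] X(2) pr1_in[OF V X(2)]],
          rule d0[OF tens_in[OF V X(2)] ob pr2_in[OF V X(2)]],
          rule d0[OF tens_in[OF V X(1)] ob pr2_in[OF V X(1)]])
    show "X i \<in> sobj C" "Y i \<in> sobj C" "tens T V X i \<in> sobj C" "tens T V Y i \<in> sobj C" "?ob V i \<in> sobj C"
      "f i \<in> simps (shom C (X i) (Y i)) 0"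
      using X f i tens_in[OF V X(1)] tens_in[OF V X(2)] ob[of V] by auto
    show "pr1 T V X i \<in> simps (shom C (tens T V X i) (X i)) 0" "pr1 T V Y i \<in> simps (shom C (tens T V Y i) (Y i)) 0"
      "pr2 T V X i \<in> simps (shom C (tens T V X i) (?ob V i)) 0" "pr2 T V Y i \<in> simps (shom C (tens T V Y i) (?ob V i)) 0"
      "\<phi> V i \<in> simps (shom C (tens T V X i) (tens T V Y i)) 0"
      using i pr1_in[OF V X(1)] pr1_in[OF V X(2)] pr2_in[OF V X(1)] pr2_in[OF V X(2)] h(1)[folded \<phi>_def] 
      by (auto simp: \<phi>_def)
    show "scomp C 0 (tens T V X i) (tens T V Y i) (Y i) (pr1 T V Y i) (\<phi> V i) =
        scomp C 0 (tens T V X i) (X i) (Y i) (f i) (pr1 T V X i)"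
      using fun_cong[OF h(2)[unfolded deg], of i] i unfolding \<phi>_def deg fV_def by simp
    show "scomp C 0 (tens T V X i) (tens T V Y i) (?ob V i) (pr2 T V Y i) (\<phi> V i) = pr2 T V X i"
      using fun_cong[OF h(3)[unfolded deg], of i] i unfolding \<phi>_def deg by simp
  qed
  have prod: "k_product C (X i) (?ob V i) (tens T V X i) (pr1 T V X i) (pr2 T V X i)"
    "k_product C (Y i) (?ob V i) (tens T V Y i) (pr1 T V Y i) (pr2 T V Y i)" if "V \<in> \<Phi>" "i \<in> I" for V i
    using k_product_component[OF eC tens_product[OF that(1) X(1)] that(2) X(1) ob]
      k_product_component[OF eC tens_product[OF that(1) X(2)] that(2) X(2) ob] by blast+
  have pr1: "k_equiv C (tens T V X i) (X i) (pr1 T V X i)" "k_equiv C (tens T V Y i) (Y i) (pr1 T V Y i)"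
    if "V \<in> \<Phi>" "i \<in> V" for V i
  proof -
    have i: "i \<in> I" "?ob V i = one"
      using sub[OF that(1)] that(2) by (auto simp: sub_object_def)
    show "k_equiv C (tens T V X i) (X i) (pr1 T V X i)" "k_equiv C (tens T V Y i) (Y i) (pr1 T V Y i)"
      using k_equiv_projection[OF C _ one] prod[OF that(1) i(1)] comp(1,2)[OF that(1) i(1)] unfolding i(2) by blast+
  qed
  have ext: "scomp ?D n x y z g h \<in> extensional I" for n x y z g h
    by simp
  have pr1_ext: "pr1 T V X \<in> extensional I" "pr1 T V Y \<in> extensional I" if "V \<in> \<Phi>" for V
    using pr1_in[OF that X(1)] pr1_in[OF that X(2)] by (auto simp: PiE_def)
  have same: "same_component (shom ?D (tens T V X) X) (scomp ?D 0 (tens T V X) (tens T V Y) X g (\<phi> V)) (pr1 T V X) \<longleftrightarrow>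
      (\<forall>i\<in>I. same_component (shom C (tens T V X i) (X i))
        (scomp C 0 (tens T V X i) (tens T V Y i) (X i) (g i) (\<phi> V i)) (pr1 T V X i))"
    "same_component (shom ?D (tens T V Y) Y) (scomp ?D 0 (tens T V Y) X Y f g) (pr1 T V Y) \<longleftrightarrow>
      (\<forall>i\<in>I. same_component (shom C (tens T V Y i) (Y i))
        (scomp C 0 (tens T V Y i) (X i) (Y i) (f i) (g i)) (pr1 T V Y i))" if "V \<in> \<Phi>" for V g
    using same_component_prod_sset_iff[OF ext pr1_ext(1)[OF that]]
      same_component_prod_sset_iff[OF ext pr1_ext(2)[OF that]] by simp_all
  show "{i \<in> I. k_equiv C (X i) (Y i) (f i)} \<in> \<Phi>" if e
  proof -
    obtain V g where V: "V \<in> \<Phi>" and g: "g \<in> simps (shom ?D (tens T V Y) X) 0"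
      "same_component (shom ?D (tens T V X) X) (scomp ?D 0 (tens T V X) (tens T V Y) X g (\<phi> V)) (pr1 T V X)"
      "same_component (shom ?D (tens T V Y) Y) (scomp ?D 0 (tens T V Y) X Y f g) (pr1 T V Y)"
      using \<open>e\<close> e by blast
    have "k_equiv C (X i) (Y i) (f i)" if "i \<in> V" for i
    proof -
      have i: "i \<in> I"
        using sub[OF V] that by blast
      have "g i \<in> simps (shom C (tens T V Y i) (X i)) 0"
        using g(1) i by auto
      then show ?thesis
        using k_pullback_square(1)[OF C comp[OF V i]] g(2,3) i pr1[OF V that] unfolding same[OF V] by blast
    qed
    then have "V \<subseteq> {i \<in> I. k_equiv C (X i) (Y i) (f i)}"
      using sub[OF V] by blast
    then show ?thesis
      using \<Phi> V unfolding product_closed_filter_def by blast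
  qed
  show e if strict: "k_strict C zero" and J: "{i \<in> I. k_equiv C (X i) (Y i) (f i)} \<in> \<Phi>" (is "?J \<in> \<Phi>")
  proof -
    have "\<exists>g\<in>simps (shom C (tens T ?J Y i) (X i)) 0.
        same_component (shom C (tens T ?J X i) (X i))
          (scomp C 0 (tens T ?J X i) (tens T ?J Y i) (X i) g (\<phi> ?J i)) (pr1 T ?J X i) \<and>
        same_component (shom C (tens T ?J Y i) (Y i))
          (scomp C 0 (tens T ?J Y i) (X i) (Y i) (f i) g) (pr1 T ?J Y i)" if i: "i \<in> I" for i
    \<comment> \<open>Inside \<open>?J\<close> the first projections and the component of
      \<open>f\<close> are equivalences; outside, both second projections end at the strict
      object.\<close>
    proof (rule k_pullback_square(2)[OF C comp[OF J i]], cases "i \<in> ?J")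
      case True
      then show "k_equiv C (tens T ?J X i) (X i) (pr1 T ?J X i) \<and> k_equiv C (tens T ?J Y i) (Y i) (pr1 T ?J Y i) \<and>
          k_equiv C (X i) (Y i) (f i) \<or>
        k_equiv C (tens T ?J X i) (?ob ?J i) (pr2 T ?J X i) \<and> k_equiv C (tens T ?J Y i) (?ob ?J i) (pr2 T ?J Y i)"
        using pr1[OF J True] by blast
    next
      case False
      then have "?ob ?J i = zero"
        using i by (simp add: sub_object_def)
      then show "k_equiv C (tens T ?J X i) (X i) (pr1 T ?J X i) \<and> k_equiv C (tens T ?J Y i) (Y i) (pr1 T ?J Y i) \<and>
          k_equiv C (X i) (Y i) (f i) \<or>
        k_equiv C (tens T ?J X i) (?ob ?J i) (pr2 T ?J X i) \<and> k_equiv C (tens T ?J Y i) (?ob ?J i) (pr2 T ?J Y i)"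
        using strict comp(3,4,9,10)[OF J i] unfolding k_strict_def by simp
    qed
    then have "\<forall>i\<in>I. \<exists>g. g \<in> simps (shom C (tens T ?J Y i) (X i)) 0 \<and>
        same_component (shom C (tens T ?J X i) (X i))
          (scomp C 0 (tens T ?J X i) (tens T ?J Y i) (X i) g (\<phi> ?J i)) (pr1 T ?J X i) \<and>
        same_component (shom C (tens T ?J Y i) (Y i))
          (scomp C 0 (tens T ?J Y i) (X i) (Y i) (f i) g) (pr1 T ?J Y i)"
      by blast
    from bchoice[OF this] obtain g where g: "\<forall>i\<in>I. g i \<in> simps (shom C (tens T ?J Y i) (X i)) 0 \<and>
        same_component (shom C (tens T ?J X i) (X i))
          (scomp C 0 (tens T ?J X i) (tens T ?J Y i) (X i) (g i) (\<phi> ?J i)) (pr1 T ?J X i) \<and>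
        same_component (shom C (tens T ?J Y i) (Y i))
          (scomp C 0 (tens T ?J Y i) (X i) (Y i) (f i) (g i)) (pr1 T ?J Y i)" ..
    define g' where "g' = restrict g I"
    have "g' \<in> simps (shom ?D (tens T ?J Y) X) 0"
      using g by (simp add: g'_def)
    moreover have
      "same_component (shom ?D (tens T ?J X) X) (scomp ?D 0 (tens T ?J X) (tens T ?J Y) X g' (\<phi> ?J)) (pr1 T ?J X)"
      "same_component (shom ?D (tens T ?J Y) Y) (scomp ?D 0 (tens T ?J Y) X Y f g') (pr1 T ?J Y)"
      unfolding same[OF J] using g by (simp_all add: g'_def)
    ultimately show e
      unfolding e using J by blast
  qed
qed

section \<open>Equivalences and filter products in complete Segal spaces\<close>

section \<open>Bisimplicial sets\<close>

lemma simps_row [simp]: "simps (row W k) n = bsimps W n k"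
  and act_row [simp]: "act (row W k) n = hact W n k"
  and simps_level [simp]: "simps (level W n) k = bsimps W n k"
  and act_level [simp]: "act (level W n) k = vact W n k"
  by (simp_all add: row_def level_def)

lemma vdeg_1: "vdeg W n 1 x = vact W n 0 [0, 0] x" "vdeg W n (Suc 0) x = vact W n 0 [0, 0] x"
  unfolding vdeg_def deg_1 by simp_all

lemma s_ident_eq: "s_ident W x = hact W 0 0 [0, 0] x"
  unfolding s_ident_def deg_1 by simp

locale bisimplicial =
  fixes W :: "'a bsset"
  assumes bsset: "is_bsset W"
begin

lemma row_sset: "is_sset (row W k)" and level_sset: "is_sset (level W n)"
  using bsset unfolding is_bsset_def by blast+

lemma hact_vact:
  "\<theta> \<in> ops m n \<Longrightarrow> \<phi> \<in> ops l k \<Longrightarrow> x \<in> bsimps W n k \<Longrightarrow>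
    hact W n l \<theta> (vact W n k \<phi> x) = vact W m k \<phi> (hact W n k \<theta> x)"
  using bsset unfolding is_bsset_def by blast

lemma hact_hact:
  "x \<in> bsimps W n k \<Longrightarrow> length \<theta> = Suc m \<Longrightarrow> sorted \<theta> \<Longrightarrow> \<forall>i\<in>set \<theta>. i \<le> n \<Longrightarrow>
    \<phi> \<noteq> [] \<Longrightarrow> sorted \<phi> \<Longrightarrow> \<forall>i\<in>set \<phi>. i \<le> m \<Longrightarrow>
    hact W m k \<phi> (hact W n k \<theta> x) = hact W n k (map ((!) \<theta>) \<phi>) x"
  using act_act_list[OF row_sset, of x k n \<theta> m \<phi>] by simp

lemma hact_in:
  "x \<in> bsimps W n k \<Longrightarrow> length \<theta> = Suc m \<Longrightarrow> sorted \<theta> \<Longrightarrow> \<forall>i\<in>set \<theta>. i \<le> n \<Longrightarrow>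
    hact W n k \<theta> x \<in> bsimps W m k"
  using act_in_list[OF row_sset, of x k n \<theta> m] by simp

lemma vact_vact:
  "x \<in> bsimps W n k \<Longrightarrow> length \<theta> = Suc m \<Longrightarrow> sorted \<theta> \<Longrightarrow> \<forall>i\<in>set \<theta>. i \<le> k \<Longrightarrow>
    \<phi> \<noteq> [] \<Longrightarrow> sorted \<phi> \<Longrightarrow> \<forall>i\<in>set \<phi>. i \<le> m \<Longrightarrow>
    vact W n m \<phi> (vact W n k \<theta> x) = vact W n k (map ((!) \<theta>) \<phi>) x"
  using act_act_list[OF level_sset, of x n k \<theta> m \<phi>] by simp

lemma vact_in:
  "x \<in> bsimps W n k \<Longrightarrow> length \<theta> = Suc m \<Longrightarrow> sorted \<theta> \<Longrightarrow> \<forall>i\<in>set \<theta>. i \<le> k \<Longrightarrow>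
    vact W n k \<theta> x \<in> bsimps W n m"
  using act_in_list[OF level_sset, of x n k \<theta> m] by simp

lemma hact_id:
  "x \<in> bsimps W 0 k \<Longrightarrow> hact W 0 k [0] x = x"
  "x \<in> bsimps W 1 k \<Longrightarrow> hact W 1 k [0, 1] x = x"
  "x \<in> bsimps W (Suc 0) k \<Longrightarrow> hact W (Suc 0) k [0, Suc 0] x = x"
  "x \<in> bsimps W 2 k \<Longrightarrow> hact W 2 k [0, 1, 2] x = x"
  "x \<in> bsimps W 2 k \<Longrightarrow> hact W 2 k [0, Suc 0, 2] x = x"
  using act_id_list[OF row_sset, of x k] by simp_all

lemma vact_id:
  "x \<in> bsimps W n 0 \<Longrightarrow> vact W n 0 [0] x = x"
  "x \<in> bsimps W n 1 \<Longrightarrow> vact W n 1 [0, 1] x = x"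
  "x \<in> bsimps W n (Suc 0) \<Longrightarrow> vact W n (Suc 0) [0, Suc 0] x = x"
  using act_id_list[OF level_sset, of x n] by simp_all

lemma hact_vact_list:
  "x \<in> bsimps W n k \<Longrightarrow> length \<phi> = Suc l \<Longrightarrow> sorted \<phi> \<Longrightarrow> \<forall>i\<in>set \<phi>. i \<le> k \<Longrightarrow> a \<le> n \<Longrightarrow>
    hact W n l [a] (vact W n k \<phi> x) = vact W 0 k \<phi> (hact W n k [a] x)"
  "x \<in> bsimps W n k \<Longrightarrow> length \<phi> = Suc l \<Longrightarrow> sorted \<phi> \<Longrightarrow> \<forall>i\<in>set \<phi>. i \<le> k \<Longrightarrow> a \<le> b \<Longrightarrow> b \<le> n \<Longrightarrow>
    hact W n l [a, b] (vact W n k \<phi> x) = vact W 1 k \<phi> (hact W n k [a, b] x)"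
  "x \<in> bsimps W n k \<Longrightarrow> length \<phi> = Suc l \<Longrightarrow> sorted \<phi> \<Longrightarrow> \<forall>i\<in>set \<phi>. i \<le> k \<Longrightarrow> a \<le> b \<Longrightarrow> b \<le> c \<Longrightarrow> c \<le> n \<Longrightarrow>
    hact W n l [a, b, c] (vact W n k \<phi> x) = vact W 2 k \<phi> (hact W n k [a, b, c] x)"
  by (rule hact_vact; simp add: ops_iff)+

lemmas hacts = hact_hact hact_in hact_id
lemmas vacts = vact_vact vact_in vact_id
lemmas bacts = hacts vacts hact_vact_list

lemma simplicial_map_hact:
  "\<theta> \<in> ops m n \<Longrightarrow> simplicial_map (level W n) (level W m) (\<lambda>k. hact W n k \<theta>)"
  unfolding simplicial_map_def using hact_vact act_in[OF row_sset, of _ _ n \<theta> m] by simp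

lemma vdeg_0: "x \<in> bsimps W n 0 \<Longrightarrow> vdeg W n 0 x = x"
  unfolding vdeg_def deg_def by (simp add: vact_id)

end

section \<open>Lifting in Reedy fibrant bisimplicial sets\<close>

text \<open>Fibrancy over the matching space in pushout-product form: a horn in the space direction
  extends when m-simplices over the whole boundary in the categorical direction are prescribed
  compatibly.\<close>

lemma reedy_lift:
  assumes W: "reedy_fibrant W" and "1 \<le> n" "1 \<le> m" "k \<le> m" "horn (level W n) m k y"
    and b: "\<And>i. i \<le> n \<Longrightarrow> b i \<in> bsimps W (n - 1) m" "boundary (row W m) n b"
    and yb: "\<And>i j. i \<le> n \<Longrightarrow> j \<le> m \<Longrightarrow> j \<noteq> k \<Longrightarrow>
      face (row W (m - 1)) n i (y j) = face (level W (n - 1)) m j (b i)"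
  shows "\<exists>z\<in>bsimps W n m. (\<forall>i\<le>n. face (row W m) n i z = b i) \<and>
    (\<forall>j\<le>m. j \<noteq> k \<longrightarrow> face (level W n) m j z = y j)"
proof -
  let ?p = "\<lambda>k x. \<lambda>i\<in>(if n = 0 then {} else {..n}). face (row W k) n i x"
  define b' where "b' = restrict b {..n}"
  have fib: "kan_fibration (level W n) (matching W n) ?p"
    using W unfolding reedy_fibrant_def by blast
  have "boundary (row W m) n b'"
    using b(2) unfolding b'_def boundary_def by auto
  then have "b' \<in> simps (matching W n) m"
    using b(1) \<open>1 \<le> n\<close> by (simp add: matching_def Let_def b'_def)
  moreover have "?p (m - 1) (y j) = face (matching W n) m j b'" if "j \<le> m" "j \<noteq> k" for j
    using yb that \<open>1 \<le> n\<close> by (auto simp: matching_def Let_def face_def b'_def fun_eq_iff)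
  ultimately obtain z where z: "z \<in> simps (level W n) m" "?p m z = b'"
    "\<forall>j\<le>m. j \<noteq> k \<longrightarrow> face (level W n) m j z = y j"
    using fib assms(3-5) unfolding kan_fibration_def by blast
  have "face (row W m) n i z = b i" if "i \<le> n" for i
    using fun_cong[OF z(2), of i] that \<open>1 \<le> n\<close> by (simp add: b'_def)
  then show ?thesis
    using z(1,3) by auto
qed

lemma path_lift:
  assumes W: "is_bsset W" "reedy_fibrant W" and "1 \<le> n" "e \<le> 1" "x \<in> bsimps W n 0"
    and b: "\<And>i. i \<le> n \<Longrightarrow> b i \<in> bsimps W (n - 1) 1" "boundary (row W 1) n b"
    and xb: "\<And>i. i \<le> n \<Longrightarrow> face (row W 0) n i x = vact W (n - 1) 1 [e] (b i)"
  shows "\<exists>z\<in>bsimps W n 1. (\<forall>i\<le>n. face (row W 1) n i z = b i) \<and> vact W n 1 [e] z = x"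
proof -
  \<comment> \<open>Face j of a path is its end 1 - j, so the horn lacking face \<open>e\<close>
    prescribes exactly the end \<open>e\<close>.\<close>
  have face_e: "face (level W l) 1 j y = vact W l 1 [e] y" if "j \<le> 1" "j \<noteq> e" for l j y
    using that \<open>e \<le> 1\<close> face_1[of "level W l" y] by (cases "e = 0") (auto simp: le_Suc_eq)
  have "horn (level W n) 1 e (\<lambda>_. x)"
    using \<open>x \<in> bsimps W n 0\<close> unfolding horn_def by simp
  then have "\<exists>z\<in>bsimps W n 1. (\<forall>i\<le>n. face (row W 1) n i z = b i) \<and>
      (\<forall>j\<le>1. j \<noteq> e \<longrightarrow> face (level W n) 1 j z = x)"
    by (rule reedy_lift[OF W(2) \<open>1 \<le> n\<close> order_refl \<open>e \<le> 1\<close> _ b]) (use xb face_e in simp_all)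
  then obtain z where z: "z \<in> bsimps W n 1" "\<forall>i\<le>n. face (row W 1) n i z = b i"
    "\<forall>j\<le>1. j \<noteq> e \<longrightarrow> face (level W n) 1 j z = x"
    by blast
  have e': "1 - e \<le> 1" "1 - e \<noteq> e"
    using \<open>e \<le> 1\<close> by (cases "e = 0"; simp)+
  have "vact W n 1 [e] z = x"
    using z(3) e' face_e[OF e', of n z] by simp
  then show ?thesis
    using z(1,2) by blast
qed

locale reedy = bisimplicial W for W :: "'a bsset" +
  assumes fibrant: "reedy_fibrant W"
begin

text \<open>This and the next two lemmas are the cases n = 1, 2, 3 of path lifting. They transport
  an n-simplex along a path of its boundary, starting from either end.\<close>

lemma edge_path:
  assumes "e \<le> 1" "f \<in> bsimps W 1 0" "\<alpha> \<in> bsimps W 0 1" "\<beta> \<in> bsimps W 0 1"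
    "hact W 1 0 [0] f = vact W 0 1 [e] \<alpha>" "hact W 1 0 [1] f = vact W 0 1 [e] \<beta>"
  obtains w where "w \<in> bsimps W 1 1" "hact W 1 1 [0] w = \<alpha>" "hact W 1 1 [1] w = \<beta>" "vact W 1 1 [e] w = f"
proof -
  define b where "b = (\<lambda>i::nat. if i = 0 then \<beta> else \<alpha>)"
  have b: "\<And>i. b i \<in> bsimps W 0 1"
    using assms by (simp add: b_def)
  then have b': "\<And>i. b i \<in> bsimps W (1 - 1) 1" "boundary (row W 1) 1 b"
    unfolding boundary_def by simp_all
  have "face (row W 0) 1 i f = vact W (1 - 1) 1 [e] (b i)" if "i \<le> 1" for i
    using that assms(5,6) face_1[of "row W 0" f] by (cases "i = 0") (auto simp: b_def le_Suc_eq)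
  then obtain z where z: "z \<in> bsimps W 1 1" "\<And>i. i \<le> 1 \<Longrightarrow> face (row W 1) 1 i z = b i" "vact W 1 1 [e] z = f"
    using path_lift[OF bsset fibrant order_refl assms(1,2) b'] by blast
  show thesis
    using that[OF z(1) _ _ z(3)] z(2)[of 0] z(2)[of 1] face_1[of "row W 1" z] by (simp add: b_def)
qed

lemma tri_path:
  assumes e: "e \<le> 1" and \<sigma>: "\<sigma> \<in> bsimps W 2 0" and abc: "a \<in> bsimps W 1 1" "b \<in> bsimps W 1 1" "c \<in> bsimps W 1 1"
    and "hact W 1 1 [1] a = hact W 1 1 [0] b" "hact W 1 1 [0] c = hact W 1 1 [0] a"
    "hact W 1 1 [1] c = hact W 1 1 [1] b"
    and "hact W 2 0 [0, 1] \<sigma> = vact W 1 1 [e] a" "hact W 2 0 [1, 2] \<sigma> = vact W 1 1 [e] b"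
    "hact W 2 0 [0, 2] \<sigma> = vact W 1 1 [e] c"
  obtains z where "z \<in> bsimps W 2 1" "hact W 2 1 [0, 1] z = a" "hact W 2 1 [1, 2] z = b"
    "hact W 2 1 [0, 2] z = c" "vact W 2 1 [e] z = \<sigma>"
proof -
  define y where "y = (\<lambda>i::nat. if i = 0 then b else if i = 1 then c else a)"
  have y: "\<And>i. y i \<in> bsimps W (2 - 1) 1"
    using abc by (simp add: y_def)
  have "boundary (row W 1) 2 y"
    using assms by (intro boundary_2I) (auto simp: y_def)
  note y = y this
  have "face (row W 0) 2 i \<sigma> = vact W (2 - 1) 1 [e] (y i)" if "i \<le> 2" for i
    using that assms unfolding le_2_cases by (auto simp: face_2 y_def)
  then obtain z where z: "z \<in> bsimps W 2 1" "\<And>i. i \<le> 2 \<Longrightarrow> face (row W 1) 2 i z = y i" "vact W 2 1 [e] z = \<sigma>"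
    using path_lift[OF bsset fibrant one_le_numeral e \<sigma> y] by blast
  show thesis
    using that[OF z(1) _ _ _ z(3)] z(2)[of 0] z(2)[of 1] z(2)[of 2] by (simp add: face_2 y_def)
qed

lemma tet_path:
  assumes e: "e \<le> 1" and \<sigma>: "\<sigma> \<in> bsimps W 3 0"
    and abc: "A \<in> bsimps W 2 1" "B \<in> bsimps W 2 1" "E \<in> bsimps W 2 1" "H \<in> bsimps W 2 1"
    and "hact W 2 1 [1, 2] H = hact W 2 1 [1, 2] B" "hact W 2 1 [1, 2] E = hact W 2 1 [0, 2] B"
    "hact W 2 1 [1, 2] A = hact W 2 1 [0, 1] B" "hact W 2 1 [0, 2] E = hact W 2 1 [0, 2] H"
    "hact W 2 1 [0, 2] A = hact W 2 1 [0, 1] H" "hact W 2 1 [0, 1] A = hact W 2 1 [0, 1] E"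
    and "hact W 3 0 [0, 1, 2] \<sigma> = vact W 2 1 [e] A" "hact W 3 0 [1, 2, 3] \<sigma> = vact W 2 1 [e] B"
    "hact W 3 0 [0, 1, 3] \<sigma> = vact W 2 1 [e] E" "hact W 3 0 [0, 2, 3] \<sigma> = vact W 2 1 [e] H"
  obtains z where "z \<in> bsimps W 3 1" "hact W 3 1 [0, 1, 2] z = A" "hact W 3 1 [1, 2, 3] z = B"
    "hact W 3 1 [0, 1, 3] z = E" "hact W 3 1 [0, 2, 3] z = H" "vact W 3 1 [e] z = \<sigma>"
proof -
  define y where "y = (\<lambda>i::nat. if i = 0 then B else if i = 1 then H else if i = 2 then E else A)"
  have y: "\<And>i. y i \<in> bsimps W (3 - 1) 1"
    using abc by (simp add: y_def)
  have "boundary (row W 1) 3 y"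
    unfolding boundary_iff_horn using assms by (intro horn_3I) (auto simp: y_def)
  note y = y this
  have "face (row W 0) 3 i \<sigma> = vact W (3 - 1) 1 [e] (y i)" if "i \<le> 3" for i
    using that assms unfolding le_3_cases by (auto simp: face_3 y_def)
  then obtain z where z: "z \<in> bsimps W 3 1" "\<And>i. i \<le> 3 \<Longrightarrow> face (row W 1) 3 i z = y i" "vact W 3 1 [e] z = \<sigma>"
    using path_lift[OF bsset fibrant one_le_numeral e \<sigma> y] by blast
  show thesis
    using that[OF z(1) _ _ _ _ z(3)] z(2)[of 0] z(2)[of 1] z(2)[of 2] z(2)[of 3] by (simp add: face_3 y_def)
qed

text \<open>Horn lifting for the map from 2-simplices to their spines. The edges [0, 2] are lifted
  first, relative to their vertices; this completes the boundary for a second lift.\<close>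

lemma spine_lift:
  assumes "1 \<le> m" "k \<le> m" and y: "horn (level W 2) m k y"
    and f: "f \<in> bsimps W 1 m" and g: "g \<in> bsimps W 1 m" and fg: "hact W 1 m [1] f = hact W 1 m [0] g"
    and yf: "\<And>j. j \<le> m \<Longrightarrow> j \<noteq> k \<Longrightarrow> hact W 2 (m - 1) [0, 1] (y j) = face (level W 1) m j f"
    and yg: "\<And>j. j \<le> m \<Longrightarrow> j \<noteq> k \<Longrightarrow> hact W 2 (m - 1) [1, 2] (y j) = face (level W 1) m j g"
  shows "\<exists>z\<in>bsimps W 2 m. hact W 2 m [0, 1] z = f \<and> hact W 2 m [1, 2] z = g \<and>
    (\<forall>j\<le>m. j \<noteq> k \<longrightarrow> face (level W 2) m j z = y j)"
proof -
  obtain m' where m: "m = Suc m'"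
    using \<open>1 \<le> m\<close> by (cases m) auto
  have y_in: "y j \<in> bsimps W 2 (m - 1)" if "j \<le> m" "j \<noteq> k" for j
    using y that unfolding horn_def by simp
  have "[0, 2] \<in> ops 1 2"
    by (simp add: ops_iff)
  then have h: "horn (level W 1) m k (\<lambda>j. hact W 2 (m - 1) [0, 2] (y j))"
    using horn_simplicial_map[OF simplicial_map_hact y \<open>1 \<le> m\<close>] by simp
  define b where "b = (\<lambda>i::nat. if i = 0 then hact W 1 m [1] g else hact W 1 m [0] f)"
  have b: "\<And>i. b i \<in> bsimps W (1 - 1) m"
    using f g by (simp add: b_def hacts)
  then have "boundary (row W m) 1 b"
    unfolding boundary_def by simp
  note b = b this
  have "face (row W (m - 1)) 1 i (hact W 2 (m - 1) [0, 2] (y j)) = face (level W (1 - 1)) m j (b i)"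
    if "i \<le> 1" "j \<le> m" "j \<noteq> k" for i j
  proof -
    have "[0] \<in> ops 0 1" "[1] \<in> ops 0 1"
      by (simp_all add: ops_iff)
    then have "face (level W 0) m j (hact W 1 m [1] g) = hact W 1 m' [1] (face (level W 1) m j g)"
      "face (level W 0) m j (hact W 1 m [0] f) = hact W 1 m' [0] (face (level W 1) m j f)"
      using simplicial_map_face[OF simplicial_map_hact, of _ 0 1 g m' j]
        simplicial_map_face[OF simplicial_map_hact, of _ 0 1 f m' j] f g that m by simp_all
    then show ?thesis
      using that y_in[OF that(2,3)] yf[OF that(2,3), symmetric] yg[OF that(2,3), symmetric] m
      by (auto simp: b_def face_1 face_1[unfolded One_nat_def] le_Suc_eq hacts)
  qed
  then obtain c where c: "c \<in> bsimps W 1 m" "\<And>i. i \<le> 1 \<Longrightarrow> face (row W m) 1 i c = b i"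
    "\<And>j. j \<le> m \<Longrightarrow> j \<noteq> k \<Longrightarrow> face (level W 1) m j c = hact W 2 (m - 1) [0, 2] (y j)"
    using reedy_lift[OF fibrant order_refl assms(1,2) h b] by blast
  have c01: "hact W 1 m [1] c = hact W 1 m [1] g" "hact W 1 m [0] c = hact W 1 m [0] f"
    using c(2)[of 0] c(2)[of 1] by (simp_all add: b_def face_1 face_1[unfolded One_nat_def])
  define b2 where "b2 = (\<lambda>i::nat. if i = 0 then g else if i = 1 then c else f)"
  have b2: "\<And>i. b2 i \<in> bsimps W (2 - 1) m"
    using f g c(1) by (simp add: b2_def)
  have "boundary (row W m) 2 b2"
    using f g c(1) c01 fg by (intro boundary_2I) (auto simp: b2_def)
  note b2 = b2 this
  have "face (row W (m - 1)) 2 i (y j) = face (level W (2 - 1)) m j (b2 i)"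
    if "i \<le> 2" "j \<le> m" "j \<noteq> k" for i j
    using that(1) yf[OF that(2,3)] yg[OF that(2,3)] c(3)[OF that(2,3)]
    unfolding le_2_cases by (auto simp: face_2 b2_def)
  then obtain z where z: "z \<in> bsimps W 2 m" "\<And>i. i \<le> 2 \<Longrightarrow> face (row W m) 2 i z = b2 i"
    "\<And>j. j \<le> m \<Longrightarrow> j \<noteq> k \<Longrightarrow> face (level W 2) m j z = y j"
    using reedy_lift[OF fibrant one_le_numeral assms(1,2) y b2] by blast
  show ?thesis
    using z(1,3) z(2)[of 0] z(2)[of 2] by (intro bexI[of _ z]) (simp_all add: face_2 b2_def)
qed

lemma spine_path:
  assumes e: "e \<le> 1" and \<sigma>: "\<sigma> \<in> bsimps W 2 0" and ab: "a \<in> bsimps W 1 1" "b \<in> bsimps W 1 1"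
    and "hact W 1 1 [1] a = hact W 1 1 [0] b"
    and "hact W 2 0 [0, 1] \<sigma> = vact W 1 1 [e] a" "hact W 2 0 [1, 2] \<sigma> = vact W 1 1 [e] b"
  obtains z where "z \<in> bsimps W 2 1" "hact W 2 1 [0, 1] z = a" "hact W 2 1 [1, 2] z = b"
    "vact W 2 1 [e] z = \<sigma>"
proof -
  have "hact W 1 0 [0] (hact W 2 0 [0, 2] \<sigma>) = hact W 1 0 [0] (hact W 2 0 [0, 1] \<sigma>)"
    "hact W 1 0 [1] (hact W 2 0 [0, 2] \<sigma>) = hact W 1 0 [1] (hact W 2 0 [1, 2] \<sigma>)"
    "hact W 2 0 [0, 2] \<sigma> \<in> bsimps W 1 0"
    using \<sigma> by (simp_all add: hacts)
  then obtain c where "c \<in> bsimps W 1 1" "hact W 1 1 [0] c = hact W 1 1 [0] a"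
    "hact W 1 1 [1] c = hact W 1 1 [1] b" "vact W 1 1 [e] c = hact W 2 0 [0, 2] \<sigma>"
    using edge_path[of e "hact W 2 0 [0, 2] \<sigma>" "hact W 1 1 [0] a" "hact W 1 1 [1] b"] e ab assms(6,7)
    by (auto simp: bacts)
  then show thesis
    using tri_path[OF e \<sigma> ab, of c thesis] assms(5-7) that by simp
qed

text \<open>The face [0, 2, 3] is missing from the path of boundaries. Its edges are already moved
  by the other three faces, so it is transported along them first.\<close>

lemma tet_horn_path:
  assumes e: "e \<le> 1" and \<sigma>: "\<sigma> \<in> bsimps W 3 0"
    and abc: "A \<in> bsimps W 2 1" "B \<in> bsimps W 2 1" "E \<in> bsimps W 2 1"
    and "hact W 2 1 [1, 2] E = hact W 2 1 [0, 2] B"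
    "hact W 2 1 [1, 2] A = hact W 2 1 [0, 1] B" "hact W 2 1 [0, 1] A = hact W 2 1 [0, 1] E"
    and ends: "hact W 3 0 [0, 1, 2] \<sigma> = vact W 2 1 [e] A" "hact W 3 0 [1, 2, 3] \<sigma> = vact W 2 1 [e] B"
    "hact W 3 0 [0, 1, 3] \<sigma> = vact W 2 1 [e] E"
  obtains z where "z \<in> bsimps W 3 1" "hact W 3 1 [0, 1, 2] z = A" "hact W 3 1 [1, 2, 3] z = B"
    "hact W 3 1 [0, 1, 3] z = E" "vact W 3 1 [e] z = \<sigma>"
proof -
  let ?H = "hact W 3 0 [0, 2, 3] \<sigma>"
  let ?a = "hact W 2 1 [0, 2] A" and ?b = "hact W 2 1 [1, 2] B" and ?c = "hact W 2 1 [0, 2] E"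
  have abc1: "?a \<in> bsimps W 1 1" "?b \<in> bsimps W 1 1" "?c \<in> bsimps W 1 1" and H: "?H \<in> bsimps W 2 0"
    using abc \<sigma> by (simp_all add: hacts)
  have "hact W 1 1 [1] ?a = hact W 1 1 [1] (hact W 2 1 [1, 2] A)"
    "hact W 1 1 [0] ?b = hact W 1 1 [1] (hact W 2 1 [0, 1] B)"
    "hact W 1 1 [0] ?c = hact W 1 1 [0] (hact W 2 1 [0, 1] E)"
    "hact W 1 1 [0] ?a = hact W 1 1 [0] (hact W 2 1 [0, 1] A)"
    "hact W 1 1 [1] ?c = hact W 1 1 [1] (hact W 2 1 [1, 2] E)"
    "hact W 1 1 [1] ?b = hact W 1 1 [1] (hact W 2 1 [0, 2] B)"
    using abc by (simp_all add: hacts)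
  then have compat: "hact W 1 1 [1] ?a = hact W 1 1 [0] ?b" "hact W 1 1 [0] ?c = hact W 1 1 [0] ?a"
    "hact W 1 1 [1] ?c = hact W 1 1 [1] ?b"
    using assms(6-8) by simp_all
  have "vact W 1 1 [e] ?a = hact W 2 0 [0, 2] (vact W 2 1 [e] A)"
    "vact W 1 1 [e] ?b = hact W 2 0 [1, 2] (vact W 2 1 [e] B)"
    "vact W 1 1 [e] ?c = hact W 2 0 [0, 2] (vact W 2 1 [e] E)"
    using abc e by (simp_all add: bacts)
  then have "hact W 2 0 [0, 1] ?H = vact W 1 1 [e] ?a" "hact W 2 0 [1, 2] ?H = vact W 1 1 [e] ?b"
    "hact W 2 0 [0, 2] ?H = vact W 1 1 [e] ?c"
    unfolding ends[symmetric] using \<sigma> by (simp_all add: hacts)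
  then obtain H' where H': "H' \<in> bsimps W 2 1" "hact W 2 1 [0, 1] H' = ?a" "hact W 2 1 [1, 2] H' = ?b"
    "hact W 2 1 [0, 2] H' = ?c" "vact W 2 1 [e] H' = ?H"
    by (rule tri_path[OF e H abc1 compat])
  show thesis
    by (rule tet_path[OF e \<sigma> abc H'(1)]) (use H' assms(6-8) ends that in simp_all)
qed

end

section \<open>Segal spaces\<close>

locale segal = reedy W for W :: "'a bsset" +
  assumes segal: "2 \<le> n \<Longrightarrow>
    weak_equivalence (level W n) (spines W n) (\<lambda>k x. \<lambda>i\<in>{..<n}. hact W n k [i, Suc i] x)"
begin

abbreviation "spine n k x \<equiv> (\<lambda>i\<in>{..<n}. hact W n k [i, Suc i] x)"

text \<open>Surjectivity of the Segal map on components, written out: some n-simplex has a spine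
  joined to \<open>y\<close> by a path.\<close>

lemma spine_component:
  assumes "2 \<le> n" "y \<in> simps (spines W n) 0"
  shows "\<exists>x w. x \<in> bsimps W n 0 \<and> (\<forall>i<n. w i \<in> bsimps W 1 1 \<and>
      (Suc i < n \<longrightarrow> hact W 1 1 [1] (w i) = hact W 1 1 [0] (w (Suc i))) \<and>
      vact W 1 1 [0] (w i) = hact W n 0 [i, Suc i] x \<and> vact W 1 1 [1] (w i) = y i)"
proof -
  obtain x where x: "x \<in> bsimps W n 0" "same_component (spines W n) (spine n 0 x) y"
    using segal[OF assms(1)] assms(2) unfolding weak_equivalence_def by auto
  then obtain w where w: "w \<in> simps (spines W n) 1" "act (spines W n) 1 [0] w = spine n 0 x" "act (spines W n) 1 [1] w = y"
    unfolding same_component_def by blast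
  have "vact W 1 1 [0] (w i) = hact W n 0 [i, Suc i] x" "vact W 1 1 [1] (w i) = y i" if "i < n" for i
    using fun_cong[OF w(2), of i] fun_cong[OF w(3), of i] that by (simp_all add: spines_def)
  then show ?thesis
    using x(1) w(1) by (intro exI[of _ x] exI[of _ w]) (auto simp: spines_def)
qed

text \<open>The Segal condition gives a 2-simplex whose spine is joined to (f, g) by a path.
  Transporting the 2-simplex along that path makes its spine equal to (f, g).\<close>

lemma segal_2:
  assumes "f \<in> bsimps W 1 0" "g \<in> bsimps W 1 0" "hact W 1 0 [1] f = hact W 1 0 [0] g"
  obtains \<sigma> where "\<sigma> \<in> bsimps W 2 0" "hact W 2 0 [0, 1] \<sigma> = f" "hact W 2 0 [1, 2] \<sigma> = g"
proof -
  define y where "y = (\<lambda>i\<in>{..<2::nat}. if i = 0 then f else g)"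
  have "y \<in> simps (spines W 2) 0"
    using assms by (auto simp: spines_def y_def)
  then obtain x w where x: "x \<in> bsimps W 2 0" and w: "\<forall>i<2. w i \<in> bsimps W 1 1 \<and>
      (Suc i < 2 \<longrightarrow> hact W 1 1 [1] (w i) = hact W 1 1 [0] (w (Suc i))) \<and>
      vact W 1 1 [0] (w i) = hact W 2 0 [i, Suc i] x \<and> vact W 1 1 [1] (w i) = y i"
    using spine_component[OF order_refl, of y] by blast
  have w: "w 0 \<in> bsimps W 1 1" "w 1 \<in> bsimps W 1 1" "hact W 1 1 [1] (w 0) = hact W 1 1 [0] (w 1)"
    "vact W 1 1 [0] (w 0) = hact W 2 0 [0, 1] x" "vact W 1 1 [0] (w 1) = hact W 2 0 [1, 2] x"
    "vact W 1 1 [1] (w 0) = f" "vact W 1 1 [1] (w 1) = g"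
    using w[rule_format, of 0] w[rule_format, of 1] by (simp_all add: y_def numeral_2_eq_2)
  obtain z where z: "z \<in> bsimps W 2 1" "hact W 2 1 [0, 1] z = w 0" "hact W 2 1 [1, 2] z = w 1"
    "vact W 2 1 [0] z = x"
    by (rule spine_path[OF _ x w(1-3), of 0]) (use w in simp_all)
  have "hact W 2 0 [0, 1] (vact W 2 1 [1] z) = vact W 1 1 [1] (hact W 2 1 [0, 1] z)"
    "hact W 2 0 [1, 2] (vact W 2 1 [1] z) = vact W 1 1 [1] (hact W 2 1 [1, 2] z)"
    "vact W 2 1 [1] z \<in> bsimps W 2 0"
    using z(1) by (simp_all add: bacts)
  then show thesis
    using that[of "vact W 2 1 [1] z"] z w by simp
qed

text \<open>As in dimension 2; the path of spines is first extended to three faces and then to the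
  3-simplex.\<close>

lemma segal_3:
  assumes "f \<in> bsimps W 1 0" "g \<in> bsimps W 1 0" "h \<in> bsimps W 1 0"
    "hact W 1 0 [1] f = hact W 1 0 [0] g" "hact W 1 0 [1] g = hact W 1 0 [0] h"
  obtains \<sigma> where "\<sigma> \<in> bsimps W 3 0" "hact W 3 0 [0, 1] \<sigma> = f" "hact W 3 0 [1, 2] \<sigma> = g" "hact W 3 0 [2, 3] \<sigma> = h"
proof -
  define y where "y = (\<lambda>i\<in>{..<3::nat}. if i = 0 then f else if i = 1 then g else h)"
  have "y \<in> simps (spines W 3) 0"
    using assms by (auto simp: spines_def y_def less_Suc_eq numeral_3_eq_3)
  then obtain x w where x: "x \<in> bsimps W 3 0" and w: "\<forall>i<3. w i \<in> bsimps W 1 1 \<and>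
      (Suc i < 3 \<longrightarrow> hact W 1 1 [1] (w i) = hact W 1 1 [0] (w (Suc i))) \<and>
      vact W 1 1 [0] (w i) = hact W 3 0 [i, Suc i] x \<and> vact W 1 1 [1] (w i) = y i"
    using spine_component[of 3 y] by auto
  have w: "w 0 \<in> bsimps W 1 1" "w 1 \<in> bsimps W 1 1" "w 2 \<in> bsimps W 1 1"
    "hact W 1 1 [1] (w 0) = hact W 1 1 [0] (w 1)" "hact W 1 1 [1] (w 1) = hact W 1 1 [0] (w 2)"
    "vact W 1 1 [0] (w 0) = hact W 3 0 [0, 1] x" "vact W 1 1 [0] (w 1) = hact W 3 0 [1, 2] x"
    "vact W 1 1 [0] (w 2) = hact W 3 0 [2, 3] x"
    "vact W 1 1 [1] (w 0) = f" "vact W 1 1 [1] (w 1) = g" "vact W 1 1 [1] (w 2) = h"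
    using w[rule_format, of 0] w[rule_format, of 1] w[rule_format, of 2]
    by (simp_all add: y_def numeral_2_eq_2 numeral_3_eq_3)
  have faces: "hact W 3 0 [0, 1, 2] x \<in> bsimps W 2 0" "hact W 3 0 [1, 2, 3] x \<in> bsimps W 2 0"
    "hact W 3 0 [0, 1, 3] x \<in> bsimps W 2 0"
    using x by (simp_all add: hacts)
  obtain A where A: "A \<in> bsimps W 2 1" "hact W 2 1 [0, 1] A = w 0" "hact W 2 1 [1, 2] A = w 1"
    "vact W 2 1 [0] A = hact W 3 0 [0, 1, 2] x"
    by (rule spine_path[OF _ faces(1) w(1,2,4), of 0]) (use x w in \<open>simp_all add: hacts\<close>)
  obtain B where B: "B \<in> bsimps W 2 1" "hact W 2 1 [0, 1] B = w 1" "hact W 2 1 [1, 2] B = w 2"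
    "vact W 2 1 [0] B = hact W 3 0 [1, 2, 3] x"
    by (rule spine_path[OF _ faces(2) w(2,3,5), of 0]) (use x w in \<open>simp_all add: hacts\<close>)
  let ?b = "hact W 2 1 [0, 2] B"
  have b: "?b \<in> bsimps W 1 1" "hact W 1 1 [1] (w 0) = hact W 1 1 [0] ?b"
    "vact W 1 1 [0] ?b = hact W 2 0 [0, 2] (vact W 2 1 [0] B)"
  proof -
    have "hact W 1 1 [0] (w 1) = hact W 2 1 [0] B"
      unfolding B(2)[symmetric] using B(1) by (simp add: hacts)
    then show "hact W 1 1 [1] (w 0) = hact W 1 1 [0] ?b"
      using B(1) w(4) by (simp add: hacts)
  qed (use B(1) in \<open>simp_all add: bacts\<close>)
  obtain E where E: "E \<in> bsimps W 2 1" "hact W 2 1 [0, 1] E = w 0" "hact W 2 1 [1, 2] E = ?b"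
    "vact W 2 1 [0] E = hact W 3 0 [0, 1, 3] x"
    by (rule spine_path[OF _ faces(3) w(1) b(1,2), of 0]) (use x w b B in \<open>simp_all add: hacts\<close>)
  obtain z where z: "z \<in> bsimps W 3 1" "hact W 3 1 [0, 1, 2] z = A" "hact W 3 1 [1, 2, 3] z = B"
    by (rule tet_horn_path[OF _ x A(1) B(1) E(1), of 0]) (use A B E in simp_all)
  let ?z = "vact W 3 1 [1] z"
  have "hact W 3 0 [0, 1] ?z = vact W 1 1 [1] (hact W 2 1 [0, 1] (hact W 3 1 [0, 1, 2] z))"
    "hact W 3 0 [1, 2] ?z = vact W 1 1 [1] (hact W 2 1 [1, 2] (hact W 3 1 [0, 1, 2] z))"
    "hact W 3 0 [2, 3] ?z = vact W 1 1 [1] (hact W 2 1 [1, 2] (hact W 3 1 [1, 2, 3] z))"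
    "?z \<in> bsimps W 3 0"
    using z(1) by (simp_all add: bacts)
  then show thesis
    using that[of ?z] A B w z by simp
qed

text \<open>
  The fibres of the Segal map are connected: a path between two points of a fibre maps to a loop,
  which is corrected by a loop upstairs before it is lifted to the fibre.
\<close>

lemma fibre_connected:
  assumes E: "E \<in> bsimps W 2 0" "E' \<in> bsimps W 2 0"
    "hact W 2 0 [0, 1] E = hact W 2 0 [0, 1] E'" "hact W 2 0 [1, 2] E = hact W 2 0 [1, 2] E'"
  obtains Q where "Q \<in> bsimps W 2 1" "vact W 2 1 [0] Q = E" "vact W 2 1 [1] Q = E'"
    "hact W 2 1 [0, 1] Q = vact W 1 0 [0, 0] (hact W 2 0 [0, 1] E')"
    "hact W 2 1 [1, 2] Q = vact W 1 0 [0, 0] (hact W 2 0 [1, 2] E')"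
proof -
  let ?X = "level W 2" and ?Y = "spines W 2" and ?q = "spine 2"
  have we: "weak_equivalence ?X ?Y ?q"
    by (rule segal[OF order_refl])
  then have q: "simplicial_map ?X ?Y ?q"
    unfolding weak_equivalence_def by blast
  have "?q 0 E = ?q 0 E'"
  proof
    fix i :: nat
    have "i = 0 \<or> i = 1 \<or> \<not> i < 2"
      by auto
    then show "?q 0 E i = ?q 0 E' i"
      using E(3,4) by (auto simp: numeral_2_eq_2)
  qed
  have q_in: "?q 0 E' \<in> simps ?Y 0"
    using simplicial_map_in[OF q] E(2) by simp
  have "same_component ?Y (?q 0 E') (?q 0 E)"
    unfolding \<open>?q 0 E = ?q 0 E'\<close>
    by (rule same_component_simplicial_map[OF q]) (use same_component_refl[OF level_sset] E(2) in simp)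
  then have "same_component ?X E' E"
    using we E(1,2) unfolding weak_equivalence_def by simp
  then obtain \<gamma> where \<gamma>: "\<gamma> \<in> bsimps W 2 1" "vact W 2 1 [0] \<gamma> = E'" "vact W 2 1 [1] \<gamma> = E"
    unfolding same_component_def by auto
  have q_deg: "deg ?Y n (?q 0 E') = ?q n (vact W 2 0 (replicate (Suc n) 0) E')" for n
    using simplicial_map_deg[OF q, of E' n] E(2) unfolding deg_def by simp
  have deg0: "deg ?Y 0 (?q 0 E') = ?q 0 E'"
    unfolding q_deg using E(2) by (simp add: vacts)
  \<comment> \<open>The spine of \<gamma> is a loop because \<open>E\<close> and \<open>E'\<close>
    have the same spine. Surjectivity on first homotopy groups gives a loop \<alpha> at
    \<open>E'\<close> whose spine is homotopic to it.\<close>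
  have "sphere ?Y 1 (?q 0 E') (?q 1 \<gamma>)"
    unfolding sphere_def
  proof (intro conjI allI impI)
    show "?q 1 \<gamma> \<in> simps ?Y 1"
      using simplicial_map_in[OF q] \<gamma>(1) by simp
    fix i :: nat
    assume "i \<le> 1"
    then have "face ?Y 1 i (?q 1 \<gamma>) = ?q 0 (face ?X 1 i \<gamma>)"
      using simplicial_map_face[OF q, of \<gamma> 0 i] \<gamma>(1) by simp
    also have "\<dots> = ?q 0 E'"
      using \<open>i \<le> 1\<close> \<gamma>(2,3) \<open>?q 0 E = ?q 0 E'\<close> face_1[of ?X \<gamma>] by (cases "i = 0") (auto simp: le_Suc_eq)
    finally show "face ?Y 1 i (?q 1 \<gamma>) = deg ?Y (1 - 1) (?q 0 E')"
      using deg0 by simp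
  qed
  moreover note conjunct2[OF conjunct2[OF conjunct2[OF we[unfolded weak_equivalence_def]]],
      THEN spec[of _ 1], THEN mp, OF order_refl, THEN bspec[of _ _ E'], unfolded simps_level, OF E(2),
      THEN conjunct1, THEN spec[of _ "?q 1 \<gamma>"]]
  ultimately obtain \<alpha> where \<alpha>: "sphere ?X 1 E' \<alpha>" "sphere_homotopic ?Y 1 (?q 0 E') (?q 1 \<alpha>) (?q 1 \<gamma>)"
    by blast
  have \<alpha>1: "\<alpha> \<in> bsimps W 2 1" "vact W 2 1 [0] \<alpha> = E'" "vact W 2 1 [1] \<alpha> = E'"
  proof -
    have "deg ?X 0 E' = E'"
      using E(2) by (simp add: deg_def vacts)
    then show "\<alpha> \<in> bsimps W 2 1" "vact W 2 1 [0] \<alpha> = E'" "vact W 2 1 [1] \<alpha> = E'"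
      using \<alpha>(1) face_1[of ?X \<alpha>] unfolding sphere_def by (auto simp: le_Suc_eq)
  qed
  obtain w where w: "w \<in> simps ?Y 2" "face ?Y 2 1 w = ?q 1 \<alpha>" "face ?Y 2 2 w = ?q 1 \<gamma>"
    "face ?Y 2 0 w = deg ?Y 1 (?q 0 E')"
    using \<alpha>(2) unfolding sphere_homotopic_def by (auto simp: numeral_2_eq_2)
  have w_in: "w 0 \<in> bsimps W 1 2" "w 1 \<in> bsimps W 1 2" "hact W 1 2 [1] (w 0) = hact W 1 2 [0] (w 1)"
  proof -
    have *: "w \<in> (\<Pi>\<^sub>E i\<in>{..<2}. bsimps W 1 2)" "\<forall>i. Suc i < 2 \<longrightarrow> hact W 1 2 [1] (w i) = hact W 1 2 [0] (w (Suc i))"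
      using w(1) by (simp_all add: spines_def)
    show "w 0 \<in> bsimps W 1 2" "w 1 \<in> bsimps W 1 2"
      by (rule PiE_mem[OF *(1)], simp)+
    show "hact W 1 2 [1] (w 0) = hact W 1 2 [0] (w 1)"
      using *(2)[rule_format, of 0] by simp
  qed
  have w_face: "face (level W 1) 2 j (w i) = face ?Y 2 j w i" if "i < 2" for i j
    using that by (simp add: spines_def face_def)
  \<comment> \<open>Face 0 of the lift runs from the end of \<gamma> to the end of \<alpha>, that is
    from \<open>E\<close> to \<open>E'\<close>, and lies over face 0 of \<open>w\<close>, which is
    constant.\<close>
  define y where "y = (\<lambda>i::nat. if i = 1 then \<alpha> else \<gamma>)"
  have "horn ?X 2 0 y"
    using \<alpha>1 \<gamma> by (intro horn_2I) (auto simp: y_def)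
  moreover have "hact W 2 (2 - 1) [0, 1] (y j) = face (level W 1) 2 j (w 0)"
    "hact W 2 (2 - 1) [1, 2] (y j) = face (level W 1) 2 j (w 1)" if "j \<le> 2" "j \<noteq> 0" for j
  proof -
    have spine: "?q 1 x 0 = hact W 2 1 [0, 1] x" "?q 1 x 1 = hact W 2 1 [1, 2] x" for x
      by (simp_all add: numeral_2_eq_2)
    have "hact W 2 1 [0, 1] (y j) = face (level W 1) 2 j (w 0) \<and>
        hact W 2 1 [1, 2] (y j) = face (level W 1) 2 j (w 1)"
    proof (cases "j = 1")
      case True
      then show ?thesis
        using w_face[of 0 1] w_face[of 1 1] spine[of \<alpha>] unfolding w(2) by (simp add: y_def)
    next
      case False
      then have "j = 2"
        using that by simp
      then show ?thesis
        using w_face[of 0 2] w_face[of 1 2] spine[of \<gamma>] unfolding w(3) by (simp add: y_def)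
    qed
    then show "hact W 2 (2 - 1) [0, 1] (y j) = face (level W 1) 2 j (w 0)"
      "hact W 2 (2 - 1) [1, 2] (y j) = face (level W 1) 2 j (w 1)"
      by simp_all
  qed
  ultimately obtain z where z: "z \<in> bsimps W 2 2" "hact W 2 2 [0, 1] z = w 0" "hact W 2 2 [1, 2] z = w 1"
    "\<forall>j\<le>2. j \<noteq> 0 \<longrightarrow> face ?X 2 j z = y j"
    using spine_lift[OF one_le_numeral le0 _ w_in, of y] by auto
  let ?Q = "vact W 2 2 [1, 2] z"
  have z12: "vact W 2 2 [0, 2] z = \<alpha>" "vact W 2 2 [0, 1] z = \<gamma>"
    using z(4)[rule_format, of 1] z(4)[rule_format, of 2] by (simp_all add: face_2 y_def)
  show thesis
  proof (rule that[of ?Q])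
    show "?Q \<in> bsimps W 2 1"
      using z(1) by (simp add: vacts)
    have "vact W 2 1 [0] ?Q = vact W 2 1 [1] (vact W 2 2 [0, 1] z)"
      "vact W 2 1 [1] ?Q = vact W 2 1 [1] (vact W 2 2 [0, 2] z)"
      using z(1) by (simp_all add: vacts)
    then show "vact W 2 1 [0] ?Q = E" "vact W 2 1 [1] ?Q = E'"
      unfolding z12 using \<gamma> \<alpha>1 by simp_all
    have "hact W 2 1 [0, 1] ?Q = face ?Y 2 0 w 0" "hact W 2 1 [1, 2] ?Q = face ?Y 2 0 w 1"
      using z(1-3) w_face[of 0 0] w_face[of 1 0] by (simp_all add: bacts face_2)
    moreover have "replicate 2 (0::nat) = [0, 0]"
      by (simp add: numeral_2_eq_2)
    ultimately show "hact W 2 1 [0, 1] ?Q = vact W 1 0 [0, 0] (hact W 2 0 [0, 1] E')"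
      "hact W 2 1 [1, 2] ?Q = vact W 1 0 [0, 0] (hact W 2 0 [1, 2] E')"
      unfolding w(4) q_deg using E(2) by (simp_all add: bacts numeral_2_eq_2[symmetric])
  qed
qed

text \<open>The path (f, g) is lifted from \<open>E\<close>; its end lies in the fibre of
  \<open>E'\<close> and is joined to \<open>E'\<close> inside that fibre. The concatenation is
  lifted over a degenerate triangle, so that its spine is (f, g) again.\<close>

lemma fibre_path:
  assumes E: "E \<in> bsimps W 2 0" "E' \<in> bsimps W 2 0"
    and fg: "f \<in> bsimps W 1 1" "g \<in> bsimps W 1 1" "hact W 1 1 [1] f = hact W 1 1 [0] g"
    and ends: "vact W 1 1 [0] f = hact W 2 0 [0, 1] E" "vact W 1 1 [1] f = hact W 2 0 [0, 1] E'"
      "vact W 1 1 [0] g = hact W 2 0 [1, 2] E" "vact W 1 1 [1] g = hact W 2 0 [1, 2] E'"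
  obtains P where "P \<in> bsimps W 2 1" "vact W 2 1 [0] P = E" "vact W 2 1 [1] P = E'"
    "hact W 2 1 [0, 1] P = f" "hact W 2 1 [1, 2] P = g"
proof -
  obtain P1 where P1: "P1 \<in> bsimps W 2 1" "hact W 2 1 [0, 1] P1 = f" "hact W 2 1 [1, 2] P1 = g"
    "vact W 2 1 [0] P1 = E"
    by (rule spine_path[OF _ E(1) fg, of 0]) (use ends in simp_all)
  let ?E = "vact W 2 1 [1] P1"
  have E1: "?E \<in> bsimps W 2 0" "hact W 2 0 [0, 1] ?E = hact W 2 0 [0, 1] E'"
    "hact W 2 0 [1, 2] ?E = hact W 2 0 [1, 2] E'"
    using P1 ends by (simp_all add: bacts)
  obtain Q where Q: "Q \<in> bsimps W 2 1" "vact W 2 1 [0] Q = ?E" "vact W 2 1 [1] Q = E'"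
    "hact W 2 1 [0, 1] Q = vact W 1 0 [0, 0] (hact W 2 0 [0, 1] E')"
    "hact W 2 1 [1, 2] Q = vact W 1 0 [0, 0] (hact W 2 0 [1, 2] E')"
    by (rule fibre_connected[OF E1(1) E(2) E1(2,3)])
  define y where "y = (\<lambda>i::nat. if i = 0 then Q else P1)"
  have h: "horn (level W 2) 2 1 y"
    using P1 Q by (intro horn_2I) (auto simp: y_def)
  let ?f = "vact W 1 1 [0, 1, 1] f" and ?g = "vact W 1 1 [0, 1, 1] g"
  have fg2: "?f \<in> bsimps W 1 2" "?g \<in> bsimps W 1 2" "hact W 1 2 [1] ?f = hact W 1 2 [0] ?g"
    using fg by (simp_all add: bacts)
  have "hact W 2 (2 - 1) [0, 1] (y j) = face (level W 1) 2 j ?f"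
    "hact W 2 (2 - 1) [1, 2] (y j) = face (level W 1) 2 j ?g" if "j \<le> 2" "j \<noteq> 1" for j
    using that P1 Q fg unfolding ends(2,4)[symmetric] le_2_cases
    by (auto simp: y_def face_2 bacts)
  then obtain z where z: "z \<in> bsimps W 2 2" "hact W 2 2 [0, 1] z = ?f" "hact W 2 2 [1, 2] z = ?g"
    "\<forall>j\<le>2. j \<noteq> 1 \<longrightarrow> face (level W 2) 2 j z = y j"
    using spine_lift[OF one_le_numeral one_le_numeral h fg2] by blast
  have z12: "vact W 2 2 [1, 2] z = Q" "vact W 2 2 [0, 1] z = P1"
    using z(4)[rule_format, of 0] z(4)[rule_format, of 2] by (simp_all add: face_2 y_def)
  let ?P = "vact W 2 2 [0, 2] z"
  show thesis
  proof (rule that[of ?P])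
    show "?P \<in> bsimps W 2 1"
      using z(1) by (simp add: vacts)
    have "vact W 2 1 [0] ?P = vact W 2 1 [0] (vact W 2 2 [0, 1] z)"
      "vact W 2 1 [1] ?P = vact W 2 1 [1] (vact W 2 2 [1, 2] z)"
      using z(1) by (simp_all add: vacts)
    then show "vact W 2 1 [0] ?P = E" "vact W 2 1 [1] ?P = E'"
      unfolding z12 using P1 Q by simp_all
    show "hact W 2 1 [0, 1] ?P = f" "hact W 2 1 [1, 2] ?P = g"
      using z(1-3) fg by (simp_all add: bacts)
  qed
qed

text \<open>A 3-simplex with the spine of the horn exists. Two of its faces are joined to
  \<open>A\<close> and \<open>B\<close> within fibres of the Segal map, the third to
  \<open>E\<close> over the resulting path of the edge [1, 3]; along these paths the 3-simplex is
  transported to the horn.\<close>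

lemma inner_horn_3:
  assumes "A \<in> bsimps W 2 0" "B \<in> bsimps W 2 0" "E \<in> bsimps W 2 0"
    "hact W 2 0 [1, 2] A = hact W 2 0 [0, 1] B" "hact W 2 0 [0, 1] A = hact W 2 0 [0, 1] E"
    "hact W 2 0 [0, 2] B = hact W 2 0 [1, 2] E"
  obtains z where "z \<in> bsimps W 3 0"
    "hact W 3 0 [0, 1, 2] z = A" "hact W 3 0 [1, 2, 3] z = B" "hact W 3 0 [0, 1, 3] z = E"
proof -
  let ?f = "hact W 2 0 [0, 1] A" and ?g = "hact W 2 0 [1, 2] A" and ?h = "hact W 2 0 [1, 2] B"
  have fgh: "?f \<in> bsimps W 1 0" "?g \<in> bsimps W 1 0" "?h \<in> bsimps W 1 0"
    and comp: "hact W 1 0 [1] ?f = hact W 1 0 [0] ?g" "hact W 1 0 [1] ?g = hact W 1 0 [0] ?h"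
  proof -
    show "hact W 1 0 [1] ?g = hact W 1 0 [0] ?h"
      unfolding assms(4) using assms(2) by (simp add: hacts)
  qed (use assms(1,2) in \<open>simp_all add: hacts\<close>)
  obtain Z where Z: "Z \<in> bsimps W 3 0" "hact W 3 0 [0, 1] Z = ?f" "hact W 3 0 [1, 2] Z = ?g" "hact W 3 0 [2, 3] Z = ?h"
    by (rule segal_3[OF fgh comp])
  let ?c = "vact W 1 0 [0, 0]"
  have c: "?c x \<in> bsimps W 1 1" "vact W 1 1 [0] (?c x) = x" "vact W 1 1 [1] (?c x) = x"
    if "x \<in> bsimps W 1 0" for x
    using that by (simp_all add: bacts)
  have c4: "hact W 1 1 [i] (?c x) = vact W 0 0 [0, 0] (hact W 1 0 [i] x)"
    if "x \<in> bsimps W 1 0" "i \<le> 1" for x i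
    using that by (simp add: bacts)
  have faces: "hact W 3 0 [0, 1, 2] Z \<in> bsimps W 2 0" "hact W 3 0 [1, 2, 3] Z \<in> bsimps W 2 0"
    "hact W 3 0 [0, 1, 3] Z \<in> bsimps W 2 0"
    using Z(1) by (simp_all add: hacts)
  obtain PA where PA: "PA \<in> bsimps W 2 1" "vact W 2 1 [0] PA = hact W 3 0 [0, 1, 2] Z" "vact W 2 1 [1] PA = A"
    "hact W 2 1 [0, 1] PA = ?c ?f" "hact W 2 1 [1, 2] PA = ?c ?g"
    by (rule fibre_path[OF faces(1) assms(1) c(1)[OF fgh(1)] c(1)[OF fgh(2)]])
      (use Z fgh comp c c4 in \<open>simp_all add: hact_hact\<close>)
  obtain PB where PB: "PB \<in> bsimps W 2 1" "vact W 2 1 [0] PB = hact W 3 0 [1, 2, 3] Z" "vact W 2 1 [1] PB = B"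
    "hact W 2 1 [0, 1] PB = ?c ?g" "hact W 2 1 [1, 2] PB = ?c ?h"
    by (rule fibre_path[OF faces(2) assms(2) c(1)[OF fgh(2)] c(1)[OF fgh(3)]])
      (use Z fgh comp c c4 assms(4) in \<open>simp_all add: hact_hact\<close>)
  let ?b = "hact W 2 1 [0, 2] PB"
  have b: "?b \<in> bsimps W 1 1" "hact W 1 1 [0] ?b = hact W 1 1 [0] (hact W 2 1 [0, 1] PB)"
    "vact W 1 1 [0] ?b = hact W 2 0 [0, 2] (vact W 2 1 [0] PB)"
    "vact W 1 1 [1] ?b = hact W 2 0 [0, 2] (vact W 2 1 [1] PB)"
    using PB(1) by (simp_all add: bacts)
  have b0: "hact W 1 1 [1] (?c ?f) = hact W 1 1 [0] ?b"
    unfolding b(2) PB(4) using c4[OF fgh(1), of 1] c4[OF fgh(2), of 0] comp(1) by simp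
  obtain PE where PE: "PE \<in> bsimps W 2 1" "vact W 2 1 [0] PE = hact W 3 0 [0, 1, 3] Z" "vact W 2 1 [1] PE = E"
    "hact W 2 1 [0, 1] PE = ?c ?f" "hact W 2 1 [1, 2] PE = ?b"
  proof (rule fibre_path[OF faces(3) assms(3) c(1)[OF fgh(1)] b(1) b0])
    show "vact W 1 1 [0] ?b = hact W 2 0 [1, 2] (hact W 3 0 [0, 1, 3] Z)"
      unfolding b(3) PB(2) using Z(1) by (simp add: hact_hact)
    show "vact W 1 1 [1] ?b = hact W 2 0 [1, 2] E"
      unfolding b(4) PB(3) using assms(6) .
  qed (use Z fgh c assms(5) in \<open>simp_all add: hact_hact\<close>)
  obtain z where z: "z \<in> bsimps W 3 1" "hact W 3 1 [0, 1, 2] z = PA" "hact W 3 1 [1, 2, 3] z = PB" "hact W 3 1 [0, 1, 3] z = PE"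
    by (rule tet_horn_path[OF _ Z(1) PA(1) PB(1) PE(1), of 0]) (use PA PB PE in simp_all)
  have "hact W 3 0 [0, 1, 2] (vact W 3 1 [1] z) = A" "hact W 3 0 [1, 2, 3] (vact W 3 1 [1] z) = B"
    "hact W 3 0 [0, 1, 3] (vact W 3 1 [1] z) = E" "vact W 3 1 [1] z \<in> bsimps W 3 0"
    using z PA(3) PB(3) PE(3) by (simp_all add: bacts)
  then show thesis
    using that by blast
qed

end

section \<open>Equivalences in complete Segal spaces\<close>

text \<open>Invertibility on both sides with composites equal to identities, not merely joined to
  them by paths; the inverses are the remaining edges of the two triangles.\<close>

definition s_inv :: "'a bsset \<Rightarrow> 'a \<Rightarrow> bool" where
  "s_inv W f \<longleftrightarrow> f \<in> bsimps W 1 0 \<and>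
     (\<exists>\<sigma>\<in>bsimps W 2 0. hact W 2 0 [0, 1] \<sigma> = f \<and>
        hact W 2 0 [0, 2] \<sigma> = hact W 0 0 [0, 0] (hact W 1 0 [0] f)) \<and>
     (\<exists>\<tau>\<in>bsimps W 2 0. hact W 2 0 [1, 2] \<tau> = f \<and>
        hact W 2 0 [0, 2] \<tau> = hact W 0 0 [0, 0] (hact W 1 0 [1] f))"

lemma s_equivD:
  assumes "s_equiv W f"
  shows "\<exists>\<sigma>\<in>bsimps W 2 0. \<exists>w\<in>bsimps W 1 1. hact W 2 0 [0, 1] \<sigma> = f \<and>
        hact W 1 1 [0] w = vact W 0 0 [0, 0] (hact W 1 0 [0] f) \<and>
        hact W 1 1 [1] w = vact W 0 0 [0, 0] (hact W 1 0 [0] f) \<and>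
        vact W 1 1 [0] w = hact W 2 0 [0, 2] \<sigma> \<and>
        vact W 1 1 [1] w = hact W 0 0 [0, 0] (hact W 1 0 [0] f)"
    and "\<exists>\<tau>\<in>bsimps W 2 0. \<exists>w\<in>bsimps W 1 1. hact W 2 0 [1, 2] \<tau> = f \<and>
        hact W 1 1 [0] w = vact W 0 0 [0, 0] (hact W 1 0 [1] f) \<and>
        hact W 1 1 [1] w = vact W 0 0 [0, 0] (hact W 1 0 [1] f) \<and>
        vact W 1 1 [0] w = hact W 2 0 [0, 2] \<tau> \<and>
        vact W 1 1 [1] w = hact W 0 0 [0, 0] (hact W 1 0 [1] f)"
  using assms unfolding s_equiv_def Let_def same_component_def s_map_def
  by (simp_all add: vdeg_1 s_ident_eq) blast+

context bisimplicial
begin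

text \<open>The definition of an equivalence without the redundant inverses.\<close>

lemma s_equiv_iff:
  "s_equiv W f \<longleftrightarrow> f \<in> bsimps W 1 0 \<and>
     (\<exists>\<sigma>\<in>bsimps W 2 0. \<exists>w\<in>bsimps W 1 1. hact W 2 0 [0, 1] \<sigma> = f \<and>
        hact W 1 1 [0] w = vact W 0 0 [0, 0] (hact W 1 0 [0] f) \<and>
        hact W 1 1 [1] w = vact W 0 0 [0, 0] (hact W 1 0 [0] f) \<and>
        vact W 1 1 [0] w = hact W 2 0 [0, 2] \<sigma> \<and>
        vact W 1 1 [1] w = hact W 0 0 [0, 0] (hact W 1 0 [0] f)) \<and>
     (\<exists>\<tau>\<in>bsimps W 2 0. \<exists>w\<in>bsimps W 1 1. hact W 2 0 [1, 2] \<tau> = f \<and>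
        hact W 1 1 [0] w = vact W 0 0 [0, 0] (hact W 1 0 [1] f) \<and>
        hact W 1 1 [1] w = vact W 0 0 [0, 0] (hact W 1 0 [1] f) \<and>
        vact W 1 1 [0] w = hact W 2 0 [0, 2] \<tau> \<and>
        vact W 1 1 [1] w = hact W 0 0 [0, 0] (hact W 1 0 [1] f))"
    (is "?L \<longleftrightarrow> ?R")
proof
  assume ?L
  then show ?R
    using s_equivD[of W f] by (simp add: s_equiv_def)
next
  assume R: ?R
  let ?x = "hact W 1 0 [0] f" and ?y = "hact W 1 0 [1] f"
  have f: "f \<in> bsimps W 1 0"
    using R by blast
  have xy: "?x \<in> bsimps W 0 0" "?y \<in> bsimps W 0 0"
    using f by (simp_all add: hacts)
  obtain \<sigma> v where \<sigma>: "\<sigma> \<in> bsimps W 2 0" "v \<in> bsimps W 1 1" "hact W 2 0 [0, 1] \<sigma> = f"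
    "hact W 1 1 [0] v = vact W 0 0 [0, 0] ?x" "hact W 1 1 [1] v = vact W 0 0 [0, 0] ?x"
    "vact W 1 1 [0] v = hact W 2 0 [0, 2] \<sigma>" "vact W 1 1 [1] v = hact W 0 0 [0, 0] ?x"
    using R by blast
  obtain \<tau> w where \<tau>: "\<tau> \<in> bsimps W 2 0" "w \<in> bsimps W 1 1" "hact W 2 0 [1, 2] \<tau> = f"
    "hact W 1 1 [0] w = vact W 0 0 [0, 0] ?y" "hact W 1 1 [1] w = vact W 0 0 [0, 0] ?y"
    "vact W 1 1 [0] w = hact W 2 0 [0, 2] \<tau>" "vact W 1 1 [1] w = hact W 0 0 [0, 0] ?y"
    using R by blast
  have "hact W 1 0 [1] (hact W 2 0 [1, 2] \<sigma>) = ?x"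
  proof -
    have "hact W 1 0 [1] (hact W 2 0 [1, 2] \<sigma>) = hact W 1 0 [1] (vact W 1 1 [0] v)"
      unfolding \<sigma>(6) using \<sigma>(1) by (simp add: hacts)
    also have "\<dots> = vact W 0 1 [0] (vact W 0 0 [0, 0] ?x)"
      unfolding \<sigma>(5)[symmetric] using \<sigma>(2) by (simp add: bacts)
    also have "\<dots> = ?x"
      using xy(1) by (simp add: vacts)
    finally show ?thesis .
  qed
  moreover have "hact W 1 0 [0] (hact W 2 0 [1, 2] \<sigma>) = ?y"
    unfolding \<sigma>(3)[symmetric] using \<sigma>(1) by (simp add: hacts)
  moreover have "hact W 1 0 [0] (hact W 2 0 [0, 1] \<tau>) = ?y"
  proof -
    have "hact W 1 0 [0] (hact W 2 0 [0, 1] \<tau>) = hact W 1 0 [0] (vact W 1 1 [0] w)"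
      unfolding \<tau>(6) using \<tau>(1) by (simp add: hacts)
    also have "\<dots> = vact W 0 1 [0] (vact W 0 0 [0, 0] ?y)"
      unfolding \<tau>(4)[symmetric] using \<tau>(2) by (simp add: bacts)
    also have "\<dots> = ?y"
      using xy(2) by (simp add: vacts)
    finally show ?thesis .
  qed
  moreover have "hact W 1 0 [1] (hact W 2 0 [0, 1] \<tau>) = ?x"
    unfolding \<tau>(3)[symmetric] using \<tau>(1) by (simp add: hacts)
  moreover have "hact W 2 0 [1, 2] \<sigma> \<in> bsimps W 1 0" "hact W 2 0 [0, 1] \<tau> \<in> bsimps W 1 0"
    using \<sigma>(1) \<tau>(1) by (simp_all add: hacts)
  ultimately have gh: "hact W 2 0 [1, 2] \<sigma> \<in> simps (s_map W ?y ?x) 0" "hact W 2 0 [0, 1] \<tau> \<in> simps (s_map W ?y ?x) 0"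
    unfolding s_map_def using xy by (simp_all add: vdeg_0)
  have "same_component (s_map W ?x ?x) (hact W 2 0 [0, 2] \<sigma>) (s_ident W ?x)"
    unfolding same_component_def s_map_def using \<sigma> by (intro bexI[of _ v]) (simp_all add: vdeg_1 s_ident_eq)
  moreover have "same_component (s_map W ?y ?y) (hact W 2 0 [0, 2] \<tau>) (s_ident W ?y)"
    unfolding same_component_def s_map_def using \<tau> by (intro bexI[of _ w]) (simp_all add: vdeg_1 s_ident_eq)
  ultimately show ?L
    unfolding s_equiv_def Let_def using f gh \<sigma>(1,3) \<tau>(1,3) by blast
qed

lemma s_equiv_if_s_inv:
  assumes "s_inv W f"
  shows "s_equiv W f"
proof -
  let ?x = "hact W 1 0 [0] f" and ?y = "hact W 1 0 [1] f"
  obtain \<sigma> \<tau> where f: "f \<in> bsimps W 1 0" and \<sigma>: "\<sigma> \<in> bsimps W 2 0" "hact W 2 0 [0, 1] \<sigma> = f"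
      "hact W 2 0 [0, 2] \<sigma> = hact W 0 0 [0, 0] ?x"
    and \<tau>: "\<tau> \<in> bsimps W 2 0" "hact W 2 0 [1, 2] \<tau> = f" "hact W 2 0 [0, 2] \<tau> = hact W 0 0 [0, 0] ?y"
    using assms unfolding s_inv_def by blast
  have path: "vact W 1 0 [0, 0] (hact W 0 0 [0, 0] z) \<in> bsimps W 1 1 \<and>
      hact W 1 1 [0] (vact W 1 0 [0, 0] (hact W 0 0 [0, 0] z)) = vact W 0 0 [0, 0] z \<and>
      hact W 1 1 [1] (vact W 1 0 [0, 0] (hact W 0 0 [0, 0] z)) = vact W 0 0 [0, 0] z \<and>
      vact W 1 1 [0] (vact W 1 0 [0, 0] (hact W 0 0 [0, 0] z)) = hact W 0 0 [0, 0] z \<and>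
      vact W 1 1 [1] (vact W 1 0 [0, 0] (hact W 0 0 [0, 0] z)) = hact W 0 0 [0, 0] z" if "z \<in> bsimps W 0 0" for z
    using that by (simp add: bacts)
  have xy: "?x \<in> bsimps W 0 0" "?y \<in> bsimps W 0 0"
    using f by (simp_all add: hacts)
  show ?thesis
    unfolding s_equiv_iff
  proof (intro conjI)
    show "\<exists>\<sigma>\<in>bsimps W 2 0. \<exists>w\<in>bsimps W 1 1. hact W 2 0 [0, 1] \<sigma> = f \<and>
        hact W 1 1 [0] w = vact W 0 0 [0, 0] ?x \<and> hact W 1 1 [1] w = vact W 0 0 [0, 0] ?x \<and>
        vact W 1 1 [0] w = hact W 2 0 [0, 2] \<sigma> \<and> vact W 1 1 [1] w = hact W 0 0 [0, 0] ?x"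
      using \<sigma> path[OF xy(1)] by (metis (no_types, lifting))
    show "\<exists>\<tau>\<in>bsimps W 2 0. \<exists>w\<in>bsimps W 1 1. hact W 2 0 [1, 2] \<tau> = f \<and>
        hact W 1 1 [0] w = vact W 0 0 [0, 0] ?y \<and> hact W 1 1 [1] w = vact W 0 0 [0, 0] ?y \<and>
        vact W 1 1 [0] w = hact W 2 0 [0, 2] \<tau> \<and> vact W 1 1 [1] w = hact W 0 0 [0, 0] ?y"
      using \<tau> path[OF xy(2)] by (metis (no_types, lifting))
  qed (rule f)
qed

end

lemma (in reedy) s_inv_if_s_equiv:
  assumes "s_equiv W f"
  shows "s_inv W f"
proof -
  let ?x = "hact W 1 0 [0] f" and ?y = "hact W 1 0 [1] f"
  \<comment> \<open>The third side of a triangle is replaced along a path that fixes its ends: the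
    two other sides stay constant and the triangle is transported.\<close>
  have strict: "\<exists>\<sigma>'\<in>bsimps W 2 0. hact W 2 0 [0, 1] \<sigma>' = hact W 2 0 [0, 1] \<sigma> \<and>
      hact W 2 0 [1, 2] \<sigma>' = hact W 2 0 [1, 2] \<sigma> \<and> hact W 2 0 [0, 2] \<sigma>' = vact W 1 1 [1] w"
    if \<sigma>: "\<sigma> \<in> bsimps W 2 0" and w: "w \<in> bsimps W 1 1" "vact W 1 1 [0] w = hact W 2 0 [0, 2] \<sigma>"
      "hact W 1 1 [0] w = vact W 0 0 [0, 0] (hact W 2 0 [0] \<sigma>)"
      "hact W 1 1 [1] w = vact W 0 0 [0, 0] (hact W 2 0 [2] \<sigma>)" for \<sigma> w
  proof -
    obtain z where z: "z \<in> bsimps W 2 1" "hact W 2 1 [0, 1] z = vact W 1 0 [0, 0] (hact W 2 0 [0, 1] \<sigma>)"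
      "hact W 2 1 [1, 2] z = vact W 1 0 [0, 0] (hact W 2 0 [1, 2] \<sigma>)" "hact W 2 1 [0, 2] z = w" "vact W 2 1 [0] z = \<sigma>"
      by (rule tri_path[OF _ \<sigma> _ _ w(1), of 0 "vact W 1 0 [0, 0] (hact W 2 0 [0, 1] \<sigma>)"
          "vact W 1 0 [0, 0] (hact W 2 0 [1, 2] \<sigma>)"]) (use \<sigma> w(2-4) in \<open>simp_all add: bacts\<close>)
    let ?\<sigma> = "vact W 2 1 [1] z"
    have "hact W 2 0 [0, 1] ?\<sigma> = vact W 1 1 [1] (hact W 2 1 [0, 1] z)"
      "hact W 2 0 [1, 2] ?\<sigma> = vact W 1 1 [1] (hact W 2 1 [1, 2] z)"
      "hact W 2 0 [0, 2] ?\<sigma> = vact W 1 1 [1] (hact W 2 1 [0, 2] z)" "?\<sigma> \<in> bsimps W 2 0"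
      using z(1) by (simp_all add: bacts)
    then show ?thesis
      unfolding z(2-4) using \<sigma> by (intro bexI[of _ ?\<sigma>]) (simp_all add: bacts)
  qed
  have f: "f \<in> bsimps W 1 0"
    using assms unfolding s_equiv_iff by blast
  obtain \<sigma> v where \<sigma>: "\<sigma> \<in> bsimps W 2 0" "v \<in> bsimps W 1 1" "hact W 2 0 [0, 1] \<sigma> = f"
    "hact W 1 1 [0] v = vact W 0 0 [0, 0] ?x" "hact W 1 1 [1] v = vact W 0 0 [0, 0] ?x"
    "vact W 1 1 [0] v = hact W 2 0 [0, 2] \<sigma>" "vact W 1 1 [1] v = hact W 0 0 [0, 0] ?x"
    using assms unfolding s_equiv_iff by blast
  obtain \<tau> w where \<tau>: "\<tau> \<in> bsimps W 2 0" "w \<in> bsimps W 1 1" "hact W 2 0 [1, 2] \<tau> = f"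
    "hact W 1 1 [0] w = vact W 0 0 [0, 0] ?y" "hact W 1 1 [1] w = vact W 0 0 [0, 0] ?y"
    "vact W 1 1 [0] w = hact W 2 0 [0, 2] \<tau>" "vact W 1 1 [1] w = hact W 0 0 [0, 0] ?y"
    using assms unfolding s_equiv_iff by blast
  have end0: "hact W 2 0 [0] \<rho> = vact W 0 1 [0] (hact W 1 1 [0] u)" "hact W 2 0 [2] \<rho> = vact W 0 1 [0] (hact W 1 1 [1] u)"
    if "\<rho> \<in> bsimps W 2 0" "u \<in> bsimps W 1 1" "vact W 1 1 [0] u = hact W 2 0 [0, 2] \<rho>" for \<rho> u
  proof -
    have "hact W 1 0 [0] (vact W 1 1 [0] u) = hact W 2 0 [0] \<rho>" "hact W 1 0 [1] (vact W 1 1 [0] u) = hact W 2 0 [2] \<rho>"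
      unfolding that(3) using that(1) by (simp_all add: hacts)
    then show "hact W 2 0 [0] \<rho> = vact W 0 1 [0] (hact W 1 1 [0] u)" "hact W 2 0 [2] \<rho> = vact W 0 1 [0] (hact W 1 1 [1] u)"
      using that(2) by (simp_all add: bacts)
  qed
  have xy: "vact W 0 1 [0] (vact W 0 0 [0, 0] ?x) = ?x" "vact W 0 1 [0] (vact W 0 0 [0, 0] ?y) = ?y"
    using f by (simp_all add: bacts)
  have "hact W 2 0 [0] \<sigma> = ?x" "hact W 2 0 [2] \<sigma> = ?x" "hact W 2 0 [0] \<tau> = ?y" "hact W 2 0 [2] \<tau> = ?y"
    using end0[OF \<sigma>(1,2,6)] end0[OF \<tau>(1,2,6)] unfolding \<sigma>(4,5) \<tau>(4,5) xy by simp_all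
  then have "\<exists>\<sigma>'\<in>bsimps W 2 0. hact W 2 0 [0, 1] \<sigma>' = f \<and> hact W 2 0 [0, 2] \<sigma>' = hact W 0 0 [0, 0] ?x"
    "\<exists>\<tau>'\<in>bsimps W 2 0. hact W 2 0 [1, 2] \<tau>' = f \<and> hact W 2 0 [0, 2] \<tau>' = hact W 0 0 [0, 0] ?y"
    using strict[OF \<sigma>(1,2,6)] strict[OF \<tau>(1,2,6)] \<sigma>(3-5,7) \<tau>(3-5,7) by auto
  then show ?thesis
    unfolding s_inv_def using f by blast
qed

text \<open>The inverses are transported along the paths of the end points, and then the two
  triangles. Their third side moves through identities of the end points, so it stays an
  identity.\<close>

lemma (in reedy) s_inv_path:
  assumes w: "w \<in> bsimps W 1 1" and ee: "e \<le> 1" "e' \<le> 1" and f: "s_inv W (vact W 1 1 [e] w)"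
  shows "s_inv W (vact W 1 1 [e'] w)"
proof -
  let ?f = "vact W 1 1 [e] w" and ?\<alpha> = "hact W 1 1 [0] w" and ?\<beta> = "hact W 1 1 [1] w"
  have ab: "?\<alpha> \<in> bsimps W 0 1" "?\<beta> \<in> bsimps W 0 1"
    using w by (simp_all add: bacts)
  have s0: "hact W 0 1 [0, 0] \<gamma> \<in> bsimps W 1 1" "hact W 1 1 [0] (hact W 0 1 [0, 0] \<gamma>) = \<gamma>"
    "hact W 1 1 [1] (hact W 0 1 [0, 0] \<gamma>) = \<gamma>"
    "d \<le> 1 \<Longrightarrow> vact W 1 1 [d] (hact W 0 1 [0, 0] \<gamma>) = hact W 0 0 [0, 0] (vact W 0 1 [d] \<gamma>)"
    if "\<gamma> \<in> bsimps W 0 1" for \<gamma> d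
    using that by (simp_all add: bacts)
  obtain \<sigma> \<tau> where \<sigma>: "\<sigma> \<in> bsimps W 2 0" "hact W 2 0 [0, 1] \<sigma> = ?f"
      "hact W 2 0 [0, 2] \<sigma> = hact W 0 0 [0, 0] (hact W 1 0 [0] ?f)"
    and \<tau>: "\<tau> \<in> bsimps W 2 0" "hact W 2 0 [1, 2] \<tau> = ?f" "hact W 2 0 [0, 2] \<tau> = hact W 0 0 [0, 0] (hact W 1 0 [1] ?f)"
    using f unfolding s_inv_def by blast
  have f01: "hact W 1 0 [0] (vact W 1 1 [d] w) = vact W 0 1 [d] ?\<alpha>"
    "hact W 1 0 [1] (vact W 1 1 [d] w) = vact W 0 1 [d] ?\<beta>" if "d \<le> 1" for d
    using that w by (simp_all add: bacts)
  note f01' = f01[OF ee(1)]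
  have \<sigma>12: "hact W 1 0 [0] (hact W 2 0 [1, 2] \<sigma>) = vact W 0 1 [e] ?\<beta>"
    "hact W 1 0 [1] (hact W 2 0 [1, 2] \<sigma>) = vact W 0 1 [e] ?\<alpha>"
  proof -
    have "hact W 1 0 [0] (hact W 2 0 [1, 2] \<sigma>) = hact W 1 0 [1] (hact W 2 0 [0, 1] \<sigma>)"
      "hact W 1 0 [1] (hact W 2 0 [1, 2] \<sigma>) = hact W 1 0 [1] (hact W 2 0 [0, 2] \<sigma>)"
      using \<sigma>(1) by (simp_all add: hacts)
    then show "hact W 1 0 [0] (hact W 2 0 [1, 2] \<sigma>) = vact W 0 1 [e] ?\<beta>"
      "hact W 1 0 [1] (hact W 2 0 [1, 2] \<sigma>) = vact W 0 1 [e] ?\<alpha>"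
      unfolding \<sigma>(2,3) f01' using ab ee(1) by (simp_all add: bacts)
  qed
  have \<tau>01: "hact W 1 0 [0] (hact W 2 0 [0, 1] \<tau>) = vact W 0 1 [e] ?\<beta>"
    "hact W 1 0 [1] (hact W 2 0 [0, 1] \<tau>) = vact W 0 1 [e] ?\<alpha>"
  proof -
    have "hact W 1 0 [0] (hact W 2 0 [0, 1] \<tau>) = hact W 1 0 [0] (hact W 2 0 [0, 2] \<tau>)"
      "hact W 1 0 [1] (hact W 2 0 [0, 1] \<tau>) = hact W 1 0 [0] (hact W 2 0 [1, 2] \<tau>)"
      using \<tau>(1) by (simp_all add: hacts)
    then show "hact W 1 0 [0] (hact W 2 0 [0, 1] \<tau>) = vact W 0 1 [e] ?\<beta>"
      "hact W 1 0 [1] (hact W 2 0 [0, 1] \<tau>) = vact W 0 1 [e] ?\<alpha>"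
      unfolding \<tau>(2,3) f01' using ab ee(1) by (simp_all add: bacts)
  qed
  have gh: "hact W 2 0 [1, 2] \<sigma> \<in> bsimps W 1 0" "hact W 2 0 [0, 1] \<tau> \<in> bsimps W 1 0"
    using \<sigma>(1) \<tau>(1) by (simp_all add: hacts)
  obtain g where g: "g \<in> bsimps W 1 1" "hact W 1 1 [0] g = ?\<beta>" "hact W 1 1 [1] g = ?\<alpha>"
    "vact W 1 1 [e] g = hact W 2 0 [1, 2] \<sigma>"
    by (rule edge_path[OF ee(1) gh(1) ab(2,1) \<sigma>12])
  obtain h where h: "h \<in> bsimps W 1 1" "hact W 1 1 [0] h = ?\<beta>" "hact W 1 1 [1] h = ?\<alpha>"
    "vact W 1 1 [e] h = hact W 2 0 [0, 1] \<tau>"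
    by (rule edge_path[OF ee(1) gh(2) ab(2,1) \<tau>01])
  obtain P where P: "P \<in> bsimps W 2 1" "hact W 2 1 [0, 1] P = w" "hact W 2 1 [0, 2] P = hact W 0 1 [0, 0] ?\<alpha>"
    by (rule tri_path[OF ee(1) \<sigma>(1) w g(1) s0(1)[OF ab(1)]])
      (use g s0(2-4)[OF ab(1)] \<sigma> f01' ee in simp_all)
  obtain Q where Q: "Q \<in> bsimps W 2 1" "hact W 2 1 [1, 2] Q = w" "hact W 2 1 [0, 2] Q = hact W 0 1 [0, 0] ?\<beta>"
    by (rule tri_path[OF ee(1) \<tau>(1) h(1) w s0(1)[OF ab(2)]])
      (use h s0(2-4)[OF ab(2)] \<tau> f01' ee in simp_all)
  have PQ: "hact W 2 0 [0, 1] (vact W 2 1 [e'] P) = vact W 1 1 [e'] (hact W 2 1 [0, 1] P)"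
    "hact W 2 0 [0, 2] (vact W 2 1 [e'] P) = vact W 1 1 [e'] (hact W 2 1 [0, 2] P)"
    "hact W 2 0 [1, 2] (vact W 2 1 [e'] Q) = vact W 1 1 [e'] (hact W 2 1 [1, 2] Q)"
    "hact W 2 0 [0, 2] (vact W 2 1 [e'] Q) = vact W 1 1 [e'] (hact W 2 1 [0, 2] Q)"
    using P(1) Q(1) ee(2) by (simp_all add: bacts)
  have "hact W 2 0 [0, 1] (vact W 2 1 [e'] P) = vact W 1 1 [e'] w"
    "hact W 2 0 [0, 2] (vact W 2 1 [e'] P) = hact W 0 0 [0, 0] (hact W 1 0 [0] (vact W 1 1 [e'] w))"
    "vact W 2 1 [e'] P \<in> bsimps W 2 0"
    "hact W 2 0 [1, 2] (vact W 2 1 [e'] Q) = vact W 1 1 [e'] w"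
    "hact W 2 0 [0, 2] (vact W 2 1 [e'] Q) = hact W 0 0 [0, 0] (hact W 1 0 [1] (vact W 1 1 [e'] w))"
    "vact W 2 1 [e'] Q \<in> bsimps W 2 0"
    unfolding PQ P(2,3) Q(2,3) f01[OF ee(2)]
    using P(1) Q(1) ee(2) s0(4)[OF ab(1) ee(2)] s0(4)[OF ab(2) ee(2)] by (simp_all add: vacts)
  moreover have "vact W 1 1 [e'] w \<in> bsimps W 1 0"
    using w ee(2) by (simp add: vacts)
  ultimately show ?thesis
    unfolding s_inv_def by blast
qed

locale css = segal W for W :: "'a bsset" +
  assumes complete: "weak_equivalence (level W 0) (hoequiv_space W) (\<lambda>k. hact W 0 k [0, 0])"
begin

lemma equiv_iff: "s_equiv W f \<longleftrightarrow> s_inv W f"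
  using s_equiv_if_s_inv s_inv_if_s_equiv by blast

text \<open>Surjectivity on components of the map from objects to the space of equivalences.\<close>

lemma equiv_path_ident:
  assumes "s_equiv W f"
  obtains z w where "z \<in> bsimps W 0 0" "w \<in> bsimps W 1 1" "vact W 1 1 [0] w = hact W 0 0 [0, 0] z" "vact W 1 1 [1] w = f"
proof -
  have "f \<in> bsimps W 1 0"
    using assms by (simp add: s_equiv_def)
  then have "f \<in> simps (hoequiv_space W) 0"
    using assms by (simp add: hoequiv_space_def vact_id)
  then obtain z where z: "z \<in> bsimps W 0 0" "same_component (hoequiv_space W) (hact W 0 0 [0, 0] z) f"
    using complete unfolding weak_equivalence_def by auto
  then show thesis
    using that[OF z(1)] unfolding same_component_def hoequiv_space_def by auto
qed

text \<open>An equivalence is joined to an identity by a path, and the triangle is transported along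
  it. A triangle with an identity as first or last side of its spine is joined, by connectedness of
  the fibres, to a degenerate one, whose other two sides coincide. Invertibility is constant along
  all these paths.\<close>

lemma cancel_equiv:
  assumes \<sigma>: "\<sigma> \<in> bsimps W 2 0"
  shows "s_equiv W (hact W 2 0 [0, 1] \<sigma>) \<Longrightarrow>
      s_equiv W (hact W 2 0 [1, 2] \<sigma>) \<longleftrightarrow> s_equiv W (hact W 2 0 [0, 2] \<sigma>)"
    and "s_equiv W (hact W 2 0 [1, 2] \<sigma>) \<Longrightarrow>
      s_equiv W (hact W 2 0 [0, 1] \<sigma>) \<longleftrightarrow> s_equiv W (hact W 2 0 [0, 2] \<sigma>)"
proof -
  have path: "s_equiv W (vact W 1 1 [0] w) \<longleftrightarrow> s_equiv W (vact W 1 1 [1] w)" if "w \<in> bsimps W 1 1" for w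
    using s_inv_path[OF that, of 0 1] s_inv_path[OF that, of 1 0] unfolding equiv_iff by auto
  have edges: "hact W 2 0 \<theta> (vact W 2 1 [e] P) = vact W 1 1 [e] (hact W 2 1 \<theta> P)"
    "hact W 2 1 \<theta> P \<in> bsimps W 1 1" "vact W 2 1 [e] P \<in> bsimps W 2 0"
    if "P \<in> bsimps W 2 1" "e \<le> 1" "\<theta> \<in> {[0, 1], [1, 2], [0, 2]}" for \<theta> e P
    using that by (auto simp: bacts)
  have step: "s_equiv W (hact W 2 0 \<theta> (vact W 2 1 [0] P)) \<longleftrightarrow> s_equiv W (hact W 2 0 \<theta> (vact W 2 1 [1] P))"
    if "P \<in> bsimps W 2 1" "\<theta> \<in> {[0, 1], [1, 2], [0, 2]}" for P \<theta>
    using path[OF edges(2)[OF that(1) le0 that(2)]] edges(1)[OF that(1) le0 that(2)]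
      edges(1)[OF that(1) order_refl that(2)] by simp
  have f: "hact W 2 0 [0, 1] \<sigma> \<in> bsimps W 1 0" "hact W 2 0 [1, 2] \<sigma> \<in> bsimps W 1 0"
    using \<sigma> by (simp_all add: hacts)
  show "s_equiv W (hact W 2 0 [1, 2] \<sigma>) \<longleftrightarrow> s_equiv W (hact W 2 0 [0, 2] \<sigma>)"
    if "s_equiv W (hact W 2 0 [0, 1] \<sigma>)"
  proof -
    obtain z w where z: "z \<in> bsimps W 0 0" and w: "w \<in> bsimps W 1 1" "vact W 1 1 [0] w = hact W 0 0 [0, 0] z"
      "vact W 1 1 [1] w = hact W 2 0 [0, 1] \<sigma>"
      using equiv_path_ident[OF \<open>s_equiv W (hact W 2 0 [0, 1] \<sigma>)\<close>] by metis
    \<comment> \<open>\<open>?\<beta>\<close> is the path of the middle vertex; \<open>?c\<close>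
      keeps the last vertex constant.\<close>
    let ?\<beta> = "hact W 1 1 [1] w" and ?c = "vact W 0 0 [0, 0] (hact W 2 0 [2] \<sigma>)"
    have ends: "?\<beta> \<in> bsimps W 0 1" "?c \<in> bsimps W 0 1"
      "hact W 1 0 [0] (hact W 2 0 [1, 2] \<sigma>) = vact W 0 1 [1] ?\<beta>"
      "hact W 1 0 [1] (hact W 2 0 [1, 2] \<sigma>) = vact W 0 1 [1] ?c"
    proof -
      have "vact W 0 1 [1] ?\<beta> = hact W 1 0 [1] (vact W 1 1 [1] w)"
        using w(1) by (simp add: bacts)
      then show "hact W 1 0 [0] (hact W 2 0 [1, 2] \<sigma>) = vact W 0 1 [1] ?\<beta>"
        unfolding w(3) using \<sigma> by (simp add: hacts)
    qed (use w(1) \<sigma> in \<open>simp_all add: bacts\<close>)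
    obtain g where g: "g \<in> bsimps W 1 1" "hact W 1 1 [0] g = ?\<beta>" "hact W 1 1 [1] g = ?c"
      "vact W 1 1 [1] g = hact W 2 0 [1, 2] \<sigma>"
      by (rule edge_path[OF order_refl f(2) ends])
    obtain P where P: "P \<in> bsimps W 2 1" "hact W 2 1 [0, 1] P = w" "hact W 2 1 [1, 2] P = g" "vact W 2 1 [1] P = \<sigma>"
      by (rule spine_path[OF order_refl \<sigma> w(1) g(1)]) (use w g in simp_all)
    define \<sigma>' where "\<sigma>' = vact W 2 1 [0] P"
    have \<sigma>': "\<sigma>' \<in> bsimps W 2 0" "hact W 2 0 [0, 1] \<sigma>' = hact W 0 0 [0, 0] z"
      using P w(2) edges[OF P(1) le0, of "[0, 1]"] by (simp_all add: \<sigma>'_def)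
    let ?g = "hact W 2 0 [1, 2] \<sigma>'"
    \<comment> \<open>The degenerate triangle on \<open>?g\<close> has the spine of \<sigma>'
      because the first side of \<sigma>' is an identity.\<close>
    let ?E = "hact W 1 0 [0, 0, 1] ?g"
    have "hact W 1 0 [1] (hact W 2 0 [0, 1] \<sigma>') = hact W 1 0 [0] ?g"
      using \<sigma>'(1) by (simp add: hacts)
    then have "hact W 1 0 [0] ?g = z"
      unfolding \<sigma>'(2) using z by (simp add: hacts)
    moreover have "?E \<in> bsimps W 2 0" "hact W 2 0 [0, 1] ?E = hact W 0 0 [0, 0] (hact W 1 0 [0] ?g)"
      "hact W 2 0 [1, 2] ?E = ?g" "hact W 2 0 [0, 2] ?E = ?g"
      using \<sigma>'(1) by (simp_all add: hacts)
    ultimately have E: "?E \<in> bsimps W 2 0" "hact W 2 0 [0, 1] ?E = hact W 2 0 [0, 1] \<sigma>'"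
      "hact W 2 0 [1, 2] ?E = ?g" "hact W 2 0 [0, 2] ?E = ?g"
      using \<sigma>'(2) by simp_all
    obtain Q where Q: "Q \<in> bsimps W 2 1" "vact W 2 1 [0] Q = ?E" "vact W 2 1 [1] Q = \<sigma>'"
      by (rule fibre_connected[OF E(1) \<sigma>'(1) E(2,3)])
    have "s_equiv W (hact W 2 0 [1, 2] \<sigma>) \<longleftrightarrow> s_equiv W ?g"
      using step[OF P(1), of "[1, 2]"] P(4) \<sigma>'_def by simp
    also have "\<dots> \<longleftrightarrow> s_equiv W (hact W 2 0 [0, 2] \<sigma>')"
      using step[OF Q(1), of "[0, 2]"] unfolding Q(2,3) E(4) by simp
    also have "\<dots> \<longleftrightarrow> s_equiv W (hact W 2 0 [0, 2] \<sigma>)"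
      using step[OF P(1), of "[0, 2]"] P(4) \<sigma>'_def by simp
    finally show ?thesis .
  qed
  show "s_equiv W (hact W 2 0 [0, 1] \<sigma>) \<longleftrightarrow> s_equiv W (hact W 2 0 [0, 2] \<sigma>)"
    if "s_equiv W (hact W 2 0 [1, 2] \<sigma>)"
  proof -
    obtain z w where z: "z \<in> bsimps W 0 0" and w: "w \<in> bsimps W 1 1" "vact W 1 1 [0] w = hact W 0 0 [0, 0] z"
      "vact W 1 1 [1] w = hact W 2 0 [1, 2] \<sigma>"
      using equiv_path_ident[OF \<open>s_equiv W (hact W 2 0 [1, 2] \<sigma>)\<close>] by metis
    let ?\<alpha> = "hact W 1 1 [0] w" and ?c = "vact W 0 0 [0, 0] (hact W 2 0 [0] \<sigma>)"
    have ends: "?c \<in> bsimps W 0 1" "?\<alpha> \<in> bsimps W 0 1"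
      "hact W 1 0 [0] (hact W 2 0 [0, 1] \<sigma>) = vact W 0 1 [1] ?c"
      "hact W 1 0 [1] (hact W 2 0 [0, 1] \<sigma>) = vact W 0 1 [1] ?\<alpha>"
    proof -
      have "vact W 0 1 [1] ?\<alpha> = hact W 1 0 [0] (vact W 1 1 [1] w)"
        using w(1) by (simp add: bacts)
      then show "hact W 1 0 [1] (hact W 2 0 [0, 1] \<sigma>) = vact W 0 1 [1] ?\<alpha>"
        unfolding w(3) using \<sigma> by (simp add: hacts)
    qed (use w(1) \<sigma> in \<open>simp_all add: bacts\<close>)
    obtain g where g: "g \<in> bsimps W 1 1" "hact W 1 1 [0] g = ?c" "hact W 1 1 [1] g = ?\<alpha>"
      "vact W 1 1 [1] g = hact W 2 0 [0, 1] \<sigma>"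
      by (rule edge_path[OF order_refl f(1) ends])
    obtain P where P: "P \<in> bsimps W 2 1" "hact W 2 1 [0, 1] P = g" "hact W 2 1 [1, 2] P = w" "vact W 2 1 [1] P = \<sigma>"
      by (rule spine_path[OF order_refl \<sigma> g(1) w(1)]) (use w g in simp_all)
    define \<sigma>' where "\<sigma>' = vact W 2 1 [0] P"
    have \<sigma>': "\<sigma>' \<in> bsimps W 2 0" "hact W 2 0 [1, 2] \<sigma>' = hact W 0 0 [0, 0] z"
      using P w(2) edges[OF P(1) le0, of "[1, 2]"] by (simp_all add: \<sigma>'_def)
    let ?g = "hact W 2 0 [0, 1] \<sigma>'"
    let ?E = "hact W 1 0 [0, 1, 1] ?g"
    have "hact W 1 0 [0] (hact W 2 0 [1, 2] \<sigma>') = hact W 1 0 [1] ?g"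
      using \<sigma>'(1) by (simp add: hacts)
    then have "hact W 1 0 [1] ?g = z"
      unfolding \<sigma>'(2) using z by (simp add: hacts)
    moreover have "?E \<in> bsimps W 2 0" "hact W 2 0 [1, 2] ?E = hact W 0 0 [0, 0] (hact W 1 0 [1] ?g)"
      "hact W 2 0 [0, 1] ?E = ?g" "hact W 2 0 [0, 2] ?E = ?g"
      using \<sigma>'(1) by (simp_all add: hacts)
    ultimately have E: "?E \<in> bsimps W 2 0" "hact W 2 0 [0, 1] ?E = ?g"
      "hact W 2 0 [1, 2] ?E = hact W 2 0 [1, 2] \<sigma>'" "hact W 2 0 [0, 2] ?E = ?g"
      using \<sigma>'(2) by simp_all
    obtain Q where Q: "Q \<in> bsimps W 2 1" "vact W 2 1 [0] Q = ?E" "vact W 2 1 [1] Q = \<sigma>'"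
      by (rule fibre_connected[OF E(1) \<sigma>'(1) E(2,3)])
    have "s_equiv W (hact W 2 0 [0, 1] \<sigma>) \<longleftrightarrow> s_equiv W ?g"
      using step[OF P(1), of "[0, 1]"] P(4) \<sigma>'_def by simp
    also have "\<dots> \<longleftrightarrow> s_equiv W (hact W 2 0 [0, 2] \<sigma>')"
      using step[OF Q(1), of "[0, 2]"] unfolding Q(2,3) E(4) by simp
    also have "\<dots> \<longleftrightarrow> s_equiv W (hact W 2 0 [0, 2] \<sigma>)"
      using step[OF P(1), of "[0, 2]"] P(4) \<sigma>'_def by simp
    finally show ?thesis .
  qed
qed

text \<open>
  An edge \<open>F\<close> of the slice over \<open>u\<close> whose image in \<open>W\<close> is an equivalence is connected to a
  degenerate edge of the slice, by completeness and the connectedness of the fibres of the Segal map.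
  Its inverses are those of the degenerate edge, transported along the paths.
\<close>

definition slice_inv :: "'a \<Rightarrow> bool" where
  "slice_inv F \<longleftrightarrow> (\<exists>\<Sigma>\<in>bsimps W 3 0. hact W 3 0 [0, 1, 3] \<Sigma> = F \<and>
       hact W 3 0 [0, 2, 3] \<Sigma> = hact W 1 0 [0, 0, 1] (hact W 2 0 [0, 2] F)) \<and>
     (\<exists>\<Sigma>\<in>bsimps W 3 0. hact W 3 0 [1, 2, 3] \<Sigma> = F \<and>
       hact W 3 0 [0, 2, 3] \<Sigma> = hact W 1 0 [0, 0, 1] (hact W 2 0 [1, 2] F))"

text \<open>A witness \<Sigma> is a tetrahedron made of \<open>F\<close>, a degenerate face and two
  further faces that share an edge back. That edge is moved first, then the two faces, then the
  tetrahedron; the degenerate face moves as the degeneracy of a moving structure map.\<close>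

lemma slice_inv_path:
  assumes \<Omega>: "\<Omega> \<in> bsimps W 2 1" and ee: "e \<le> 1" "e' \<le> 1" and F: "slice_inv (vact W 2 1 [e] \<Omega>)"
  shows "slice_inv (vact W 2 1 [e'] \<Omega>)"
proof -
  have s0: "hact W 1 1 [0, 0, 1] p \<in> bsimps W 2 1" "hact W 2 1 [0, 2] (hact W 1 1 [0, 0, 1] p) = p"
    "hact W 2 1 [1, 2] (hact W 1 1 [0, 0, 1] p) = p"
    "hact W 2 1 [0, 1] (hact W 1 1 [0, 0, 1] p) = hact W 0 1 [0, 0] (hact W 1 1 [0] p)"
    "d \<le> 1 \<Longrightarrow> vact W 2 1 [d] (hact W 1 1 [0, 0, 1] p) = hact W 1 0 [0, 0, 1] (vact W 1 1 [d] p)"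
    if "p \<in> bsimps W 1 1" for p d
    using that by (simp_all add: bacts)
  have edge: "hact W 2 0 \<theta> (vact W 2 1 [d] P) = vact W 1 1 [d] (hact W 2 1 \<theta> P)"
    if "P \<in> bsimps W 2 1" "d \<le> 1" "\<theta> \<in> {[0, 1], [1, 2], [0, 2]}" for P d \<theta>
    using that by (auto simp: bacts)
  have tet: "hact W 3 0 \<theta> (vact W 3 1 [d] P) = vact W 2 1 [d] (hact W 3 1 \<theta> P)"
    if "P \<in> bsimps W 3 1" "d \<le> 1" "\<theta> \<in> {[0, 1, 2], [1, 2, 3], [0, 2, 3], [0, 1, 3]}" for P d \<theta>
    using that by (auto simp: bacts)
  let ?f = "hact W 2 1 [0, 1] \<Omega>" and ?q = "hact W 2 1 [1, 2] \<Omega>" and ?p = "hact W 2 1 [0, 2] \<Omega>"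
  let ?F = "vact W 2 1 [e] \<Omega>"
  have fqp: "?f \<in> bsimps W 1 1" "?q \<in> bsimps W 1 1" "?p \<in> bsimps W 1 1"
    "hact W 1 1 [1] ?f = hact W 1 1 [0] ?q" "hact W 1 1 [0] ?p = hact W 1 1 [0] ?f" "hact W 1 1 [1] ?p = hact W 1 1 [1] ?q"
    using \<Omega> by (simp_all add: hacts)
  obtain L where L: "L \<in> bsimps W 3 0" "hact W 3 0 [0, 1, 3] L = ?F"
    "hact W 3 0 [0, 2, 3] L = vact W 2 1 [e] (hact W 1 1 [0, 0, 1] ?p)"
    using F s0(5)[OF fqp(3) ee(1)] edge[OF \<Omega> ee(1), of "[0, 2]"] unfolding slice_inv_def by auto
  obtain R where R: "R \<in> bsimps W 3 0" "hact W 3 0 [1, 2, 3] R = ?F"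
    "hact W 3 0 [0, 2, 3] R = vact W 2 1 [e] (hact W 1 1 [0, 0, 1] ?q)"
    using F s0(5)[OF fqp(2) ee(1)] edge[OF \<Omega> ee(1), of "[1, 2]"] unfolding slice_inv_def by auto
  have "\<exists>\<Sigma>\<in>bsimps W 3 0. hact W 3 0 [0, 1, 3] \<Sigma> = vact W 2 1 [e'] \<Omega> \<and>
      hact W 3 0 [0, 2, 3] \<Sigma> = vact W 2 1 [e'] (hact W 1 1 [0, 0, 1] ?p)"
  proof -
    let ?H = "hact W 1 1 [0, 0, 1] ?p"
    note H = s0[OF fqp(3)]
    have L3: "hact W 3 0 [0, 1] L = vact W 1 1 [e] ?f" "hact W 3 0 [1, 3] L = vact W 1 1 [e] ?q"
      "hact W 3 0 [0, 2] L = vact W 1 1 [e] (hact W 2 1 [0, 1] ?H)" "hact W 3 0 [2, 3] L = vact W 1 1 [e] ?p"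
    proof -
      have "hact W 3 0 [0, 1] L = hact W 2 0 [0, 1] (hact W 3 0 [0, 1, 3] L)"
        "hact W 3 0 [1, 3] L = hact W 2 0 [1, 2] (hact W 3 0 [0, 1, 3] L)"
        "hact W 3 0 [0, 2] L = hact W 2 0 [0, 1] (hact W 3 0 [0, 2, 3] L)"
        "hact W 3 0 [2, 3] L = hact W 2 0 [1, 2] (hact W 3 0 [0, 2, 3] L)"
        using L(1) by (simp_all add: hacts)
      then show "hact W 3 0 [0, 1] L = vact W 1 1 [e] ?f" "hact W 3 0 [1, 3] L = vact W 1 1 [e] ?q"
        "hact W 3 0 [0, 2] L = vact W 1 1 [e] (hact W 2 1 [0, 1] ?H)" "hact W 3 0 [2, 3] L = vact W 1 1 [e] ?p"
        unfolding L(2,3) using edge[OF \<Omega> ee(1)] edge[OF H(1) ee(1)] H(3) by simp_all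
    qed
    have g12: "hact W 3 0 [1, 2] L \<in> bsimps W 1 0" "hact W 1 1 [0] ?q \<in> bsimps W 0 1" "hact W 1 1 [0] ?p \<in> bsimps W 0 1"
      "hact W 1 0 [0] (hact W 3 0 [1, 2] L) = vact W 0 1 [e] (hact W 1 1 [0] ?q)"
      "hact W 1 0 [1] (hact W 3 0 [1, 2] L) = vact W 0 1 [e] (hact W 1 1 [0] ?p)"
    proof -
      have "vact W 0 1 [e] (hact W 1 1 [0] ?q) = hact W 1 0 [0] (hact W 3 0 [1, 3] L)"
        "vact W 0 1 [e] (hact W 1 1 [0] ?p) = hact W 1 0 [0] (hact W 3 0 [2, 3] L)"
        unfolding L3 using fqp ee(1) by (simp_all add: hact_vact_list)
      then show "hact W 1 0 [0] (hact W 3 0 [1, 2] L) = vact W 0 1 [e] (hact W 1 1 [0] ?q)"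
        "hact W 1 0 [1] (hact W 3 0 [1, 2] L) = vact W 0 1 [e] (hact W 1 1 [0] ?p)"
        using L(1) by (simp_all add: hacts)
    qed (use L(1) \<Omega> in \<open>simp_all add: hacts\<close>)
    obtain g where g: "g \<in> bsimps W 1 1" "hact W 1 1 [0] g = hact W 1 1 [0] ?q" "hact W 1 1 [1] g = hact W 1 1 [0] ?p"
      "vact W 1 1 [e] g = hact W 3 0 [1, 2] L"
      by (rule edge_path[OF ee(1) g12])
    have faces: "hact W 3 0 [0, 1, 2] L \<in> bsimps W 2 0" "hact W 3 0 [1, 2, 3] L \<in> bsimps W 2 0" "hact W 2 1 [0, 1] ?H \<in> bsimps W 1 1"
      using L(1) H(1) by (simp_all add: hacts)
    have x: "hact W 1 1 [0] ?p \<in> bsimps W 0 1"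
      using fqp(3) by (simp add: hacts)
    have H01: "hact W 1 1 [0] (hact W 2 1 [0, 1] ?H) = hact W 1 1 [0] ?p" "hact W 1 1 [1] (hact W 2 1 [0, 1] ?H) = hact W 1 1 [0] ?p"
      unfolding H(4) using x by (simp_all add: hacts)
    obtain A where A: "A \<in> bsimps W 2 1" "hact W 2 1 [0, 1] A = ?f" "hact W 2 1 [1, 2] A = g"
      "hact W 2 1 [0, 2] A = hact W 2 1 [0, 1] ?H" "vact W 2 1 [e] A = hact W 3 0 [0, 1, 2] L"
      by (rule tri_path[OF ee(1) faces(1) fqp(1) g(1) faces(3)])
        (use g fqp H01 L3 L(1) in \<open>simp_all add: hact_hact\<close>)
    obtain B where B: "B \<in> bsimps W 2 1" "hact W 2 1 [0, 1] B = g" "hact W 2 1 [1, 2] B = ?p"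
      "hact W 2 1 [0, 2] B = ?q" "vact W 2 1 [e] B = hact W 3 0 [1, 2, 3] L"
      by (rule tri_path[OF ee(1) faces(2) g(1) fqp(3,2)])
        (use g fqp L3 L(1) in \<open>simp_all add: hact_hact\<close>)
    obtain z where z: "z \<in> bsimps W 3 1" "hact W 3 1 [0, 1, 3] z = \<Omega>" "hact W 3 1 [0, 2, 3] z = ?H"
      by (rule tet_path[OF ee(1) L(1) A(1) B(1) \<Omega> H(1)])
        (use A B H L in simp_all)
    show ?thesis
      using tet[OF z(1) ee(2), of "[0, 1, 3]"] tet[OF z(1) ee(2), of "[0, 2, 3]"] z ee(2)
      by (intro bexI[of _ "vact W 3 1 [e'] z"]) (simp_all add: vacts)
  qed
  moreover have "\<exists>\<Sigma>\<in>bsimps W 3 0. hact W 3 0 [1, 2, 3] \<Sigma> = vact W 2 1 [e'] \<Omega> \<and>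
      hact W 3 0 [0, 2, 3] \<Sigma> = vact W 2 1 [e'] (hact W 1 1 [0, 0, 1] ?q)"
  proof -
    let ?H = "hact W 1 1 [0, 0, 1] ?q"
    note H = s0[OF fqp(2)]
    have R3: "hact W 3 0 [1, 2] R = vact W 1 1 [e] ?f" "hact W 3 0 [1, 3] R = vact W 1 1 [e] ?p"
      "hact W 3 0 [0, 2] R = vact W 1 1 [e] (hact W 2 1 [0, 1] ?H)" "hact W 3 0 [0, 3] R = vact W 1 1 [e] ?q"
    proof -
      have "hact W 3 0 [1, 2] R = hact W 2 0 [0, 1] (hact W 3 0 [1, 2, 3] R)"
        "hact W 3 0 [1, 3] R = hact W 2 0 [0, 2] (hact W 3 0 [1, 2, 3] R)"
        "hact W 3 0 [0, 2] R = hact W 2 0 [0, 1] (hact W 3 0 [0, 2, 3] R)"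
        "hact W 3 0 [0, 3] R = hact W 2 0 [0, 2] (hact W 3 0 [0, 2, 3] R)"
        using R(1) by (simp_all add: hacts)
      then show "hact W 3 0 [1, 2] R = vact W 1 1 [e] ?f" "hact W 3 0 [1, 3] R = vact W 1 1 [e] ?p"
        "hact W 3 0 [0, 2] R = vact W 1 1 [e] (hact W 2 1 [0, 1] ?H)" "hact W 3 0 [0, 3] R = vact W 1 1 [e] ?q"
        unfolding R(2,3) using edge[OF \<Omega> ee(1)] edge[OF H(1) ee(1)] H(2) by simp_all
    qed
    have g01: "hact W 3 0 [0, 1] R \<in> bsimps W 1 0" "hact W 1 1 [0] ?q \<in> bsimps W 0 1" "hact W 1 1 [0] ?p \<in> bsimps W 0 1"
      "hact W 1 0 [0] (hact W 3 0 [0, 1] R) = vact W 0 1 [e] (hact W 1 1 [0] ?q)"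
      "hact W 1 0 [1] (hact W 3 0 [0, 1] R) = vact W 0 1 [e] (hact W 1 1 [0] ?p)"
    proof -
      have "vact W 0 1 [e] (hact W 1 1 [0] ?q) = hact W 1 0 [0] (hact W 3 0 [0, 3] R)"
        "vact W 0 1 [e] (hact W 1 1 [0] ?p) = hact W 1 0 [0] (hact W 3 0 [1, 3] R)"
        unfolding R3 using fqp ee(1) by (simp_all add: hact_vact_list)
      then show "hact W 1 0 [0] (hact W 3 0 [0, 1] R) = vact W 0 1 [e] (hact W 1 1 [0] ?q)"
        "hact W 1 0 [1] (hact W 3 0 [0, 1] R) = vact W 0 1 [e] (hact W 1 1 [0] ?p)"
        using R(1) by (simp_all add: hacts)
    qed (use R(1) \<Omega> in \<open>simp_all add: hacts\<close>)
    obtain g where g: "g \<in> bsimps W 1 1" "hact W 1 1 [0] g = hact W 1 1 [0] ?q" "hact W 1 1 [1] g = hact W 1 1 [0] ?p"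
      "vact W 1 1 [e] g = hact W 3 0 [0, 1] R"
      by (rule edge_path[OF ee(1) g01])
    have faces: "hact W 3 0 [0, 1, 2] R \<in> bsimps W 2 0" "hact W 3 0 [0, 1, 3] R \<in> bsimps W 2 0" "hact W 2 1 [0, 1] ?H \<in> bsimps W 1 1"
      using R(1) H(1) by (simp_all add: hacts)
    have y: "hact W 1 1 [0] ?q \<in> bsimps W 0 1"
      using fqp(2) by (simp add: hacts)
    have H01: "hact W 1 1 [0] (hact W 2 1 [0, 1] ?H) = hact W 1 1 [0] ?q" "hact W 1 1 [1] (hact W 2 1 [0, 1] ?H) = hact W 1 1 [0] ?q"
      unfolding H(4) using y by (simp_all add: hacts)
    obtain A where A: "A \<in> bsimps W 2 1" "hact W 2 1 [0, 1] A = g" "hact W 2 1 [1, 2] A = ?f"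
      "hact W 2 1 [0, 2] A = hact W 2 1 [0, 1] ?H" "vact W 2 1 [e] A = hact W 3 0 [0, 1, 2] R"
      by (rule tri_path[OF ee(1) faces(1) g(1) fqp(1) faces(3)])
        (use g fqp H01 R3 R(1) in \<open>simp_all add: hact_hact\<close>)
    obtain E where E: "E \<in> bsimps W 2 1" "hact W 2 1 [0, 1] E = g" "hact W 2 1 [1, 2] E = ?p"
      "hact W 2 1 [0, 2] E = ?q" "vact W 2 1 [e] E = hact W 3 0 [0, 1, 3] R"
      by (rule tri_path[OF ee(1) faces(2) g(1) fqp(3,2)])
        (use g fqp R3 R(1) in \<open>simp_all add: hact_hact\<close>)
    obtain z where z: "z \<in> bsimps W 3 1" "hact W 3 1 [1, 2, 3] z = \<Omega>" "hact W 3 1 [0, 2, 3] z = ?H"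
      by (rule tet_path[OF ee(1) R(1) A(1) \<Omega> E(1) H(1)])
        (use A E H R in simp_all)
    show ?thesis
      using tet[OF z(1) ee(2), of "[1, 2, 3]"] tet[OF z(1) ee(2), of "[0, 2, 3]"] z ee(2)
      by (intro bexI[of _ "vact W 3 1 [e'] z"]) (simp_all add: vacts)
  qed
  ultimately show ?thesis
    unfolding slice_inv_def using s0(5)[OF fqp(3) ee(2)] s0(5)[OF fqp(2) ee(2)]
      edge[OF \<Omega> ee(2), of "[0, 2]"] edge[OF \<Omega> ee(2), of "[1, 2]"] by simp
qed

lemma slice_inv_if_equiv:
  assumes F: "F \<in> bsimps W 2 0" and f: "s_equiv W (hact W 2 0 [0, 1] F)"
  shows "slice_inv F"
proof -
  obtain z w where z: "z \<in> bsimps W 0 0" and w: "w \<in> bsimps W 1 1" "vact W 1 1 [0] w = hact W 0 0 [0, 0] z"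
    "vact W 1 1 [1] w = hact W 2 0 [0, 1] F"
    using equiv_path_ident[OF f] by metis
  let ?\<beta> = "hact W 1 1 [1] w" and ?c = "vact W 0 0 [0, 0] (hact W 2 0 [2] F)"
  have ends: "hact W 2 0 [1, 2] F \<in> bsimps W 1 0" "?\<beta> \<in> bsimps W 0 1" "?c \<in> bsimps W 0 1"
    "hact W 1 0 [0] (hact W 2 0 [1, 2] F) = vact W 0 1 [1] ?\<beta>"
    "hact W 1 0 [1] (hact W 2 0 [1, 2] F) = vact W 0 1 [1] ?c"
  proof -
    have "vact W 0 1 [1] ?\<beta> = hact W 1 0 [1] (vact W 1 1 [1] w)"
      using w(1) by (simp add: bacts)
    then show "hact W 1 0 [0] (hact W 2 0 [1, 2] F) = vact W 0 1 [1] ?\<beta>"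
      unfolding w(3) using F by (simp add: hacts)
  qed (use w(1) F in \<open>simp_all add: bacts\<close>)
  obtain q where q: "q \<in> bsimps W 1 1" "hact W 1 1 [0] q = ?\<beta>" "vact W 1 1 [1] q = hact W 2 0 [1, 2] F"
    by (rule edge_path[OF order_refl ends])
  obtain P where P: "P \<in> bsimps W 2 1" "hact W 2 1 [0, 1] P = w" "vact W 2 1 [1] P = F"
    by (rule spine_path[OF order_refl F w(1) q(1)]) (use w q in simp_all)
  define F' where "F' = vact W 2 1 [0] P"
  have F': "F' \<in> bsimps W 2 0" "hact W 2 0 [0, 1] F' = hact W 0 0 [0, 0] z"
    using P(1) by (simp_all add: F'_def bacts flip: w(2) P(2))
  let ?q = "hact W 2 0 [1, 2] F'"
  let ?E = "hact W 1 0 [0, 0, 1] ?q"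
  have qq: "?q \<in> bsimps W 1 0"
    using F'(1) by (simp add: hacts)
  have "hact W 1 0 [1] (hact W 2 0 [0, 1] F') = hact W 1 0 [0] ?q"
    using F'(1) by (simp add: hacts)
  then have "hact W 1 0 [0] ?q = z"
    unfolding F'(2) using z by (simp add: hacts)
  moreover have "?E \<in> bsimps W 2 0" "hact W 2 0 [0, 1] ?E = hact W 0 0 [0, 0] (hact W 1 0 [0] ?q)"
    "hact W 2 0 [1, 2] ?E = ?q"
    using F'(1) by (simp_all add: hacts)
  ultimately have E: "?E \<in> bsimps W 2 0" "hact W 2 0 [0, 1] ?E = hact W 2 0 [0, 1] F'"
    "hact W 2 0 [1, 2] ?E = ?q"
    using F'(2) by simp_all
  obtain Q where Q: "Q \<in> bsimps W 2 1" "vact W 2 1 [0] Q = ?E" "vact W 2 1 [1] Q = F'"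
    by (rule fibre_connected[OF E(1) F'(1) E(2,3)])
  \<comment> \<open>For a degenerate edge the doubly degenerate tetrahedron is a witness on both
    sides.\<close>
  have "slice_inv (hact W 1 0 [0, 0, 1] p)" if "p \<in> bsimps W 1 0" for p
  proof -
    have "hact W 1 0 [0, 0, 0, 1] p \<in> bsimps W 3 0"
      "hact W 3 0 [0, 1, 3] (hact W 1 0 [0, 0, 0, 1] p) = hact W 1 0 [0, 0, 1] p"
      "hact W 3 0 [1, 2, 3] (hact W 1 0 [0, 0, 0, 1] p) = hact W 1 0 [0, 0, 1] p"
      "hact W 3 0 [0, 2, 3] (hact W 1 0 [0, 0, 0, 1] p) = hact W 1 0 [0, 0, 1] p"
      "hact W 2 0 [0, 2] (hact W 1 0 [0, 0, 1] p) = p" "hact W 2 0 [1, 2] (hact W 1 0 [0, 0, 1] p) = p"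
      using that by (simp_all add: hacts)
    then show ?thesis
      unfolding slice_inv_def by metis
  qed
  \<comment> \<open>Invertibility travels from the degenerate edge to \<open>F'\<close> along
    \<open>Q\<close>, and on to \<open>F\<close> along \<open>P\<close>.\<close>
  from this[OF qq] have "slice_inv (vact W 2 1 [0] Q)"
    unfolding Q(2) .
  then have "slice_inv (vact W 2 1 [1] Q)"
    by (rule slice_inv_path[OF Q(1) le0 order_refl])
  then have "slice_inv (vact W 2 1 [1] P)"
    unfolding Q(3) F'_def by (rule slice_inv_path[OF P(1) le0 order_refl])
  then show ?thesis
    unfolding P(3) .
qed

end

lemma css_if_complete_segal_space:
  assumes "complete_segal_space W"
  shows "css W"
  using assms unfolding complete_segal_space_def segal_space_def by unfold_locales auto

section \<open>Powers and slices of bisimplicial sets\<close>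

lemma row_of_rows [simp]: "row (of_rows R v) k = R k"
  by (simp add: row_def of_rows_def)

lemma bsimps_of_rows: "bsimps (of_rows R v) n k = simps (R k) n"
  and hact_of_rows: "hact (of_rows R v) n k = act (R k) n"
  and vact_of_rows: "vact (of_rows R v) = v"
  by (simp_all add: of_rows_def)

lemma is_bssetI:
  assumes "\<And>k. is_sset (row W k)" "\<And>n. is_sset (level W n)"
    "\<And>m n k l \<theta> \<phi> x. \<theta> \<in> ops m n \<Longrightarrow> \<phi> \<in> ops l k \<Longrightarrow> x \<in> bsimps W n k \<Longrightarrow>
      hact W n l \<theta> (vact W n k \<phi> x) = vact W m k \<phi> (hact W n k \<theta> x)"
  shows "is_bsset W"
  unfolding is_bsset_def using assms by blast

lemma row_s_power: "row (s_power I C) k = prod_sset I (\<lambda>_. row C k)"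
  by (simp add: s_power_def)

lemma s_power_simps [simp]:
  "bsimps (s_power I C) n k = (\<Pi>\<^sub>E i\<in>I. bsimps C n k)"
  "hact (s_power I C) n k \<theta> x = (\<lambda>i\<in>I. hact C n k \<theta> (x i))"
  "vact (s_power I C) n k \<theta> x = (\<lambda>i\<in>I. vact C n k \<theta> (x i))"
  by (simp_all add: s_power_def bsimps_of_rows hact_of_rows vact_of_rows)

lemma level_s_power: "level (s_power I C) n = prod_sset I (\<lambda>_. level C n)"
  by (simp add: level_def prod_sset_def fun_eq_iff)

lemma is_bsset_s_power:
  assumes C: "is_bsset C"
  shows "is_bsset (s_power I C)"
proof (rule is_bssetI)
  interpret bisimplicial C
    by unfold_locales (rule C)
  show "is_sset (row (s_power I C) k)" "is_sset (level (s_power I C) n)" for k n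
    unfolding row_s_power level_s_power by (rule is_sset_prod_sset row_sset level_sset)+
  show "hact (s_power I C) n l \<theta> (vact (s_power I C) n k \<phi> x) = vact (s_power I C) m k \<phi> (hact (s_power I C) n k \<theta> x)"
    if "\<theta> \<in> ops m n" "\<phi> \<in> ops l k" "x \<in> bsimps (s_power I C) n k" for m n k l \<theta> \<phi> x
    using that hact_vact[OF that(1,2)] by (auto simp: fun_eq_iff)
qed

lemma row_s_slice: "row (s_slice W v) k = slice (row W k) (vdeg W 0 k v)"
  by (simp add: s_slice_def)

lemma s_slice_simps [simp]:
  "x \<in> bsimps (s_slice W v) n k \<longleftrightarrow> x \<in> bsimps W (Suc n) k \<and> hact W (Suc n) k [Suc n] x = vdeg W 0 k v"
  "hact (s_slice W v) n k \<theta> x = hact W (Suc n) k (\<theta> @ [Suc n]) x"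
  "vact (s_slice W v) n k \<theta> x = vact W (Suc n) k \<theta> x"
  by (simp_all add: s_slice_def bsimps_of_rows hact_of_rows vact_of_rows)

lemma (in bisimplicial) is_bsset_s_slice:
  assumes v: "v \<in> bsimps W 0 0"
  shows "is_bsset (s_slice W v)"
proof (rule is_bssetI)
  show "is_sset (row (s_slice W v) k)" for k
    unfolding row_s_slice by (rule is_sset_slice[OF row_sset])
  have in_slice: "vact W (Suc n) k \<phi> x \<in> bsimps (s_slice W v) n l"
    if "\<phi> \<in> ops l k" "x \<in> bsimps (s_slice W v) n k" for n k l \<phi> x
  proof -
    have "hact W (Suc n) l [Suc n] (vact W (Suc n) k \<phi> x) = vact W 0 k \<phi> (vdeg W 0 k v)"
      using that hact_vact[OF last_in_ops that(1), of x "Suc n"] by simp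
    also have "\<dots> = vdeg W 0 l v"
      unfolding vdeg_def using act_deg[OF level_sset, of v 0 \<phi> l k] v that(1) by simp
    finally show ?thesis
      using that act_in[OF level_sset, of x "Suc n" k \<phi> l] by simp
  qed
  show "is_sset (level (s_slice W v) n)" for n
    unfolding is_sset_def
  proof (intro conjI allI ballI)
    fix k x
    assume "x \<in> simps (level (s_slice W v) n) k"
    then show "act (level (s_slice W v) n) k [0..<Suc k] x = x"
      using act_id[OF level_sset, of x "Suc n" k] by simp
  next
    fix j l k \<phi> \<theta> x
    assume "\<phi> \<in> ops j l" "\<theta> \<in> ops l k" "x \<in> simps (level (s_slice W v) n) k"
    then show "act (level (s_slice W v) n) l \<phi> (act (level (s_slice W v) n) k \<theta> x) =
        act (level (s_slice W v) n) k (map ((!) \<theta>) \<phi>) x"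
      using act_act[OF level_sset, of x "Suc n" k \<theta> l \<phi>] ops_ops_length[of \<phi> j l] by simp
  qed (use in_slice in simp)
  show "hact (s_slice W v) n l \<theta> (vact (s_slice W v) n k \<phi> x) = vact (s_slice W v) m k \<phi> (hact (s_slice W v) n k \<theta> x)"
    if "\<theta> \<in> ops m n" "\<phi> \<in> ops l k" "x \<in> bsimps (s_slice W v) n k" for m n k l \<theta> \<phi> x
    using that hact_vact[OF ops_snoc[OF that(1)] that(2), of x] by simp
qed

lemma s_slice_proj_eq: "s_slice_proj W n k x = hact W (Suc n) k [0..<Suc n] x"
  by (simp add: s_slice_proj_def slice_proj_def)

lemma (in bisimplicial) bisimplicial_map_s_slice_proj: "bisimplicial_map (s_slice W v) W (s_slice_proj W)"
  unfolding bisimplicial_map_def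
proof (intro conjI allI)
  show "simplicial_map (row (s_slice W v) k) (row W k) (\<lambda>n. s_slice_proj W n k)" for k
    unfolding row_s_slice s_slice_proj_def using simplicial_map_slice_proj[OF row_sset] by simp
  show "simplicial_map (level (s_slice W v) n) (level W n) (s_slice_proj W n)" for n
    unfolding simplicial_map_def s_slice_proj_eq
    using hact_vact[OF upt_in_ops[of n "Suc n"]] act_in[OF row_sset _ upt_in_ops[of n "Suc n"]] by simp
qed

lemma bisimplicial_map_component:
  assumes "i \<in> I"
  shows "bisimplicial_map (s_power I C) C (\<lambda>n k x. x i)"
  unfolding bisimplicial_map_def row_s_power level_s_power
  using simplicial_map_component[OF assms] by blast

section \<open>Preservation of equivalences\<close>

lemma simplicial_map_s_map:
  assumes F: "bisimplicial_map W Z F" and ab: "a \<in> bsimps W 0 0" "b \<in> bsimps W 0 0"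
  shows "simplicial_map (s_map W a b) (s_map Z (F 0 0 a) (F 0 0 b)) (F 1)"
proof -
  have row: "simplicial_map (row W k) (row Z k) (\<lambda>n. F n k)" and level: "simplicial_map (level W n) (level Z n) (F n)" for k n
    using F unfolding bisimplicial_map_def by blast+
  have deg: "F 0 k (vdeg W 0 k c) = vdeg Z 0 k (F 0 0 c)" if "c \<in> bsimps W 0 0" for c k
    unfolding vdeg_def using simplicial_map_deg[OF level, of c 0 k] that by simp
  have ops: "[0] \<in> ops 0 1" "[1] \<in> ops 0 1"
    by (simp_all add: ops_iff)
  have h: "hact Z 1 k \<theta> (F 1 k x) = F 0 k (hact W 1 k \<theta> x)" if "x \<in> bsimps W 1 k" "\<theta> \<in> ops 0 1" for k x \<theta>
    using simplicial_map_act[OF row, of x k 1 \<theta> 0] that by simp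
  show ?thesis
    unfolding simplicial_map_def s_map_def sset.simps
  proof (intro conjI allI ballI)
    fix n x
    assume "x \<in> {w \<in> bsimps W 1 n. hact W 1 n [0] w = vdeg W 0 n a \<and> hact W 1 n [1] w = vdeg W 0 n b}"
    then show "F 1 n x \<in> {w \<in> bsimps Z 1 n. hact Z 1 n [0] w = vdeg Z 0 n (F 0 0 a) \<and> hact Z 1 n [1] w = vdeg Z 0 n (F 0 0 b)}"
      using simplicial_map_in[OF level, of x 1 n] h[OF _ ops(1), of x n] h[OF _ ops(2), of x n]
        deg[OF ab(1)] deg[OF ab(2)] by simp
  next
    fix m n \<theta> x
    assume "\<theta> \<in> ops m n" "x \<in> {w \<in> bsimps W 1 n. hact W 1 n [0] w = vdeg W 0 n a \<and> hact W 1 n [1] w = vdeg W 0 n b}"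
    then show "F 1 m (vact W 1 n \<theta> x) = vact Z 1 n \<theta> (F 1 n x)"
      using simplicial_map_act[OF level, of x 1 n \<theta> m] by simp
  qed
qed

lemma s_equiv_bisimplicial_map:
  assumes F: "bisimplicial_map W Z F" and W: "is_bsset W" and f: "s_equiv W f"
  shows "s_equiv Z (F 1 0 f)"
proof -
  interpret bisimplicial W
    by unfold_locales (rule W)
  have row: "simplicial_map (row W 0) (row Z 0) (\<lambda>n. F n 0)"
    using F unfolding bisimplicial_map_def by blast
  have ops: "[0] \<in> ops 0 1" "[1] \<in> ops 0 1" "[0, 1] \<in> ops 1 2" "[1, 2] \<in> ops 1 2" "[0, 2] \<in> ops 1 2"
    by (simp_all add: ops_iff)
  have h: "F m 0 (hact W n 0 \<theta> x) = hact Z n 0 \<theta> (F n 0 x)" if "x \<in> bsimps W n 0" "\<theta> \<in> ops m n" for m n \<theta> x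
    using simplicial_map_act[OF row, of x n \<theta> m] that by simp
  let ?x = "hact W 1 0 [0] f" and ?y = "hact W 1 0 [1] f"
  obtain g \<sigma> h' \<tau> where f1: "f \<in> bsimps W 1 0"
    and g: "g \<in> simps (s_map W ?y ?x) 0" "\<sigma> \<in> bsimps W 2 0" "hact W 2 0 [0, 1] \<sigma> = f" "hact W 2 0 [1, 2] \<sigma> = g"
      "same_component (s_map W ?x ?x) (hact W 2 0 [0, 2] \<sigma>) (s_ident W ?x)"
    and h': "h' \<in> simps (s_map W ?y ?x) 0" "\<tau> \<in> bsimps W 2 0" "hact W 2 0 [0, 1] \<tau> = h'" "hact W 2 0 [1, 2] \<tau> = f"
      "same_component (s_map W ?y ?y) (hact W 2 0 [0, 2] \<tau>) (s_ident W ?y)"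
    using f unfolding s_equiv_def Let_def by blast
  have xy: "?x \<in> bsimps W 0 0" "?y \<in> bsimps W 0 0"
    using f1 by (simp_all add: hacts)
  have xy': "hact Z 1 0 [0] (F 1 0 f) = F 0 0 ?x" "hact Z 1 0 [1] (F 1 0 f) = F 0 0 ?y"
    using h[OF f1 ops(1)] h[OF f1 ops(2)] by simp_all
  have ident: "F 1 0 (s_ident W c) = s_ident Z (F 0 0 c)" if "c \<in> bsimps W 0 0" for c
    unfolding s_ident_def using simplicial_map_deg[OF row, of c 1] that by simp
  note map = simplicial_map_s_map[OF F]
  have "F 1 0 f \<in> bsimps Z 1 0" "F 2 0 \<sigma> \<in> bsimps Z 2 0" "F 2 0 \<tau> \<in> bsimps Z 2 0"
    using simplicial_map_in[OF row, of f 1] simplicial_map_in[OF row, of \<sigma> 2] simplicial_map_in[OF row, of \<tau> 2]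
      f1 g(2) h'(2) by simp_all
  moreover have "F 1 0 g \<in> simps (s_map Z (F 0 0 ?y) (F 0 0 ?x)) 0" "F 1 0 h' \<in> simps (s_map Z (F 0 0 ?y) (F 0 0 ?x)) 0"
    by (rule simplicial_map_in[OF map[OF xy(2,1)] g(1)], rule simplicial_map_in[OF map[OF xy(2,1)] h'(1)])
  moreover have "hact Z 2 0 [0, 1] (F 2 0 \<sigma>) = F 1 0 f" "hact Z 2 0 [1, 2] (F 2 0 \<sigma>) = F 1 0 g"
    "hact Z 2 0 [0, 1] (F 2 0 \<tau>) = F 1 0 h'" "hact Z 2 0 [1, 2] (F 2 0 \<tau>) = F 1 0 f"
    using h[OF g(2) ops(3)] h[OF g(2) ops(4)] h[OF h'(2) ops(3)] h[OF h'(2) ops(4)] g(3,4) h'(3,4) by simp_all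
  moreover have "same_component (s_map Z (F 0 0 ?x) (F 0 0 ?x)) (hact Z 2 0 [0, 2] (F 2 0 \<sigma>)) (s_ident Z (F 0 0 ?x))"
    "same_component (s_map Z (F 0 0 ?y) (F 0 0 ?y)) (hact Z 2 0 [0, 2] (F 2 0 \<tau>)) (s_ident Z (F 0 0 ?y))"
    using same_component_simplicial_map[OF map[OF xy(1,1)] g(5)] same_component_simplicial_map[OF map[OF xy(2,2)] h'(5)]
    unfolding h[OF g(2) ops(5)] h[OF h'(2) ops(5)] ident[OF xy(1)] ident[OF xy(2)] by simp_all
  ultimately show ?thesis
    unfolding s_equiv_def Let_def xy' by blast
qed

section \<open>Directed colimits of bisimplicial sets\<close>

locale bsset_system =
  fixes \<Phi> :: "'j::order set" and G :: "'j \<Rightarrow> 'a bsset" and T :: "'j \<Rightarrow> 'j \<Rightarrow> nat \<Rightarrow> nat \<Rightarrow> 'a \<Rightarrow> 'a"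
  assumes system: "directed_system \<Phi> (\<lambda>V. bsimps (G V) n k) (\<lambda>V U. T V U n k)"
    and bisimplicial: "V \<in> \<Phi> \<Longrightarrow> U \<in> \<Phi> \<Longrightarrow> U \<le> V \<Longrightarrow> bisimplicial_map (G V) (G U) (T V U)"
    and bsset: "V \<in> \<Phi> \<Longrightarrow> is_bsset (G V)"
begin

sublocale rows: sset_system \<Phi> "\<lambda>V. row (G V) k" "\<lambda>V U n. T V U n k" for k
  using system bisimplicial bsset
  by (intro sset_system.intro) (auto simp: bisimplicial_map_def is_bsset_def)

sublocale levels: sset_system \<Phi> "\<lambda>V. level (G V) n" "\<lambda>V U. T V U n" for n
  using system bisimplicial bsset
  by (intro sset_system.intro) (auto simp: bisimplicial_map_def is_bsset_def)

text \<open>The two actions come from the colimits of rows and of levels; both colimits have the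
  same germs as elements.\<close>

definition Q :: "('j \<times> 'a) set bsset" where
  "Q = \<lparr>bsimps = (\<lambda>n k. simps (rows.colim k) n), hact = (\<lambda>n k. act (rows.colim k) n),
    vact = (\<lambda>n k. act (levels.colim n) k)\<rparr>"

abbreviation "rep_nk n k \<equiv> directed_system.rep \<Phi> (\<lambda>V. bsimps (G V) n k) (\<lambda>V U. T V U n k)"
abbreviation "germ_nk n k \<equiv> germ \<Phi> (\<lambda>V. bsimps (G V) n k) (\<lambda>V U. T V U n k)"

lemma bsimps_Q: "bsimps Q n k = germs \<Phi> (\<lambda>V. bsimps (G V) n k) (\<lambda>V U. T V U n k)"
  by (simp add: Q_def rows.simps_colim)

lemma row_Q: "row Q k = rows.colim k"
  by (simp add: row_def Q_def)

lemma level_Q: "level Q n = levels.colim n"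
proof -
  have "bsimps Q n = simps (levels.colim n)"
    by (simp add: bsimps_Q levels.simps_colim fun_eq_iff)
  then show ?thesis
    by (simp add: level_def Q_def)
qed

lemma rep_hact: "\<theta> \<in> ops m n \<Longrightarrow> rep_nk n k c a \<Longrightarrow> rep_nk m k (hact Q n k \<theta> c) (\<lambda>V. hact (G V) n k \<theta> (a V))"
  using rows.rep_act[of \<theta> m n k c a] by (simp add: Q_def)

lemma rep_vact: "\<theta> \<in> ops l k \<Longrightarrow> rep_nk n k c a \<Longrightarrow> rep_nk n l (vact Q n k \<theta> c) (\<lambda>V. vact (G V) n k \<theta> (a V))"
  using levels.rep_act[of \<theta> l k n c a] by (simp add: Q_def)

lemma bisimplicial_map_germ: "V \<in> \<Phi> \<Longrightarrow> bisimplicial_map (G V) Q (\<lambda>n k. germ_nk n k V)"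
  unfolding bisimplicial_map_def row_Q level_Q
  using rows.simplicial_map_germ levels.simplicial_map_germ by simp

lemma s_equiv_colim_iff:
  assumes V: "V \<in> \<Phi>" and x: "x \<in> bsimps (G V) 1 0"
  shows "s_equiv Q (germ_nk 1 0 V x) \<longleftrightarrow> (\<exists>U\<in>\<Phi>. U \<le> V \<and> s_equiv (G U) (T V U 1 0 x))"
proof
  assume "\<exists>U\<in>\<Phi>. U \<le> V \<and> s_equiv (G U) (T V U 1 0 x)"
  then obtain U where U: "U \<in> \<Phi>" "U \<le> V" "s_equiv (G U) (T V U 1 0 x)"
    by blast
  note y = directed_system.T_in[OF system V U(1,2) x]
  have "germ_nk 1 0 V x = germ_nk 1 0 U (T V U 1 0 x)"
    using directed_system.T_refl[OF system U(1) y] U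
    by (subst directed_system.germ_eq_iff[OF system V U(1) x y]) auto
  then show "s_equiv Q (germ_nk 1 0 V x)"
    using s_equiv_bisimplicial_map[OF bisimplicial_map_germ[OF U(1)] bsset[OF U(1)] U(3)] by simp
next
  let ?x = "germ_nk 1 0 V x"
  assume *: "s_equiv Q ?x"
  \<comment> \<open>\<open>s_equivD\<close> only unfolds the definition, so it applies to the
    colimit; the stages are bisimplicial sets, where the converse is available.\<close>
  obtain \<sigma> v where \<sigma>: "\<sigma> \<in> bsimps Q 2 0" "v \<in> bsimps Q 1 1" "hact Q 2 0 [0, 1] \<sigma> = ?x"
        "hact Q 1 1 [0] v = vact Q 0 0 [0, 0] (hact Q 1 0 [0] ?x)"
        "hact Q 1 1 [1] v = vact Q 0 0 [0, 0] (hact Q 1 0 [0] ?x)"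
        "vact Q 1 1 [0] v = hact Q 2 0 [0, 2] \<sigma>"
        "vact Q 1 1 [1] v = hact Q 0 0 [0, 0] (hact Q 1 0 [0] ?x)"
    using s_equivD(1)[OF *] by blast
  obtain \<tau> w where \<tau>: "\<tau> \<in> bsimps Q 2 0" "w \<in> bsimps Q 1 1" "hact Q 2 0 [1, 2] \<tau> = ?x"
        "hact Q 1 1 [0] w = vact Q 0 0 [0, 0] (hact Q 1 0 [1] ?x)"
        "hact Q 1 1 [1] w = vact Q 0 0 [0, 0] (hact Q 1 0 [1] ?x)"
        "vact Q 1 1 [0] w = hact Q 2 0 [0, 2] \<tau>"
        "vact Q 1 1 [1] w = hact Q 0 0 [0, 0] (hact Q 1 0 [1] ?x)"
    using s_equivD(2)[OF *] by blast
  note ex = directed_system.rep_exists[OF system]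
  obtain s where s: "rep_nk 2 0 \<sigma> s"
    using \<sigma>(1) unfolding bsimps_Q by (rule ex)
  obtain a where a: "rep_nk 1 1 v a"
    using \<sigma>(2) unfolding bsimps_Q by (rule ex)
  obtain t where t: "rep_nk 2 0 \<tau> t"
    using \<tau>(1) unfolding bsimps_Q by (rule ex)
  obtain b where b: "rep_nk 1 1 w b"
    using \<tau>(2) unfolding bsimps_Q by (rule ex)
  have ops: "[0, 1] \<in> ops 1 2" "[1, 2] \<in> ops 1 2" "[0, 2] \<in> ops 1 2" "[0] \<in> ops 0 1" "[1] \<in> ops 0 1"
    "[0, 0] \<in> ops 1 0"
    by (simp_all add: ops_iff)
  note r = directed_system.rep_germ[OF system V x]
  note h = rep_hact[OF ops(1)] rep_hact[OF ops(2)] rep_hact[OF ops(3)] rep_hact[OF ops(4)]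
    rep_hact[OF ops(5)] rep_hact[OF ops(6)]
  note v = rep_vact[OF ops(4)] rep_vact[OF ops(5)] rep_vact[OF ops(6)]
  note u = directed_system.rep_unique[OF system]
  have "\<forall>\<^sub>F U in below \<Phi>. hact (G U) 2 0 [0, 1] (s U) = T V U 1 0 x"
    using h(1)[OF s] r unfolding \<sigma>(3) by (rule u)
  moreover have "\<forall>\<^sub>F U in below \<Phi>. hact (G U) 1 1 [0] (a U) = vact (G U) 0 0 [0, 0] (hact (G U) 1 0 [0] (T V U 1 0 x))"
    using h(4)[OF a] v(3)[OF h(4)[OF r]] unfolding \<sigma>(4) by (rule u)
  moreover have "\<forall>\<^sub>F U in below \<Phi>. hact (G U) 1 1 [1] (a U) = vact (G U) 0 0 [0, 0] (hact (G U) 1 0 [0] (T V U 1 0 x))"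
    using h(5)[OF a] v(3)[OF h(4)[OF r]] unfolding \<sigma>(5) by (rule u)
  moreover have "\<forall>\<^sub>F U in below \<Phi>. vact (G U) 1 1 [0] (a U) = hact (G U) 2 0 [0, 2] (s U)"
    using v(1)[OF a] h(3)[OF s] unfolding \<sigma>(6) by (rule u)
  moreover have "\<forall>\<^sub>F U in below \<Phi>. vact (G U) 1 1 [1] (a U) = hact (G U) 0 0 [0, 0] (hact (G U) 1 0 [0] (T V U 1 0 x))"
    using v(2)[OF a] h(6)[OF h(4)[OF r]] unfolding \<sigma>(7) by (rule u)
  moreover have "\<forall>\<^sub>F U in below \<Phi>. hact (G U) 2 0 [1, 2] (t U) = T V U 1 0 x"
    using h(2)[OF t] r unfolding \<tau>(3) by (rule u)
  moreover have "\<forall>\<^sub>F U in below \<Phi>. hact (G U) 1 1 [0] (b U) = vact (G U) 0 0 [0, 0] (hact (G U) 1 0 [1] (T V U 1 0 x))"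
    using h(4)[OF b] v(3)[OF h(5)[OF r]] unfolding \<tau>(4) by (rule u)
  moreover have "\<forall>\<^sub>F U in below \<Phi>. hact (G U) 1 1 [1] (b U) = vact (G U) 0 0 [0, 0] (hact (G U) 1 0 [1] (T V U 1 0 x))"
    using h(5)[OF b] v(3)[OF h(5)[OF r]] unfolding \<tau>(5) by (rule u)
  moreover have "\<forall>\<^sub>F U in below \<Phi>. vact (G U) 1 1 [0] (b U) = hact (G U) 2 0 [0, 2] (t U)"
    using v(1)[OF b] h(3)[OF t] unfolding \<tau>(6) by (rule u)
  moreover have "\<forall>\<^sub>F U in below \<Phi>. vact (G U) 1 1 [1] (b U) = hact (G U) 0 0 [0, 0] (hact (G U) 1 0 [1] (T V U 1 0 x))"
    using v(2)[OF b] h(6)[OF h(5)[OF r]] unfolding \<tau>(7) by (rule u)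
  moreover note directed_system.rep_mem[OF system a] directed_system.rep_mem[OF system b]
    directed_system.rep_mem[OF system s] directed_system.rep_mem[OF system t]
    directed_system.rep_mem[OF system r] directed_system.eventually_ge[OF system V]
  ultimately have "\<forall>\<^sub>F U in below \<Phi>. U \<in> \<Phi> \<and> U \<le> V \<and> s_equiv (G U) (T V U 1 0 x)"
  proof eventually_elim
    case (elim U)
    then interpret bisimplicial "G U"
      by unfold_locales (simp add: bsset)
    show ?case
      unfolding s_equiv_iff
      using elim
      by (intro conjI bexI[of _ "s U"] bexI[of _ "a U"] bexI[of _ "t U"] bexI[of _ "b U"]) simp_all
  qed
  then show "\<exists>U\<in>\<Phi>. U \<le> V \<and> s_equiv (G U) (T V U 1 0 x)"
    unfolding directed_system.eventually_below[OF system] using order_refl by blast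
qed

end

section \<open>Projections in complete Segal spaces\<close>

lemma s_slice2_simps:
  "(s, t) \<in> bsimps (s_slice2 W u v) n k \<longleftrightarrow> s \<in> bsimps (s_slice W u) n k \<and> t \<in> bsimps (s_slice W v) n k \<and>
     hact W (Suc n) k [0..<Suc n] s = hact W (Suc n) k [0..<Suc n] t"
  "hact (s_slice2 W u v) n k \<theta> (s, t) = (hact W (Suc n) k (\<theta> @ [Suc n]) s, hact W (Suc n) k (\<theta> @ [Suc n]) t)"
  "vact (s_slice2 W u v) n k \<theta> (s, t) = (vact W (Suc n) k \<theta> s, vact W (Suc n) k \<theta> t)"
  by (simp_all add: s_slice2_def bsimps_of_rows hact_of_rows vact_of_rows slice2_simps_iff slice2_act slice_proj_def)

lemma contractible_path:
  assumes "contractible_sset X" "x \<in> simps X 0" "y \<in> simps X 0"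
  shows "same_component X x y"
proof -
  have "boundary X 1 (\<lambda>i. if i = 0 then y else x)"
    unfolding boundary_def using assms by simp
  then have "boundary_fills X 1 (\<lambda>i. if i = 0 then y else x)"
    using assms(1) unfolding contractible_sset_def by blast
  then obtain z where z: "z \<in> simps X 1" "\<forall>i\<le>1. face X 1 i z = (if i = 0 then y else x)"
    unfolding boundary_fills_def by blast
  then show ?thesis
    unfolding same_component_def using z(2)[rule_format, of 0] z(2)[rule_format, of 1] face_1[of X z]
    by (intro bexI[of _ z]) simp_all
qed

text \<open>Terminality of \<open>(a, b)\<close> in the double slice, written out in
  \<open>W\<close>: contractible mapping spaces are nonempty, and two endomorphisms of
  \<open>(a, b)\<close> are joined by a path, of which the part over \<open>a\<close> is
  recorded.\<close>

lemma (in bisimplicial) s_product_maps: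
  assumes P: "s_product W x u a b" and x: "x \<in> bsimps W 0 0" "u \<in> bsimps W 0 0"
  shows "a \<in> bsimps W 1 0" "b \<in> bsimps W 1 0" "hact W 1 0 [1] a = x" "hact W 1 0 [1] b = u"
      "hact W 1 0 [0] a = hact W 1 0 [0] b"
    and "s \<in> bsimps W 1 0 \<Longrightarrow> t \<in> bsimps W 1 0 \<Longrightarrow> hact W 1 0 [1] s = x \<Longrightarrow> hact W 1 0 [1] t = u \<Longrightarrow>
      hact W 1 0 [0] s = hact W 1 0 [0] t \<Longrightarrow> \<exists>S\<in>bsimps W 2 0. \<exists>T\<in>bsimps W 2 0.
        hact W 2 0 [1, 2] S = a \<and> hact W 2 0 [0, 2] S = s \<and>
        hact W 2 0 [1, 2] T = b \<and> hact W 2 0 [0, 2] T = t \<and> hact W 2 0 [0, 1] S = hact W 2 0 [0, 1] T"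
    and "S \<in> bsimps W 2 0 \<Longrightarrow> T \<in> bsimps W 2 0 \<Longrightarrow> S' \<in> bsimps W 2 0 \<Longrightarrow> T' \<in> bsimps W 2 0 \<Longrightarrow>
      hact W 2 0 [1, 2] S = a \<Longrightarrow> hact W 2 0 [0, 2] S = a \<Longrightarrow>
      hact W 2 0 [1, 2] T = b \<Longrightarrow> hact W 2 0 [0, 2] T = b \<Longrightarrow> hact W 2 0 [0, 1] S = hact W 2 0 [0, 1] T \<Longrightarrow>
      hact W 2 0 [1, 2] S' = a \<Longrightarrow> hact W 2 0 [0, 2] S' = a \<Longrightarrow>
      hact W 2 0 [1, 2] T' = b \<Longrightarrow> hact W 2 0 [0, 2] T' = b \<Longrightarrow> hact W 2 0 [0, 1] S' = hact W 2 0 [0, 1] T' \<Longrightarrow>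
      \<exists>P\<in>bsimps W 2 1. vact W 2 1 [0] P = S \<and> vact W 2 1 [1] P = S' \<and>
        hact W 2 1 [0, 2] P = vact W 1 0 [0, 0] a \<and> hact W 2 1 [1, 2] P = vact W 1 0 [0, 0] a"
proof -
  let ?Q = "s_slice2 W x u"
  have tm: "(a, b) \<in> bsimps ?Q 0 0" "\<And>z. z \<in> bsimps ?Q 0 0 \<Longrightarrow> contractible_sset (s_map ?Q z (a, b))"
    using P unfolding s_product_def s_terminal_def by blast+
  have vdeg0: "vdeg W 0 0 x = x" "vdeg W 0 0 u = u"
    using x by (simp_all add: vdeg_0)
  have vertex: "(s, t) \<in> bsimps ?Q 0 0 \<longleftrightarrow> s \<in> bsimps W 1 0 \<and> t \<in> bsimps W 1 0 \<and> hact W 1 0 [1] s = x \<and>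
      hact W 1 0 [1] t = u \<and> hact W 1 0 [0] s = hact W 1 0 [0] t" for s t
    unfolding s_slice2_simps by (simp add: vdeg0) blast
  show ab: "a \<in> bsimps W 1 0" "b \<in> bsimps W 1 0" "hact W 1 0 [1] a = x" "hact W 1 0 [1] b = u"
      "hact W 1 0 [0] a = hact W 1 0 [0] b"
    using tm(1) unfolding vertex by blast+
  have deg: "vdeg ?Q 0 0 (s, t) = (s, t)" if "(s, t) \<in> bsimps ?Q 0 0" for s t
    using that unfolding vertex vdeg_def deg_def by (simp add: s_slice2_simps vacts)
  have edge: "(S, T) \<in> bsimps ?Q 1 k \<longleftrightarrow> S \<in> bsimps W 2 k \<and> T \<in> bsimps W 2 k \<and> hact W 2 k [2] S = vdeg W 0 k x \<and>
      hact W 2 k [2] T = vdeg W 0 k u \<and> hact W 2 k [0, 1] S = hact W 2 k [0, 1] T" for S T k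
    unfolding s_slice2_simps by (simp add: numeral_2_eq_2) blast
  have src: "hact ?Q 1 k [0] (S, T) = (hact W 2 k [0, 2] S, hact W 2 k [0, 2] T)"
    "hact ?Q 1 k [1] (S, T) = (hact W 2 k [1, 2] S, hact W 2 k [1, 2] T)" for k S T
    by (simp_all add: s_slice2_simps numeral_2_eq_2)
  show "\<exists>S\<in>bsimps W 2 0. \<exists>T\<in>bsimps W 2 0. hact W 2 0 [1, 2] S = a \<and> hact W 2 0 [0, 2] S = s \<and>
      hact W 2 0 [1, 2] T = b \<and> hact W 2 0 [0, 2] T = t \<and> hact W 2 0 [0, 1] S = hact W 2 0 [0, 1] T"
    if "s \<in> bsimps W 1 0" "t \<in> bsimps W 1 0" "hact W 1 0 [1] s = x" "hact W 1 0 [1] t = u"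
      "hact W 1 0 [0] s = hact W 1 0 [0] t"
  proof -
    have z: "(s, t) \<in> bsimps ?Q 0 0"
      unfolding vertex using that by blast
    then obtain w where w: "w \<in> simps (s_map ?Q (s, t) (a, b)) 0"
      using tm(2) unfolding contractible_sset_def by blast
    obtain S T where "w = (S, T)"
      by (cases w)
    then show ?thesis
      using w edge[of S T 0] src[of 0 S T] deg[OF z] deg[OF tm(1)] unfolding s_map_def by auto
  qed
  show "\<exists>P\<in>bsimps W 2 1. vact W 2 1 [0] P = S \<and> vact W 2 1 [1] P = S' \<and>
        hact W 2 1 [0, 2] P = vact W 1 0 [0, 0] a \<and> hact W 2 1 [1, 2] P = vact W 1 0 [0, 0] a"
    if ST: "S \<in> bsimps W 2 0" "T \<in> bsimps W 2 0" "S' \<in> bsimps W 2 0" "T' \<in> bsimps W 2 0"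
      "hact W 2 0 [1, 2] S = a" "hact W 2 0 [0, 2] S = a"
      "hact W 2 0 [1, 2] T = b" "hact W 2 0 [0, 2] T = b" "hact W 2 0 [0, 1] S = hact W 2 0 [0, 1] T"
      "hact W 2 0 [1, 2] S' = a" "hact W 2 0 [0, 2] S' = a"
      "hact W 2 0 [1, 2] T' = b" "hact W 2 0 [0, 2] T' = b" "hact W 2 0 [0, 1] S' = hact W 2 0 [0, 1] T'"
  proof -
    have end2: "hact W 2 0 [2] R = hact W 1 0 [1] (hact W 2 0 [1, 2] R)" if "R \<in> bsimps W 2 0" for R
      using that by (simp add: hacts)
    have "(S, T) \<in> simps (s_map ?Q (a, b) (a, b)) 0" "(S', T') \<in> simps (s_map ?Q (a, b) (a, b)) 0"
      unfolding s_map_def sset.simps mem_Collect_eq edge src deg[OF tm(1)] vdeg0 end2[OF ST(1)] end2[OF ST(2)] end2[OF ST(3)] end2[OF ST(4)]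
      using ST ab by simp_all
    then have "same_component (s_map ?Q (a, b) (a, b)) (S, T) (S', T')"
      by (rule contractible_path[OF tm(2)[OF tm(1)]])
    then obtain w where w: "w \<in> simps (s_map ?Q (a, b) (a, b)) 1" "act (s_map ?Q (a, b) (a, b)) 1 [0] w = (S, T)"
      "act (s_map ?Q (a, b) (a, b)) 1 [1] w = (S', T')"
      unfolding same_component_def by blast
    obtain P P' where P: "w = (P, P')"
      by (cases w)
    have w1: "(P, P') \<in> bsimps ?Q 1 1" "hact ?Q 1 1 [0] (P, P') = vdeg ?Q 0 1 (a, b)" "hact ?Q 1 1 [1] (P, P') = vdeg ?Q 0 1 (a, b)"
      "vact ?Q 1 1 [0] (P, P') = (S, T)" "vact ?Q 1 1 [1] (P, P') = (S', T')"
      using w unfolding P s_map_def by simp_all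
    have "vdeg ?Q 0 1 (a, b) = (vact W 1 0 [0, 0] a, vact W 1 0 [0, 0] b)"
      unfolding vdeg_1 by (simp add: s_slice2_simps)
    then show ?thesis
      using w1(1-3) w1(4,5)[unfolded s_slice2_simps] unfolding edge src
      by (intro bexI[of _ P]) (simp_all add: numeral_2_eq_2)
  qed
qed

text \<open>As for quasi-categories, but with the product taken in the power: the test cone agrees
  with \<open>(a, b)\<close> away from \<open>i\<close>. The composite of \<open>a i\<close> with
  the section is an endomorphism of the product, hence joined to the identity, and this path turns
  the composite triangle into one with an identity as third side.\<close>

lemma s_equiv_projection:
  assumes C: "css C" and i: "i \<in> I" and xu: "x \<in> bsimps (s_power I C) 0 0" "u \<in> bsimps (s_power I C) 0 0"
    and one: "s_terminal C (u i)" and P: "s_product (s_power I C) x u a b"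
  shows "s_equiv C (a i)"
proof -
  interpret css C
    by (rule C)
  interpret D: bisimplicial "s_power I C"
    by unfold_locales (rule is_bsset_s_power[OF bsset])
  note P' = D.s_product_maps[OF P xu]
  have a: "a j \<in> bsimps C 1 0" "b j \<in> bsimps C 1 0" "hact C 1 0 [1] (a j) = x j" "hact C 1 0 [1] (b j) = u j"
    "hact C 1 0 [0] (a j) = hact C 1 0 [0] (b j)" "x j \<in> bsimps C 0 0" "u j \<in> bsimps C 0 0" if "j \<in> I" for j
    using P'(1,2) fun_cong[OF P'(3), of j] fun_cong[OF P'(4), of j] fun_cong[OF P'(5), of j] xu that by auto
  note ai = a[OF i]
  let ?p = "hact C 1 0 [0] (a i)"
  have p: "?p \<in> bsimps C 0 0"
    using ai by (simp add: hacts)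
  have ext: "y \<in> extensional I" if "y \<in> (\<Pi>\<^sub>E i\<in>I. X i)" for y :: "_ \<Rightarrow> 'a" and X
    using that by (auto simp: PiE_def)
  obtain k where k: "k \<in> bsimps C 1 0" "hact C 1 0 [0] k = x i" "hact C 1 0 [1] k = u i"
  proof -
    have "simps (s_map C (x i) (u i)) 0 \<noteq> {}"
      using one ai(6) unfolding s_terminal_def contractible_sset_def by blast
    then show thesis
      using that ai unfolding s_map_def by (auto simp: vdeg_0)
  qed
  \<comment> \<open>At \<open>i\<close> the cone is (identity, k), elsewhere (a, b); the map it
    induces to the product is a section of \<open>a i\<close> at index \<open>i\<close>.\<close>
  define s where "s = (\<lambda>j\<in>I. if j = i then hact C 0 0 [0, 0] (x i) else a j)"
  define t where "t = (\<lambda>j\<in>I. if j = i then k else b j)"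
  have d: "hact C 1 0 [1] (hact C 0 0 [0, 0] (x i)) = x i" "hact C 1 0 [0] (hact C 0 0 [0, 0] (x i)) = x i"
    "hact C 0 0 [0, 0] (x i) \<in> bsimps C 1 0"
    using ai by (simp_all add: hacts)
  have st: "s \<in> bsimps (s_power I C) 1 0" "t \<in> bsimps (s_power I C) 1 0" "hact (s_power I C) 1 0 [1] s = x"
    "hact (s_power I C) 1 0 [1] t = u" "hact (s_power I C) 1 0 [0] s = hact (s_power I C) 1 0 [0] t"
    unfolding s_power_simps s_def t_def
    by (use a d k xu ext in \<open>auto simp: fun_eq_iff extensional_def\<close>)
  obtain S T where ST: "S \<in> bsimps (s_power I C) 2 0" "T \<in> bsimps (s_power I C) 2 0"
    "hact (s_power I C) 2 0 [1, 2] S = a" "hact (s_power I C) 2 0 [0, 2] S = s"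
    "hact (s_power I C) 2 0 [1, 2] T = b" "hact (s_power I C) 2 0 [0, 2] T = t"
    "hact (s_power I C) 2 0 [0, 1] S = hact (s_power I C) 2 0 [0, 1] T"
    using P'(6)[OF st] by blast
  have Si: "S i \<in> bsimps C 2 0" "T i \<in> bsimps C 2 0" "hact C 2 0 [1, 2] (S i) = a i"
    "hact C 2 0 [0, 2] (S i) = hact C 0 0 [0, 0] (x i)" "hact C 2 0 [1, 2] (T i) = b i" "hact C 2 0 [0, 2] (T i) = k"
    "hact C 2 0 [0, 1] (S i) = hact C 2 0 [0, 1] (T i)"
    using ST(1,2) fun_cong[OF ST(3), of i] fun_cong[OF ST(4), of i] fun_cong[OF ST(5), of i] fun_cong[OF ST(6), of i]
      fun_cong[OF ST(7), of i] i by (auto simp: s_def t_def)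
  let ?h = "hact C 2 0 [0, 1] (S i)"
  have h: "?h \<in> bsimps C 1 0" "hact C 1 0 [0] ?h = x i" "hact C 1 0 [1] ?h = ?p"
  proof -
    have "hact C 1 0 [0] ?h = hact C 1 0 [0] (hact C 2 0 [0, 2] (S i))" "hact C 1 0 [1] ?h = hact C 1 0 [0] (hact C 2 0 [1, 2] (S i))"
      using Si(1) by (simp_all add: hacts)
    then show "hact C 1 0 [0] ?h = x i" "hact C 1 0 [1] ?h = ?p"
      unfolding Si(3,4) using ai by (simp_all add: hacts)
  qed (use Si(1) in \<open>simp add: hacts\<close>)
  obtain \<sigma> where \<sigma>: "\<sigma> \<in> bsimps C 2 0" "hact C 2 0 [0, 1] \<sigma> = a i" "hact C 2 0 [1, 2] \<sigma> = ?h"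
    by (rule segal_2[OF ai(1) h(1)]) (use ai h in simp_all)
  let ?e = "hact C 2 0 [0, 2] \<sigma>"
  have e: "?e \<in> bsimps C 1 0" "hact C 1 0 [0] ?e = ?p" "hact C 1 0 [1] ?e = ?p"
  proof -
    have "hact C 1 0 [0] ?e = hact C 1 0 [0] (hact C 2 0 [0, 1] \<sigma>)" "hact C 1 0 [1] ?e = hact C 1 0 [1] (hact C 2 0 [1, 2] \<sigma>)"
      using \<sigma>(1) by (simp_all add: hacts)
    then show "hact C 1 0 [0] ?e = ?p" "hact C 1 0 [1] ?e = ?p"
      unfolding \<sigma>(2,3) h(3) by simp_all
  qed (use \<sigma>(1) in \<open>simp add: hacts\<close>)
  text \<open>The composite of \<open>a i\<close> and \<open>h\<close> is an endomorphism of the product over both factors.\<close>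
  have comp: "\<exists>R\<in>bsimps C 2 0. hact C 2 0 [0, 1] R = ?e \<and> hact C 2 0 [1, 2] R = hact C 2 0 [1, 2] B \<and>
      hact C 2 0 [0, 2] R = hact C 2 0 [0, 2] E"
    if BE: "B \<in> bsimps C 2 0" "E \<in> bsimps C 2 0" "hact C 2 0 [0, 1] B = ?h" "hact C 2 0 [0, 1] E = a i"
      "hact C 2 0 [0, 2] B = hact C 2 0 [1, 2] E" for B E
  proof -
    obtain Z where Z: "Z \<in> bsimps C 3 0" "hact C 3 0 [0, 1, 2] Z = \<sigma>" "hact C 3 0 [1, 2, 3] Z = B" "hact C 3 0 [0, 1, 3] Z = E"
      by (rule inner_horn_3[OF \<sigma>(1) BE(1,2)]) (use \<sigma> BE in simp_all)
    have "hact C 2 0 [0, 1] (hact C 3 0 [0, 2, 3] Z) = hact C 2 0 [0, 2] (hact C 3 0 [0, 1, 2] Z)"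
      "hact C 2 0 [1, 2] (hact C 3 0 [0, 2, 3] Z) = hact C 2 0 [1, 2] (hact C 3 0 [1, 2, 3] Z)"
      "hact C 2 0 [0, 2] (hact C 3 0 [0, 2, 3] Z) = hact C 2 0 [0, 2] (hact C 3 0 [0, 1, 3] Z)"
      "hact C 3 0 [0, 2, 3] Z \<in> bsimps C 2 0"
      using Z(1) by (simp_all add: hacts)
    then show ?thesis
      unfolding Z by blast
  qed
  \<comment> \<open>\<open>?e\<close> followed by \<open>a i\<close> is \<open>a i\<close>: the
    section followed by \<open>a i\<close> is an identity, and \<open>a i\<close> followed by that
    identity is \<open>a i\<close>.\<close>
  have "hact C 1 0 [0, 1, 1] (a i) \<in> bsimps C 2 0" "hact C 2 0 [0, 1] (hact C 1 0 [0, 1, 1] (a i)) = a i"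
    "hact C 2 0 [1, 2] (hact C 1 0 [0, 1, 1] (a i)) = hact C 0 0 [0, 0] (hact C 1 0 [1] (a i))"
    "hact C 2 0 [0, 2] (hact C 1 0 [0, 1, 1] (a i)) = a i"
    using ai(1) by (simp_all add: hacts)
  then obtain S' where S': "S' \<in> bsimps C 2 0" "hact C 2 0 [0, 1] S' = ?e" "hact C 2 0 [1, 2] S' = a i" "hact C 2 0 [0, 2] S' = a i"
    using comp[OF Si(1), of "hact C 1 0 [0, 1, 1] (a i)"] Si(3,4) ai(3) by auto
  \<comment> \<open>The composite of \<open>a i\<close> with \<open>k\<close> agrees with
    \<open>b i\<close> only up to a path, by terminality of \<open>u i\<close>; the triangle is then
    transported along this path.\<close>
  obtain \<rho> where \<rho>: "\<rho> \<in> bsimps C 2 0" "hact C 2 0 [0, 1] \<rho> = a i" "hact C 2 0 [1, 2] \<rho> = k"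
    by (rule segal_2[OF ai(1) k(1)]) (use ai k in simp_all)
  let ?c = "hact C 2 0 [0, 2] \<rho>"
  have c: "?c \<in> bsimps C 1 0" "hact C 1 0 [0] ?c = ?p" "hact C 1 0 [1] ?c = u i"
  proof -
    have "hact C 1 0 [0] ?c = hact C 1 0 [0] (hact C 2 0 [0, 1] \<rho>)" "hact C 1 0 [1] ?c = hact C 1 0 [1] (hact C 2 0 [1, 2] \<rho>)"
      using \<rho>(1) by (simp_all add: hacts)
    then show "hact C 1 0 [0] ?c = ?p" "hact C 1 0 [1] ?c = u i"
      unfolding \<rho>(2,3) k(3) by simp_all
  qed (use \<rho>(1) in \<open>simp add: hacts\<close>)
  have "?c \<in> simps (s_map C ?p (u i)) 0" "b i \<in> simps (s_map C ?p (u i)) 0"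
    unfolding s_map_def using c ai p by (simp_all add: vdeg_0)
  then have "same_component (s_map C ?p (u i)) ?c (b i)"
    using one p unfolding s_terminal_def by (intro contractible_path) auto
  then obtain w where w: "w \<in> bsimps C 1 1" "hact C 1 1 [0] w = vact C 0 0 [0, 0] ?p" "hact C 1 1 [1] w = vact C 0 0 [0, 0] (u i)"
    "vact C 1 1 [0] w = ?c" "vact C 1 1 [1] w = b i"
    unfolding same_component_def s_map_def by (auto simp: vdeg_1)
  let ?const = "vact C 1 0 [0, 0]"
  have const: "?const y \<in> bsimps C 1 1" "vact C 1 1 [0] (?const y) = y" "vact C 1 1 [1] (?const y) = y"
    "hact C 1 1 [0] (?const y) = vact C 0 0 [0, 0] (hact C 1 0 [0] y)" "hact C 1 1 [1] (?const y) = vact C 0 0 [0, 0] (hact C 1 0 [1] y)"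
    if "y \<in> bsimps C 1 0" for y
    using that by (simp_all add: bacts)
  obtain R where R: "R \<in> bsimps C 2 1" "hact C 2 1 [0, 1] R = ?const (a i)" "hact C 2 1 [1, 2] R = ?const k" "hact C 2 1 [0, 2] R = w"
    by (rule tri_path[OF le0 \<rho>(1) const(1)[OF ai(1)] const(1)[OF k(1)] w(1)])
      (use const[OF ai(1)] const[OF k(1)] w \<rho> ai k in simp_all)
  have "vact C 2 1 [1] R \<in> bsimps C 2 0" "hact C 2 0 [0, 1] (vact C 2 1 [1] R) = vact C 1 1 [1] (hact C 2 1 [0, 1] R)"
    "hact C 2 0 [1, 2] (vact C 2 1 [1] R) = vact C 1 1 [1] (hact C 2 1 [1, 2] R)"
    "hact C 2 0 [0, 2] (vact C 2 1 [1] R) = vact C 1 1 [1] (hact C 2 1 [0, 2] R)"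
    using R(1) by (simp_all add: bacts)
  then have R1: "vact C 2 1 [1] R \<in> bsimps C 2 0" "hact C 2 0 [0, 1] (vact C 2 1 [1] R) = a i"
    "hact C 2 0 [1, 2] (vact C 2 1 [1] R) = k" "hact C 2 0 [0, 2] (vact C 2 1 [1] R) = b i"
    unfolding R(2-4) using const[OF ai(1)] const[OF k(1)] w(5) by simp_all
  then obtain T' where T': "T' \<in> bsimps C 2 0" "hact C 2 0 [0, 1] T' = ?e" "hact C 2 0 [1, 2] T' = b i" "hact C 2 0 [0, 2] T' = b i"
    using comp[OF Si(2) R1(1)] Si(5,6,7) by auto
  \<comment> \<open>Extends a triangle at \<open>i\<close> by degenerate triangles elsewhere.
    Applied to \<open>S'\<close> and \<open>T'\<close>, and to degenerate triangles at
    \<open>i\<close>, it gives two endomorphisms of \<open>(a, b)\<close>.\<close>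
  define SD where "SD = (\<lambda>f z. \<lambda>j\<in>I. if j = i then z else hact C 1 0 [0, 0, 1] (f j))"
  have id: "hact C 1 0 [0, 0, 1] y \<in> bsimps C 2 0" "hact C 2 0 [0, 1] (hact C 1 0 [0, 0, 1] y) = hact C 0 0 [0, 0] (hact C 1 0 [0] y)"
    "hact C 2 0 [1, 2] (hact C 1 0 [0, 0, 1] y) = y" "hact C 2 0 [0, 2] (hact C 1 0 [0, 0, 1] y) = y" if "y \<in> bsimps C 1 0" for y
    using that by (simp_all add: hacts)
  have SD: "SD f z \<in> bsimps (s_power I C) 2 0" "hact (s_power I C) 2 0 [1, 2] (SD f z) = f"
      "hact (s_power I C) 2 0 [0, 2] (SD f z) = f"
      "hact (s_power I C) 2 0 [0, 1] (SD f z) = (\<lambda>j\<in>I. if j = i then hact C 2 0 [0, 1] z else hact C 0 0 [0, 0] (hact C 1 0 [0] (f j)))"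
    if "f \<in> bsimps (s_power I C) 1 0" "z \<in> bsimps C 2 0" "hact C 2 0 [1, 2] z = f i" "hact C 2 0 [0, 2] z = f i" for f z
  proof -
    have f: "f \<in> extensional I" "\<And>j. j \<in> I \<Longrightarrow> f j \<in> bsimps C 1 0"
      using that(1) by (auto simp: PiE_def)
    show "SD f z \<in> bsimps (s_power I C) 2 0"
      using that(2) id(1)[OF f(2)] by (auto simp: SD_def)
    show "hact (s_power I C) 2 0 [1, 2] (SD f z) = f" "hact (s_power I C) 2 0 [0, 2] (SD f z) = f"
      using that(3,4) id(3,4)[OF f(2)] f(1) by (auto simp: SD_def fun_eq_iff extensional_def)
    show "hact (s_power I C) 2 0 [0, 1] (SD f z) = (\<lambda>j\<in>I. if j = i then hact C 2 0 [0, 1] z else hact C 0 0 [0, 0] (hact C 1 0 [0] (f j)))"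
      using id(2)[OF f(2)] by (auto simp: SD_def fun_eq_iff)
  qed
  let ?Sa = "hact C 1 0 [0, 0, 1] (a i)" and ?Sb = "hact C 1 0 [0, 0, 1] (b i)"
  have same: "(\<lambda>j\<in>I. if j = i then y else hact C 0 0 [0, 0] (hact C 1 0 [0] (a j))) =
      (\<lambda>j\<in>I. if j = i then y else hact C 0 0 [0, 0] (hact C 1 0 [0] (b j)))" for y
    using a(5) by (auto simp: fun_eq_iff)
  note SDa = SD[OF P'(1) S'(1) S'(3,4)] and SDb = SD[OF P'(2) T'(1) T'(3,4)]
    and Ia = SD[OF P'(1) id(1)[OF ai(1)] id(3,4)[OF ai(1)]] and Ib = SD[OF P'(2) id(1)[OF ai(2)] id(3,4)[OF ai(2)]]
  obtain Z where Z: "Z \<in> bsimps (s_power I C) 2 1" "vact (s_power I C) 2 1 [0] Z = SD a S'" "vact (s_power I C) 2 1 [1] Z = SD a ?Sa"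
    "hact (s_power I C) 2 1 [0, 2] Z = vact (s_power I C) 1 0 [0, 0] a" "hact (s_power I C) 2 1 [1, 2] Z = vact (s_power I C) 1 0 [0, 0] a"
    using P'(7)[OF SDa(1) SDb(1) Ia(1) Ib(1) SDa(2,3) SDb(2,3) _ Ia(2,3) Ib(2,3)]
    unfolding SDa(4) SDb(4) Ia(4) Ib(4) S'(2) T'(2) id(2)[OF ai(1)] id(2)[OF ai(2)] ai(5) same by blast
  have Zi: "Z i \<in> bsimps C 2 1" "vact C 2 1 [0] (Z i) = S'" "vact C 2 1 [1] (Z i) = ?Sa"
    "hact C 2 1 [0, 2] (Z i) = ?const (a i)" "hact C 2 1 [1, 2] (Z i) = ?const (a i)"
    using Z(1) fun_cong[OF Z(2), of i] fun_cong[OF Z(3), of i] fun_cong[OF Z(4), of i] fun_cong[OF Z(5), of i] i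
    by (auto simp: SD_def)
  let ?w = "hact C 2 1 [0, 1] (Z i)"
  have w': "?w \<in> bsimps C 1 1" "vact C 1 1 [0] ?w = ?e" "vact C 1 1 [1] ?w = hact C 0 0 [0, 0] ?p"
    "hact C 1 1 [0] ?w = vact C 0 0 [0, 0] ?p" "hact C 1 1 [1] ?w = vact C 0 0 [0, 0] ?p"
  proof -
    have "vact C 1 1 [0] ?w = hact C 2 0 [0, 1] (vact C 2 1 [0] (Z i))" "vact C 1 1 [1] ?w = hact C 2 0 [0, 1] (vact C 2 1 [1] (Z i))"
      "hact C 1 1 [0] ?w = hact C 1 1 [0] (hact C 2 1 [0, 2] (Z i))" "hact C 1 1 [1] ?w = hact C 1 1 [0] (hact C 2 1 [1, 2] (Z i))"
      using Zi(1) by (simp_all add: bacts)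
    then show "vact C 1 1 [0] ?w = ?e" "vact C 1 1 [1] ?w = hact C 0 0 [0, 0] ?p"
      "hact C 1 1 [0] ?w = vact C 0 0 [0, 0] ?p" "hact C 1 1 [1] ?w = vact C 0 0 [0, 0] ?p"
      unfolding Zi(2-5) S'(2) id(2)[OF ai(1)] const(4)[OF ai(1)] by simp_all
  qed (use Zi(1) in \<open>simp add: hacts\<close>)
  \<comment> \<open>The third side \<open>?e\<close> of \<sigma> is moved along \<open>?w\<close> to
    the identity while the two other sides stay fixed.\<close>
  obtain K where K: "K \<in> bsimps C 2 1" "hact C 2 1 [0, 1] K = ?const (a i)" "hact C 2 1 [1, 2] K = ?const ?h" "hact C 2 1 [0, 2] K = ?w"
    by (rule tri_path[OF le0 \<sigma>(1) const(1)[OF ai(1)] const(1)[OF h(1)] w'(1)])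
      (use const[OF ai(1)] const[OF h(1)] w' \<sigma> ai h in simp_all)
  have "vact C 2 1 [1] K \<in> bsimps C 2 0" "hact C 2 0 [0, 1] (vact C 2 1 [1] K) = vact C 1 1 [1] (hact C 2 1 [0, 1] K)"
    "hact C 2 0 [0, 2] (vact C 2 1 [1] K) = vact C 1 1 [1] (hact C 2 1 [0, 2] K)"
    using K(1) by (simp_all add: bacts)
  then have "vact C 2 1 [1] K \<in> bsimps C 2 0" "hact C 2 0 [0, 1] (vact C 2 1 [1] K) = a i"
    "hact C 2 0 [0, 2] (vact C 2 1 [1] K) = hact C 0 0 [0, 0] ?p"
    unfolding K(2,4) using const[OF ai(1)] w'(3) by simp_all
  then have "s_inv C (a i)"
    unfolding s_inv_def ai(3) using ai(1) Si(1,3,4) by blast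
  then show ?thesis
    by (rule s_equiv_if_s_inv)
qed

section \<open>Filter products of complete Segal spaces\<close>

lemma s_times_square:
  assumes W: "is_bsset W" and T: "s_times W v u F" and x: "x \<in> bsimps (s_slice W v) 1 0"
  obtains e d b where
    "q_tri (row W 0) (s_slice_proj W 1 0 (F 1 0 x)) (e 1) d" "q_tri (row W 0) (e 0) (s_slice_proj W 1 0 x) d"
    "\<And>j. j \<le> 1 \<Longrightarrow> s_product W (hact W 2 0 [j] x) u (e j) (b j)"
proof -
  interpret bisimplicial W
    by unfold_locales (rule W)
  let ?X = "row (s_slice W v) 0"
  have X: "is_sset ?X"
    unfolding row_s_slice by (rule is_sset_slice[OF row_sset])
  have x': "x \<in> simps ?X 1" "x \<in> bsimps W 2 0"
    using x by (simp_all add: numeral_2_eq_2)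
  obtain \<epsilon> where bi: "bisimplicial_map (s_interval_prod (s_slice W v)) W \<epsilon>"
    and \<epsilon>: "\<And>n k x. x \<in> bsimps (s_slice W v) n k \<Longrightarrow> \<epsilon> n k (replicate (Suc n) 0, x) = s_slice_proj W n k (F n k x)"
    "\<And>n k x. x \<in> bsimps (s_slice W v) n k \<Longrightarrow> \<epsilon> n k (replicate (Suc n) 1, x) = s_slice_proj W n k x"
    "\<And>x. x \<in> bsimps (s_slice W v) 0 0 \<Longrightarrow>
      s_product W (s_slice_proj W 0 0 x) u (\<epsilon> 1 0 ([0, 1], s_ident (s_slice W v) x)) (F 0 0 x)"
    using T unfolding s_times_def by blast
  have \<epsilon>0: "simplicial_map (prod2 (std_simplex 1) ?X) (row W 0) (\<lambda>n. \<epsilon> n 0)"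
    using bi unfolding bisimplicial_map_def s_interval_prod_def row_of_rows by blast
  define y where "y = (\<lambda>j. hact (s_slice W v) 1 0 [j] x)"
  have y: "y j \<in> bsimps (s_slice W v) 0 0" "s_slice_proj W 0 0 (y j) = hact W 2 0 [j] x" if "j \<le> 1" for j
  proof -
    show "y j \<in> bsimps (s_slice W v) 0 0"
      using act_in_list[OF X x'(1), of "[j]" 0] that by (simp add: y_def)
    show "s_slice_proj W 0 0 (y j) = hact W 2 0 [j] x"
      using that x'(2) hact_hact[OF x'(2), of "[j, 2]" 1 "[0]"] by (simp add: y_def s_slice_proj_eq numeral_2_eq_2)
  qed
  show thesis
  proof (rule that[of "\<lambda>j. \<epsilon> 1 0 ([0, 1], s_ident (s_slice W v) (y j))" "\<epsilon> 1 0 ([0, 1], x)" "\<lambda>j. F 0 0 (y j)"])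
    show "q_tri (row W 0) (s_slice_proj W 1 0 (F 1 0 x)) (\<epsilon> 1 0 ([0, 1], s_ident (s_slice W v) (y 1))) (\<epsilon> 1 0 ([0, 1], x))"
      using naturality_square(1)[OF X \<epsilon>0 x'(1)] \<epsilon>(1)[OF x] by (simp add: y_def s_ident_def)
    show "q_tri (row W 0) (\<epsilon> 1 0 ([0, 1], s_ident (s_slice W v) (y 0))) (s_slice_proj W 1 0 x) (\<epsilon> 1 0 ([0, 1], x))"
      using naturality_square(2)[OF X \<epsilon>0 x'(1)] \<epsilon>(2)[OF x] by (simp add: y_def s_ident_def)
    show "s_product W (hact W 2 0 [j] x) u (\<epsilon> 1 0 ([0, 1], s_ident (s_slice W v) (y j))) (F 0 0 (y j))" if "j \<le> 1" for j
      using \<epsilon>(3)[OF y(1)[OF that]] y(2)[OF that] by simp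
  qed
qed

text \<open>\<open>cancel_equiv\<close> takes over the part of the weak category: the two triangles
  of the naturality square are compared along their common side \<open>d i\<close>.\<close>

lemma s_power_equiv_transfer:
  assumes C: "css C" and one: "s_terminal C one" and zero: "zero \<in> bsimps C 0 0"
    and T: "s_times (s_power I C) v (sub_object I zero one V) F"
    and x: "x \<in> bsimps (s_slice (s_power I C) v) 1 0" and i: "i \<in> I"
  defines "y \<equiv> s_slice_proj (s_power I C) 1 0 (F 1 0 x)"
  shows "i \<in> V \<Longrightarrow> s_equiv C (y i) \<longleftrightarrow> s_equiv C (s_slice_proj (s_power I C) 1 0 x i)"
    and "s_strict C zero \<Longrightarrow> i \<notin> V \<Longrightarrow> F 1 0 x \<in> bsimps (s_slice (s_power I C) (sub_object I zero one V)) 1 0 \<Longrightarrow>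
      s_equiv C (y i)"
proof -
  interpret css C
    by (rule C)
  let ?D = "s_power I C" and ?u = "sub_object I zero one V"
  interpret D: bisimplicial ?D
    by unfold_locales (rule is_bsset_s_power[OF bsset])
  obtain e d b where e: "q_tri (row ?D 0) y (e 1) d" "q_tri (row ?D 0) (e 0) (s_slice_proj ?D 1 0 x) d"
    "\<And>j. j \<le> 1 \<Longrightarrow> s_product ?D (hact ?D 2 0 [j] x) ?u (e j) (b j)"
    using s_times_square[OF D.bsset T x] unfolding y_def by metis
  have x2: "x \<in> bsimps ?D 2 0"
    using x by (simp add: numeral_2_eq_2)
  have u: "?u \<in> bsimps ?D 0 0"
    using one zero by (auto simp: sub_object_def s_terminal_def)
  have tri: "\<exists>\<sigma>\<in>bsimps C 2 0. hact C 2 0 [0, 1] \<sigma> = f i \<and> hact C 2 0 [1, 2] \<sigma> = g i \<and> hact C 2 0 [0, 2] \<sigma> = h i"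
    if "q_tri (row ?D 0) f g h" for f g h
    using q_tri_component[OF that[unfolded row_s_power] i] unfolding q_tri_def by simp
  show "s_equiv C (y i) \<longleftrightarrow> s_equiv C (s_slice_proj ?D 1 0 x i)" if "i \<in> V"
  proof -
    have "s_equiv C (e j i)" if j: "j \<le> 1" for j
    proof (rule s_equiv_projection[OF C i _ u _ e(3)[OF j]])
      show "hact ?D 2 0 [j] x \<in> bsimps ?D 0 0"
        using x2 j by (intro D.hact_in) auto
      show "s_terminal C (?u i)"
        using i \<open>i \<in> V\<close> one by (simp add: sub_object_def)
    qed
    then have e': "s_equiv C (e 0 i)" "s_equiv C (e 1 i)"
      by simp_all
    obtain \<sigma> \<tau> where \<sigma>: "\<sigma> \<in> bsimps C 2 0" "hact C 2 0 [0, 1] \<sigma> = y i" "hact C 2 0 [1, 2] \<sigma> = e 1 i" "hact C 2 0 [0, 2] \<sigma> = d i"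
      and \<tau>: "\<tau> \<in> bsimps C 2 0" "hact C 2 0 [0, 1] \<tau> = e 0 i" "hact C 2 0 [1, 2] \<tau> = s_slice_proj ?D 1 0 x i"
        "hact C 2 0 [0, 2] \<tau> = d i"
      using tri[OF e(1)] tri[OF e(2)] by blast
    show ?thesis
      using cancel_equiv(2)[OF \<sigma>(1)] cancel_equiv(1)[OF \<tau>(1)] e' unfolding \<sigma> \<tau> by blast
  qed
  show "s_equiv C (y i)" if strict: "s_strict C zero" and "i \<notin> V" and F: "F 1 0 x \<in> bsimps (s_slice ?D ?u) 1 0"
  proof -
    define \<sigma> where "\<sigma> = F 1 0 x i"
    have F2: "F 1 0 x \<in> bsimps ?D 2 0" "hact ?D 2 0 [2] (F 1 0 x) = ?u"
      using F D.vdeg_0[OF u] by (simp_all add: numeral_2_eq_2)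
    then have \<sigma>: "\<sigma> \<in> bsimps C 2 0" "y i = hact C 2 0 [0, 1] \<sigma>"
      using i by (auto simp: \<sigma>_def y_def s_slice_proj_eq upt_0_2 simp flip: numeral_2_eq_2)
    have \<sigma>2: "hact C 2 0 [2] \<sigma> = zero"
      using fun_cong[OF F2(2), of i] i \<open>i \<notin> V\<close> by (simp add: \<sigma>_def sub_object_def)
    have "hact C 1 0 [1] (hact C 2 0 [1, 2] \<sigma>) = zero" "hact C 1 0 [1] (hact C 2 0 [0, 2] \<sigma>) = zero"
      "hact C 2 0 [1, 2] \<sigma> \<in> bsimps C 1 0" "hact C 2 0 [0, 2] \<sigma> \<in> bsimps C 1 0"
      using \<sigma>(1) \<sigma>2 by (simp_all add: hacts)
    then show ?thesis
      using strict cancel_equiv(2)[OF \<sigma>(1)] unfolding s_strict_def \<sigma>(2) by blast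
  qed
qed

text \<open>\<open>slice_inv\<close> consists of equations between simplices of \<open>C\<close>, so
  witnesses chosen at each index assemble to tetrahedra of the power. Their last vertex is
  \<open>v\<close>, which makes them triangles of the slice.\<close>

lemma s_power_slice_equiv:
  assumes C: "css C" and v: "v \<in> bsimps (s_power I C) 0 0" and F: "F \<in> bsimps (s_slice (s_power I C) v) 1 0"
    and f: "\<And>i. i \<in> I \<Longrightarrow> s_equiv C (s_slice_proj (s_power I C) 1 0 F i)"
  shows "s_equiv (s_slice (s_power I C) v) F"
proof -
  interpret css C
    by (rule C)
  let ?D = "s_power I C"
  interpret D: bisimplicial ?D
    by unfold_locales (rule is_bsset_s_power[OF bsset])
  interpret S: bisimplicial "s_slice ?D v"
    by unfold_locales (rule D.is_bsset_s_slice[OF v])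
  have F2: "F \<in> bsimps ?D 2 0" "hact ?D 2 0 [2] F = v"
    using F D.vdeg_0[OF v] by (simp_all add: numeral_2_eq_2)
  have Fi: "F i \<in> bsimps C 2 0" if "i \<in> I" for i
    using F2(1) that by auto
  have "slice_inv (F i)" if "i \<in> I" for i
    by (rule slice_inv_if_equiv[OF Fi[OF that]])
      (use f[OF that] that in \<open>simp add: s_slice_proj_eq upt_0_2 flip: numeral_2_eq_2\<close>)
  then have *: "\<forall>i\<in>I. \<exists>\<Sigma>. \<Sigma> \<in> bsimps C 3 0 \<and> hact C 3 0 [0, 1, 3] \<Sigma> = F i \<and>
       hact C 3 0 [0, 2, 3] \<Sigma> = hact C 1 0 [0, 0, 1] (hact C 2 0 [0, 2] (F i))"
     "\<forall>i\<in>I. \<exists>\<Sigma>. \<Sigma> \<in> bsimps C 3 0 \<and> hact C 3 0 [1, 2, 3] \<Sigma> = F i \<and>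
       hact C 3 0 [0, 2, 3] \<Sigma> = hact C 1 0 [0, 0, 1] (hact C 2 0 [1, 2] (F i))"
    unfolding slice_inv_def by blast+
  obtain L where L: "\<forall>i\<in>I. L i \<in> bsimps C 3 0 \<and> hact C 3 0 [0, 1, 3] (L i) = F i \<and>
       hact C 3 0 [0, 2, 3] (L i) = hact C 1 0 [0, 0, 1] (hact C 2 0 [0, 2] (F i))"
    using bchoice[OF *(1)] by blast
  obtain R where R: "\<forall>i\<in>I. R i \<in> bsimps C 3 0 \<and> hact C 3 0 [1, 2, 3] (R i) = F i \<and>
       hact C 3 0 [0, 2, 3] (R i) = hact C 1 0 [0, 0, 1] (hact C 2 0 [1, 2] (F i))"
    using bchoice[OF *(2)] by blast
  have ext: "(\<lambda>i\<in>I. F i) = F"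
    using F2(1) by (simp add: PiE_restrict)
  let ?L = "restrict L I" and ?R = "restrict R I"
  have L': "?L \<in> bsimps ?D 3 0" "hact ?D 3 0 [0, 1, 3] ?L = F"
      "hact ?D 3 0 [0, 2, 3] ?L = hact ?D 1 0 [0, 0, 1] (hact ?D 2 0 [0, 2] F)"
    and R': "?R \<in> bsimps ?D 3 0" "hact ?D 3 0 [1, 2, 3] ?R = F"
      "hact ?D 3 0 [0, 2, 3] ?R = hact ?D 1 0 [0, 0, 1] (hact ?D 2 0 [1, 2] F)"
    using L R ext by (simp_all cong: restrict_cong)
  have "hact ?D 3 0 [3] ?L = hact ?D 2 0 [2] (hact ?D 3 0 [0, 1, 3] ?L)"
    "hact ?D 3 0 [3] ?R = hact ?D 2 0 [2] (hact ?D 3 0 [1, 2, 3] ?R)"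
    using D.hact_hact[OF L'(1), of "[0, 1, 3]" 2 "[2]"] D.hact_hact[OF R'(1), of "[1, 2, 3]" 2 "[2]"]
    by (simp_all del: s_power_simps)
  then have "hact ?D 3 0 [3] ?L = v" "hact ?D 3 0 [3] ?R = v"
    unfolding L'(2) R'(2) F2(2) .
  then have in_slice: "?L \<in> bsimps (s_slice ?D v) 2 0" "?R \<in> bsimps (s_slice ?D v) 2 0"
    using L'(1) R'(1) D.vdeg_0[OF v] by (simp_all add: numeral_3_eq_3 numeral_2_eq_2 del: s_power_simps)
  \<comment> \<open>Operators of the slice get the last vertex appended, so its degeneracy [0, 0] is
    the operator [0, 0, 1] of the power; the required identities are the degenerate faces of the
    tetrahedra.\<close>
  have "s_inv (s_slice ?D v) F"
    unfolding s_inv_def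
  proof (intro conjI)
    show "\<exists>\<sigma>\<in>bsimps (s_slice ?D v) 2 0. hact (s_slice ?D v) 2 0 [0, 1] \<sigma> = F \<and>
        hact (s_slice ?D v) 2 0 [0, 2] \<sigma> = hact (s_slice ?D v) 0 0 [0, 0] (hact (s_slice ?D v) 1 0 [0] F)"
      by (rule bexI[OF _ in_slice(1)]) (use L' in \<open>simp add: numeral_3_eq_3 numeral_2_eq_2 del: s_power_simps\<close>)
    show "\<exists>\<tau>\<in>bsimps (s_slice ?D v) 2 0. hact (s_slice ?D v) 2 0 [1, 2] \<tau> = F \<and>
        hact (s_slice ?D v) 2 0 [0, 2] \<tau> = hact (s_slice ?D v) 0 0 [0, 0] (hact (s_slice ?D v) 1 0 [1] F)"
      by (rule bexI[OF _ in_slice(2)]) (use R' in \<open>simp add: numeral_3_eq_3 numeral_2_eq_2 del: s_power_simps\<close>)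
  qed (rule F)
  then show ?thesis
    by (rule S.s_equiv_if_s_inv)
qed

lemma bsset_system_slices:
  assumes \<Phi>: "product_closed_filter I \<Phi>" and D: "is_bsset D" and T: "s_filter_system D \<Phi> ob T"
    and ob: "\<And>V. V \<in> \<Phi> \<Longrightarrow> ob V \<in> bsimps D 0 0"
  shows "bsset_system \<Phi> (\<lambda>V. s_slice D (ob V)) T"
proof (rule bsset_system.intro)
  note T' = T[unfolded s_filter_system_def]
  show map: "bisimplicial_map (s_slice D (ob V)) (s_slice D (ob U)) (T V U)"
    if "V \<in> \<Phi>" "U \<in> \<Phi>" "U \<le> V" for U V
    using conjunct1[OF T'] that unfolding s_times_def by simp
  interpret bisimplicial D
    by unfold_locales (rule D)
  show "is_bsset (s_slice D (ob V))" if "V \<in> \<Phi>" for V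
    by (rule is_bsset_s_slice[OF ob[OF that]])
  show "directed_system \<Phi> (\<lambda>V. bsimps (s_slice D (ob V)) n k) (\<lambda>V U. T V U n k)" for n k
  proof (rule directed_systemI[OF \<Phi>])
    show "T V U n k x \<in> bsimps (s_slice D (ob U)) n k"
      if "V \<in> \<Phi>" "U \<in> \<Phi>" "U \<le> V" "x \<in> bsimps (s_slice D (ob V)) n k" for V U x
    proof -
      have "simplicial_map (row (s_slice D (ob V)) k) (row (s_slice D (ob U)) k) (\<lambda>n. T V U n k)"
        using map[OF that(1-3)] unfolding bisimplicial_map_def by blast
      from simplicial_map_in[OF this, of x n] show ?thesis
        using that(4) by (simp del: s_slice_simps)
    qed
    show "T U W n k (T V U n k x) = T V W n k x"
      if "V \<in> \<Phi>" "U \<in> \<Phi>" "W \<in> \<Phi>" "W \<le> U" "U \<le> V" "x \<in> bsimps (s_slice D (ob V)) n k" for V U W x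
      using conjunct2[OF conjunct2[OF T']] that by (simp del: s_slice_simps)
    show "T V V n k x = x" if "V \<in> \<Phi>" "x \<in> bsimps (s_slice D (ob V)) n k" for V x
      using conjunct1[OF conjunct2[OF T']] that by (simp del: s_slice_simps)
  qed
qed

theorem s_filter_product_equiv:
  fixes C :: "'a bsset"
  assumes \<Phi>: "product_closed_filter I \<Phi>"
    and C: "complete_segal_space C" and one: "s_terminal C one" and zero: "zero \<in> bsimps C 0 0"
    and T: "s_filter_system (s_power I C) \<Phi> (sub_object I zero one) T"
    and P: "s_canonical (s_power I C) \<Phi> (sub_object I zero one) T I P"
    and f: "f \<in> bsimps (s_power I C) 1 0"
  shows "s_equiv (s_filter_quotient (s_power I C) \<Phi> (sub_object I zero one) T) (P 1 0 f) \<Longrightarrow>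
      {i \<in> I. s_equiv C (f i)} \<in> \<Phi>"
    and "s_strict C zero \<Longrightarrow> {i \<in> I. s_equiv C (f i)} \<in> \<Phi> \<Longrightarrow>
      s_equiv (s_filter_quotient (s_power I C) \<Phi> (sub_object I zero one) T) (P 1 0 f)"
proof -
  let ?D = "s_power I C" and ?ob = "sub_object I zero one"
  note css = css_if_complete_segal_space[OF C]
  interpret css C
    by (rule css)
  interpret D: bisimplicial ?D
    by unfold_locales (rule is_bsset_s_power[OF bsset])
  have ob: "?ob V \<in> bsimps ?D 0 0" for V
    using one zero by (auto simp: sub_object_def s_terminal_def)
  interpret S: bsset_system \<Phi> "\<lambda>V. s_slice ?D (?ob V)" T
    by (rule bsset_system_slices[OF \<Phi> D.bsset T ob])
  have I: "I \<in> \<Phi>" and sub: "\<And>V. V \<in> \<Phi> \<Longrightarrow> V \<le> I"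
    using \<Phi> unfolding product_closed_filter_def by auto
  obtain s where s: "bisimplicial_map ?D (s_slice ?D (?ob I)) s"
    "\<And>n k x. x \<in> bsimps ?D n k \<Longrightarrow> s_slice_proj ?D n k (s n k x) = x"
    "\<And>n k x. x \<in> bsimps ?D n k \<Longrightarrow> P n k x = S.germ_nk n k I (s n k x)"
    using P unfolding s_canonical_def by blast
  define x where "x = s 1 0 f"
  have row: "simplicial_map (row W 0) (row Z 0) (\<lambda>n. F n 0)" if "bisimplicial_map W Z F"
    for W :: "('b \<Rightarrow> 'a) bsset" and Z :: "('b \<Rightarrow> 'a) bsset" and F
    using that unfolding bisimplicial_map_def by blast
  have x: "x \<in> bsimps (s_slice ?D (?ob I)) 1 0" "s_slice_proj ?D 1 0 x = f"
    using simplicial_map_in[OF row[OF s(1)], of f 1] s(2)[OF f] f by (simp_all add: x_def del: s_slice_simps)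
  have Q: "s_filter_quotient ?D \<Phi> ?ob T = S.Q"
    by (simp add: s_filter_quotient_def S.Q_def)
  have quotient: "s_equiv (s_filter_quotient ?D \<Phi> ?ob T) (P 1 0 f) \<longleftrightarrow>
      (\<exists>V\<in>\<Phi>. s_equiv (s_slice ?D (?ob V)) (T I V 1 0 x))"
    unfolding Q s(3)[OF f] x_def[symmetric] S.s_equiv_colim_iff[OF I x(1)]
    using sub by blast
  have times: "s_times ?D (?ob I) (?ob V) (T I V)" if "V \<in> \<Phi>" for V
    using conjunct1[OF T[unfolded s_filter_system_def]] I sub[OF that] that by simp
  note transfer = s_power_equiv_transfer[OF css one zero times x(1), unfolded x(2)]
  have TI: "T I V 1 0 x \<in> bsimps (s_slice ?D (?ob V)) 1 0" if "V \<in> \<Phi>" for V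
    using simplicial_map_in[OF row[OF S.bisimplicial[OF I that sub[OF that]]], of x 1] x(1)
    by (simp del: s_slice_simps)
  show "{i \<in> I. s_equiv C (f i)} \<in> \<Phi>" if "s_equiv (s_filter_quotient ?D \<Phi> ?ob T) (P 1 0 f)"
  proof -
    obtain V where V: "V \<in> \<Phi>" "s_equiv (s_slice ?D (?ob V)) (T I V 1 0 x)"
      using \<open>s_equiv (s_filter_quotient ?D \<Phi> ?ob T) (P 1 0 f)\<close> quotient by blast
    have "s_equiv C (f i)" if "i \<in> V" for i
    proof -
      have i: "i \<in> I"
        using sub[OF V(1)] that by blast
      have "s_equiv ?D (s_slice_proj ?D 1 0 (T I V 1 0 x))"
        by (rule s_equiv_bisimplicial_map[OF D.bisimplicial_map_s_slice_proj S.bsset[OF V(1)] V(2)])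
      then have "s_equiv C (s_slice_proj ?D 1 0 (T I V 1 0 x) i)"
        by (rule s_equiv_bisimplicial_map[OF bisimplicial_map_component[OF i] D.bsset])
      then show ?thesis
        using transfer(1)[OF V(1) i that] by blast
    qed
    then have "V \<subseteq> {i \<in> I. s_equiv C (f i)}"
      using sub[OF V(1)] by blast
    then show ?thesis
      using \<Phi> V(1) unfolding product_closed_filter_def by blast
  qed
  show "s_equiv (s_filter_quotient ?D \<Phi> ?ob T) (P 1 0 f)"
    if strict: "s_strict C zero" and J: "{i \<in> I. s_equiv C (f i)} \<in> \<Phi>" (is "?J \<in> \<Phi>")
  proof -
    have "s_equiv C (s_slice_proj ?D 1 0 (T I ?J 1 0 x) i)" if "i \<in> I" for i
      using transfer[OF J that] strict TI[OF J] that by (cases "i \<in> ?J") blast+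
    then have "s_equiv (s_slice ?D (?ob ?J)) (T I ?J 1 0 x)"
      by (rule s_power_slice_equiv[OF css ob TI[OF J]])
    then show ?thesis
      using quotient J by blast
  qed
qed

section \<open>The three models together\<close>

lemma q_monos_source:
  assumes "quasi_category S" "m \<in> q_monos S y" "z = act S 1 [0] m"
  shows "z \<in> simps S 0"
  using assms act_in_list[OF quasi_category_is_sset, of S m 1 "[0]" 0] by (simp add: q_monos_def)

lemma k_monos_source: "(u, m) \<in> k_monos C y \<Longrightarrow> u \<in> sobj C"
  by (simp add: k_monos_def)

lemma s_monos_source:
  assumes "complete_segal_space W" "m \<in> s_monos W y" "z = hact W 1 0 [0] m"
  shows "z \<in> bsimps W 0 0"
proof -
  interpret css W
    by (rule css_if_complete_segal_space[OF assms(1)])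
  show ?thesis
    using assms(2,3) hact_in[of m 1 0 "[0]" 0] by (simp add: s_monos_def)
qed

theorem corollary4p7:
  fixes I :: "'i set" and \<Phi> :: "'i set set"
  assumes "product_closed_filter I \<Phi>"
  shows
    "(\<forall>(C :: 'a sset) one zero m T P f.
        quasi_category C \<and> q_finitely_complete C \<and> q_terminal C one \<and>
        card (q_Sub C one) = 2 \<and> m \<in> q_monos C one \<and> \<not> q_equiv C m \<and> zero = act C 1 [0] m \<and>
        q_filter_system (q_power I C) \<Phi> (sub_object I zero one) T \<and>
        q_canonical (q_power I C) \<Phi> (sub_object I zero one) T I P \<and>
        f \<in> simps (q_power I C) 1 \<longrightarrow>
        (q_equiv (q_filter_quotient (q_power I C) \<Phi> (sub_object I zero one) T) (P 1 f) \<longrightarrow>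
           {i \<in> I. q_equiv C (f i)} \<in> \<Phi>) \<and>
        (q_strict C zero \<longrightarrow>
           (q_equiv (q_filter_quotient (q_power I C) \<Phi> (sub_object I zero one) T) (P 1 f) \<longleftrightarrow>
            {i \<in> I. q_equiv C (f i)} \<in> \<Phi>))) \<and>
     (\<forall>(C :: ('o, 'm) scat) one zero m T X Y f.
        kan_enriched C \<and> k_finitely_complete C \<and> k_terminal C one \<and>
        card (k_Sub C one) = 2 \<and> (zero, m) \<in> k_monos C one \<and> \<not> k_equiv C zero one m \<and>
        k_filter_system (k_power I C) \<Phi> (sub_object I zero one) T \<and>
        X \<in> sobj (k_power I C) \<and> Y \<in> sobj (k_power I C) \<and>
        f \<in> simps (shom (k_power I C) X Y) 0 \<longrightarrow>
        (k_equiv (k_filter_quotient (k_power I C) \<Phi> (sub_object I zero one) T) X Y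
             (k_canonical (k_power I C) \<Phi> (sub_object I zero one) T I X Y f) \<longrightarrow>
           {i \<in> I. k_equiv C (X i) (Y i) (f i)} \<in> \<Phi>) \<and>
        (k_strict C zero \<longrightarrow>
           (k_equiv (k_filter_quotient (k_power I C) \<Phi> (sub_object I zero one) T) X Y
              (k_canonical (k_power I C) \<Phi> (sub_object I zero one) T I X Y f) \<longleftrightarrow>
            {i \<in> I. k_equiv C (X i) (Y i) (f i)} \<in> \<Phi>))) \<and>
     (\<forall>(C :: 'b bsset) one zero m T P f.
        complete_segal_space C \<and> s_finitely_complete C \<and> s_terminal C one \<and>
        card (s_Sub C one) = 2 \<and> m \<in> s_monos C one \<and> \<not> s_equiv C m \<and> zero = hact C 1 0 [0] m \<and>
        s_filter_system (s_power I C) \<Phi> (sub_object I zero one) T \<and>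
        s_canonical (s_power I C) \<Phi> (sub_object I zero one) T I P \<and>
        f \<in> bsimps (s_power I C) 1 0 \<longrightarrow>
        (s_equiv (s_filter_quotient (s_power I C) \<Phi> (sub_object I zero one) T) (P 1 0 f) \<longrightarrow>
           {i \<in> I. s_equiv C (f i)} \<in> \<Phi>) \<and>
        (s_strict C zero \<longrightarrow>
           (s_equiv (s_filter_quotient (s_power I C) \<Phi> (sub_object I zero one) T) (P 1 0 f) \<longleftrightarrow>
            {i \<in> I. s_equiv C (f i)} \<in> \<Phi>)))"
proof -
  \<comment> \<open>\<open>zero\<close> is given as the source of a monomorphism into
    \<open>one\<close>; the source lemmas turn this into the hypothesis that it is an
    object.\<close>
  note q = q_filter_product_equiv[OF assms _ _ q_monos_source]
    and k = k_filter_product_equiv[OF assms _ _ k_monos_source]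
    and s = s_filter_product_equiv[OF assms _ _ s_monos_source]
  show ?thesis
    by (intro conjI; intro allI impI; elim conjE; intro conjI impI iffI; (rule q k s; assumption))
qed

end
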